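(* Let $f$ be a real-valued continuous function on $\mathbb R$. Then $f\in H^{\frac32}$ if and only if $f$ extends to a quasiconformal deformation $\tilde f$ on the upper half-plane $\mathbb U$ such that $\tilde f(z)=o(z^2)$ as $z\to\infty$ and $$\iint_{\mathbb U}|\bar\partial\tilde f(z)|^2y^{-2}dxdy<\infty,\qquad z=x+iy.$$
   Context: $H^{\frac32}$: locally absolutely continuous functions $f$ on $\mathbb R$ with $f'\in H^{\frac12}$, where $H^{\frac12}$ consists of locally integrable $\varphi$ with $\frac1{4\pi^2}\int_{\mathbb R}\int_{\mathbb R}\frac{|\varphi(s)-\varphi(t)|^2}{|s-t|^2}ds\,dt<\infty$. A quasiconformal deformation on a domain $\Omega$ is a complex-valued function $F$ on $\Omega$ having a generalized (distributional) derivative $\bar\partial F$ with $\bar\partial F\in L^\infty(\Omega)$; an extension of $f$ means a continuous function on $\mathbb U\cup\mathbb R$ equal to $f$ on $\mathbb R$. *)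

theory Defs
  imports "HOL-Analysis.Analysis" "HOL-Library.Landau_Symbols"
begin

definition locally_integrable_real :: "(real \<Rightarrow> real) \<Rightarrow> bool" where
  "locally_integrable_real \<phi> \<longleftrightarrow> (\<forall>a b. set_integrable lborel {a..b} \<phi>)"

definition H_half :: "(real \<Rightarrow> real) \<Rightarrow> bool" where
  "H_half \<phi> \<longleftrightarrow> locally_integrable_real \<phi> \<and>
     (\<integral>\<^sup>+ p. ennreal (1 / (4 * pi\<^sup>2) * (\<bar>\<phi> (fst p) - \<phi> (snd p)\<bar>\<^sup>2 / \<bar>fst p - snd p\<bar>\<^sup>2))
        \<partial>(lborel \<Otimes>\<^sub>M lborel)) < \<infinity>"

definition abs_continuous_on :: "real \<Rightarrow> real \<Rightarrow> (real \<Rightarrow> real) \<Rightarrow> bool" where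
  "abs_continuous_on a b f \<longleftrightarrow>
     (\<forall>\<epsilon>>0. \<exists>\<delta>>0. \<forall>(n::nat) (u::nat \<Rightarrow> real) (v::nat \<Rightarrow> real).
        (\<forall>i<n. a \<le> u i \<and> u i \<le> v i \<and> v i \<le> b) \<and>
        (\<forall>i<n. \<forall>j<n. i \<noteq> j \<longrightarrow> {u i<..<v i} \<inter> {u j<..<v j} = {}) \<and>
        (\<Sum>i<n. v i - u i) < \<delta>
        \<longrightarrow> (\<Sum>i<n. \<bar>f (v i) - f (u i)\<bar>) < \<epsilon>)"

definition locally_abs_continuous :: "(real \<Rightarrow> real) \<Rightarrow> bool" where
  "locally_abs_continuous f \<longleftrightarrow> (\<forall>a b. abs_continuous_on a b f)"

definition H_three_half :: "(real \<Rightarrow> real) \<Rightarrow> bool" where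
  "H_three_half f \<longleftrightarrow> locally_abs_continuous f \<and>
     (\<exists>g. H_half g \<and> (AE x in lborel. (f has_real_derivative g x) (at x)))"

definition px :: "(complex \<Rightarrow> complex) \<Rightarrow> complex \<Rightarrow> complex" where
  "px g z = vector_derivative (\<lambda>t::real. g (z + of_real t)) (at 0)"

definition py :: "(complex \<Rightarrow> complex) \<Rightarrow> complex \<Rightarrow> complex" where
  "py g z = vector_derivative (\<lambda>t::real. g (z + \<i> * of_real t)) (at 0)"

coinductive smooth_c :: "(complex \<Rightarrow> complex) \<Rightarrow> bool" where
  "continuous_on UNIV g \<Longrightarrow>
   (\<forall>z. (\<lambda>t::real. g (z + of_real t)) differentiable (at 0)) \<Longrightarrow>
   (\<forall>z. (\<lambda>t::real. g (z + \<i> * of_real t)) differentiable (at 0)) \<Longrightarrow>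
   smooth_c (px g) \<Longrightarrow> smooth_c (py g) \<Longrightarrow> smooth_c g"

definition test_function :: "complex set \<Rightarrow> (complex \<Rightarrow> complex) \<Rightarrow> bool" where
  "test_function \<Omega> \<phi> \<longleftrightarrow> smooth_c \<phi> \<and>
     compact (closure {z. \<phi> z \<noteq> 0}) \<and> closure {z. \<phi> z \<noteq> 0} \<subseteq> \<Omega>"

definition dbar :: "(complex \<Rightarrow> complex) \<Rightarrow> complex \<Rightarrow> complex" where
  "dbar g z = (px g z + \<i> * py g z) / 2"

definition locally_integrable_on :: "complex set \<Rightarrow> (complex \<Rightarrow> complex) \<Rightarrow> bool" where
  "locally_integrable_on \<Omega> F \<longleftrightarrow> (\<forall>K. compact K \<and> K \<subseteq> \<Omega> \<longrightarrow> set_integrable lborel K F)"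

definition weak_dbar :: "complex set \<Rightarrow> (complex \<Rightarrow> complex) \<Rightarrow> (complex \<Rightarrow> complex) \<Rightarrow> bool" where
  "weak_dbar \<Omega> F h \<longleftrightarrow> locally_integrable_on \<Omega> F \<and> locally_integrable_on \<Omega> h \<and>
     (\<forall>\<phi>. test_function \<Omega> \<phi> \<longrightarrow>
        (LINT z:\<Omega>|lborel. F z * dbar \<phi> z) = - (LINT z:\<Omega>|lborel. h z * \<phi> z))"

definition Linf_on :: "complex set \<Rightarrow> (complex \<Rightarrow> complex) \<Rightarrow> bool" where
  "Linf_on \<Omega> h \<longleftrightarrow> set_borel_measurable lborel \<Omega> h \<and>
     (\<exists>C. AE z in lborel. z \<in> \<Omega> \<longrightarrow> norm (h z) \<le> C)"

definition qc_deformation :: "complex set \<Rightarrow> (complex \<Rightarrow> complex) \<Rightarrow> bool" where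
  "qc_deformation \<Omega> F \<longleftrightarrow> (\<exists>h. weak_dbar \<Omega> F h \<and> Linf_on \<Omega> h)"

definition upper_half_plane :: "complex set" where
  "upper_half_plane = {z. Im z > 0}"

definition closed_upper_half_plane :: "complex set" where
  "closed_upper_half_plane = {z. Im z \<ge> 0}"

end

theory Submission
  imports Defs "HOL-Probability.Sinc_Integral"
begin

text \<open>For the forward implication, let \<open>P\<close> be a primitive of \<open>f\<close> and take the Beurling--Ahlfors extension
  \<open>F = u + \<i>v\<close> with \<open>u = (P (x + y) - P (x - y)) / (2y)\<close> and \<open>v = (P (x + y) - 2 P x + P (x - y)) / y\<close>.
  Its d-bar derivative kills affine \<open>f\<close>, hence is bounded by mean oscillations of \<open>f'\<close> over
  \<open>[x - y, x + y]\<close>, and the weighted area integral is controlled by the double integral that defines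
  the energy of \<open>f'\<close>.

  Conversely, let \<open>h\<close> be the weak d-bar derivative of \<open>F\<close>. Since \<open>F\<close> is real on the axis, the
  Cauchy--Pompeiu formula, applied at \<open>x\<close>, 0 and 1 and combined so that the growth \<open>o(z\<^sup>2)\<close> kills the
  contribution of large contours, gives \<open>f x = (1 - x) f 0 + x f 1 - (2/\<pi>) Re V(x)\<close>. Here \<open>V\<close> is
  a potential of \<open>h\<close>, holomorphic in the lower half-plane, with \<open>V''(\<zeta>) = \<integral> 2 h(w) / (w - \<zeta>)\<^sup>3\<close>.
  Schur's test bounds the \<open>L\<^sup>2\<close> norm of \<open>V''\<close> by the weighted norm of \<open>h\<close>. Finally, Hardy's inequality
  along vertical segments shows that \<open>V'\<close> has boundary values of finite energy, and these represent the
  derivative of \<open>f\<close> up to a constant.\<close>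

section \<open>Lebesgue measure on the complex plane\<close>

text \<open>Affine functions are invisible to the energy of the derivative, and both directions
  exploit this freedom. In the forward direction a line of any slope \<open>c\<close> may be
  subtracted on each interval, and averaging over \<open>c = g t\<close> turns one oscillation into
  the double integral. In the converse it pays for decay: at a cutoff of size R the error is area
  R^2 times o(R^2) for \<open>F\<close>, 1/R for the derivative of the cutoff and the size of the
  kernel, so a kernel of order R^-3 is required. Interpolating the Cauchy kernel at two nodes gives
  exactly this order. The same decay makes the kernel times Im w square integrable, as pairing with
  h / Im w requires. \<open>F\<close> has only a distributional d-bar derivative inside and mere
  continuity up to the axis. Hence test functions carry a pole strictly below the axis and are
  switched off in a thin layer above it; the layer produces the boundary integral, and the pole is
  raised to the axis afterwards. Membership in the coinductive class \<open>smooth_c\<close> is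
  obtained from explicit function algebras closed under partial derivatives.\<close>

lemma lborel_complex_eq:
  "(lborel :: complex measure) = distr (lborel \<Otimes>\<^sub>M lborel) borel (\<lambda>p. Complex (fst p) (snd p))"
proof (rule lborel_eqI)
  show "sets (distr (lborel \<Otimes>\<^sub>M lborel) borel (\<lambda>p. Complex (fst p) (snd p))) = sets borel" by simp
next
  fix l u :: complex
  assume le: "\<And>b. b \<in> Basis \<Longrightarrow> l \<bullet> b \<le> u \<bullet> b"
  have *: "Re l \<le> Re u" "Im l \<le> Im u" using le[of 1] le[of \<i>] by (auto simp: Basis_complex_def)
  have m: "(\<lambda>p. Complex (fst p) (snd p)) \<in> borel_measurable (lborel \<Otimes>\<^sub>M lborel)"
    by (intro borel_measurable_complex_iff[THEN iffD2]) (auto simp: measurable_lborel1 )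
  have v: "(\<lambda>p. Complex (fst p) (snd p)) -` box l u = {Re l<..<Re u} \<times> {Im l<..<Im u}"
    by (auto simp: box_def Basis_complex_def)
  show "emeasure (distr (lborel \<Otimes>\<^sub>M lborel) borel (\<lambda>p. Complex (fst p) (snd p))) (box l u) = (\<Prod>b\<in>Basis. (u - l) \<bullet> b)"
    using * by (simp add: emeasure_distr m v lborel.emeasure_pair_measure_Times space_pair_measure Basis_complex_def ennreal_mult)
qed

lemma measurable_Complex [measurable]:
  "(\<lambda>p. Complex (fst p) (snd p)) \<in> borel_measurable (lborel \<Otimes>\<^sub>M lborel)"
    by (intro borel_measurable_complex_iff[THEN iffD2]) (auto simp: measurable_lborel1 )

lemma measurable_Complex' [measurable (raw)]:
  assumes [measurable]: "f \<in> borel_measurable M" "g \<in> borel_measurable M"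
  shows "(\<lambda>x. Complex (f x) (g x)) \<in> borel_measurable M"
  by (subst borel_measurable_complex_iff) simp

lemma nn_integral_complex:
  fixes f :: "complex \<Rightarrow> ennreal"
  assumes [measurable]: "f \<in> borel_measurable borel"
  shows "(\<integral>\<^sup>+z. f z \<partial>lborel) = (\<integral>\<^sup>+x. \<integral>\<^sup>+y. f (Complex x y) \<partial>lborel \<partial>lborel)"
    (is "_ = ?R") and "(\<integral>\<^sup>+z. f z \<partial>lborel) = (\<integral>\<^sup>+y. \<integral>\<^sup>+x. f (Complex x y) \<partial>lborel \<partial>lborel)" (is "_ = ?S")
proof -
  have "(\<integral>\<^sup>+z. f z \<partial>lborel) = (\<integral>\<^sup>+p. f (Complex (fst p) (snd p)) \<partial>(lborel \<Otimes>\<^sub>M lborel))"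
    by (subst lborel_complex_eq) (simp add: nn_integral_distr)
  also have "\<dots> = ?R" by (subst lborel.nn_integral_fst[symmetric]) auto
  finally show 1: "(\<integral>\<^sup>+z. f z \<partial>lborel) = ?R" .
  show "(\<integral>\<^sup>+z. f z \<partial>lborel) = ?S" unfolding 1
    by (subst lborel_pair.Fubini') auto
qed

lemma integral_complex:
  fixes f :: "complex \<Rightarrow> 'a::{banach,second_countable_topology}"
  assumes "integrable lborel f"
  shows "integral\<^sup>L lborel f = (LINT x|lborel. LINT y|lborel. f (Complex x y))" (is "_ = ?R")
    and "integral\<^sup>L lborel f = (LINT y|lborel. LINT x|lborel. f (Complex x y))" (is "_ = ?S")
proof -
  have [measurable]: "f \<in> borel_measurable borel" using assms by auto
  have i: "integrable (lborel \<Otimes>\<^sub>M lborel) (\<lambda>(x,y). f (Complex x y))"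
    using assms by (subst (asm) lborel_complex_eq) (simp add: integrable_distr_eq case_prod_unfold)
  have "integral\<^sup>L lborel f = (\<integral>p. f (Complex (fst p) (snd p)) \<partial>(lborel \<Otimes>\<^sub>M lborel))"
    by (subst lborel_complex_eq) (simp add: integral_distr)
  also have "\<dots> = ?R" using lborel_pair.integral_fst'[OF i] by (simp add: case_prod_unfold)
  finally show 1: "integral\<^sup>L lborel f = ?R" .
  show "integral\<^sup>L lborel f = ?S" unfolding 1 using lborel_pair.Fubini_integral[OF i] by simp
qed

lemma integrable_cont_compact:
  fixes f :: "'b::euclidean_space \<Rightarrow> 'a::{banach,second_countable_topology}"
  assumes "continuous_on UNIV f" "compact K" "\<And>z. z \<notin> K \<Longrightarrow> f z = 0"
  shows "integrable lborel f"
proof -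
  have "integrable lborel (\<lambda>x. indicator K x *\<^sub>R f x)"
    by (rule borel_integrable_compact) (use assms continuous_on_subset in blast)+
  moreover have "(\<lambda>x. indicator K x *\<^sub>R f x) = f" using assms(3) by (auto simp: indicator_def fun_eq_iff)
  ultimately show ?thesis by simp
qed

section \<open>Vanishing integrals of compactly supported partial derivatives\<close>

lemma integral_deriv_zero:
  fixes g g' :: "real \<Rightarrow> complex"
  assumes d: "\<And>t. (g has_vector_derivative g' t) (at t)" and c: "continuous_on UNIV g'"
    and z: "\<And>t. \<bar>t\<bar> \<ge> R \<Longrightarrow> g t = 0" "\<And>t. \<bar>t\<bar> \<ge> R \<Longrightarrow> g' t = 0"
  shows "(LINT t|lborel. g' t) = 0"
proof -
  have "(\<integral>t. indicator {-\<bar>R\<bar>..\<bar>R\<bar>} t *\<^sub>R g' t \<partial>lborel) = g \<bar>R\<bar> - g (-\<bar>R\<bar>)"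
    by (rule integral_FTC_Icc)
       (auto intro: has_vector_derivative_at_within d continuous_on_subset[OF c])
  moreover have "(\<lambda>t. indicator {-\<bar>R\<bar>..\<bar>R\<bar>} t *\<^sub>R g' t) = g'"
    using z(2) by (auto simp: fun_eq_iff indicator_def abs_le_iff not_le)
  ultimately show ?thesis using z(1)[of "\<bar>R\<bar>"] z(1)[of "-\<bar>R\<bar>"] by simp
qed

text \<open>Partial derivatives are encoded as derivatives at parameter 0 of a line through the
  point. Moving the base point along the line gives the derivative at every parameter, which the
  fundamental theorem of calculus on lines needs.\<close>

lemma has_vector_derivative_shift:
  assumes "((\<lambda>s. \<Psi> (a + c * of_real s)) has_vector_derivative D) (at 0)"
  shows "((\<lambda>s. \<Psi> (a + c * of_real (s - t))) has_vector_derivative D) (at t)"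
proof -
  have "((\<lambda>s. s - t) has_vector_derivative 1) (at t)" by (auto intro!: derivative_eq_intros)
  from vector_diff_chain_at[OF this, of "\<lambda>s. \<Psi> (a + c * of_real s)" D] assms
  show ?thesis by (simp add: o_def)
qed

text \<open>Fubini with the inner integral along horizontal lines, where the fundamental theorem
  gives 0. Applied to a product, this is integration by parts without boundary terms.\<close>

lemma integral_px_zero:
  fixes \<Psi> \<Psi>' :: "complex \<Rightarrow> complex"
  assumes d: "\<And>z. ((\<lambda>t::real. \<Psi> (z + of_real t)) has_vector_derivative \<Psi>' z) (at 0)"
    and c: "continuous_on UNIV \<Psi>'" and K: "compact K" "\<And>z. z \<notin> K \<Longrightarrow> \<Psi> z = 0" "\<And>z. z \<notin> K \<Longrightarrow> \<Psi>' z = 0"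
  shows "(LINT z|lborel. \<Psi>' z) = 0"
proof -
  obtain R where R: "\<And>z. z \<in> K \<Longrightarrow> norm z < R" using compact_imp_bounded[OF K(1)] by (auto simp: bounded_pos_less)
  have 0: "(LINT x|lborel. \<Psi>' (Complex x y)) = 0" for y
  proof (rule integral_deriv_zero[where g="\<lambda>x. \<Psi> (Complex x y)" and R=R])
    fix t
    have "Complex t y + 1 * of_real (s - t) = Complex s y" for s by (simp add: complex_eq_iff)
    then show "((\<lambda>x. \<Psi> (Complex x y)) has_vector_derivative \<Psi>' (Complex t y)) (at t)"
      using has_vector_derivative_shift[of \<Psi> "Complex t y" 1 "\<Psi>' (Complex t y)" t] d[of "Complex t y"] by simp
  next
    show "continuous_on UNIV (\<lambda>x. \<Psi>' (Complex x y))"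
      by (rule continuous_on_compose2[OF c]) (auto simp: Complex_eq intro!: continuous_intros)
  next
    fix t assume "R \<le> \<bar>t\<bar>"
    then have "Complex t y \<notin> K" using R[of "Complex t y"] abs_Re_le_cmod[of "Complex t y"] by auto
    then show "\<Psi> (Complex t y) = 0" "\<Psi>' (Complex t y) = 0" using K by auto
  qed
  show ?thesis
    by (subst integral_complex(2)) (use integrable_cont_compact[OF c K(1,3)] 0 in auto)
qed

lemma integral_py_zero:
  fixes \<Psi> \<Psi>' :: "complex \<Rightarrow> complex"
  assumes d: "\<And>z. ((\<lambda>t::real. \<Psi> (z + \<i> * of_real t)) has_vector_derivative \<Psi>' z) (at 0)"
    and c: "continuous_on UNIV \<Psi>'" and K: "compact K" "\<And>z. z \<notin> K \<Longrightarrow> \<Psi> z = 0" "\<And>z. z \<notin> K \<Longrightarrow> \<Psi>' z = 0"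
  shows "(LINT z|lborel. \<Psi>' z) = 0"
proof -
  obtain R where R: "\<And>z. z \<in> K \<Longrightarrow> norm z < R" using compact_imp_bounded[OF K(1)] by (auto simp: bounded_pos_less)
  have 0: "(LINT y|lborel. \<Psi>' (Complex x y)) = 0" for x
  proof (rule integral_deriv_zero[where g="\<lambda>y. \<Psi> (Complex x y)" and R=R])
    fix t
    have *: "Complex x t + \<i> * of_real (s - t) = Complex x s" for s by (simp add: complex_eq_iff)
    show "((\<lambda>y. \<Psi> (Complex x y)) has_vector_derivative \<Psi>' (Complex x t)) (at t)"
      using has_vector_derivative_shift[of \<Psi> "Complex x t" \<i> "\<Psi>' (Complex x t)" t] d[of "Complex x t"]
      unfolding * .
  next
    show "continuous_on UNIV (\<lambda>y. \<Psi>' (Complex x y))"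
      by (rule continuous_on_compose2[OF c]) (auto simp: Complex_eq intro!: continuous_intros)
  next
    fix t assume "R \<le> \<bar>t\<bar>"
    then have "Complex x t \<notin> K" using R[of "Complex x t"] abs_Im_le_cmod[of "Complex x t"] by auto
    then show "\<Psi> (Complex x t) = 0" "\<Psi>' (Complex x t) = 0" using K by auto
  qed
  show ?thesis
    by (subst integral_complex(1)) (use integrable_cont_compact[OF c K(1,3)] 0 in auto)
qed

section \<open>The fundamental theorem of calculus for absolutely continuous functions\<close>

text \<open>The straddle lemma: an interval around \<open>x\<close> is cut at \<open>x\<close>, and
  the two one-sided errors add up to \<open>e\<close> times its full length. This is the form in
  which tagged divisions see differentiability.\<close>

lemma has_real_derivative_straddle:
  fixes f :: "real \<Rightarrow> real"
  assumes "(f has_real_derivative D) (at x)" "0 < e"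
  obtains d where "0 < d" "\<And>u v. u \<le> x \<Longrightarrow> x \<le> v \<Longrightarrow> \<bar>u - x\<bar> < d \<Longrightarrow> \<bar>v - x\<bar> < d \<Longrightarrow> \<bar>f v - f u - D * (v - u)\<bar> \<le> e * (v - u)"
proof -
  have "(f has_derivative (\<lambda>h. D * h)) (at x)" using assms(1) by (simp add: has_field_derivative_def)
  then obtain d where d: "0 < d" "\<And>y. \<bar>y - x\<bar> < d \<Longrightarrow> \<bar>f y - f x - D * (y - x)\<bar> \<le> e * \<bar>y - x\<bar>"
    using assms(2) unfolding has_derivative_at_alt by (auto simp: real_norm_def)
  have "\<bar>f v - f u - D * (v - u)\<bar> \<le> e * (v - u)" if "u \<le> x" "x \<le> v" "\<bar>u - x\<bar> < d" "\<bar>v - x\<bar> < d" for u v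
  proof -
    have "\<bar>f v - f u - D * (v - u)\<bar> = \<bar>(f v - f x - D * (v - x)) - (f u - f x - D * (u - x))\<bar>" by (simp add: algebra_simps)
    also have "\<dots> \<le> e * \<bar>v - x\<bar> + e * \<bar>u - x\<bar>" using d(2)[OF that(3)] d(2)[OF that(4)] by linarith
    also have "\<dots> = e * (v - u)" using that by (simp add: algebra_simps)
    finally show ?thesis .
  qed
  then show ?thesis by (rule that[OF d(1)])
qed

text \<open>Tagged divisions are sets of pairs, whereas \<open>abs_continuous_on\<close> speaks of
  families indexed by initial segments of the naturals; a bijection transfers the bound.\<close>

lemma abs_continuous_on_finite:
  assumes ac: "abs_continuous_on a b f" and "0 < e"
  shows "\<exists>\<delta>>0. \<forall>(I :: 'i set) u v. finite I \<longrightarrow> (\<forall>i\<in>I. a \<le> u i \<and> u i \<le> v i \<and> v i \<le> b) \<longrightarrow>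
       disjoint_family_on (\<lambda>i. {u i<..<v i}) I \<longrightarrow> (\<Sum>i\<in>I. v i - u i) < \<delta> \<longrightarrow>
       (\<Sum>i\<in>I. \<bar>f (v i) - f (u i)\<bar>) < e"
proof -
  obtain \<delta> where \<delta>: "0 < \<delta>" "\<And>(n::nat) (u::nat \<Rightarrow> real) (v::nat \<Rightarrow> real).
        (\<forall>i<n. a \<le> u i \<and> u i \<le> v i \<and> v i \<le> b) \<and>
        (\<forall>i<n. \<forall>j<n. i \<noteq> j \<longrightarrow> {u i<..<v i} \<inter> {u j<..<v j} = {}) \<and>
        (\<Sum>i<n. v i - u i) < \<delta>
        \<Longrightarrow> (\<Sum>i<n. \<bar>f (v i) - f (u i)\<bar>) < e"
    using ac[unfolded abs_continuous_on_def, rule_format, OF \<open>0 < e\<close>] by auto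
  have "(\<Sum>i\<in>I. \<bar>f (v i) - f (u i)\<bar>) < e"
    if I: "finite I" "\<And>i. i \<in> I \<Longrightarrow> a \<le> u i \<and> u i \<le> v i \<and> v i \<le> b"
      "disjoint_family_on (\<lambda>i. {u i<..<v i}) I" "(\<Sum>i\<in>I. v i - u i) < \<delta>" for I :: "'i set" and u v
  proof -
    obtain h where h: "bij_betw h {..<card I} I" using ex_bij_betw_nat_finite[OF I(1)] by (auto simp: lessThan_atLeast0)
    have *: "(\<Sum>i<card I. g (h i)) = (\<Sum>i\<in>I. g i)" for g :: "'i \<Rightarrow> real" by (rule sum.reindex_bij_betw[OF h])
    have "(\<Sum>i<card I. \<bar>f ((v \<circ> h) i) - f ((u \<circ> h) i)\<bar>) < e"
    proof (rule \<delta>(2), intro conjI allI impI)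
      show "(\<Sum>i<card I. (v \<circ> h) i - (u \<circ> h) i) < \<delta>" using *[of "\<lambda>i. v i - u i"] I(4) by simp
      show "{(u \<circ> h) i<..<(v \<circ> h) i} \<inter> {(u \<circ> h) j<..<(v \<circ> h) j} = {}" if "i < card I" "j < card I" "i \<noteq> j" for i j
      proof -
        have "h i \<in> I" "h j \<in> I" "h i \<noteq> h j" using h that by (auto simp: bij_betw_def inj_on_def)
        then show ?thesis using I(3) unfolding disjoint_family_on_def by simp
      qed
    qed (use I(2) h in \<open>auto simp: bij_betw_def\<close>)
    then show ?thesis using *[of "\<lambda>i. \<bar>f (v i) - f (u i)\<bar>"] by simp
  qed
  with \<delta>(1) show ?thesis by (intro exI[of _ \<delta>]) simp
qed

lemma sum_disjoint_intervals_le: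
  fixes u v :: "'i \<Rightarrow> real"
  assumes "finite I" "disjoint_family_on (\<lambda>i. {u i<..<v i}) I" "\<And>i. i \<in> I \<Longrightarrow> u i \<le> v i"
    "\<And>i. i \<in> I \<Longrightarrow> {u i<..<v i} \<subseteq> U" "emeasure lborel U < ennreal \<delta>" "U \<in> sets borel"
  shows "(\<Sum>i\<in>I. v i - u i) < \<delta>"
proof -
  have "ennreal (\<Sum>i\<in>I. v i - u i) = (\<Sum>i\<in>I. emeasure lborel {u i<..<v i})"
    using assms by (subst sum_ennreal[symmetric]) auto
  also have "\<dots> = emeasure lborel (\<Union>i\<in>I. {u i<..<v i})" by (rule sum_emeasure) (use assms in auto)
  also have "\<dots> \<le> emeasure lborel U" by (rule emeasure_mono) (use assms in auto)
  also have "\<dots> < ennreal \<delta>" by fact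
  finally show ?thesis using assms by (simp add: ennreal_less_iff sum_nonneg)
qed

text \<open>Proved for the gauge integral, so integrability of \<open>g\<close> comes out of the
  argument. Tags outside a null set \<open>N\<close> are handled by the straddle estimate; tags in
  \<open>N\<close> belong to intervals inside an open set of small measure, where absolute
  continuity bounds the increments of \<open>f\<close>.\<close>

lemma abs_continuous_on_FTC:
  fixes f g :: "real \<Rightarrow> real"
  assumes ac: "abs_continuous_on a b f" and ab: "a \<le> b"
    and AE: "AE x in lborel. (f has_real_derivative g x) (at x)"
  shows "(g has_integral (f b - f a)) {a..b}"
proof -
  obtain N where N: "{x. \<not> (f has_real_derivative g x) (at x)} \<subseteq> N" "N \<in> null_sets lborel"
    using AE unfolding eventually_ae_filter by auto
  \<comment> \<open>Setting the integrand to 0 on the null set leaves only increments of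
    \<open>f\<close> at tags in \<open>N\<close>.\<close>
  define g0 where "g0 = (\<lambda>x. if x \<in> N then 0 else g x)"
  have neg: "negligible N" using N(2) null_sets_completionI by (auto simp: negligible_iff_null_sets)
  have "(g0 has_integral (f b - f a)) (cbox a b)"
    unfolding has_integral
  proof (intro allI impI)
    fix e :: real assume e: "0 < e"
    obtain \<delta> where \<delta>: "0 < \<delta>"
      "\<And>(I :: (real \<times> real set) set) u v. finite I \<Longrightarrow> (\<And>i. i \<in> I \<Longrightarrow> a \<le> u i \<and> u i \<le> v i \<and> v i \<le> b) \<Longrightarrow>
       disjoint_family_on (\<lambda>i. {u i<..<v i}) I \<Longrightarrow> (\<Sum>i\<in>I. v i - u i) < \<delta> \<Longrightarrow>
       (\<Sum>i\<in>I. \<bar>f (v i) - f (u i)\<bar>) < e / 2"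
      using abs_continuous_on_finite[OF ac half_gt_zero[OF e], where 'i="real \<times> real set"] by (auto simp: Ball_def)
    obtain U where U: "open U" "N \<subseteq> U" "emeasure lborel U < ennreal \<delta>"
    proof -
      obtain U where U: "open U" "N \<subseteq> U" "emeasure lborel (U - N) < ennreal \<delta>"
        using outer_regular_lborel[OF _ \<delta>(1), of N] N(2) by (metis null_setsD2 sets_lborel)
      have "emeasure lborel U = emeasure lborel ((U - N) \<union> N)" using U by (simp add: Un_absorb2)
      also have "\<dots> = emeasure lborel (U - N)"
        by (rule emeasure_Un_null_set) (use U N in auto)
      finally show ?thesis using U that by auto
    qed
    \<comment> \<open>The good tags contribute at most \<open>e1 * (b - a)\<close>, hence at most
      \<open>e / 2\<close>; the summand 1 covers the case \<open>a = b\<close>.\<close>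
    define e1 where "e1 = e / 2 / (b - a + 1)"
    have e1: "0 < e1" using e ab by (simp add: e1_def)
    have "\<exists>d>0. \<forall>u v. u \<le> x \<longrightarrow> x \<le> v \<longrightarrow> \<bar>u - x\<bar> < d \<longrightarrow> \<bar>v - x\<bar> < d \<longrightarrow> \<bar>f v - f u - g x * (v - u)\<bar> \<le> e1 * (v - u)"
      if "x \<notin> N" for x
    proof -
      have "(f has_real_derivative g x) (at x)" using N(1) that by auto
      from has_real_derivative_straddle[OF this e1] obtain d where "0 < d" "\<And>u v. u \<le> x \<Longrightarrow> x \<le> v \<Longrightarrow> \<bar>u - x\<bar> < d \<Longrightarrow> \<bar>v - x\<bar> < d \<Longrightarrow> \<bar>f v - f u - g x * (v - u)\<bar> \<le> e1 * (v - u)" by blast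
      then show ?thesis by (intro exI[of _ d]) simp
    qed
    then have "\<exists>d. \<forall>x. x \<notin> N \<longrightarrow> d x > 0 \<and> (\<forall>u v. u \<le> x \<longrightarrow> x \<le> v \<longrightarrow> \<bar>u - x\<bar> < d x \<longrightarrow> \<bar>v - x\<bar> < d x \<longrightarrow> \<bar>f v - f u - g x * (v - u)\<bar> \<le> e1 * (v - u))"
      by (intro choice) blast
    then obtain d where d: "\<And>x. x \<notin> N \<Longrightarrow> 0 < d x"
      "\<And>x u v. x \<notin> N \<Longrightarrow> u \<le> x \<Longrightarrow> x \<le> v \<Longrightarrow> \<bar>u - x\<bar> < d x \<Longrightarrow> \<bar>v - x\<bar> < d x \<Longrightarrow> \<bar>f v - f u - g x * (v - u)\<bar> \<le> e1 * (v - u)"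
      by auto
    \<comment> \<open>Tags in \<open>N\<close> may only own intervals inside \<open>U\<close>, which
      makes their total length smaller than \<delta>.\<close>
    define \<gamma> where "\<gamma> x = (if x \<in> N then U else ball x (d x))" for x
    have G: "gauge \<gamma>" using U d(1) unfolding gauge_def \<gamma>_def by auto
    have R: "norm ((\<Sum>(x, k)\<in>D. measure lborel k *\<^sub>R g0 x) - (f b - f a)) < e"
      if D: "D tagged_division_of cbox a b" and fine: "\<gamma> fine D" for D
    proof -
      have fin: "finite D" using D by auto
      define u where "u i = Inf (snd i)" for i :: "real \<times> real set"
      define v where "v i = Sup (snd i)" for i :: "real \<times> real set"
      have K: "snd i = {u i..v i}" "u i \<le> fst i" "fst i \<le> v i" "a \<le> u i" "v i \<le> b" "{u i..v i} \<subseteq> \<gamma> (fst i)" if "i \<in> D" for i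
      proof -
        obtain x k where i: "i = (x,k)" by force
        have xk: "x \<in> k" "k \<subseteq> {a..b}" "\<exists>p q. k = cbox p q" using tagged_division_ofD(2-4)[OF D] that i by auto
        then obtain p q where k: "k = {p..q}" by auto
        then have "p \<le> q" using xk by auto
        then have uv: "u i = p" "v i = q" by (simp_all add: u_def v_def i k)
        show "snd i = {u i..v i}" "u i \<le> fst i" "fst i \<le> v i" unfolding uv using i k xk by auto
        show "a \<le> u i" "v i \<le> b" unfolding uv using xk(2) \<open>p \<le> q\<close> by (auto simp: k)
        show "{u i..v i} \<subseteq> \<gamma> (fst i)" unfolding uv using fine that i k by (auto simp: fine_def)
      qed
      have disj: "disjoint_family_on (\<lambda>i. {u i<..<v i}) D"
        unfolding disjoint_family_on_def
      proof (intro ballI impI)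
        fix i j assume ij: "i \<in> D" "j \<in> D" "i \<noteq> j"
        then have "interior (snd i) \<inter> interior (snd j) = {}"
          using tagged_division_ofD(5)[OF D, of "fst i" "snd i" "fst j" "snd j"] by (auto simp: prod_eq_iff)
        then show "{u i<..<v i} \<inter> {u j<..<v j} = {}" using K(1) ij by (simp add: interior_atLeastAtMost_real)
      qed
      define D1 where "D1 = {i \<in> D. fst i \<notin> N}"
      define D2 where "D2 = {i \<in> D. fst i \<in> N}"
      have DD: "D = D1 \<union> D2" "D1 \<inter> D2 = {}" "finite D1" "finite D2" using fin by (auto simp: D1_def D2_def)
      have "(\<Sum>(x,k)\<in>D. f (Sup k) - f (Inf k)) = f b - f a"
        using additive_tagged_division_1[of a b D f] D ab by simp
      then have fba: "f b - f a = (\<Sum>i\<in>D. f (v i) - f (u i))" by (simp add: u_def v_def case_prod_unfold)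
      have "(\<Sum>(x, k)\<in>D. measure lborel k *\<^sub>R g0 x) = (\<Sum>i\<in>D. (v i - u i) * g0 (fst i))"
        unfolding case_prod_unfold
      proof (rule sum.cong)
        fix i assume i: "i \<in> D"
        then have "u i \<le> v i" using K(2,3)[OF i] by linarith
        then show "measure lborel (snd i) *\<^sub>R g0 (fst i) = (v i - u i) * g0 (fst i)"
          unfolding K(1)[OF i] by simp
      qed simp
      then have "norm ((\<Sum>(x, k)\<in>D. measure lborel k *\<^sub>R g0 x) - (f b - f a))
          = \<bar>\<Sum>i\<in>D. (v i - u i) * g0 (fst i) - (f (v i) - f (u i))\<bar>" unfolding fba by (simp add: sum_subtractf)
      also have "\<dots> \<le> (\<Sum>i\<in>D. \<bar>(v i - u i) * g0 (fst i) - (f (v i) - f (u i))\<bar>)" by (rule sum_abs)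
      also have "\<dots> = (\<Sum>i\<in>D1. \<bar>(v i - u i) * g0 (fst i) - (f (v i) - f (u i))\<bar>) + (\<Sum>i\<in>D2. \<bar>f (v i) - f (u i)\<bar>)"
        unfolding DD(1) using DD by (subst sum.union_disjoint) (auto simp: D2_def g0_def intro!: sum.cong)
      finally have A1: "norm ((\<Sum>(x, k)\<in>D. measure lborel k *\<^sub>R g0 x) - (f b - f a)) \<le> \<dots>" .
      have "(\<Sum>i\<in>D1. \<bar>(v i - u i) * g0 (fst i) - (f (v i) - f (u i))\<bar>) \<le> (\<Sum>i\<in>D1. e1 * (v i - u i))"
      proof (rule sum_mono)
        fix i assume i: "i \<in> D1"
        then have iD: "i \<in> D" "fst i \<notin> N" by (auto simp: D1_def)
        have "u i \<in> ball (fst i) (d (fst i))" "v i \<in> ball (fst i) (d (fst i))"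
          using K(2,3,6)[OF iD(1)] iD(2) by (auto simp: \<gamma>_def subset_iff)
        then have "\<bar>u i - fst i\<bar> < d (fst i)" "\<bar>v i - fst i\<bar> < d (fst i)"
          by (auto simp: dist_real_def abs_minus_commute)
        from d(2)[OF iD(2) K(2,3)[OF iD(1)] this]
        show "\<bar>(v i - u i) * g0 (fst i) - (f (v i) - f (u i))\<bar> \<le> e1 * (v i - u i)"
          using iD(2) by (simp add: g0_def abs_minus_commute mult.commute)
      qed
      also have "\<dots> \<le> (\<Sum>i\<in>D. e1 * (v i - u i))"
      proof (rule sum_mono2)
        fix i assume "i \<in> D - D1"
        then have "u i \<le> v i" using K(2,3)[of i] by auto
        then show "0 \<le> e1 * (v i - u i)" using e1 by simp
      qed (use fin in \<open>auto simp: D1_def\<close>)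
      also have "\<dots> = e1 * (b - a)"
        using additive_tagged_division_1[of a b D "\<lambda>x. x"] D ab by (simp add: u_def v_def case_prod_unfold sum_distrib_left[symmetric])
      finally have A2: "(\<Sum>i\<in>D1. \<bar>(v i - u i) * g0 (fst i) - (f (v i) - f (u i))\<bar>) \<le> e1 * (b - a)" .
      have A3: "(\<Sum>i\<in>D2. \<bar>f (v i) - f (u i)\<bar>) < e / 2"
      proof (rule \<delta>(2))
        show "finite D2" by fact
        show "a \<le> u i \<and> u i \<le> v i \<and> v i \<le> b" if "i \<in> D2" for i
            using K(2-5)[of i] that by (simp add: D2_def)
        show d2: "disjoint_family_on (\<lambda>i. {u i<..<v i}) D2" using disj by (rule disjoint_family_on_mono[rotated]) (auto simp: D2_def)
        show "(\<Sum>i\<in>D2. v i - u i) < \<delta>"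
        proof (rule sum_disjoint_intervals_le[OF _ d2])
          show "u i \<le> v i" "{u i<..<v i} \<subseteq> U" if "i \<in> D2" for i
            using K(2,3,6)[of i] that by (auto simp: D2_def \<gamma>_def subset_iff)
        qed (simp_all add: DD(4) U(1,3))
      qed
      have "e1 * (b - a) \<le> e / 2" using e ab by (simp add: e1_def field_simps)
      with A1 A2 A3 show ?thesis by linarith
    qed
    show "\<exists>\<gamma>. gauge \<gamma> \<and> (\<forall>D. D tagged_division_of cbox a b \<and> \<gamma> fine D \<longrightarrow>
        norm ((\<Sum>(x, k)\<in>D. measure lborel k *\<^sub>R g0 x) - (f b - f a)) < e)"
      by (rule exI[of _ \<gamma>], rule conjI[OF G], intro allI impI, elim conjE, rule R)
  qed
  then have "(g has_integral (f b - f a)) (cbox a b)"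
    by (rule has_integral_spike[OF neg, rotated]) (simp add: g0_def)
  then show ?thesis by simp
qed

section \<open>Classical and weak d-bar derivatives\<close>

lemma open_upper_half_plane: "open upper_half_plane"
  unfolding upper_half_plane_def by (simp add: open_halfspace_Im_gt)

lemma locally_integrable_on_continuous:
  assumes "continuous_on \<Omega> F"
  shows "locally_integrable_on \<Omega> F"
  unfolding locally_integrable_on_def set_integrable_def
proof (intro allI impI)
  fix K assume K: "compact K \<and> K \<subseteq> \<Omega>"
  show "integrable lborel (\<lambda>x. indicator K x *\<^sub>R F x)"
    by (rule borel_integrable_compact) (use K assms continuous_on_subset in blast)+
qed

lemma smooth_cD:
  assumes "smooth_c \<phi>"
  shows "continuous_on UNIV \<phi>" "smooth_c (px \<phi>)" "smooth_c (py \<phi>)"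
    "continuous_on UNIV (px \<phi>)" "continuous_on UNIV (py \<phi>)"
    "((\<lambda>t::real. \<phi> (z + of_real t)) has_vector_derivative px \<phi> z) (at 0)"
    "((\<lambda>t::real. \<phi> (z + \<i> * of_real t)) has_vector_derivative py \<phi> z) (at 0)"
proof -
  show 1: "continuous_on UNIV \<phi>" "smooth_c (px \<phi>)" "smooth_c (py \<phi>)" using assms by (auto elim: smooth_c.cases)
  show "continuous_on UNIV (px \<phi>)" "continuous_on UNIV (py \<phi>)" using 1(2,3) by (auto elim: smooth_c.cases)
  have "(\<lambda>t::real. \<phi> (z + of_real t)) differentiable (at 0)" "(\<lambda>t::real. \<phi> (z + \<i> * of_real t)) differentiable (at 0)"
    using assms by (auto elim: smooth_c.cases)
  then show "((\<lambda>t::real. \<phi> (z + of_real t)) has_vector_derivative px \<phi> z) (at 0)"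
    "((\<lambda>t::real. \<phi> (z + \<i> * of_real t)) has_vector_derivative py \<phi> z) (at 0)"
    unfolding px_def py_def by (simp_all add: vector_derivative_works)
qed

lemma partial_cong:
  fixes f g :: "complex \<Rightarrow> complex"
  assumes "open S" "z \<in> S" "\<And>w. w \<in> S \<Longrightarrow> f w = g w"
    "((\<lambda>t::real. f (z + c * of_real t)) has_vector_derivative D) (at 0)"
  shows "((\<lambda>t::real. g (z + c * of_real t)) has_vector_derivative D) (at 0)"
proof -
  have "open ((\<lambda>t::real. z + c * of_real t) -` S)"
    by (intro open_vimage assms continuous_intros)
  moreover have "0 \<in> ((\<lambda>t::real. z + c * of_real t) -` S)" using assms by simp
  ultimately show ?thesis
    using assms(3) by (intro has_vector_derivative_transform_within_open[OF assms(4)]) auto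
qed

lemma dbar_zero_outside:
  assumes z: "z \<notin> closure {z. \<phi> z \<noteq> 0}"
  shows "px \<phi> z = 0" "py \<phi> z = 0" "\<phi> z = 0"
proof -
  let ?S = "- closure {z. \<phi> z \<noteq> 0}"
  have e: "\<phi> w = 0" if "w \<in> ?S" for w
    using that closure_subset[of "{z. \<phi> z \<noteq> 0}"] by blast
  show "\<phi> z = 0" by (rule e) (use z in simp)
  have "((\<lambda>t::real. \<phi> (z + c * of_real t)) has_vector_derivative 0) (at 0)" for c
  proof (rule partial_cong[where f="\<lambda>_. 0" and S="?S"])
    show "0 = \<phi> w" if "w \<in> ?S" for w using e[OF that] by simp
  qed (use z in auto)
  from this[of 1] this[of \<i>] show "px \<phi> z = 0" "py \<phi> z = 0"
    unfolding px_def py_def by (auto intro: vector_derivative_at)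
qed

text \<open>The product \<open>F * \<phi>\<close>, extended by 0, has compact support in
  \<open>U\<close>, so both of its partial derivatives integrate to 0. Adding i times the second to
  the first and halving gives the weak identity.\<close>

lemma weak_dbar_C1:
  assumes U: "open U"
    and Fx: "\<And>z. z \<in> U \<Longrightarrow> ((\<lambda>t::real. F (z + of_real t)) has_vector_derivative Fx z) (at 0)"
    and Fy: "\<And>z. z \<in> U \<Longrightarrow> ((\<lambda>t::real. F (z + \<i> * of_real t)) has_vector_derivative Fy z) (at 0)"
    and c: "continuous_on U F" "continuous_on U Fx" "continuous_on U Fy"
  shows "weak_dbar U F (\<lambda>z. (Fx z + \<i> * Fy z) / 2)"
  unfolding weak_dbar_def
proof (intro conjI allI impI)
  show "locally_integrable_on U F" by (rule locally_integrable_on_continuous) fact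
  show "locally_integrable_on U (\<lambda>z. (Fx z + \<i> * Fy z) / 2)"
    by (rule locally_integrable_on_continuous) (intro continuous_intros c, simp)
next
  fix \<phi> assume "test_function U \<phi>"
  then have s: "smooth_c \<phi>" and K': "compact (closure {z. \<phi> z \<noteq> 0})" "closure {z. \<phi> z \<noteq> 0} \<subseteq> U" by (auto simp: test_function_def)
  define K where "K = closure {z. \<phi> z \<noteq> 0}"
  have z: "px \<phi> z = 0" "py \<phi> z = 0" "\<phi> z = 0" if "z \<notin> K" for z
    using dbar_zero_outside[of z \<phi>] that by (simp_all add: K_def)
  have K: "compact K" "K \<subseteq> U" using K' by (simp_all add: K_def)
  have "open (- K)" unfolding K_def by (rule open_Compl) (rule closed_closure)
  \<comment> \<open>\<open>U\<close> and the complement of \<open>K\<close> form an open cover, and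
    on the second set the extension vanishes; continuity is local.\<close>
  have cont: "continuous_on UNIV (\<lambda>z. if z \<in> U then q z else 0)" if "continuous_on U q" "\<And>z. z \<in> U \<Longrightarrow> z \<notin> K \<Longrightarrow> q z = 0" for q :: "complex \<Rightarrow> complex"
  proof -
    have "continuous_on (U \<union> - K) (\<lambda>z. if z \<in> U then q z else 0)"
    proof (rule continuous_on_open_Un)
      show "continuous_on U (\<lambda>z. if z \<in> U then q z else 0)" using that(1) by (rule continuous_on_eq) simp
      have "continuous_on (- K) (\<lambda>z. 0::complex)" by simp
      then show "continuous_on (- K) (\<lambda>z. if z \<in> U then q z else 0)" by (rule continuous_on_eq) (use that(2) in auto)
    qed (use U \<open>open (- K)\<close> in auto)
    moreover have "U \<union> - K = UNIV" using K by auto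
    ultimately show ?thesis by simp
  qed
  have int: "integrable lborel (\<lambda>z. if z \<in> U then q z else 0)" if "continuous_on U q" "\<And>z. z \<in> U \<Longrightarrow> z \<notin> K \<Longrightarrow> q z = 0" for q :: "complex \<Rightarrow> complex"
    by (rule integrable_cont_compact[OF cont[OF that] K(1)]) (simp_all add: that)
  have cphi: "continuous_on U \<phi>" "continuous_on U (px \<phi>)" "continuous_on U (py \<phi>)"
    using smooth_cD(1,4,5)[OF s] by (auto intro: continuous_on_subset)
  define \<Psi> where "\<Psi> z = (if z \<in> U then F z * \<phi> z else 0)" for z
  have der: "((\<lambda>t::real. \<Psi> (z + e * of_real t)) has_vector_derivative (if z \<in> U then Fe z * \<phi> z + F z * pe z else 0)) (at 0)"
    if "\<And>z. z \<in> U \<Longrightarrow> ((\<lambda>t::real. F (z + e * of_real t)) has_vector_derivative Fe z) (at 0)"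
      "\<And>z. ((\<lambda>t::real. \<phi> (z + e * of_real t)) has_vector_derivative pe z) (at 0)" for e Fe pe z
  proof (cases "z \<in> U")
    case True
    have "((\<lambda>t::real. F (z + e * of_real t) * \<phi> (z + e * of_real t)) has_vector_derivative F (z + e * of_real 0) * pe z + Fe z * \<phi> (z + e * of_real 0)) (at 0)"
      by (rule has_vector_derivative_mult[OF that(1)[OF True] that(2)])
    then have "((\<lambda>t::real. (\<lambda>z. F z * \<phi> z) (z + e * of_real t)) has_vector_derivative Fe z * \<phi> z + F z * pe z) (at 0)"
      by (simp add: add.commute)
    then have "((\<lambda>t::real. \<Psi> (z + e * of_real t)) has_vector_derivative Fe z * \<phi> z + F z * pe z) (at 0)"
      by (rule partial_cong[OF U True, rotated]) (simp add: \<Psi>_def)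
    then show ?thesis using True by simp
  next
    case False
    then have "z \<in> - K" using K by auto
    have "((\<lambda>t::real. \<Psi> (z + e * of_real t)) has_vector_derivative 0) (at 0)"
    proof (rule partial_cong[where f="\<lambda>_. 0" and S="- K"])
      show "0 = \<Psi> w" if "w \<in> - K" for w using z(3)[of w] that by (simp add: \<Psi>_def)
    qed (use \<open>z \<in> - K\<close> \<open>open (- K)\<close> in auto)
    then show ?thesis using False by simp
  qed
  have cx: "continuous_on U (\<lambda>z. Fx z * \<phi> z + F z * px \<phi> z)" and cy: "continuous_on U (\<lambda>z. Fy z * \<phi> z + F z * py \<phi> z)"
    using c cphi by (auto intro!: continuous_on_add continuous_on_mult)
  have x0: "(LINT z|lborel. (if z \<in> U then Fx z * \<phi> z + F z * px \<phi> z else 0)) = 0" (is "integral\<^sup>L _ ?X = 0")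
  proof (rule integral_px_zero[of \<Psi> _ K])
    show "((\<lambda>t::real. \<Psi> (z + of_real t)) has_vector_derivative (if z \<in> U then Fx z * \<phi> z + F z * px \<phi> z else 0)) (at 0)" for z
      using der[of 1 Fx "px \<phi>" z, unfolded mult_1, OF Fx smooth_cD(6)[OF s]] .
    show "continuous_on UNIV ?X" by (rule cont[OF cx]) (simp add: z)
    show "compact K" by (rule K)
    show "\<Psi> z = 0" if "z \<notin> K" for z using z(3)[OF that] by (simp add: \<Psi>_def)
  qed (simp add: z)
  have y0: "(LINT z|lborel. (if z \<in> U then Fy z * \<phi> z + F z * py \<phi> z else 0)) = 0" (is "integral\<^sup>L _ ?Y = 0")
  proof (rule integral_py_zero[of \<Psi> _ K])
    show "((\<lambda>t::real. \<Psi> (z + \<i> * of_real t)) has_vector_derivative (if z \<in> U then Fy z * \<phi> z + F z * py \<phi> z else 0)) (at 0)" for z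
      by (rule der[of \<i> Fy "py \<phi>" z, OF Fy smooth_cD(7)[OF s]])
    show "continuous_on UNIV ?Y" by (rule cont[OF cy]) (simp add: z)
    show "compact K" by (rule K)
    show "\<Psi> z = 0" if "z \<notin> K" for z using z(3)[OF that] by (simp add: \<Psi>_def)
  qed (simp add: z)
  let ?A = "\<lambda>z. if z \<in> U then F z * dbar \<phi> z else 0"
  let ?B = "\<lambda>z. if z \<in> U then (Fx z + \<i> * Fy z) / 2 * \<phi> z else 0"
  have iA: "integrable lborel ?A" by (rule int) (use z in \<open>auto intro!: continuous_intros c cphi simp: dbar_def\<close>)
  have iB: "integrable lborel ?B" by (rule int) (use z in \<open>auto intro!: continuous_intros c cphi\<close>)
  have iX: "integrable lborel ?X" by (rule int) (use z cx in auto)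
  have iY: "integrable lborel ?Y" by (rule int) (use z cy in auto)
  have "(LINT z|lborel. ?A z + ?B z) = (LINT z|lborel. (?X z + \<i> * ?Y z) / 2)"
    by (intro Bochner_Integration.integral_cong) (auto simp: dbar_def field_simps)
  also have "\<dots> = (integral\<^sup>L lborel ?X + \<i> * integral\<^sup>L lborel ?Y) / 2"
    using iX iY by simp
  also have "\<dots> = 0" using x0 y0 by simp
  finally have "integral\<^sup>L lborel ?A + integral\<^sup>L lborel ?B = 0" using iA iB by simp
  moreover have "(LINT z:U|lborel. F z * dbar \<phi> z) = integral\<^sup>L lborel ?A" "(LINT z:U|lborel. (Fx z + \<i> * Fy z) / 2 * \<phi> z) = integral\<^sup>L lborel ?B"
    unfolding set_lebesgue_integral_def by (intro Bochner_Integration.integral_cong; simp add: indicator_def)+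
  ultimately show "(LINT z:U|lborel. F z * dbar \<phi> z) = - (LINT z:U|lborel. (Fx z + \<i> * Fy z) / 2 * \<phi> z)"
    by (simp add: add_eq_0_iff)
qed

section \<open>The Beurling--Ahlfors extension\<close>

text \<open>With \<open>P\<close> a primitive of \<open>f\<close>, the real part is the mean of
  \<open>f\<close> over an interval of radius \<open>Im z\<close>, and the imaginary part is the
  mean over its right half minus the mean over its left half. Using \<open>P\<close> keeps all
  partial derivatives explicit.\<close>

definition ba_ext :: "(real \<Rightarrow> real) \<Rightarrow> (real \<Rightarrow> real) \<Rightarrow> complex \<Rightarrow> complex" where
  "ba_ext P f z = (if Im z > 0 then
     Complex ((P (Re z + Im z) - P (Re z - Im z)) / (2 * Im z))
             ((P (Re z + Im z) - 2 * P (Re z) + P (Re z - Im z)) / Im z)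
   else of_real (f (Re z)))"

definition ba_x :: "(real \<Rightarrow> real) \<Rightarrow> complex \<Rightarrow> complex" where
  "ba_x f z = Complex ((f (Re z + Im z) - f (Re z - Im z)) / (2 * Im z))
     ((f (Re z + Im z) - 2 * f (Re z) + f (Re z - Im z)) / Im z)"

definition ba_y :: "(real \<Rightarrow> real) \<Rightarrow> (real \<Rightarrow> real) \<Rightarrow> complex \<Rightarrow> complex" where
  "ba_y P f z = Complex
     ((f (Re z + Im z) + f (Re z - Im z)) / (2 * Im z) - (P (Re z + Im z) - P (Re z - Im z)) / (2 * (Im z)\<^sup>2))
     ((f (Re z + Im z) - f (Re z - Im z)) / Im z - (P (Re z + Im z) - 2 * P (Re z) + P (Re z - Im z)) / (Im z)\<^sup>2)"

definition ba_dbar :: "(real \<Rightarrow> real) \<Rightarrow> (real \<Rightarrow> real) \<Rightarrow> complex \<Rightarrow> complex" where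
  "ba_dbar P f z = (ba_x f z + \<i> * ba_y P f z) / 2"

lemma primitive_exists:
  fixes f :: "real \<Rightarrow> real"
  assumes "continuous_on UNIV f"
  obtains P where "\<And>x. (P has_real_derivative f x) (at x)"
proof -
  have "\<exists>P. \<forall>x::real. -\<infinity> < ereal x \<longrightarrow> ereal x < \<infinity> \<longrightarrow> (P has_vector_derivative f x) (at x)"
    by (rule einterval_antiderivative) (use assms in \<open>auto simp: continuous_on_eq_continuous_at\<close>)
  then show ?thesis using that by (auto simp: has_real_derivative_iff_has_vector_derivative)
qed

lemma primitive_approx:
  fixes P f :: "real \<Rightarrow> real"
  assumes P: "\<And>x. (P has_real_derivative f x) (at x)" and "a \<le> b"
    and e: "\<And>s. s \<in> {a..b} \<Longrightarrow> \<bar>f s - c\<bar> \<le> e"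
  shows "\<bar>P b - P a - c * (b - a)\<bar> \<le> e * (b - a)"
proof (cases "a < b")
  case True
  obtain s where s: "a < s" "s < b" "P b - P a = (b - a) * f s" using MVT2[OF True, of P f] P by auto
  have "P b - P a - c * (b - a) = (f s - c) * (b - a)" unfolding s(3) by (simp add: algebra_simps)
  then have "\<bar>P b - P a - c * (b - a)\<bar> = \<bar>f s - c\<bar> * (b - a)" using True by (simp add: abs_mult)
  also have "\<dots> \<le> e * (b - a)" using e[of s] s True by (intro mult_right_mono) auto
  finally show ?thesis .
qed (use \<open>a \<le> b\<close> in auto)

lemma cmod_Complex_le: "cmod (Complex a b) \<le> \<bar>a\<bar> + \<bar>b\<bar>"
  using cmod_le[of "Complex a b"] by simp

text \<open>The two one-sided means of \<open>f\<close> deviate from \<open>c\<close> by at most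
  \<open>e\<close>, so the real part of the difference is at most \<open>e\<close> and the imaginary
  part at most \<open>2 * e\<close>. The bound serves twice: with \<open>c\<close> a boundary value
  of \<open>f\<close> for continuity at the axis, and with \<open>c = 0\<close> for growth.\<close>

lemma ba_ext_near:
  assumes P: "\<And>x. (P has_real_derivative f x) (at x)" and y: "Im z \<ge> 0"
    and e: "\<And>s. s \<in> {Re z - Im z..Re z + Im z} \<Longrightarrow> \<bar>f s - c\<bar> \<le> e"
  shows "cmod (ba_ext P f z - of_real c) \<le> 3 * e"
proof -
  define x y where "x = Re z" and "y = Im z"
  have e0: "0 \<le> e" using e[of x] y by (simp add: x_def)
  show ?thesis
  proof (cases "y > 0")
    case False
    then have "cmod (ba_ext P f z - of_real c) = \<bar>f x - c\<bar>"
      using norm_of_real[of "f x - c", where 'a=complex] by (simp add: ba_ext_def x_def y_def)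
    then show ?thesis using e[of x] y e0 by (simp add: x_def del: of_real_diff)
  next
    case True
    have 1: "\<bar>P (x + y) - P x - c * y\<bar> \<le> e * y"
      using primitive_approx[OF P, where a=x and b="x+y" and c=c and e=e] e True by (auto simp: x_def y_def)
    have 2: "\<bar>P x - P (x - y) - c * y\<bar> \<le> e * y"
      using primitive_approx[OF P, where a="x-y" and b="x" and c=c and e=e] e True by (auto simp: x_def y_def)
    have "ba_ext P f z - of_real c = Complex (((P (x + y) - P x - c * y) + (P x - P (x - y) - c * y)) / (2 * y))
          (((P (x + y) - P x - c * y) - (P x - P (x - y) - c * y)) / y)"
      using True by (simp add: ba_ext_def x_def y_def complex_eq_iff field_simps)
    also have "cmod \<dots> \<le> \<bar>((P (x + y) - P x - c * y) + (P x - P (x - y) - c * y)) / (2 * y)\<bar> +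
        \<bar>((P (x + y) - P x - c * y) - (P x - P (x - y) - c * y)) / y\<bar>" by (rule cmod_Complex_le)
    also have "\<dots> \<le> e + 2 * e"
    proof (rule add_mono)
      show "\<bar>((P (x + y) - P x - c * y) + (P x - P (x - y) - c * y)) / (2 * y)\<bar> \<le> e"
        using 1 2 True by (simp add: abs_divide pos_divide_le_eq)
      show "\<bar>((P (x + y) - P x - c * y) - (P x - P (x - y) - c * y)) / y\<bar> \<le> 2 * e"
        using 1 2 True by (simp add: abs_divide pos_divide_le_eq)
    qed
    finally show ?thesis by simp
  qed
qed

lemma ba_ext_partials:
  assumes P: "\<And>x. (P has_real_derivative f x) (at x)" and z: "z \<in> upper_half_plane"
  shows "((\<lambda>t::real. ba_ext P f (z + of_real t)) has_vector_derivative ba_x f z) (at 0)"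
    and "((\<lambda>t::real. ba_ext P f (z + \<i> * of_real t)) has_vector_derivative ba_y P f z) (at 0)"
proof -
  define E where "E z = Complex ((P (Re z + Im z) - P (Re z - Im z)) / (2 * Im z))
             ((P (Re z + Im z) - 2 * P (Re z) + P (Re z - Im z)) / Im z)" for z
  have E: "E w = ba_ext P f w" if "w \<in> upper_half_plane" for w
    using that by (simp add: E_def ba_ext_def upper_half_plane_def)
  have y: "Im z > 0" using z by (simp add: upper_half_plane_def)
  note D = DERIV_chain2[OF P]
  have "((\<lambda>t::real. E (z + 1 * of_real t)) has_vector_derivative ba_x f z) (at 0)"
    unfolding has_vector_derivative_complex_iff E_def ba_x_def
    using y by (auto intro!: derivative_eq_intros D simp: field_simps)
  from partial_cong[OF open_upper_half_plane z E this]
  show "((\<lambda>t::real. ba_ext P f (z + of_real t)) has_vector_derivative ba_x f z) (at 0)" by simp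
  have "((\<lambda>t::real. E (z + \<i> * of_real t)) has_vector_derivative ba_y P f z) (at 0)"
    unfolding has_vector_derivative_complex_iff E_def ba_y_def
    using y by (auto intro!: derivative_eq_intros D simp: field_simps power2_eq_square)
  from partial_cong[OF open_upper_half_plane z E this]
  show "((\<lambda>t::real. ba_ext P f (z + \<i> * of_real t)) has_vector_derivative ba_y P f z) (at 0)" .
qed

lemma ba_continuous:
  assumes P: "\<And>x. (P has_real_derivative f x) (at x)" and f: "continuous_on UNIV f"
  shows "continuous_on upper_half_plane (ba_x f)" "continuous_on upper_half_plane (ba_y P f)"
    "continuous_on upper_half_plane (ba_ext P f)" "continuous_on upper_half_plane (ba_dbar P f)"
proof -
  have cP: "continuous_on UNIV P"
    by (intro continuous_at_imp_continuous_on ballI DERIV_isCont[OF P])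
  let ?U = upper_half_plane
  have nz: "\<forall>z\<in>?U. Im z \<noteq> 0" "\<forall>z\<in>?U. 2 * Im z \<noteq> 0" "\<forall>z\<in>?U. (Im z)\<^sup>2 \<noteq> 0" "\<forall>z\<in>?U. 2 * (Im z)\<^sup>2 \<noteq> 0"
    by (auto simp: upper_half_plane_def)
  have a: "continuous_on ?U Re" "continuous_on ?U Im" "continuous_on ?U (\<lambda>z. Re z + Im z)" "continuous_on ?U (\<lambda>z. Re z - Im z)"
    "continuous_on ?U (\<lambda>z. 2 * Im z)" "continuous_on ?U (\<lambda>z. (Im z)\<^sup>2)" "continuous_on ?U (\<lambda>z. 2 * (Im z)\<^sup>2)"
    by (intro continuous_intros)+
  note f' = a(1,3,4)[THEN continuous_on_compose2[OF f], simplified]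
  note P' = a(1,3,4)[THEN continuous_on_compose2[OF cP], simplified]
  note ci = continuous_on_add continuous_on_diff continuous_on_mult_left continuous_on_mult_right continuous_on_divide continuous_on_of_real continuous_on_const f' P' a nz
  show x: "continuous_on ?U (ba_x f)" unfolding ba_x_def Complex_eq by (intro ci)
  show y: "continuous_on ?U (ba_y P f)" unfolding ba_y_def Complex_eq by (intro ci)
  show "continuous_on ?U (ba_dbar P f)" unfolding ba_dbar_def by (intro ci x y) simp
  have "continuous_on ?U (\<lambda>z. Complex ((P (Re z + Im z) - P (Re z - Im z)) / (2 * Im z))
             ((P (Re z + Im z) - 2 * P (Re z) + P (Re z - Im z)) / Im z))"
    unfolding Complex_eq by (intro ci)
  then show "continuous_on ?U (ba_ext P f)"
    by (rule continuous_on_eq) (simp add: ba_ext_def upper_half_plane_def)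
qed

lemma ba_ext_continuous:
  assumes P: "\<And>x. (P has_real_derivative f x) (at x)" and f: "continuous_on UNIV f"
  shows "continuous_on closed_upper_half_plane (ba_ext P f)"
proof -
  note 2 = ba_continuous(3)[OF P f]
  show ?thesis
    unfolding continuous_on_eq_continuous_within
  proof
    fix z assume z: "z \<in> closed_upper_half_plane"
    show "continuous (at z within closed_upper_half_plane) (ba_ext P f)"
    proof (cases "Im z > 0")
      case True
      then have "z \<in> upper_half_plane" by (simp add: upper_half_plane_def)
      then have "continuous (at z) (ba_ext P f)" using 2 open_upper_half_plane continuous_on_eq_continuous_at by blast
      then show ?thesis by (rule continuous_at_imp_continuous_at_within)
    next
      case False
      with z have z0: "Im z = 0" by (simp add: closed_upper_half_plane_def)
      show ?thesis unfolding continuous_within_eps_delta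
      proof (intro allI impI)
        fix e :: real assume e: "e > 0"
        \<comment> \<open>\<open>ba_ext_near\<close> costs a factor 3, so oscillation
          \<open>e / 4\<close> is small enough.\<close>
        then have e4: "e / 4 > 0" by simp
        obtain d where d0: "d > 0" "\<forall>s\<in>UNIV. dist s (Re z) < d \<longrightarrow> dist (f s) (f (Re z)) < e / 4"
          using f[unfolded continuous_on_iff, THEN bspec, OF UNIV_I[of "Re z"], rule_format, OF e4] by auto
        have d: "\<bar>f s - f (Re z)\<bar> < e / 4" if "\<bar>s - Re z\<bar> < d" for s
          using d0(2)[THEN bspec, OF UNIV_I[of s]] that by (simp add: dist_real_def)
        have "dist (ba_ext P f w) (ba_ext P f z) < e" if w: "w \<in> closed_upper_half_plane" "dist w z < d / 2" for w
        proof -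
          have "\<bar>Re w - Re z\<bar> < d / 2" "\<bar>Im w\<bar> < d / 2"
            using w(2) abs_Re_le_cmod[of "w - z"] abs_Im_le_cmod[of "w - z"] z0 by (simp_all add: dist_norm)
          have "\<bar>f s - f (Re z)\<bar> \<le> e / 4" if "s \<in> {Re w - Im w..Re w + Im w}" for s
          proof (rule less_imp_le[OF d])
            have "Re w - Im w \<le> s" "s \<le> Re w + Im w" using that by auto
            then show "\<bar>s - Re z\<bar> < d"
              using \<open>\<bar>Re w - Re z\<bar> < d / 2\<close> \<open>\<bar>Im w\<bar> < d / 2\<close> by linarith
          qed
          then have "cmod (ba_ext P f w - of_real (f (Re z))) \<le> 3 * (e / 4)"
            using w(1) by (intro ba_ext_near[OF P]) (simp_all add: closed_upper_half_plane_def)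
          then show ?thesis using e z0 by (simp add: dist_norm ba_ext_def)
        qed
        then show "\<exists>d>0. \<forall>x'\<in>closed_upper_half_plane. dist x' z < d \<longrightarrow> dist (ba_ext P f x') (ba_ext P f z) < e"
          using d0(1) by (intro exI[of _ "d/2"]) simp
      qed
    qed
  qed
qed

lemma ba_weak_dbar:
  assumes P: "\<And>x. (P has_real_derivative f x) (at x)" and f: "continuous_on UNIV f"
  shows "weak_dbar upper_half_plane (ba_ext P f) (ba_dbar P f)"
  unfolding ba_dbar_def[abs_def]
  by (rule weak_dbar_C1[OF open_upper_half_plane ba_ext_partials[OF P] ba_continuous(3,1,2)[OF P f]])

text \<open>The kernel of the extension annihilates affine functions, so only the deviation of \<open>f\<close> from
  an affine function enters.\<close>

lemma ba_dbar_bound: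
  assumes P: "\<And>x. (P has_real_derivative f x) (at x)" and y: "Im z > 0"
    and M: "\<And>s. s \<in> {Re z - Im z..Re z + Im z} \<Longrightarrow> \<bar>f s - f (Re z) - c * (s - Re z)\<bar> \<le> M"
  shows "cmod (ba_dbar P f z) \<le> 4 * M / Im z"
proof -
  define x y where "x = Re z" and "y = Im z"
  have y0: "y > 0" using y by (simp add: y_def)
  \<comment> \<open>\<open>Q\<close> is a primitive of \<open>f\<close> minus the linear term
    centred at \<open>x\<close>; the contribution of the quadratic correction cancels from the d-bar
    derivative.\<close>
  define Q where "Q s = P s - c * (s - x)\<^sup>2 / 2" for s
  have Q: "(Q has_real_derivative f s - c * (s - x)) (at s)" for s
    unfolding Q_def by (auto intro!: derivative_eq_intros P)
  define A B p q where "A = f (x + y) - f x - c * y" and "B = f (x - y) - f x + c * y"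
    and "p = Q (x + y) - Q x - f x * y" and "q = Q x - Q (x - y) - f x * y"
  have M': "\<bar>(f s - c * (s - x)) - f x\<bar> \<le> M" if "s \<in> {x-y..x+y}" for s
    using M[of s] that unfolding x_def y_def by (simp add: algebra_simps)
  have A: "\<bar>A\<bar> \<le> M" "\<bar>B\<bar> \<le> M" using M[of "x+y"] M[of "x-y"] y0 by (auto simp: A_def B_def x_def y_def)
  have p: "\<bar>p\<bar> \<le> M * y"
    using primitive_approx[OF Q, where a=x and b="x+y" and c="f x" and e=M] M' y0 by (auto simp: p_def)
  have q: "\<bar>q\<bar> \<le> M * y"
    using primitive_approx[OF Q, where a="x-y" and b=x and c="f x" and e=M] M' y0 by (auto simp: q_def)
  have eq: "ba_dbar P f z = Complex ((p / y - q / y - (A - B) / 2) / y / 2) (((A + B) * (3 / 2) - (p / y + q / y) / 2) / y / 2)"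
    using y0 unfolding ba_dbar_def ba_x_def ba_y_def A_def B_def p_def q_def Q_def x_def[symmetric] y_def[symmetric]
    by (simp add: complex_eq_iff field_simps power2_eq_square)
  have pq: "\<bar>p / y\<bar> \<le> M" "\<bar>q / y\<bar> \<le> M" using p q y0 by (auto simp: abs_divide pos_divide_le_eq)
  have "cmod (ba_dbar P f z) \<le> \<bar>(p / y - q / y - (A - B) / 2) / y / 2\<bar> + \<bar>((A + B) * (3 / 2) - (p / y + q / y) / 2) / y / 2\<bar>"
    unfolding eq by (rule cmod_Complex_le)
  also have "\<dots> = (\<bar>p / y - q / y - (A - B) / 2\<bar> / 2 + \<bar>(A + B) * (3 / 2) - (p / y + q / y) / 2\<bar> / 2) / y"
  proof -
    have "\<bar>u / y / 2\<bar> + \<bar>v / y / 2\<bar> = (\<bar>u\<bar> / 2 + \<bar>v\<bar> / 2) / y" for u v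
      using y0 by (simp add: abs_divide add_divide_distrib)
    then show ?thesis .
  qed
  also have "\<dots> \<le> (4 * M) / y"
  proof (rule divide_right_mono)
    \<comment> \<open>The numerators are at most \<open>3 * M\<close> and \<open>4 * M\<close>; half
      of their sum stays below \<open>4 * M\<close>.\<close>
    show "\<bar>p / y - q / y - (A - B) / 2\<bar> / 2 + \<bar>(A + B) * (3 / 2) - (p / y + q / y) / 2\<bar> / 2 \<le> 4 * M"
    proof -
      have "\<bar>p / y - q / y - (A - B) / 2\<bar> \<le> 3 * M" "\<bar>(A + B) * (3 / 2) - (p / y + q / y) / 2\<bar> \<le> 4 * M"
        by (rule abs_leI; use A[THEN abs_le_D1] A[THEN abs_le_D2] pq[THEN abs_le_D1] pq[THEN abs_le_D2] in argo)+
      moreover have "0 \<le> M" using A(1) by simp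
      ultimately show ?thesis by argo
    qed
  qed (use y0 in simp)
  finally show ?thesis by (simp add: y_def)
qed

section \<open>Energy estimates for the extension\<close>

lemma locally_integrable_real_measurable:
  assumes "locally_integrable_real g"
  shows "g \<in> borel_measurable borel"
proof (rule borel_measurable_LIMSEQ_real)
  fix x :: real
  have "\<forall>\<^sub>F n in sequentially. indicator {-real n..real n} x *\<^sub>R g x = g x"
    using eventually_ge_at_top[of "nat \<lceil>\<bar>x\<bar>\<rceil>"]
  proof eventually_elim
    case (elim n)
    then have "\<bar>x\<bar> \<le> real n" by linarith
    then show ?case by (simp add: indicator_def abs_le_iff)
  qed
  then show "(\<lambda>n. indicator {-real n..real n} x *\<^sub>R g x) \<longlonglongrightarrow> g x" by (rule tendsto_eventually)
next
  fix n
  have "set_integrable lborel {-real n..real n} g" using assms by (simp add: locally_integrable_real_def)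
  then show "(\<lambda>x. indicator {-real n..real n} x *\<^sub>R g x) \<in> borel_measurable borel"
    unfolding set_integrable_def by (auto dest: borel_measurable_integrable)
qed

text \<open>Tonelli, with the positive constant in front of the double integral dropped, since only
  finiteness matters.\<close>

lemma H_half_iterated:
  "H_half g \<longleftrightarrow> locally_integrable_real g \<and>
     (\<integral>\<^sup>+s. \<integral>\<^sup>+t. ennreal ((g s - g t)\<^sup>2 / (s - t)\<^sup>2) \<partial>lborel \<partial>lborel) < \<infinity>"
proof (cases "locally_integrable_real g")
  case True
  have [measurable]: "g \<in> borel_measurable borel" by (rule locally_integrable_real_measurable) fact
  have "(\<integral>\<^sup>+ p. ennreal (1 / (4 * pi\<^sup>2) * (\<bar>g (fst p) - g (snd p)\<bar>\<^sup>2 / \<bar>fst p - snd p\<bar>\<^sup>2)) \<partial>(lborel \<Otimes>\<^sub>M lborel))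
    = (\<integral>\<^sup>+s. \<integral>\<^sup>+t. ennreal (1 / (4 * pi\<^sup>2) * ((g s - g t)\<^sup>2 / (s - t)\<^sup>2)) \<partial>lborel \<partial>lborel)"
    by (subst lborel.nn_integral_fst[symmetric]) auto
  also have "\<dots> = (\<integral>\<^sup>+s. \<integral>\<^sup>+t. ennreal (1 / (4 * pi\<^sup>2)) * ennreal ((g s - g t)\<^sup>2 / (s - t)\<^sup>2) \<partial>lborel \<partial>lborel)"
    by (subst ennreal_mult) auto
  also have "\<dots> = ennreal (1 / (4 * pi\<^sup>2)) * (\<integral>\<^sup>+s. \<integral>\<^sup>+t. ennreal ((g s - g t)\<^sup>2 / (s - t)\<^sup>2) \<partial>lborel \<partial>lborel)"
    by (simp add: nn_integral_cmult)
  finally show ?thesis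
    using True unfolding H_half_def by (auto simp: ennreal_mult_less_top)
qed (simp add: H_half_def)

text \<open>Absolute continuity enters the estimates only through the integrated identity
  \<open>ftc\<close>; the primitive \<open>P\<close> is carried along for the extension.\<close>

locale grad =
  fixes f g P :: "real \<Rightarrow> real"
  assumes gi: "locally_integrable_real g"
    and ftc: "\<And>a b. a \<le> b \<Longrightarrow> f b - f a = (LINT x:{a..b}|lborel. g x)"
    and P: "\<And>x. (P has_real_derivative f x) (at x)"
begin

lemma meas [measurable]: "g \<in> borel_measurable borel"
  by (rule locally_integrable_real_measurable[OF gi])

lemma integrable_diff: "set_integrable lborel {a..b} (\<lambda>\<sigma>. g \<sigma> - c)"
proof (rule set_integral_diff)
  show "set_integrable lborel {a..b} g" using gi by (simp add: locally_integrable_real_def)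
  have "integrable lborel (\<lambda>x. indicator {a..b} x *\<^sub>R c)"
    by (rule borel_integrable_compact) auto
  then show "set_integrable lborel {a..b} (\<lambda>_. c)" by (simp add: set_integrable_def)
qed

text \<open>The deviation of \<open>f\<close> from a line of slope \<open>c\<close> is an integral
  of \<open>g - c\<close>. The right-hand side is the \<open>M\<close> consumed by
  \<open>ba_dbar_bound\<close>.\<close>

lemma increment_bound:
  assumes "s \<in> {a..b}" "x \<in> {a..b}"
  shows "\<bar>f s - f x - c * (s - x)\<bar> \<le> (LINT \<sigma>:{a..b}|lborel. \<bar>g \<sigma> - c\<bar>)"
proof -
  have *: "\<bar>f q - f p - c * (q - p)\<bar> \<le> (LINT \<sigma>:{a..b}|lborel. \<bar>g \<sigma> - c\<bar>)" if "p \<le> q" "a \<le> p" "q \<le> b" for p q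
  proof -
    have "set_integrable lborel {p..q} g" using gi by (simp add: locally_integrable_real_def)
    moreover have "set_integrable lborel {p..q} (\<lambda>_. c)"
      using borel_integrable_compact[of "{p..q}" "\<lambda>_. c"] by (simp add: set_integrable_def)
    ultimately have "(LINT \<sigma>:{p..q}|lborel. g \<sigma> - c) = f q - f p - c * (q - p)"
      using ftc[OF that(1)] that(1) by (simp add: set_integral_diff(2) set_integral_const)
    then have "\<bar>f q - f p - c * (q - p)\<bar> = norm (LINT \<sigma>:{p..q}|lborel. g \<sigma> - c)" by simp
    also have "\<dots> \<le> (LINT \<sigma>:{p..q}|lborel. norm (g \<sigma> - c))"
      by (rule set_integral_norm_bound) (rule integrable_diff)
    also have "\<dots> \<le> (LINT \<sigma>:{a..b}|lborel. \<bar>g \<sigma> - c\<bar>)"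
      unfolding set_lebesgue_integral_def
    proof (rule integral_mono)
      show "integrable lborel (\<lambda>x. indicator {p..q} x *\<^sub>R norm (g x - c))" "integrable lborel (\<lambda>x. indicator {a..b} x *\<^sub>R \<bar>g x - c\<bar>)"
        using integrable_diff[THEN set_integrable_norm] by (simp_all add: set_integrable_def)
    qed (use that in \<open>auto simp: indicator_def\<close>)
    finally show ?thesis .
  qed
  show ?thesis
  proof (cases "x \<le> s")
    case True then show ?thesis using *[of x s] assms by simp
  next
    case False
    have "f s - f x - c * (s - x) = - (f x - f s - c * (x - s))" by (simp add: algebra_simps)
    then show ?thesis using *[of s x] assms False by (simp only: abs_minus_cancel) auto
  qed
qed

text \<open>The slope \<open>c\<close> stays free. Cauchy-Schwarz on an interval of length
  \<open>2 * y\<close> contributes that length, which turns \<open>16 / y^2\<close> into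
  \<open>32 / y\<close>.\<close>

lemma ba_dbar_sq1:
  assumes y: "y > 0"
  shows "ennreal ((cmod (ba_dbar P f (Complex x y)))\<^sup>2)
    \<le> ennreal (32 / y) * (\<integral>\<^sup>+\<sigma>. ennreal ((g \<sigma> - c)\<^sup>2) * indicator {x-y..x+y} \<sigma> \<partial>lborel)"
proof -
  define M where "M = (LINT \<sigma>:{x-y..x+y}|lborel. \<bar>g \<sigma> - c\<bar>)"
  have M0: "0 \<le> M" unfolding M_def set_lebesgue_integral_def by (rule integral_nonneg_AE) auto
  have "cmod (ba_dbar P f (Complex x y)) \<le> 4 * M / y"
    using ba_dbar_bound[OF P, of "Complex x y" c M] y increment_bound[of _ "x-y" "x+y" x c]
    by (simp add: M_def)
  then have "(cmod (ba_dbar P f (Complex x y)))\<^sup>2 \<le> (4 * M / y)\<^sup>2" by (rule power_mono) simp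
  then have "ennreal ((cmod (ba_dbar P f (Complex x y)))\<^sup>2) \<le> ennreal ((4 * M / y)\<^sup>2)" by (rule ennreal_leI)
  also have "\<dots> = ennreal (16 / y\<^sup>2) * (ennreal M)\<^sup>2"
    using M0 y by (simp add: ennreal_mult[symmetric] ennreal_power power_divide power_mult_distrib)
  also have "ennreal M = (\<integral>\<^sup>+\<sigma>. ennreal \<bar>g \<sigma> - c\<bar> * indicator {x-y..x+y} \<sigma> \<partial>lborel)"
  proof -
    have "integrable lborel (\<lambda>\<sigma>. indicator {x-y..x+y} \<sigma> *\<^sub>R \<bar>g \<sigma> - c\<bar>)"
      using set_integrable_norm[OF integrable_diff] by (simp add: set_integrable_def)
    from nn_integral_eq_integral[OF this]
    have "ennreal M = (\<integral>\<^sup>+\<sigma>. ennreal (indicator {x-y..x+y} \<sigma> *\<^sub>R \<bar>g \<sigma> - c\<bar>) \<partial>lborel)"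
      by (simp add: M_def set_lebesgue_integral_def)
    also have "\<dots> = (\<integral>\<^sup>+\<sigma>. ennreal \<bar>g \<sigma> - c\<bar> * indicator {x-y..x+y} \<sigma> \<partial>lborel)"
      by (intro nn_integral_cong) (simp add: indicator_def)
    finally show ?thesis .
  qed
  also have "(\<integral>\<^sup>+\<sigma>. ennreal \<bar>g \<sigma> - c\<bar> * indicator {x-y..x+y} \<sigma> \<partial>lborel)
    = (\<integral>\<^sup>+\<sigma>. (ennreal \<bar>g \<sigma> - c\<bar> * indicator {x-y..x+y} \<sigma>) * indicator {x-y..x+y} \<sigma> \<partial>lborel)"
    by (intro nn_integral_cong) (simp add: indicator_def)
  also have "\<dots>\<^sup>2 \<le> (\<integral>\<^sup>+\<sigma>. (ennreal \<bar>g \<sigma> - c\<bar> * indicator {x-y..x+y} \<sigma>)\<^sup>2 \<partial>lborel) * (\<integral>\<^sup>+\<sigma>. (indicator {x-y..x+y} \<sigma>)\<^sup>2 \<partial>lborel)"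
    by (rule Cauchy_Schwarz_nn_integral) auto
  also have "(\<integral>\<^sup>+\<sigma>. (ennreal \<bar>g \<sigma> - c\<bar> * indicator {x-y..x+y} \<sigma>)\<^sup>2 \<partial>lborel) = (\<integral>\<^sup>+\<sigma>. ennreal ((g \<sigma> - c)\<^sup>2) * indicator {x-y..x+y} \<sigma> \<partial>lborel)"
    by (intro nn_integral_cong) (simp add: indicator_def ennreal_power)
  also have "(\<integral>\<^sup>+\<sigma>. (indicator {x-y..x+y} \<sigma>)\<^sup>2 \<partial>lborel) = ennreal (2 * y)"
  proof -
    have "(\<integral>\<^sup>+\<sigma>. (indicator {x-y..x+y} \<sigma> :: ennreal)\<^sup>2 \<partial>lborel) = (\<integral>\<^sup>+\<sigma>. indicator {x-y..x+y} \<sigma> \<partial>lborel)"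
      by (intro nn_integral_cong) (simp add: indicator_def)
    then show ?thesis using y by simp
  qed
  finally have "ennreal ((cmod (ba_dbar P f (Complex x y)))\<^sup>2) \<le> ennreal (16 / y\<^sup>2) *
    ((\<integral>\<^sup>+\<sigma>. ennreal ((g \<sigma> - c)\<^sup>2) * indicator {x-y..x+y} \<sigma> \<partial>lborel) * ennreal (2 * y))" by (simp add: mult_left_mono)
  also have "\<dots> = (ennreal (16 / y\<^sup>2) * ennreal (2 * y)) * (\<integral>\<^sup>+\<sigma>. ennreal ((g \<sigma> - c)\<^sup>2) * indicator {x-y..x+y} \<sigma> \<partial>lborel)"
    by (simp only: ac_simps)
  also have "ennreal (16 / y\<^sup>2) * ennreal (2 * y) = ennreal (32 / y)"
    using y by (simp add: ennreal_mult[symmetric] power2_eq_square)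
  finally show ?thesis .
qed

text \<open>\<open>ba_dbar_sq1\<close> holds for every slope, so it may be averaged over
  \<open>c = g t\<close> with \<open>t\<close> in the interval; dividing by the length
  \<open>2 * y\<close> yields \<open>16 / y^2\<close>.\<close>

lemma ba_dbar_sq2:
  assumes y: "y > 0"
  shows "ennreal ((cmod (ba_dbar P f (Complex x y)))\<^sup>2)
    \<le> ennreal (16 / y\<^sup>2) * (\<integral>\<^sup>+t. \<integral>\<^sup>+s. ennreal ((g s - g t)\<^sup>2) * indicator {x-y..x+y} s * indicator {x-y..x+y} t \<partial>lborel \<partial>lborel)"
  (is "?h \<le> _ * ?R")
proof -
  have "?h * ennreal (2 * y) = (\<integral>\<^sup>+t. ?h * indicator {x-y..x+y} t \<partial>lborel)"
    using y by (subst nn_integral_cmult) auto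
  also have "\<dots> \<le> (\<integral>\<^sup>+t. ennreal (32 / y) * (\<integral>\<^sup>+\<sigma>. ennreal ((g \<sigma> - g t)\<^sup>2) * indicator {x-y..x+y} \<sigma> \<partial>lborel) * indicator {x-y..x+y} t \<partial>lborel)"
    by (intro nn_integral_mono mult_right_mono ba_dbar_sq1 y) simp
  also have "\<dots> = (\<integral>\<^sup>+t. ennreal (32 / y) * (\<integral>\<^sup>+s. ennreal ((g s - g t)\<^sup>2) * indicator {x-y..x+y} s * indicator {x-y..x+y} t \<partial>lborel) \<partial>lborel)"
    by (subst nn_integral_multc) (auto simp: mult.assoc)
  also have "\<dots> = ennreal (32 / y) * ?R" by (rule nn_integral_cmult) measurable
  finally have *: "?h * ennreal (2 * y) \<le> ennreal (32 / y) * ?R" .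
  have "?h = ennreal (1 / (2 * y)) * (?h * ennreal (2 * y))"
    using y by (simp add: ennreal_mult[symmetric])
  also have "\<dots> \<le> ennreal (1 / (2 * y)) * (ennreal (32 / y) * ?R)" by (rule mult_left_mono[OF *]) simp
  also have "\<dots> = ennreal (1 / (2 * y) * (32 / y)) * ?R" using y by (subst ennreal_mult) (auto simp: mult.assoc)
  also have "1 / (2 * y) * (32 / y) = 16 / y\<^sup>2" using y by (simp add: power2_eq_square)
  finally show ?thesis .
qed

definition "H = (\<integral>\<^sup>+s. \<integral>\<^sup>+t. ennreal ((g s - g t)\<^sup>2 / (s - t)\<^sup>2) \<partial>lborel \<partial>lborel)"

text \<open>Two points of an interval of length \<open>2 * y\<close> satisfy
  \<open>(s - t)^2 <= 4 * y^2\<close>, so the squared difference of \<open>g\<close> is at most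
  \<open>4 * y^2\<close> times the energy density. The powers of \<open>y\<close> cancel and leave a
  bound uniform in the point.\<close>

lemma ba_dbar_sup:
  assumes y: "y > 0"
  shows "ennreal ((cmod (ba_dbar P f (Complex x y)))\<^sup>2) \<le> 64 * H"
proof -
  have *: "ennreal ((g s - g t)\<^sup>2) * indicator {x-y..x+y} s * indicator {x-y..x+y} t \<le> ennreal (4 * y\<^sup>2) * ennreal ((g t - g s)\<^sup>2 / (t - s)\<^sup>2)" for s t
  proof (cases "s \<in> {x-y..x+y} \<and> t \<in> {x-y..x+y} \<and> s \<noteq> t")
    case True
    then have "\<bar>t - s\<bar> \<le> 2 * y" by auto
    then have "(t - s)\<^sup>2 \<le> (2 * y)\<^sup>2" using power_mono[of "\<bar>t - s\<bar>" "2 * y" 2] by simp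
    then have "(g t - g s)\<^sup>2 * (t - s)\<^sup>2 \<le> (g t - g s)\<^sup>2 * (4 * y\<^sup>2)" by (intro mult_left_mono) (auto simp: power_mult_distrib)
    then have "(g s - g t)\<^sup>2 \<le> 4 * y\<^sup>2 * ((g t - g s)\<^sup>2 / (t - s)\<^sup>2)"
      using True by (simp add: pos_le_divide_eq power2_commute[of "g s"] mult.commute)
    then show ?thesis using True by (simp add: ennreal_mult[symmetric] ennreal_leI)
  qed (auto simp: indicator_def)
  have "ennreal ((cmod (ba_dbar P f (Complex x y)))\<^sup>2) \<le> ennreal (16 / y\<^sup>2) * (\<integral>\<^sup>+t. \<integral>\<^sup>+s. ennreal (4 * y\<^sup>2) * ennreal ((g t - g s)\<^sup>2 / (t - s)\<^sup>2) \<partial>lborel \<partial>lborel)"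
    by (rule order_trans[OF ba_dbar_sq2[OF y]]) (intro mult_left_mono nn_integral_mono *, simp)
  also have "\<dots> = ennreal (16 / y\<^sup>2) * (ennreal (4 * y\<^sup>2) * H)" unfolding H_def by (simp add: nn_integral_cmult)
  also have "\<dots> = ennreal (16 / y\<^sup>2 * (4 * y\<^sup>2)) * H" by (subst ennreal_mult) (auto simp: mult.assoc)
  also have "16 / y\<^sup>2 * (4 * y\<^sup>2) = 64" using y by simp
  finally show ?thesis by simp
qed

text \<open>A pair \<open>s\<close>, \<open>t\<close> fits into an interval of radius
  \<open>y\<close> only if \<open>y\<close> is at least \<open>a\<close>, half the distance of the
  pair, and the centres then fill a set of length at most \<open>2 * y\<close>. The integral of
  \<open>32 / y^3\<close> from \<open>a\<close> on is \<open>16 / a^2\<close>, which is 64 divided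
  by the squared distance.\<close>

lemma kernel_integral:
  "(\<integral>\<^sup>+y. \<integral>\<^sup>+x. ennreal (if y > 0 \<and> \<bar>s - x\<bar> \<le> y \<and> \<bar>t - x\<bar> \<le> y then 16 / y ^ 4 * (g s - g t)\<^sup>2 else 0) \<partial>lborel \<partial>lborel)
    \<le> 64 * ennreal ((g t - g s)\<^sup>2 / (t - s)\<^sup>2)"
proof (cases "s = t")
  case False
  define a where "a = \<bar>s - t\<bar> / 2"
  have a: "a > 0" using False by (simp add: a_def)
  have "(\<integral>\<^sup>+x. ennreal (if y > 0 \<and> \<bar>s - x\<bar> \<le> y \<and> \<bar>t - x\<bar> \<le> y then 16 / y ^ 4 * (g s - g t)\<^sup>2 else 0) \<partial>lborel)
     \<le> ennreal ((g s - g t)\<^sup>2) * (ennreal (32 / y ^ 3) * indicator {a..} y)" for y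
  proof (cases "y \<ge> a")
    case True
    with a have y: "y > 0" by simp
    have "(\<integral>\<^sup>+x. ennreal (if y > 0 \<and> \<bar>s - x\<bar> \<le> y \<and> \<bar>t - x\<bar> \<le> y then 16 / y ^ 4 * (g s - g t)\<^sup>2 else 0) \<partial>lborel)
      \<le> (\<integral>\<^sup>+x. ennreal (16 / y ^ 4 * (g s - g t)\<^sup>2) * indicator {s-y..s+y} x \<partial>lborel)"
      by (intro nn_integral_mono) (auto simp: indicator_def)
    also have "\<dots> = ennreal (16 / y ^ 4 * (g s - g t)\<^sup>2) * ennreal (2 * y)"
      using y by (subst nn_integral_cmult) auto
    also have "\<dots> = ennreal ((g s - g t)\<^sup>2 * (32 / y ^ 3))"
    proof -
      have "16 / y ^ 4 * (g s - g t)\<^sup>2 * (2 * y) = (g s - g t)\<^sup>2 * (32 / y ^ 3)"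
        using y by (simp add: divide_simps power_numeral_reduce)
      then show ?thesis using y by (subst ennreal_mult[symmetric]) auto
    qed
    finally show ?thesis using True y by (simp add: ennreal_mult[symmetric])
  next
    case False
    have "(\<integral>\<^sup>+x. ennreal (if y > 0 \<and> \<bar>s - x\<bar> \<le> y \<and> \<bar>t - x\<bar> \<le> y then 16 / y ^ 4 * (g s - g t)\<^sup>2 else 0) \<partial>lborel) = (\<integral>\<^sup>+x. 0 \<partial>(lborel::real measure))"
    proof (intro nn_integral_cong)
      fix x
      have n: "\<not> (y > 0 \<and> \<bar>s - x\<bar> \<le> y \<and> \<bar>t - x\<bar> \<le> y)"
      proof
        assume "y > 0 \<and> \<bar>s - x\<bar> \<le> y \<and> \<bar>t - x\<bar> \<le> y"
        then have "\<bar>s - x\<bar> \<le> y" "\<bar>t - x\<bar> \<le> y" by auto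
        moreover have "\<bar>s - t\<bar> \<le> \<bar>s - x\<bar> + \<bar>t - x\<bar>" using abs_triangle_ineq4[of "s - x" "t - x"] by simp
        ultimately show False using False unfolding a_def by argo
      qed
      show "ennreal (if y > 0 \<and> \<bar>s - x\<bar> \<le> y \<and> \<bar>t - x\<bar> \<le> y then 16 / y ^ 4 * (g s - g t)\<^sup>2 else 0) = 0" unfolding if_not_P[OF n] by simp
    qed
    then show ?thesis by simp
  qed
  then have "(\<integral>\<^sup>+y. \<integral>\<^sup>+x. ennreal (if y > 0 \<and> \<bar>s - x\<bar> \<le> y \<and> \<bar>t - x\<bar> \<le> y then 16 / y ^ 4 * (g s - g t)\<^sup>2 else 0) \<partial>lborel \<partial>lborel)
    \<le> (\<integral>\<^sup>+y. ennreal ((g s - g t)\<^sup>2) * (ennreal (32 / y ^ 3) * indicator {a..} y) \<partial>lborel)"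
    by (intro nn_integral_mono)
  also have "\<dots> = ennreal ((g s - g t)\<^sup>2) * (\<integral>\<^sup>+y. ennreal (32 / y ^ 3) * indicator {a..} y \<partial>lborel)"
    by (rule nn_integral_cmult) measurable
  also have "(\<integral>\<^sup>+y. ennreal (32 / y ^ 3) * indicator {a..} y \<partial>lborel) = ennreal (0 - (- 16 / a\<^sup>2))"
  proof (rule nn_integral_FTC_atLeast)
    fix y assume "a \<le> y"
    with a have y: "y > 0" by simp
    show "((\<lambda>y. - 16 / y\<^sup>2) has_real_derivative 32 / y ^ 3) (at y)"
      using y by (auto intro!: derivative_eq_intros simp: field_simps power_numeral_reduce)
    show "0 \<le> 32 / y ^ 3" using y by simp
  next
    show "((\<lambda>y::real. - 16 / y\<^sup>2) \<longlongrightarrow> 0) at_top"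
      by (intro tendsto_divide_0[OF tendsto_const] filterlim_at_top_imp_at_infinity filterlim_pow_at_top filterlim_ident) simp
  qed measurable
  also have "ennreal ((g s - g t)\<^sup>2) * ennreal (0 - (- 16 / a\<^sup>2)) = ennreal ((g s - g t)\<^sup>2 * (16 / a\<^sup>2))"
    by (subst ennreal_mult) auto
  also have "(g s - g t)\<^sup>2 * (16 / a\<^sup>2) = 64 * ((g t - g s)\<^sup>2 / (t - s)\<^sup>2)"
    by (simp add: a_def power_divide power2_commute[of s] power2_commute[of "g s"])
  also have "ennreal \<dots> = 64 * ennreal ((g t - g s)\<^sup>2 / (t - s)\<^sup>2)" by (subst ennreal_mult) auto
  finally show ?thesis .
qed (simp cong: if_cong)

text \<open>Four-fold Tonelli: after \<open>ba_dbar_sq2\<close> the integral runs over a point of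
  the half-plane and a pair on the line; with the pair outermost the inner integral is the one
  bounded in \<open>kernel_integral\<close>.\<close>

lemma ba_dbar_weighted:
  assumes f: "continuous_on UNIV f"
  shows "(\<integral>\<^sup>+ z. ennreal (indicator upper_half_plane z * (cmod (ba_dbar P f z))\<^sup>2 / (Im z)\<^sup>2) \<partial>lborel) \<le> 64 * H"
proof -
  \<comment> \<open>The moving intervals are written as inequalities between the four variables, a
    form whose joint measurability is evident.\<close>
  let ?G = "\<lambda>y x t s. ennreal (if y > 0 \<and> \<bar>s - x\<bar> \<le> y \<and> \<bar>t - x\<bar> \<le> y then 16 / y ^ 4 * (g s - g t)\<^sup>2 else 0)"
  have "(\<lambda>z. indicator upper_half_plane z *\<^sub>R ba_dbar P f z) \<in> borel_measurable borel"
    using ba_continuous(4)[OF P f] open_upper_half_plane by (intro borel_measurable_continuous_on_indicator) auto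
  then have "(\<lambda>z. ennreal ((cmod (indicator upper_half_plane z *\<^sub>R ba_dbar P f z))\<^sup>2 / (Im z)\<^sup>2)) \<in> borel_measurable borel"
    by measurable
  also have "(\<lambda>z. ennreal ((cmod (indicator upper_half_plane z *\<^sub>R ba_dbar P f z))\<^sup>2 / (Im z)\<^sup>2)) =
    (\<lambda>z. ennreal (indicator upper_half_plane z * (cmod (ba_dbar P f z))\<^sup>2 / (Im z)\<^sup>2))"
    by (auto simp: fun_eq_iff indicator_def)
  finally have m: "(\<lambda>z. ennreal (indicator upper_half_plane z * (cmod (ba_dbar P f z))\<^sup>2 / (Im z)\<^sup>2)) \<in> borel_measurable borel" .
  have le: "ennreal (indicator upper_half_plane (Complex x y) * (cmod (ba_dbar P f (Complex x y)))\<^sup>2 / (Im (Complex x y))\<^sup>2)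
    \<le> (\<integral>\<^sup>+t. \<integral>\<^sup>+s. ?G y x t s \<partial>lborel \<partial>lborel)" for x y
  proof (cases "y > 0")
    case True
    have "ennreal (indicator upper_half_plane (Complex x y) * (cmod (ba_dbar P f (Complex x y)))\<^sup>2 / (Im (Complex x y))\<^sup>2)
       = ennreal (1 / y\<^sup>2) * ennreal ((cmod (ba_dbar P f (Complex x y)))\<^sup>2)"
      using True by (subst ennreal_mult[symmetric]) (auto simp: upper_half_plane_def)
    also have "\<dots> \<le> ennreal (1 / y\<^sup>2) * (ennreal (16 / y\<^sup>2) * (\<integral>\<^sup>+t. \<integral>\<^sup>+s. ennreal ((g s - g t)\<^sup>2) * indicator {x-y..x+y} s * indicator {x-y..x+y} t \<partial>lborel \<partial>lborel))"
      by (intro mult_left_mono ba_dbar_sq2 True) simp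
    also have "\<dots> = ennreal (16 / y ^ 4) * (\<integral>\<^sup>+t. \<integral>\<^sup>+s. ennreal ((g s - g t)\<^sup>2) * indicator {x-y..x+y} s * indicator {x-y..x+y} t \<partial>lborel \<partial>lborel)"
      using True by (subst mult.assoc[symmetric], subst ennreal_mult[symmetric]) (auto simp: power_numeral_reduce mult.assoc)
    also have "\<dots> = (\<integral>\<^sup>+t. \<integral>\<^sup>+s. ennreal (16 / y ^ 4) * (ennreal ((g s - g t)\<^sup>2) * indicator {x-y..x+y} s * indicator {x-y..x+y} t) \<partial>lborel \<partial>lborel)"
      by (simp add: nn_integral_cmult)
    also have "\<dots> = (\<integral>\<^sup>+t. \<integral>\<^sup>+s. ?G y x t s \<partial>lborel \<partial>lborel)"
    proof (intro nn_integral_cong)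
      fix t s
      have "(s \<in> {x-y..x+y}) = (\<bar>s - x\<bar> \<le> y)" "(t \<in> {x-y..x+y}) = (\<bar>t - x\<bar> \<le> y)" by auto
      then show "ennreal (16 / y ^ 4) * (ennreal ((g s - g t)\<^sup>2) * indicator {x-y..x+y} s * indicator {x-y..x+y} t) = ?G y x t s"
        using True by (simp add: indicator_def ennreal_mult[symmetric])
    qed
    finally show ?thesis .
  qed (simp add: upper_half_plane_def)
  have "(\<integral>\<^sup>+ z. ennreal (indicator upper_half_plane z * (cmod (ba_dbar P f z))\<^sup>2 / (Im z)\<^sup>2) \<partial>lborel)
     \<le> (\<integral>\<^sup>+y. \<integral>\<^sup>+x. \<integral>\<^sup>+t. \<integral>\<^sup>+s. ?G y x t s \<partial>lborel \<partial>lborel \<partial>lborel \<partial>lborel)"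
    by (subst nn_integral_complex(2)[OF m]) (intro nn_integral_mono le)
  also have "\<dots> = (\<integral>\<^sup>+y. \<integral>\<^sup>+t. \<integral>\<^sup>+x. \<integral>\<^sup>+s. ?G y x t s \<partial>lborel \<partial>lborel \<partial>lborel \<partial>lborel)"
    by (intro nn_integral_cong lborel_pair.Fubini') measurable
  also have "\<dots> = (\<integral>\<^sup>+y. \<integral>\<^sup>+t. \<integral>\<^sup>+s. \<integral>\<^sup>+x. ?G y x t s \<partial>lborel \<partial>lborel \<partial>lborel \<partial>lborel)"
    by (intro nn_integral_cong lborel_pair.Fubini') measurable
  also have "\<dots> = (\<integral>\<^sup>+t. \<integral>\<^sup>+y. \<integral>\<^sup>+s. \<integral>\<^sup>+x. ?G y x t s \<partial>lborel \<partial>lborel \<partial>lborel \<partial>lborel)"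
    by (intro lborel_pair.Fubini') measurable
  also have "\<dots> = (\<integral>\<^sup>+t. \<integral>\<^sup>+s. \<integral>\<^sup>+y. \<integral>\<^sup>+x. ?G y x t s \<partial>lborel \<partial>lborel \<partial>lborel \<partial>lborel)"
    by (intro nn_integral_cong lborel_pair.Fubini') measurable
  also have "\<dots> \<le> (\<integral>\<^sup>+t. \<integral>\<^sup>+s. 64 * ennreal ((g t - g s)\<^sup>2 / (t - s)\<^sup>2) \<partial>lborel \<partial>lborel)"
    by (intro nn_integral_mono kernel_integral)
  also have "\<dots> = 64 * H" unfolding H_def by (simp add: nn_integral_cmult)
  finally show ?thesis .
qed

text \<open>Finiteness of the double integral gives one good base point \<open>\<tau>\<close>; around it the increments of
  \<open>f\<close> deviate from linear ones by \<open>O(\<bar>s - \<tau>\<bar>\<^bsup>3/2\<^esup>)\<close>.\<close>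

lemma f_growth:
  assumes H: "H < \<infinity>" and e: "e > 0"
  obtains R where "\<And>s. \<bar>s\<bar> \<ge> R \<Longrightarrow> \<bar>f s\<bar> \<le> e * s\<^sup>2"
proof -
  have "AE s in lborel. (\<integral>\<^sup>+t. ennreal ((g s - g t)\<^sup>2 / (s - t)\<^sup>2) \<partial>lborel) \<noteq> \<infinity>"
    by (rule nn_integral_PInf_AE) (use H in \<open>auto simp: H_def\<close>)
  moreover have "ae_filter (lborel :: real measure) \<noteq> bot" by (simp add: ae_filter_eq_bot_iff)
  ultimately obtain \<tau> where \<tau>: "(\<integral>\<^sup>+t. ennreal ((g \<tau> - g t)\<^sup>2 / (\<tau> - t)\<^sup>2) \<partial>lborel) \<noteq> \<infinity>"
    using eventually_happens' by blast
  define q where "q t = (g \<tau> - g t)\<^sup>2 / (\<tau> - t)\<^sup>2" for t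
  have qi: "integrable lborel q"
    unfolding q_def by (rule integrableI_nonneg) (use \<tau> in \<open>auto simp: less_top\<close>)
  define B where "B = integral\<^sup>L lborel q"
  have B0: "B \<ge> 0" unfolding B_def by (rule integral_nonneg_AE) (simp add: q_def)
  define c where "c = g \<tau>"
  \<comment> \<open>The integrand \<open>\<bar>g \<sigma> - c\<bar>\<close> is bounded by a weighted
    arithmetic-geometric mean of the energy density at the base point and a constant. Optimising
    \<open>K\<close> would give the exponent 3/2; a free \<open>K\<close> is easier to use.\<close>
  have dev: "\<bar>f s - f \<tau> - c * (s - \<tau>)\<bar> \<le> (K * L * B + L\<^sup>2 / K)" if L: "\<bar>s - \<tau>\<bar> \<le> L" and K: "K > 0" and L0: "L > 0" for s L K
  proof -
    define a b where "a = min s \<tau>" and "b = max s \<tau>"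
    have ab: "b - a \<le> L" "a \<le> b" using L by (auto simp: a_def b_def)
    have "\<bar>f s - f \<tau> - c * (s - \<tau>)\<bar> \<le> (LINT \<sigma>:{a..b}|lborel. \<bar>g \<sigma> - c\<bar>)"
      by (rule increment_bound) (auto simp: a_def b_def)
    also have "\<dots> \<le> (LINT \<sigma>|lborel. (K * L) * q \<sigma> + (L / K) * indicator {a..b} \<sigma>)"
      unfolding set_lebesgue_integral_def
    proof (rule integral_mono)
      show "integrable lborel (\<lambda>x. indicator {a..b} x *\<^sub>R \<bar>g x - c\<bar>)"
        using set_integrable_norm[OF integrable_diff] by (simp add: set_integrable_def)
      show "integrable lborel (\<lambda>\<sigma>. (K * L) * q \<sigma> + (L / K) * indicator {a..b} \<sigma>)"
        using qi borel_integrable_compact[of "{a..b}" "\<lambda>_. 1::real"]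
        by (intro Bochner_Integration.integrable_add integrable_mult_right) auto
    next
      fix \<sigma>
      show "indicator {a..b} \<sigma> *\<^sub>R \<bar>g \<sigma> - c\<bar> \<le> (K * L) * q \<sigma> + (L / K) * indicator {a..b} \<sigma>"
      proof (cases "\<sigma> \<in> {a..b}")
        case True
        define d where "d = \<bar>\<sigma> - \<tau>\<bar>"
        have d: "0 \<le> d" "d \<le> L" using True L by (auto simp: d_def a_def b_def)
        show ?thesis
        proof (cases "d = 0")
          case False
          define u where "u = \<bar>g \<sigma> - c\<bar>"
          have q: "q \<sigma> = u\<^sup>2 / d\<^sup>2" by (simp add: q_def u_def d_def c_def power2_commute)
          have "u\<^sup>2 / L\<^sup>2 \<le> q \<sigma>" unfolding q
            using d False by (intro divide_left_mono power_mono mult_pos_pos) auto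
          then have "(K * L) * (u\<^sup>2 / L\<^sup>2) \<le> (K * L) * q \<sigma>" using K L0 by (intro mult_left_mono) auto
          moreover have "u \<le> (K * L) * (u\<^sup>2 / L\<^sup>2) + L / K"
          proof -
            have "0 \<le> (K * u - L)\<^sup>2 + K * u * L" using K L0 by (simp add: u_def)
            then have "u * (K * L) \<le> K\<^sup>2 * u\<^sup>2 + L\<^sup>2" by (simp add: power2_eq_square algebra_simps)
            then show ?thesis using K L0 by (simp add: field_simps power2_eq_square)
          qed
          ultimately show ?thesis using True by (simp add: u_def)
        qed (use True K L0 in \<open>simp add: d_def c_def q_def\<close>)
      qed (use K L0 in \<open>simp add: q_def\<close>)
    qed
    also have "\<dots> = (K * L) * B + (L / K) * (b - a)"
      using qi ab by (simp add: B_def)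
    also have "\<dots> \<le> (K * L) * B + (L / K) * L" using ab K L0 by (intro add_left_mono mult_left_mono) auto
    finally show ?thesis by (simp add: power2_eq_square)
  qed
  \<comment> \<open>Each summand enforces one requirement: \<open>s\<close> dominates \<tau>, the
    energy term is small against \<open>e * s^2\<close>, and so is the affine part of slope
    \<open>c\<close>.\<close>
  define R where "R = 1 + \<bar>\<tau>\<bar> + 100 * B / e\<^sup>2 + 8 * (\<bar>f \<tau>\<bar> + \<bar>c\<bar> * 2) / e"
  have "0 \<le> 100 * B / e\<^sup>2" "0 \<le> 8 * (\<bar>f \<tau>\<bar> + \<bar>c\<bar> * 2) / e" using e B0 by auto
  then have R: "R \<ge> 1" "R \<ge> \<bar>\<tau>\<bar>" "R \<ge> 100 * B / e\<^sup>2" "R \<ge> 8 * (\<bar>f \<tau>\<bar> + \<bar>c\<bar> * 2) / e"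
    unfolding R_def by linarith+
  have "\<bar>f s\<bar> \<le> e * s\<^sup>2" if s: "\<bar>s\<bar> \<ge> R" for s
  proof -
    define r where "r = \<bar>s\<bar>"
    have r: "r \<ge> 1" "\<bar>\<tau>\<bar> \<le> r" "100 * B / e\<^sup>2 \<le> r" "8 * (\<bar>f \<tau>\<bar> + \<bar>c\<bar> * 2) / e \<le> r" using R s by (auto simp: r_def)
    have st: "\<bar>s - \<tau>\<bar> \<le> 2 * r" using r(2) by (simp add: r_def)
    \<comment> \<open>With \<open>L = 2 * r\<close> the choice \<open>K = 8 / e\<close> makes
      \<open>L^2 / K\<close> equal to half of \<open>e * r^2\<close>; the other term is only linear
      in \<open>r\<close>.\<close>
    have "\<bar>f s - f \<tau> - c * (s - \<tau>)\<bar> \<le> (8 / e) * (2 * r) * B + (2 * r)\<^sup>2 / (8 / e)"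
      by (rule dev[OF st]) (use e r in auto)
    also have "(8 / e) * (2 * r) * B \<le> (1 / 4) * e * r\<^sup>2"
    proof -
      have "100 * B \<le> r * e\<^sup>2" using r(3) e by (simp add: pos_divide_le_eq)
      then have "16 * r * B \<le> r * (r * e\<^sup>2) * (16 / 100)" using r(1) by (simp add: mult_left_mono)
      also have "\<dots> \<le> r * (r * e\<^sup>2) * (1 / 4)" using r(1) by (intro mult_left_mono) auto
      finally show ?thesis using e by (simp add: field_simps power2_eq_square)
    qed
    also have "(2 * r)\<^sup>2 / (8 / e) = (1 / 2) * e * r\<^sup>2" using e by (simp add: power2_eq_square)
    finally have 1: "\<bar>f s - f \<tau> - c * (s - \<tau>)\<bar> \<le> (3 / 4) * e * r\<^sup>2" by simp
    have "\<bar>f \<tau>\<bar> + \<bar>c * (s - \<tau>)\<bar> \<le> \<bar>f \<tau>\<bar> * r + \<bar>c\<bar> * (2 * r)"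
      using st r(1) by (intro add_mono) (auto simp: abs_mult mult_left_mono mult_le_cancel_left1)
    also have "\<dots> = (\<bar>f \<tau>\<bar> + \<bar>c\<bar> * 2) * r" by (simp add: algebra_simps)
    also have "\<dots> \<le> (e * r / 8) * r" using r(1,4) e by (intro mult_right_mono) (auto simp: field_simps)
    finally have 2: "\<bar>f \<tau>\<bar> + \<bar>c * (s - \<tau>)\<bar> \<le> (1 / 8) * e * r\<^sup>2" by (simp add: power2_eq_square)
    have "0 \<le> e * r\<^sup>2" using e by simp
    with 1 2 have "\<bar>f s\<bar> \<le> e * r\<^sup>2" by linarith
    then show ?thesis by (simp add: r_def)
  qed
  then show ?thesis by (rule that)
qed

end

section \<open>Growth at infinity and the forward implication\<close>

context grad
begin

lemma ba_ext_smallo: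
  assumes f: "continuous_on UNIV f" and H: "H < \<infinity>"
  shows "ba_ext P f \<in> o[inf at_infinity (principal closed_upper_half_plane)](\<lambda>z. z\<^sup>2)"
proof (rule landau_o.smallI)
  fix e :: real assume e: "e > 0"
  \<comment> \<open>Of the factor 24, \<open>ba_ext_near\<close> uses 3 and the squared bound
    \<open>\<bar>s\<bar> <= 2 * r\<close> uses 4; the remaining 2 leaves room for the bound
    \<open>M\<close> on the compact part.\<close>
  obtain R where R: "\<And>s. \<bar>s\<bar> \<ge> R \<Longrightarrow> \<bar>f s\<bar> \<le> e / 24 * s\<^sup>2"
    using f_growth[OF H, of "e / 24"] e by auto
  have "compact (f ` {-R..R})" using f by (intro compact_continuous_image) (auto intro: continuous_on_subset)
  then obtain M where M: "\<And>s. s \<in> {-R..R} \<Longrightarrow> \<bar>f s\<bar> \<le> M"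
    using compact_imp_bounded[of "f ` {-R..R}"] unfolding bounded_iff by (metis imageI real_norm_def)
  have fb: "\<bar>f s\<bar> \<le> \<bar>M\<bar> + e / 24 * s\<^sup>2" for s
  proof (cases "\<bar>s\<bar> \<ge> R")
    case True
    then show ?thesis using R[OF True] by linarith
  next
    case False
    then have "\<bar>f s\<bar> \<le> M" by (intro M) auto
    moreover have "0 \<le> e / 24 * s\<^sup>2" using e by simp
    ultimately show ?thesis by linarith
  qed
  have bound: "cmod (ba_ext P f z) \<le> e * cmod (z\<^sup>2)" if z: "z \<in> closed_upper_half_plane" "cmod z \<ge> 1 + 6 * \<bar>M\<bar> / e" for z
  proof -
    define r where "r = cmod z"
    have r1: "r \<ge> 1" "6 * \<bar>M\<bar> \<le> e * r"
    proof -
      have "0 \<le> 6 * \<bar>M\<bar> / e" using e by simp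
      then show "r \<ge> 1" using z(2) unfolding r_def by linarith
      have "6 * \<bar>M\<bar> / e \<le> r" using z(2) unfolding r_def by linarith
      then show "6 * \<bar>M\<bar> \<le> e * r" using e by (simp add: pos_divide_le_eq mult.commute)
    qed
    have "\<bar>f s - 0\<bar> \<le> \<bar>M\<bar> + e / 6 * r\<^sup>2" if s: "s \<in> {Re z - Im z..Re z + Im z}" for s
    proof -
      have "Re z - Im z \<le> s" "s \<le> Re z + Im z" using s by auto
      then have "\<bar>s\<bar> \<le> 2 * r" using abs_Re_le_cmod[of z] abs_Im_le_cmod[of z] unfolding r_def by linarith
      then have "s\<^sup>2 \<le> (2 * r)\<^sup>2" using power_mono[of "\<bar>s\<bar>" "2 * r" 2] by simp
      then have "e / 24 * s\<^sup>2 \<le> e / 24 * (2 * r)\<^sup>2" using e by (intro mult_left_mono) auto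
      then show ?thesis using fb[of s] by (simp add: power_mult_distrib)
    qed
    then have "cmod (ba_ext P f z - of_real 0) \<le> 3 * (\<bar>M\<bar> + e / 6 * r\<^sup>2)"
      using z(1) by (intro ba_ext_near[OF P]) (simp_all add: closed_upper_half_plane_def)
    moreover have "e * r \<le> e * r\<^sup>2" using e r1(1) by (simp add: power2_eq_square)
    ultimately have "cmod (ba_ext P f z) \<le> e * r\<^sup>2" using r1(2) by (simp add: algebra_simps)
    then show ?thesis by (simp add: r_def norm_power)
  qed
  have "eventually (\<lambda>z::complex. cmod z \<ge> 1 + 6 * \<bar>M\<bar> / e) at_infinity"
    by (auto simp: eventually_at_infinity)
  then show "\<forall>\<^sub>F z in inf at_infinity (principal closed_upper_half_plane). norm (ba_ext P f z) \<le> e * norm (z\<^sup>2)"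
    unfolding eventually_inf_principal by eventually_elim (simp add: bound)
qed

lemma ba_ext_works:
  assumes f: "continuous_on UNIV f" and H: "H < \<infinity>"
  shows "qc_deformation upper_half_plane (ba_ext P f)"
    "(\<integral>\<^sup>+ z. ennreal (indicator upper_half_plane z * (cmod (ba_dbar P f z))\<^sup>2 / (Im z)\<^sup>2) \<partial>lborel) < \<infinity>"
proof -
  have H': "64 * H < \<infinity>" using H by (simp add: ennreal_mult_less_top)
  then show "(\<integral>\<^sup>+ z. ennreal (indicator upper_half_plane z * (cmod (ba_dbar P f z))\<^sup>2 / (Im z)\<^sup>2) \<partial>lborel) < \<infinity>"
    using ba_dbar_weighted[OF f] by (rule le_less_trans[rotated])
  obtain C where C: "64 * H = ennreal C" "C \<ge> 0" using H' by (cases "64 * H") auto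
  have "cmod (ba_dbar P f z) \<le> sqrt C" if "z \<in> upper_half_plane" for z
  proof -
    have "ennreal ((cmod (ba_dbar P f (Complex (Re z) (Im z))))\<^sup>2) \<le> ennreal C"
      using ba_dbar_sup[of "Im z" "Re z"] that by (simp add: C upper_half_plane_def)
    then have "(cmod (ba_dbar P f z))\<^sup>2 \<le> C" using C(2) by simp
    then show ?thesis by (rule real_le_rsqrt)
  qed
  moreover have "set_borel_measurable lborel upper_half_plane (ba_dbar P f)"
    unfolding set_borel_measurable_def
    using borel_measurable_continuous_on_indicator[OF _ ba_continuous(4)[OF P f]] open_upper_half_plane by simp
  ultimately have "Linf_on upper_half_plane (ba_dbar P f)" unfolding Linf_on_def by auto
  then show "qc_deformation upper_half_plane (ba_ext P f)"
    unfolding qc_deformation_def using ba_weak_dbar[OF P f] by blast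
qed

end

lemma extension_exists:
  fixes f :: "real \<Rightarrow> real"
  assumes f: "continuous_on UNIV f" and H3: "H_three_half f"
  shows "\<exists>F :: complex \<Rightarrow> complex.
       continuous_on closed_upper_half_plane F \<and>
       (\<forall>x. F (of_real x) = of_real (f x)) \<and>
       qc_deformation upper_half_plane F \<and>
       F \<in> o[inf at_infinity (principal closed_upper_half_plane)](\<lambda>z. z\<^sup>2) \<and>
       (\<exists>h. weak_dbar upper_half_plane F h \<and>
          (\<integral>\<^sup>+ z. ennreal (indicator upper_half_plane z * (cmod (h z))\<^sup>2 / (Im z)\<^sup>2) \<partial>lborel) < \<infinity>)"
proof -
  obtain P where P: "\<And>x. (P has_real_derivative f x) (at x)" using primitive_exists[OF f] by blast
  obtain g where g: "H_half g" "AE x in lborel. (f has_real_derivative g x) (at x)"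
    and ac: "locally_abs_continuous f" using H3 by (auto simp: H_three_half_def)
  have gi: "locally_integrable_real g" using g(1) by (simp add: H_half_def)
  interpret grad f g P
  proof
    fix a b :: real assume ab: "a \<le> b"
    have "(g has_integral (f b - f a)) {a..b}"
      by (rule abs_continuous_on_FTC[OF _ ab g(2)]) (use ac in \<open>simp add: locally_abs_continuous_def\<close>)
    \<comment> \<open>Local integrability of \<open>g\<close> identifies the gauge integral from the
      fundamental theorem with the Lebesgue integral.\<close>
    moreover have "(LINT x:{a..b}|lborel. g x) = integral {a..b} g"
      by (rule set_borel_integral_eq_integral) (use gi in \<open>simp add: locally_integrable_real_def\<close>)
    ultimately show "f b - f a = (LINT x:{a..b}|lborel. g x)" by (simp add: integral_unique)
  qed (rule gi, rule P)
  have H: "H < \<infinity>" using g(1) by (simp add: H_half_iterated H_def)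
  show ?thesis
  proof (rule exI[of _ "ba_ext P f"], intro conjI allI, goal_cases)
    case 5
    show ?case by (rule exI[of _ "ba_dbar P f"]) (intro conjI ba_weak_dbar[OF P f] ba_ext_works(2)[OF f H])
  next
    case 2
    show ?case by (simp add: ba_ext_def)
  qed (intro ba_ext_continuous[OF P f] ba_ext_works(1)[OF f H] ba_ext_smallo[OF f H])+
qed

section \<open>Smooth test functions\<close>

text \<open>Infinite differentiability in the coinductive style of \<open>smooth_c\<close>: a
  function is smooth as soon as it lies in some class closed under differentiation.\<close>

coinductive smooth_real :: "(real \<Rightarrow> real) \<Rightarrow> bool" where
  "(\<And>x. (\<beta> has_real_derivative \<beta>' x) (at x)) \<Longrightarrow> smooth_real \<beta>' \<Longrightarrow> smooth_real \<beta>"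

text \<open>\<open>flat 0\<close> is the classical smooth function exp(-1/t). The powers in the
  denominator are included because the derivative of \<open>flat n\<close> is a linear combination
  of \<open>flat (n + 1)\<close> and \<open>flat (n + 2)\<close>.\<close>

definition flat :: "nat \<Rightarrow> real \<Rightarrow> real" where
  "flat n t = (if t > 0 then exp (- (1 / t)) / t ^ n else 0)"

text \<open>The class closed under differentiation that serves as coinduction invariant. Affine
  substitution is included to reflect \<open>flat 0\<close> for a two-sided bump.\<close>

inductive real_alg :: "(real \<Rightarrow> real) \<Rightarrow> bool" where
  flat: "real_alg (flat n)"
| const: "real_alg (\<lambda>_. c)"
| add: "real_alg f \<Longrightarrow> real_alg g \<Longrightarrow> real_alg (\<lambda>x. f x + g x)"
| mult: "real_alg f \<Longrightarrow> real_alg g \<Longrightarrow> real_alg (\<lambda>x. f x * g x)"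
| affine: "real_alg f \<Longrightarrow> real_alg (\<lambda>x. f (a * x + b))"

lemma power_le_fact_exp:
  fixes x :: real
  assumes "x \<ge> 0"
  shows "x ^ n \<le> fact n * exp x"
proof -
  have "(\<Sum>k\<in>{n}. x ^ k /\<^sub>R fact k) \<le> (\<Sum>k. x ^ k /\<^sub>R fact k)"
    by (rule sum_le_suminf) (use assms summable_exp_generic[of x] in auto)
  then show ?thesis by (simp add: exp_def divide_simps mult.commute)
qed

text \<open>A quadratic bound forces derivative 0 at the origin. It is
  \<open>power_le_fact_exp\<close> at \<open>1 / t\<close> with exponent \<open>n + 2\<close>: two
  powers of \<open>t\<close> survive the division by \<open>t ^ n\<close>.\<close>

lemma flat_bound: "\<bar>flat n t\<bar> \<le> fact (n + 2) * t\<^sup>2"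
proof (cases "t > 0")
  case True
  have "(1 / t) ^ (n + 2) \<le> fact (n + 2) * exp (1 / t)" by (rule power_le_fact_exp) (use True in simp)
  then have "1 \<le> fact (n + 2) * exp (1 / t) * t ^ (n + 2)"
    using True by (simp add: power_one_over divide_le_eq del: fact_Suc power_Suc)
  then have "exp (- (1 / t)) * 1 \<le> exp (- (1 / t)) * (fact (n + 2) * exp (1 / t) * t ^ (n + 2))"
    by (intro mult_left_mono) auto
  also have "\<dots> = fact (n + 2) * t ^ (n + 2)" by (simp add: exp_minus del: fact_Suc power_Suc)
  also have "\<dots> = (fact (n + 2) * t\<^sup>2) * t ^ n" by (simp only: power_add mult_ac)
  finally have "exp (- (1 / t)) \<le> (fact (n + 2) * t\<^sup>2) * t ^ n" by simp
  then show ?thesis using True by (simp add: flat_def divide_le_eq del: fact_Suc)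
qed (simp add: flat_def)

lemma flat_deriv: "(flat n has_real_derivative (- real n * flat (n + 1) x + flat (n + 2) x)) (at x)"
proof -
  consider "x > 0" | "x < 0" | "x = 0" by linarith
  then show ?thesis
  proof cases
    case 1
    have "((\<lambda>t. exp (- (1 / t)) / t ^ n) has_real_derivative (- real n * flat (n + 1) x + flat (n + 2) x)) (at x)"
      using 1 by (auto intro!: derivative_eq_intros simp: flat_def field_simps power2_eq_square)
        (cases n; simp add: field_simps)
    then show ?thesis
      by (rule has_field_derivative_transform_within_open[of _ _ _ "{0<..}"]) (use 1 in \<open>auto simp: flat_def\<close>)
  next
    case 2
    have "((\<lambda>t. 0) has_real_derivative 0) (at x)" by simp
    then have "(flat n has_real_derivative 0) (at x)"
      by (rule has_field_derivative_transform_within_open[of _ _ _ "{..<0}"]) (use 2 in \<open>auto simp: flat_def\<close>)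
    then show ?thesis using 2 by (simp add: flat_def)
  next
    case 3
    define C where "C = (fact (n + 2) :: real)"
    have "((\<lambda>h. (flat n (0 + h) - flat n 0) / h) \<longlongrightarrow> 0) (at 0)"
    proof (rule Lim_null_comparison)
      show "\<forall>\<^sub>F h in at 0. norm ((flat n (0 + h) - flat n 0) / h) \<le> C * \<bar>h\<bar>"
      proof (rule always_eventually, rule allI)
        fix h :: real
        have "\<bar>flat n h\<bar> \<le> C * \<bar>h\<bar> * \<bar>h\<bar>" using flat_bound[of n h] by (simp add: C_def power2_eq_square mult.assoc)
        then have "\<bar>flat n h\<bar> / \<bar>h\<bar> \<le> C * \<bar>h\<bar>"
          by (cases "h = 0") (simp_all add: pos_divide_le_eq)
        then show "norm ((flat n (0 + h) - flat n 0) / h) \<le> C * \<bar>h\<bar>" by (simp add: flat_def[of n 0] abs_divide)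
      qed
      have "((\<lambda>h::real. C * \<bar>h\<bar>) \<longlongrightarrow> C * \<bar>0\<bar>) (at 0)" by (intro tendsto_intros)
      then show "((\<lambda>h::real. C * \<bar>h\<bar>) \<longlongrightarrow> 0) (at 0)" by simp
    qed
    then have "(flat n has_real_derivative 0) (at 0)" unfolding DERIV_def .
    then show ?thesis using 3 by (simp add: flat_def)
  qed
qed

lemma real_alg_deriv:
  assumes "real_alg f"
  shows "\<exists>f'. real_alg f' \<and> (\<forall>x. (f has_real_derivative f' x) (at x))"
  using assms
proof induction
  case (flat n)
  show ?case
    by (rule exI[of _ "\<lambda>x. - real n * flat (n + 1) x + flat (n + 2) x"])
       (intro conjI allI flat_deriv real_alg.intros)
next
  case (const c)
  show ?case by (rule exI[of _ "\<lambda>_. 0"]) (auto intro: real_alg.intros)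
next
  case (add f g)
  then obtain f' g' where *: "real_alg f'" "real_alg g'" "\<And>x. (f has_real_derivative f' x) (at x)" "\<And>x. (g has_real_derivative g' x) (at x)" by auto
  show ?case by (rule exI[of _ "\<lambda>x. f' x + g' x"]) (auto intro!: derivative_intros * real_alg.intros)
next
  case (mult f g)
  then obtain f' g' where *: "real_alg f'" "real_alg g'" "\<And>x. (f has_real_derivative f' x) (at x)" "\<And>x. (g has_real_derivative g' x) (at x)" by auto
  have "real_alg (\<lambda>x. f' x * g x + f x * g' x)"
    by (intro real_alg.add real_alg.mult * mult.hyps)
  then show ?case by (rule_tac exI[of _ "\<lambda>x. f' x * g x + f x * g' x"]) (auto intro!: derivative_eq_intros *)
next
  case (affine f a b)
  then obtain f' where *: "real_alg f'" "\<And>x. (f has_real_derivative f' x) (at x)" by auto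
  have "real_alg (\<lambda>x. f' (a * x + b) * a)"
    by (intro real_alg.affine[of f' a b] real_alg.mult real_alg.const *)
  moreover have "((\<lambda>x. f (a * x + b)) has_real_derivative f' (a * x + b) * a) (at x)" for x
    by (rule DERIV_chain2[OF *(2)]) (auto intro!: derivative_eq_intros)
  ultimately show ?case by blast
qed

lemma real_alg_smooth: "real_alg f \<Longrightarrow> smooth_real f"
proof (coinduction arbitrary: f)
  case smooth_real
  then show ?case using real_alg_deriv by blast
qed

lemma smooth_realE:
  assumes "smooth_real \<beta>"
  shows "\<exists>\<beta>'. (\<forall>x. (\<beta> has_real_derivative \<beta>' x) (at x)) \<and> smooth_real \<beta>' \<and> continuous_on UNIV \<beta>"
proof -
  have "\<exists>\<beta>'. (\<forall>x. (\<beta> has_real_derivative \<beta>' x) (at x)) \<and> smooth_real \<beta>'"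
    using assms by (subst (asm) smooth_real.simps) blast
  then obtain \<beta>' where *: "\<forall>x. (\<beta> has_real_derivative \<beta>' x) (at x)" "smooth_real \<beta>'" by blast
  moreover have "continuous_on UNIV \<beta>"
    by (intro continuous_at_imp_continuous_on ballI DERIV_isCont[OF *(1)[rule_format]])
  ultimately show ?thesis by blast
qed

text \<open>The chain rule multiplies by \<open>a\<close> at every differentiation, so the
  coinduction needs the free factor \<open>c\<close>.\<close>

lemma smooth_real_affine:
  assumes "smooth_real \<beta>" shows "smooth_real (\<lambda>t. c * \<beta> (a * t + b))"
  using assms
proof (coinduction arbitrary: \<beta> c)
  case smooth_real
  then obtain \<beta>' where *: "\<And>x. (\<beta> has_real_derivative \<beta>' x) (at x)" "smooth_real \<beta>'" using smooth_realE by blast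
  have "((\<lambda>t. c * \<beta> (a * t + b)) has_real_derivative (c * a) * \<beta>' (a * x + b)) (at x)" for x
  proof -
    have "((\<lambda>t. \<beta> (a * t + b)) has_real_derivative \<beta>' (a * x + b) * a) (at x)"
      by (rule DERIV_chain2[OF *(1)]) (auto intro!: derivative_eq_intros)
    from DERIV_cmult[OF this, of c] show ?thesis by (simp add: mult_ac)
  qed
  note d = this
  show ?case
    by (rule exI[of _ "\<lambda>t. c * \<beta> (a * t + b)"], rule exI[of _ "\<lambda>t. (c * a) * \<beta>' (a * t + b)"],
        intro conjI refl allI d, rule disjI1, rule exI[of _ \<beta>'], rule exI[of _ "c * a"]) (use *(2) in simp)
qed

text \<open>The step is the normalised primitive of the bump
  \<open>flat 0 t * flat 0 (1 - t)\<close>. Its derivative has mass 1 and support in the unit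
  interval, so rescaled copies form an approximate identity.\<close>

lemma smooth_step_exists:
  obtains S \<sigma> :: "real \<Rightarrow> real" where
    "smooth_real S" "smooth_real \<sigma>" "\<And>t. (S has_real_derivative \<sigma> t) (at t)"
    "\<And>t. t \<le> 0 \<Longrightarrow> S t = 0" "\<And>t. t \<ge> 1 \<Longrightarrow> S t = 1" "\<And>t. 0 \<le> S t" "\<And>t. S t \<le> 1"
    "\<And>t. t \<notin> {0..1} \<Longrightarrow> \<sigma> t = 0" "continuous_on UNIV \<sigma>" "(LINT t|lborel. \<sigma> t) = 1"
proof -
  define \<rho> where "\<rho> t = flat 0 t * flat 0 ((-1) * t + 1)" for t
  have ra: "real_alg \<rho>" unfolding \<rho>_def by (intro real_alg.mult real_alg.flat real_alg.affine[OF real_alg.flat])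
  then obtain \<rho>' where \<rho>': "\<And>x. (\<rho> has_real_derivative \<rho>' x) (at x)" using real_alg_deriv by blast
  have c: "continuous_on UNIV \<rho>" by (intro continuous_at_imp_continuous_on ballI DERIV_isCont[OF \<rho>'])
  have "\<exists>P. \<forall>x::real. -\<infinity> < ereal x \<longrightarrow> ereal x < \<infinity> \<longrightarrow> (P has_vector_derivative \<rho> x) (at x)"
    by (rule einterval_antiderivative) (use c in \<open>auto simp: continuous_on_eq_continuous_at\<close>)
  then obtain P where P: "\<And>x. (P has_real_derivative \<rho> x) (at x)"
    by (auto simp: has_real_derivative_iff_has_vector_derivative)
  have nn: "\<rho> t \<ge> 0" for t by (simp add: \<rho>_def flat_def)
  have pos: "\<rho> t > 0" if "0 < t" "t < 1" for t using that by (simp add: \<rho>_def flat_def)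
  have z: "\<rho> t = 0" if "t \<le> 0 \<or> t \<ge> 1" for t using that by (auto simp: \<rho>_def flat_def)
  have mono: "P a \<le> P b" if "a \<le> b" for a b
    by (rule DERIV_nonneg_imp_nondecreasing[OF that]) (rule exI, rule conjI, rule P, rule nn)
  define Z where "Z = P 1 - P 0"
  have Z: "Z > 0"
  proof -
    obtain s where "0 < s" "s < 1" "P 1 - P 0 = (1 - 0) * \<rho> s" using MVT2[of 0 1 P \<rho>] P by auto
    then show ?thesis using pos by (simp add: Z_def)
  qed
  have const: "P a = P b" if "a \<le> b" "\<And>t. a < t \<Longrightarrow> t < b \<Longrightarrow> \<rho> t = 0" for a b
  proof (cases "a < b")
    case True
    obtain s where "a < s" "s < b" "P b - P a = (b - a) * \<rho> s" using MVT2[OF True, of P \<rho>] P by auto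
    then show ?thesis using that(2)[of s] by simp
  qed (use that in simp)
  define S where "S t = (P t - P 0) / Z" for t
  define \<sigma> where "\<sigma> t = \<rho> t / Z" for t
  have d: "(S has_real_derivative \<sigma> t) (at t)" for t
  proof -
    have "((\<lambda>t. P t - P 0) has_real_derivative \<rho> t) (at t)" using DERIV_diff[OF P DERIV_const] by simp
    then show ?thesis unfolding S_def \<sigma>_def by (rule DERIV_cdivide)
  qed
  have "real_alg (\<lambda>t. \<rho> t * (1 / Z))" by (intro real_alg.mult real_alg.const ra)
  then have s\<sigma>: "smooth_real \<sigma>" unfolding \<sigma>_def[abs_def] using real_alg_smooth by simp
  have S0: "S t = 0" if t: "t \<le> 0" for t
  proof -
    have "P t = P 0" using t by (rule const) (simp add: z)
    then show ?thesis by (simp add: S_def)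
  qed
  have S1: "S t = 1" if t: "t \<ge> 1" for t
  proof -
    have "P 1 = P t" using t by (rule const) (simp add: z)
    then have "P t - P 0 = Z" by (simp add: Z_def)
    then show ?thesis using Z by (simp add: S_def)
  qed
  have S2: "0 \<le> S t" for t
  proof (cases "t \<le> 0")
    case False
    then have "P 0 \<le> P t" by (intro mono) simp
    then show ?thesis using Z by (simp add: S_def)
  qed (simp add: S0)
  have S3: "S t \<le> 1" for t
  proof (cases "t \<ge> 1")
    case False
    then have "P t - P 0 \<le> Z" using mono[of t 1] unfolding Z_def by linarith
    then show ?thesis using Z by (simp add: S_def divide_le_eq_1)
  qed (simp add: S1)
  have c\<sigma>: "continuous_on UNIV \<sigma>" unfolding \<sigma>_def[abs_def] using c Z by (auto intro!: continuous_intros)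
  have z\<sigma>: "\<sigma> t = 0" if "t \<notin> {0..1}" for t using that z[of t] by (auto simp: \<sigma>_def)
  have "(LINT t|lborel. indicator {0..1} t *\<^sub>R \<sigma> t) = S 1 - S 0"
  proof (rule integral_FTC_Icc)
    show "(S has_vector_derivative \<sigma> t) (at t within {0..1})" for t
      by (rule has_vector_derivative_at_within[OF d[unfolded has_real_derivative_iff_has_vector_derivative]])
    show "continuous_on {0..1} \<sigma>" by (rule continuous_on_subset[OF c\<sigma>]) simp
  qed simp
  also have "(\<lambda>t. indicator {0..1} t *\<^sub>R \<sigma> t) = \<sigma>" using z\<sigma> by (auto simp: fun_eq_iff indicator_def)
  finally have "(LINT t|lborel. \<sigma> t) = 1" using S0[of 0] S1[of 1] by simp
  moreover have "smooth_real S" using d s\<sigma> by (rule smooth_real.intros)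
  ultimately show ?thesis using s\<sigma> d S0 S1 S2 S3 z\<sigma> c\<sigma> by (intro that[of S \<sigma>])
qed

text \<open>The coinduction invariant for \<open>smooth_c\<close>. In the case \<open>pole\<close>
  the factor in \<open>Im z\<close> vanishes below a height \<open>d\<close> that lies above
  \<zeta>, so the singularity is never met. Arbitrary powers \<open>m\<close> occur because
  differentiation raises the power.\<close>

inductive plane_alg :: "(complex \<Rightarrow> complex) \<Rightarrow> bool" where
  re: "smooth_real \<beta> \<Longrightarrow> plane_alg (\<lambda>z. of_real (\<beta> (Re z)))"
| im: "smooth_real \<beta> \<Longrightarrow> plane_alg (\<lambda>z. of_real (\<beta> (Im z)))"
| scalar: "plane_alg (\<lambda>_. c)"
| pole: "smooth_real \<beta> \<Longrightarrow> (\<And>y. y < d \<Longrightarrow> \<beta> y = 0) \<Longrightarrow> Im \<zeta> < d \<Longrightarrow>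
    plane_alg (\<lambda>z. of_real (\<beta> (Im z)) * (1 / (z - \<zeta>)) ^ m)"
| add: "plane_alg f \<Longrightarrow> plane_alg g \<Longrightarrow> plane_alg (\<lambda>x. f x + g x)"
| mult: "plane_alg f \<Longrightarrow> plane_alg g \<Longrightarrow> plane_alg (\<lambda>x. f x * g x)"

text \<open>A direction \<open>c\<close> and a rate \<open>k\<close> treat both partial derivatives
  of a function of a single coordinate at once; in the applications \<open>k\<close> is 0 or
  1.\<close>

lemma of_real_line_deriv:
  fixes \<beta> :: "real \<Rightarrow> real"
  assumes "(\<beta> has_real_derivative D) (at (q z))" "\<And>t. q (z + c * of_real t) = q z + k * t"
  shows "((\<lambda>t::real. of_real (\<beta> (q (z + c * of_real t))) :: complex) has_vector_derivative of_real (D * k)) (at 0)"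
proof -
  have "((\<lambda>t. \<beta> (q z + k * t)) has_real_derivative D * k) (at 0)"
    by (rule DERIV_chain2[where f=\<beta>]) (use assms(1) in \<open>auto intro!: derivative_eq_intros\<close>)
  then show ?thesis unfolding assms(2) by (rule has_vector_derivative_of_real)
qed

lemma pole_line_deriv:
  assumes b: "(\<beta> has_real_derivative D) (at (Im z))" and c: "\<And>t. Im (z + c * of_real t) = Im z + k * t"
    and z: "z \<noteq> \<zeta>"
  shows "((\<lambda>t::real. of_real (\<beta> (Im (z + c * of_real t))) * (1 / (z + c * of_real t - \<zeta>)) ^ m) has_vector_derivative
     (of_real (D * k) * (1 / (z - \<zeta>)) ^ m + of_real (\<beta> (Im z)) * (- of_nat m * c * (1 / (z - \<zeta>)) ^ (m + 1)))) (at 0)"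
proof -
  have 0: "((\<lambda>w. 1 / (w - \<zeta>)) has_field_derivative (- ((1 / (z - \<zeta>))\<^sup>2))) (at (z + c * of_real 0))"
    using z by (auto intro!: derivative_eq_intros simp: power2_eq_square divide_simps)
  have a1: "((\<lambda>w. (1 / (w - \<zeta>)) ^ m) has_field_derivative (- of_nat m * (1 / (z - \<zeta>)) ^ (m + 1))) (at (z + c * of_real 0))"
    using DERIV_power[OF 0, of m]
    by (cases m) (simp_all add: power2_eq_square mult_ac minus_mult_left minus_divide_left del: mult_minus_left divide_minus_left)
  have a2: "((\<lambda>t::real. z + c * of_real t) has_vector_derivative c) (at 0)"
    by (auto intro!: derivative_eq_intros)
  have 1: "((\<lambda>t::real. (1 / (z + c * of_real t - \<zeta>)) ^ m) has_vector_derivative (c * (- of_nat m * (1 / (z - \<zeta>)) ^ (m + 1)))) (at 0)"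
    using field_vector_diff_chain_at[OF a2 a1] by (simp only: o_def)
  have 2: "((\<lambda>t::real. of_real (\<beta> (Im (z + c * of_real t))) :: complex) has_vector_derivative of_real (D * k)) (at 0)"
    by (rule of_real_line_deriv[OF b c])
  from has_vector_derivative_mult[OF 2 1] show ?thesis by (simp add: mult_ac add.commute)
qed

lemma plane_alg_partials:
  assumes "plane_alg \<phi>"
  shows "continuous_on UNIV \<phi> \<and> (\<exists>\<phi>x \<phi>y. plane_alg \<phi>x \<and> plane_alg \<phi>y \<and>
    (\<forall>z. ((\<lambda>t::real. \<phi> (z + 1 * of_real t)) has_vector_derivative \<phi>x z) (at 0)) \<and>
    (\<forall>z. ((\<lambda>t::real. \<phi> (z + \<i> * of_real t)) has_vector_derivative \<phi>y z) (at 0)))"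
  using assms
proof induction
  case (re \<beta>)
  then obtain \<beta>' where b: "\<And>x. (\<beta> has_real_derivative \<beta>' x) (at x)" "smooth_real \<beta>'" "continuous_on UNIV \<beta>" using smooth_realE by blast
  have "continuous_on UNIV (\<lambda>z. complex_of_real (\<beta> (Re z)))"
    by (intro continuous_on_of_real continuous_on_compose2[OF b(3)] continuous_intros) auto
  moreover have "((\<lambda>t::real. complex_of_real (\<beta> (Re (z + 1 * of_real t)))) has_vector_derivative of_real (\<beta>' (Re z))) (at 0)" for z
    using of_real_line_deriv[OF b(1), of Re z 1 1] by simp
  moreover have "((\<lambda>t::real. complex_of_real (\<beta> (Re (z + \<i> * of_real t)))) has_vector_derivative 0) (at 0)" for z
    using of_real_line_deriv[OF b(1), of Re z \<i> 0] by simp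
  ultimately show ?case using plane_alg.re[OF b(2)] plane_alg.scalar[of 0] by blast
next
  case (im \<beta>)
  then obtain \<beta>' where b: "\<And>x. (\<beta> has_real_derivative \<beta>' x) (at x)" "smooth_real \<beta>'" "continuous_on UNIV \<beta>" using smooth_realE by blast
  have "continuous_on UNIV (\<lambda>z. complex_of_real (\<beta> (Im z)))"
    by (intro continuous_on_of_real continuous_on_compose2[OF b(3)] continuous_intros) auto
  moreover have "((\<lambda>t::real. complex_of_real (\<beta> (Im (z + 1 * of_real t)))) has_vector_derivative 0) (at 0)" for z
    using of_real_line_deriv[OF b(1), of Im z 1 0] by simp
  moreover have "((\<lambda>t::real. complex_of_real (\<beta> (Im (z + \<i> * of_real t)))) has_vector_derivative of_real (\<beta>' (Im z))) (at 0)" for z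
    using of_real_line_deriv[OF b(1), of Im z \<i> 1] by simp
  ultimately show ?case using plane_alg.im[OF b(2)] plane_alg.scalar[of 0] by blast
next
  case (scalar c)
  show ?case using plane_alg.scalar[of c] plane_alg.scalar[of 0] by (intro conjI exI[of _ "\<lambda>_. 0"]) auto
next
  case (pole \<beta> d \<zeta> m)
  obtain \<beta>' where b: "\<And>x. (\<beta> has_real_derivative \<beta>' x) (at x)" "smooth_real \<beta>'" "continuous_on UNIV \<beta>"
    using smooth_realE[OF pole(1)] by blast
  \<comment> \<open>The derivative inherits the vanishing below \<open>d\<close>, so it is again
    admissible in \<open>plane_alg.pole\<close>.\<close>
  have b0: "\<beta>' y = 0" if "y < d" for y
  proof -
    have "((\<lambda>_. 0) has_real_derivative 0) (at y)" by simp
    then have "(\<beta> has_real_derivative 0) (at y)"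
      by (rule has_field_derivative_transform_within_open[of _ _ _ "{..<d}"]) (use that pole(2) in auto)
    then show ?thesis using b(1) DERIV_unique by blast
  qed
  let ?p = "\<lambda>\<beta> m z. complex_of_real (\<beta> (Im z)) * (1 / (z - \<zeta>)) ^ m"
  have cont: "continuous_on UNIV (?p \<beta> m)"
  proof -
    \<comment> \<open>The half-planes overlap because \<open>Im \<zeta> < d\<close>; the product is
      0 on the lower one and free of poles on the upper one.\<close>
    have "continuous_on ({z. Im z < d} \<union> {z. Im \<zeta> < Im z}) (?p \<beta> m)"
    proof (rule continuous_on_open_Un)
      have "continuous_on {z. Im z < d} (\<lambda>_. 0::complex)" by simp
      then show "continuous_on {z. Im z < d} (?p \<beta> m)" by (rule continuous_on_eq) (simp add: pole(2))
      show "continuous_on {z. Im \<zeta> < Im z} (?p \<beta> m)"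
        by (intro continuous_on_mult continuous_on_power continuous_on_divide continuous_on_of_real
            continuous_on_compose2[OF b(3)] continuous_intros) auto
    qed (simp_all add: open_halfspace_Im_lt open_halfspace_Im_gt)
    moreover have "{z. Im z < d} \<union> {z. Im \<zeta> < Im z} = UNIV" using pole(3) by auto
    ultimately show ?thesis by simp
  qed
  have d1: "((\<lambda>t::real. ?p \<beta> m (z + c * of_real t)) has_vector_derivative
       of_real k * ?p \<beta>' m z + (- of_nat m * c) * ?p \<beta> (m + 1) z) (at 0)"
    if c: "\<And>t. Im (z + c * of_real t) = Im z + k * t" for z c k
  proof (cases "Im z < d")
    case True
    have "((\<lambda>t::real. ?p \<beta> m (z + c * of_real t)) has_vector_derivative 0) (at 0)"
    proof (rule partial_cong[where f="\<lambda>_. 0" and S="{z. Im z < d}"])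
      show "0 = ?p \<beta> m w" if "w \<in> {z. Im z < d}" for w using that pole(2)[of "Im w"] by simp
    qed (use True in \<open>auto simp: open_halfspace_Im_lt\<close>)
    then show ?thesis using True pole(2)[of "Im z"] b0[of "Im z"] by simp
  next
    case False
    then have "z \<noteq> \<zeta>" using pole(3) by auto
    from pole_line_deriv[OF b(1) c this, of m] show ?thesis by (simp add: mult_ac)
  qed
  have x: "((\<lambda>t::real. ?p \<beta> m (z + 1 * of_real t)) has_vector_derivative (- of_nat m) * ?p \<beta> (m + 1) z) (at 0)" for z
    using d1[of z 1 0] by simp
  have y: "((\<lambda>t::real. ?p \<beta> m (z + \<i> * of_real t)) has_vector_derivative ?p \<beta>' m z + (- of_nat m * \<i>) * ?p \<beta> (m + 1) z) (at 0)" for z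
    using d1[of z \<i> 1] by simp
  have p: "plane_alg (?p \<beta> m)" "plane_alg (?p \<beta>' m)" for m
    by (rule plane_alg.pole; use pole b b0 in blast)+
  have "plane_alg (\<lambda>z. (- of_nat m) * ?p \<beta> (m + 1) z)" "plane_alg (\<lambda>z. ?p \<beta>' m z + (- of_nat m * \<i>) * ?p \<beta> (m + 1) z)"
    by (intro plane_alg.mult plane_alg.add plane_alg.scalar p)+
  with x y cont show ?case by blast
next
  case (add f g)
  then obtain fx fy gx gy where "plane_alg fx" "plane_alg fy" "plane_alg gx" "plane_alg gy" and
    *: "\<And>z. ((\<lambda>t::real. f (z + 1 * of_real t)) has_vector_derivative fx z) (at 0)" "\<And>z. ((\<lambda>t::real. f (z + \<i> * of_real t)) has_vector_derivative fy z) (at 0)"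
    "\<And>z. ((\<lambda>t::real. g (z + 1 * of_real t)) has_vector_derivative gx z) (at 0)" "\<And>z. ((\<lambda>t::real. g (z + \<i> * of_real t)) has_vector_derivative gy z) (at 0)" by blast
  then have "plane_alg (\<lambda>z. fx z + gx z)" "plane_alg (\<lambda>z. fy z + gy z)" by (auto intro: plane_alg.add)
  moreover have "continuous_on UNIV (\<lambda>z. f z + g z)" using add by (intro continuous_on_add) auto
  ultimately show ?case using has_vector_derivative_add[OF *(1) *(3)] has_vector_derivative_add[OF *(2) *(4)] by blast
next
  case (mult f g)
  then obtain fx fy gx gy where p: "plane_alg fx" "plane_alg fy" "plane_alg gx" "plane_alg gy" and
    *: "\<And>z. ((\<lambda>t::real. f (z + 1 * of_real t)) has_vector_derivative fx z) (at 0)" "\<And>z. ((\<lambda>t::real. f (z + \<i> * of_real t)) has_vector_derivative fy z) (at 0)"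
    "\<And>z. ((\<lambda>t::real. g (z + 1 * of_real t)) has_vector_derivative gx z) (at 0)" "\<And>z. ((\<lambda>t::real. g (z + \<i> * of_real t)) has_vector_derivative gy z) (at 0)" by blast
  have "plane_alg (\<lambda>z. f z * gx z + fx z * g z)" "plane_alg (\<lambda>z. f z * gy z + fy z * g z)"
    by (intro plane_alg.add plane_alg.mult p mult.hyps)+
  moreover have "continuous_on UNIV (\<lambda>z. f z * g z)" using mult by (intro continuous_on_mult) auto
  moreover have "((\<lambda>t::real. f (z + 1 * of_real t) * g (z + 1 * of_real t)) has_vector_derivative (f z * gx z + fx z * g z)) (at 0)" for z
    using has_vector_derivative_mult[OF *(1)[of z] *(3)[of z]] by simp
  moreover have "((\<lambda>t::real. f (z + \<i> * of_real t) * g (z + \<i> * of_real t)) has_vector_derivative (f z * gy z + fy z * g z)) (at 0)" for z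
    using has_vector_derivative_mult[OF *(2)[of z] *(4)[of z]] by simp
  ultimately show ?case by blast
qed

lemma partials_unique:
  assumes "\<And>z. ((\<lambda>t::real. \<phi> (z + 1 * of_real t)) has_vector_derivative \<phi>x z) (at 0)"
    "\<And>z. ((\<lambda>t::real. \<phi> (z + \<i> * of_real t)) has_vector_derivative \<phi>y z) (at 0)"
  shows "px \<phi> = \<phi>x" "py \<phi> = \<phi>y"
  using assms unfolding px_def py_def by (auto simp: fun_eq_iff intro!: vector_derivative_at)

lemma plane_alg_smooth: "plane_alg \<phi> \<Longrightarrow> smooth_c \<phi>"
proof (coinduction arbitrary: \<phi>)
  case smooth_c
  then obtain \<phi>x \<phi>y where *: "continuous_on UNIV \<phi>" "plane_alg \<phi>x" "plane_alg \<phi>y"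
    "\<And>z. ((\<lambda>t::real. \<phi> (z + 1 * of_real t)) has_vector_derivative \<phi>x z) (at 0)"
    "\<And>z. ((\<lambda>t::real. \<phi> (z + \<i> * of_real t)) has_vector_derivative \<phi>y z) (at 0)"
    using plane_alg_partials by blast
  have "px \<phi> = \<phi>x" "py \<phi> = \<phi>y" by (rule partials_unique[OF *(4,5)])+
  moreover have "(\<lambda>t::real. \<phi> (z + of_real t)) differentiable (at 0)" "(\<lambda>t::real. \<phi> (z + \<i> * of_real t)) differentiable (at 0)" for z
    using *(4,5)[of z] by (auto intro: differentiableI_vector)
  ultimately show ?case using *(1,2,3) by auto
qed

section \<open>The Cauchy--Pompeiu formula up to the boundary\<close>

lemma integral_inverse_one_plus_sq:
  "integrable lborel (\<lambda>s::real. 1 / (1 + s\<^sup>2))" "(LINT s|lborel. 1 / (1 + s\<^sup>2)) = pi"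
  using integrable_inverse_1_plus_square LBINT_inverse_1_plus_square
  by (simp_all add: set_integrable_def interval_lebesgue_integral_def set_lebesgue_integral_def inverse_eq_divide)

lemma integral_diff3:
  fixes u v w :: "complex \<Rightarrow> complex"
  assumes "integrable lborel u" "integrable lborel v" "integrable lborel w"
  shows "(LINT z|lborel. u z - c * v z - d * w z) = integral\<^sup>L lborel u - c * integral\<^sup>L lborel v - d * integral\<^sup>L lborel w"
  using assms by simp

text \<open>Dominated convergence with a fixed integrable factor \<open>A\<close>. Boundedness and
  convergence of the multipliers matter only where \<open>A\<close> is nonzero, which hides their
  behaviour outside the half-plane.\<close>

lemma bounded_mult_limit:
  fixes A :: "'a \<Rightarrow> 'b::{real_normed_field,banach,second_countable_topology}"
  assumes A: "integrable M A" and m: "\<And>n. m n \<in> borel_measurable M" "m' \<in> borel_measurable M"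
    and C: "\<And>n z. A z \<noteq> 0 \<Longrightarrow> norm (m n z) \<le> C"
    and lim: "\<And>z. A z \<noteq> 0 \<Longrightarrow> (\<lambda>n. m n z) \<longlonglongrightarrow> m' z"
  shows "(\<lambda>n. LINT z|M. A z * m n z) \<longlonglongrightarrow> (LINT z|M. A z * m' z)"
proof (rule integral_dominated_convergence[where w="\<lambda>z. norm (A z) * \<bar>C\<bar>"])
  have [measurable]: "A \<in> borel_measurable M" using A by simp
  note m[measurable]
  show "(\<lambda>z. A z * m' z) \<in> borel_measurable M" "\<And>n. (\<lambda>z. A z * m n z) \<in> borel_measurable M" by measurable
  show "integrable M (\<lambda>z. norm (A z) * \<bar>C\<bar>)" using A by simp
  show "AE z in M. (\<lambda>n. A z * m n z) \<longlonglongrightarrow> A z * m' z"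
  proof (rule AE_I2)
    fix z show "(\<lambda>n. A z * m n z) \<longlonglongrightarrow> A z * m' z"
      by (cases "A z = 0") (auto intro!: tendsto_mult_left lim)
  qed
  show "AE z in M. norm (A z * m n z) \<le> norm (A z) * \<bar>C\<bar>" for n
  proof (rule AE_I2)
    fix z show "norm (A z * m n z) \<le> norm (A z) * \<bar>C\<bar>"
    proof (cases "A z = 0")
      case False
      have "norm (m n z) \<le> \<bar>C\<bar>" using C[OF False, of n] by simp
      then show ?thesis by (simp add: norm_mult mult_left_mono)
    qed simp
  qed
qed

text \<open>The substitution \<open>t = x + y n * s\<close> moves the parameter from the kernel into
  \<open>k\<close> and leaves the fixed density \<open>1 / (1 + s^2)\<close> of mass pi.\<close>

lemma poisson_limit:
  fixes k :: "real \<Rightarrow> real"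
  assumes k: "continuous_on UNIV k" and M: "\<And>t. \<bar>k t\<bar> \<le> M" and y: "y \<longlonglongrightarrow> 0" "\<And>n. y n > 0"
  shows "(\<lambda>n. LINT t|lborel. k t * (y n / ((t - x)\<^sup>2 + (y n)\<^sup>2))) \<longlonglongrightarrow> pi * k x"
proof -
  have [measurable]: "k \<in> borel_measurable borel" by (rule borel_measurable_continuous_onI[OF k])
  have "(LINT t|lborel. k t * (y n / ((t - x)\<^sup>2 + (y n)\<^sup>2))) = (LINT s|lborel. (1 / (1 + s\<^sup>2)) * k (x + y n * s))" for n
  proof -
    have "(LINT t|lborel. k t * (y n / ((t - x)\<^sup>2 + (y n)\<^sup>2)))
        = \<bar>y n\<bar> *\<^sub>R (LINT s|lborel. k (x + y n * s) * (y n / ((x + y n * s - x)\<^sup>2 + (y n)\<^sup>2)))"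
      by (rule lborel_integral_real_affine) (use y(2)[of n] in simp)
    also have "\<dots> = (LINT s|lborel. \<bar>y n\<bar> * (k (x + y n * s) * (y n / ((x + y n * s - x)\<^sup>2 + (y n)\<^sup>2))))"
      by (simp only: real_scaleR_def integral_mult_right_zero)
    also have "\<dots> = (LINT s|lborel. (1 / (1 + s\<^sup>2)) * k (x + y n * s))"
    proof (intro Bochner_Integration.integral_cong refl)
      fix s :: real
      have p: "1 + s\<^sup>2 > 0" by (simp add: add_pos_nonneg)
      have "(x + y n * s - x)\<^sup>2 + (y n)\<^sup>2 = (y n)\<^sup>2 * (1 + s\<^sup>2)" by (simp add: power2_eq_square algebra_simps)
      then show "\<bar>y n\<bar> * (k (x + y n * s) * (y n / ((x + y n * s - x)\<^sup>2 + (y n)\<^sup>2))) = (1 / (1 + s\<^sup>2)) * k (x + y n * s)"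
        using y(2)[of n] p by (simp add: power2_eq_square)
    qed
    finally show ?thesis .
  qed
  moreover have "(\<lambda>n. LINT s|lborel. (1 / (1 + s\<^sup>2)) * k (x + y n * s)) \<longlonglongrightarrow> (LINT s|lborel. (1 / (1 + s\<^sup>2)) * k x)"
  proof (rule bounded_mult_limit[where C=M])
    show "norm (k (x + y n * s)) \<le> M" for n s using M by simp
    fix s
    have "(\<lambda>n. x + y n * s) \<longlonglongrightarrow> x + 0 * s" by (intro tendsto_intros y)
    then have "(\<lambda>n. x + y n * s) \<longlonglongrightarrow> x" by simp
    moreover have "isCont k x" using k by (simp add: continuous_on_eq_continuous_at)
    ultimately show "(\<lambda>n. k (x + y n * s)) \<longlonglongrightarrow> k x" by (rule isCont_tendsto_compose[rotated])
  qed (simp_all add: integral_inverse_one_plus_sq)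
  moreover have "(LINT s|lborel. (1 / (1 + s\<^sup>2)) * k x) = pi * k x"
    by (subst integral_mult_left_zero) (simp add: integral_inverse_one_plus_sq)
  ultimately show ?thesis by simp
qed

lemma dbar_mult:
  assumes "smooth_c A" "smooth_c B"
  shows "dbar (\<lambda>z. A z * B z) z = dbar A z * B z + A z * dbar B z"
proof -
  have "px (\<lambda>z. A z * B z) z = A z * px B z + px A z * B z"
    unfolding px_def[of "\<lambda>z. A z * B z"]
    using has_vector_derivative_mult[OF smooth_cD(6)[OF assms(1), of z] smooth_cD(6)[OF assms(2), of z]]
    by (intro vector_derivative_at) simp
  moreover have "py (\<lambda>z. A z * B z) z = A z * py B z + py A z * B z"
    unfolding py_def[of "\<lambda>z. A z * B z"]
    using has_vector_derivative_mult[OF smooth_cD(7)[OF assms(1), of z] smooth_cD(7)[OF assms(2), of z]]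
    by (intro vector_derivative_at) simp
  ultimately show ?thesis by (simp add: dbar_def algebra_simps add_divide_distrib)
qed

text \<open>The Cauchy kernel is holomorphic off its pole: the two squared terms cancel, and only
  the derivative of the vertical cutoff remains.\<close>

lemma dbar_pole:
  assumes b: "(\<beta> has_real_derivative D) (at (Im z))" and z: "z \<noteq> \<zeta>"
  shows "dbar (\<lambda>z. of_real (\<beta> (Im z)) * (1 / (z - \<zeta>))) z = \<i> / 2 * of_real D / (z - \<zeta>)"
proof -
  have "px (\<lambda>z. of_real (\<beta> (Im z)) * (1 / (z - \<zeta>))) z = - (of_real (\<beta> (Im z)) * (1 / (z - \<zeta>))\<^sup>2)"
    unfolding px_def using pole_line_deriv[OF b _ z, of 1 0 1]
    by (intro vector_derivative_at) (simp add: power2_eq_square)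
  moreover have "py (\<lambda>z. of_real (\<beta> (Im z)) * (1 / (z - \<zeta>))) z = of_real D * (1 / (z - \<zeta>)) - \<i> * (of_real (\<beta> (Im z)) * (1 / (z - \<zeta>))\<^sup>2)"
    unfolding py_def using pole_line_deriv[OF b _ z, of \<i> 1 1]
    by (intro vector_derivative_at) (simp add: power2_eq_square mult_ac)
  ultimately show ?thesis unfolding dbar_def by (simp only:) (simp add: field_simps)
qed

section \<open>The converse: an integrable majorant for the weak derivative\<close>

locale extension =
  fixes F h :: "complex \<Rightarrow> complex" and f :: "real \<Rightarrow> real"
  assumes Fc: "continuous_on closed_upper_half_plane F"
    and Fr: "\<And>x. F (of_real x) = of_real (f x)"
    and Fo: "F \<in> o[inf at_infinity (principal closed_upper_half_plane)](\<lambda>z. z\<^sup>2)"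
    and wd: "weak_dbar upper_half_plane F h"
    and hfin: "(\<integral>\<^sup>+ z. ennreal (indicator upper_half_plane z * (cmod (h z))\<^sup>2 / (Im z)\<^sup>2) \<partial>lborel) < \<infinity>"
begin

definition h0 :: "complex \<Rightarrow> complex" where
  "h0 z = (if z \<in> upper_half_plane then h z else 0)"

text \<open>A universal majorant. With y = Im z a product is written as (|h| / y) times (|k| y), and
  \<open>a * b <= a^2 + b^2\<close> bounds it by a multiple of \<open>dom\<close> whenever |k| y
  decays like 1 / (1 + |z|^2); the second summand is the square of that decay.\<close>

definition dom :: "complex \<Rightarrow> real" where
  "dom z = (cmod (h0 z))\<^sup>2 / (Im z)\<^sup>2 + 1 / (1 + (cmod z)\<^sup>2)\<^sup>2"

text \<open>Local integrability gives measurability only on compact subsets of the open half-plane;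
  the sets used here stay away from the axis and from infinity and exhaust it.\<close>

lemma h0_measurable [measurable]: "h0 \<in> borel_measurable borel"
proof (rule borel_measurable_LIMSEQ_metric)
  fix n
  let ?K = "{z. 1 / (real n + 1) \<le> Im z} \<inter> cball 0 (real n)"
  have "compact ?K" by (intro closed_Int_compact closed_halfspace_Im_ge compact_cball)
  moreover have "?K \<subseteq> upper_half_plane"
  proof
    fix z assume "z \<in> ?K"
    moreover have "0 < 1 / (real n + 1)" by simp
    ultimately have "0 < Im z" unfolding Int_iff mem_Collect_eq by linarith
    then show "z \<in> upper_half_plane" by (simp add: upper_half_plane_def)
  qed
  ultimately have "set_integrable lborel ?K h" using wd by (simp add: weak_dbar_def locally_integrable_on_def)
  then show "(\<lambda>z. indicator ?K z *\<^sub>R h z) \<in> borel_measurable borel"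
    unfolding set_integrable_def by (auto dest: borel_measurable_integrable)
next
  fix z :: complex
  show "(\<lambda>n. indicator ({z. 1 / (real n + 1) \<le> Im z} \<inter> cball 0 (real n)) z *\<^sub>R h z) \<longlonglongrightarrow> h0 z"
  proof (cases "z \<in> upper_half_plane")
    case True
    then have y: "Im z > 0" by (simp add: upper_half_plane_def)
    have "\<forall>\<^sub>F n in sequentially. indicator ({z. 1 / (real n + 1) \<le> Im z} \<inter> cball 0 (real n)) z *\<^sub>R h z = h0 z"
      using eventually_ge_at_top[of "nat \<lceil>cmod z\<rceil> + nat \<lceil>1 / Im z\<rceil>"]
    proof eventually_elim
      case (elim n)
      then have "cmod z \<le> real n" "1 / Im z \<le> real n" by linarith+
      then have "1 / (real n + 1) \<le> Im z" using y by (simp add: field_simps)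
      with \<open>cmod z \<le> real n\<close> True show ?case by (simp add: h0_def)
    qed
    then show ?thesis by (rule tendsto_eventually)
  next
    case False
    have 0: "indicator ({z. 1 / (real n + 1) \<le> Im z} \<inter> cball 0 (real n)) z *\<^sub>R h z = 0" for n
    proof -
      have "Im z \<le> 0" "0 < 1 / (real n + 1)" using False by (auto simp: upper_half_plane_def)
      then have "\<not> 1 / (real n + 1) \<le> Im z" by linarith
      then show ?thesis by simp
    qed
    show ?thesis unfolding 0 using False by (simp add: h0_def)
  qed
qed

lemma h0_weighted: "(\<integral>\<^sup>+ z. ennreal ((cmod (h0 z))\<^sup>2 / (Im z)\<^sup>2) \<partial>lborel) < \<infinity>"
proof -
  have "(\<integral>\<^sup>+ z. ennreal ((cmod (h0 z))\<^sup>2 / (Im z)\<^sup>2) \<partial>lborel) =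
     (\<integral>\<^sup>+ z. ennreal (indicator upper_half_plane z * (cmod (h z))\<^sup>2 / (Im z)\<^sup>2) \<partial>lborel)"
    by (intro nn_integral_cong) (simp add: h0_def)
  then show ?thesis using hfin by simp
qed

lemma dom_integrable: "integrable lborel dom"
proof -
  have 1: "integrable lborel (\<lambda>z. (cmod (h0 z))\<^sup>2 / (Im z)\<^sup>2)"
    by (rule integrableI_nonneg) (use h0_weighted in auto)
  have "(\<integral>\<^sup>+z. ennreal (1 / (1 + (cmod z)\<^sup>2)\<^sup>2) \<partial>lborel) \<le> (\<integral>\<^sup>+z. ennreal (1 / (1 + (Re z)\<^sup>2)) * ennreal (1 / (1 + (Im z)\<^sup>2)) \<partial>lborel)"
  proof (intro nn_integral_mono)
    fix z :: complex
    \<comment> \<open>Comparison with a product of the one-dimensional densities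
      \<open>1 / (1 + s^2)\<close> reduces integrability over the plane to the line.\<close>
    have "(1 + (Re z)\<^sup>2) * (1 + (Im z)\<^sup>2) \<le> (1 + (cmod z)\<^sup>2)\<^sup>2"
    proof -
      have "(1 + a) * (1 + b) \<le> (1 + (a + b))\<^sup>2" if "a \<ge> 0" "b \<ge> 0" for a b :: real
      proof -
        have "(1 + (a + b))\<^sup>2 = (1 + a) * (1 + b) + (a + b + a\<^sup>2 + b\<^sup>2 + a * b)" by (simp add: power2_eq_square algebra_simps)
        moreover have "0 \<le> a + b + a\<^sup>2 + b\<^sup>2 + a * b" using that by simp
        ultimately show ?thesis by linarith
      qed
      then show ?thesis unfolding cmod_power2 by simp
    qed
    moreover have "0 < (1 + (Re z)\<^sup>2) * (1 + (Im z)\<^sup>2)" by (intro mult_pos_pos add_pos_nonneg) auto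
    ultimately have "1 / (1 + (cmod z)\<^sup>2)\<^sup>2 \<le> 1 / ((1 + (Re z)\<^sup>2) * (1 + (Im z)\<^sup>2))" by (intro frac_le) auto
    also have "\<dots> = 1 / (1 + (Re z)\<^sup>2) * (1 / (1 + (Im z)\<^sup>2))" by simp
    finally show "ennreal (1 / (1 + (cmod z)\<^sup>2)\<^sup>2) \<le> ennreal (1 / (1 + (Re z)\<^sup>2)) * ennreal (1 / (1 + (Im z)\<^sup>2))"
      by (subst ennreal_mult[symmetric]) (auto intro: ennreal_leI)
  qed
  also have "\<dots> = (\<integral>\<^sup>+x. \<integral>\<^sup>+y. ennreal (1 / (1 + x\<^sup>2)) * ennreal (1 / (1 + y\<^sup>2)) \<partial>lborel \<partial>lborel)"
    by (subst nn_integral_complex(1)) auto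
  also have "\<dots> = (\<integral>\<^sup>+x. ennreal (1 / (1 + x\<^sup>2)) \<partial>lborel) * (\<integral>\<^sup>+y. ennreal (1 / (1 + y\<^sup>2)) \<partial>lborel)"
    by (simp add: nn_integral_cmult nn_integral_multc)
  also have "(\<integral>\<^sup>+x. ennreal (1 / (1 + x\<^sup>2)) \<partial>lborel) = ennreal pi"
    using nn_integral_eq_integral[OF integral_inverse_one_plus_sq(1)] integral_inverse_one_plus_sq(2) by simp
  also have "ennreal pi * ennreal pi < \<infinity>" by (simp add: ennreal_mult_less_top)
  finally have 2: "integrable lborel (\<lambda>z::complex. 1 / (1 + (cmod z)\<^sup>2)\<^sup>2)"
    by (intro integrableI_nonneg) auto
  show ?thesis unfolding dom_def[abs_def] by (rule Bochner_Integration.integrable_add[OF 1 2])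
qed

lemma dom_nonneg: "dom z \<ge> 0" by (simp add: dom_def)

lemma dom_bound:
  assumes "z \<in> upper_half_plane \<Longrightarrow> cmod k * Im z * (1 + (cmod z)\<^sup>2) \<le> C" and C: "C \<ge> 0"
  shows "cmod (h0 z * k) \<le> C * dom z"
proof (cases "z \<in> upper_half_plane")
  case True
  then have y: "Im z > 0" by (simp add: upper_half_plane_def)
  define a b where "a = cmod (h0 z) / Im z" and "b = 1 / (1 + (cmod z)\<^sup>2)"
  have p: "1 + (cmod z)\<^sup>2 > 0" by (simp add: add_pos_nonneg)
  have ab: "a \<ge> 0" "b > 0" using y p by (auto simp: a_def b_def)
  have "cmod (h0 z * k) = a * (cmod k * Im z)" using y by (simp add: a_def norm_mult)
  also have "\<dots> \<le> a * (C * b)"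
  proof (rule mult_left_mono[OF _ ab(1)])
    have "cmod k * Im z * (1 + (cmod z)\<^sup>2) \<le> C" using assms(1)[OF True] .
    then show "cmod k * Im z \<le> C * b" using p by (simp add: b_def pos_le_divide_eq)
  qed
  also have "\<dots> = C * (a * b)" by simp
  also have "\<dots> \<le> C * (a\<^sup>2 + b\<^sup>2)"
  proof (rule mult_left_mono[OF _ C])
    have "2 * a * b \<le> a\<^sup>2 + b\<^sup>2" by (rule sum_squares_bound)
    moreover have "0 \<le> a * b" using ab by simp
    ultimately show "a * b \<le> a\<^sup>2 + b\<^sup>2" by simp
  qed
  also have "a\<^sup>2 + b\<^sup>2 = dom z" by (simp add: a_def b_def dom_def power_divide)
  finally show ?thesis .
qed (use C dom_nonneg in \<open>simp add: h0_def\<close>)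

lemma dom_kernel_integrable:
  assumes "\<And>z. z \<in> upper_half_plane \<Longrightarrow> cmod (k z) * Im z * (1 + (cmod z)\<^sup>2) \<le> C" and C: "C \<ge> 0"
    and [measurable]: "k \<in> borel_measurable borel"
  shows "integrable lborel (\<lambda>z. h0 z * k z)"
proof (rule Bochner_Integration.integrable_bound)
  show "integrable lborel (\<lambda>z. C * dom z)" using dom_integrable by simp
  show "AE z in lborel. norm (h0 z * k z) \<le> norm (C * dom z)"
  proof (rule AE_I2)
    fix z show "norm (h0 z * k z) \<le> norm (C * dom z)"
      using dom_bound[OF assms(1) C, of z] by (simp del: norm_mult)
  qed
qed measurable

end

context extension
begin

text \<open>Continuity of \<open>F\<close> up to the axis lets the compact set \<open>K\<close> be
  intersected with the closed half-plane, so nothing is lost near the axis.\<close>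

lemma boundary_weighted_integrable:
  fixes \<psi> :: "complex \<Rightarrow> complex"
  assumes c: "continuous_on UNIV \<psi>" and K: "compact K" "\<And>z. z \<notin> K \<Longrightarrow> \<psi> z = 0"
  shows "integrable lborel (\<lambda>z. indicator upper_half_plane z *\<^sub>R (F z * \<psi> z))"
    and "\<exists>M. \<forall>z\<in>closed_upper_half_plane. cmod (F z * \<psi> z) \<le> M"
proof -
  have clo: "closed closed_upper_half_plane" unfolding closed_upper_half_plane_def by (rule closed_halfspace_Im_ge)
  have comp: "compact (closed_upper_half_plane \<inter> K)" using clo K(1) by (rule closed_Int_compact)
  have cont: "continuous_on (closed_upper_half_plane \<inter> K) (\<lambda>z. F z * \<psi> z)"
    by (intro continuous_on_mult continuous_on_subset[OF Fc] continuous_on_subset[OF c]) auto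
  have "integrable lborel (\<lambda>z. indicator (closed_upper_half_plane \<inter> K) z *\<^sub>R (F z * \<psi> z))"
    by (rule borel_integrable_compact[OF comp cont])
  then have "set_integrable lborel (closed_upper_half_plane \<inter> K) (\<lambda>z. F z * \<psi> z)" by (simp add: set_integrable_def)
  then have "set_integrable lborel (upper_half_plane \<inter> K) (\<lambda>z. F z * \<psi> z)"
  proof (rule set_integrable_subset)
    show "upper_half_plane \<inter> K \<in> sets lborel" using open_upper_half_plane K(1) by (auto intro: borel_compact)
  qed (auto simp: upper_half_plane_def closed_upper_half_plane_def)
  moreover have "(\<lambda>z. indicator (upper_half_plane \<inter> K) z *\<^sub>R (F z * \<psi> z)) = (\<lambda>z. indicator upper_half_plane z *\<^sub>R (F z * \<psi> z))"
    using K(2) by (auto simp: fun_eq_iff indicator_def)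
  ultimately show "integrable lborel (\<lambda>z. indicator upper_half_plane z *\<^sub>R (F z * \<psi> z))"
    by (simp add: set_integrable_def)
  have "bounded ((\<lambda>z. F z * \<psi> z) ` (closed_upper_half_plane \<inter> K))"
    by (intro compact_imp_bounded compact_continuous_image cont comp)
  then obtain M where M: "\<And>z. z \<in> closed_upper_half_plane \<inter> K \<Longrightarrow> cmod (F z * \<psi> z) \<le> M"
    unfolding bounded_iff by auto
  have "cmod (F z * \<psi> z) \<le> \<bar>M\<bar>" if "z \<in> closed_upper_half_plane" for z
    using M[of z] K(2)[of z] that by (cases "z \<in> K") force+
  then show "\<exists>M. \<forall>z\<in>closed_upper_half_plane. cmod (F z * \<psi> z) \<le> M" by blast
qed

end

section \<open>Cutoffs and the boundary integral\<close>

lemma dist_lower_ge: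
  assumes "Im z \<ge> 0" "y \<ge> 0"
  shows "cmod (z - of_real x) \<le> cmod (z - Complex x (- y))" "y \<le> cmod (z - Complex x (- y))"
    "Im z \<le> cmod (z - Complex x (- y))"
proof -
  have "(Im z)\<^sup>2 \<le> (Im z + y)\<^sup>2" using assms by (intro power_mono) auto
  then show "cmod (z - of_real x) \<le> cmod (z - Complex x (- y))"
    unfolding cmod_def by (intro real_sqrt_le_mono) simp
  have "\<bar>Im (z - Complex x (- y))\<bar> \<le> cmod (z - Complex x (- y))" by (rule abs_Im_le_cmod)
  then show "y \<le> cmod (z - Complex x (- y))" "Im z \<le> cmod (z - Complex x (- y))" using assms by auto
qed

text \<open>The cutoff is real, so its product with \<open>f\<close> stays real on the axis and an
  imaginary part can be taken there. Being in \<open>plane_alg\<close>, it can be multiplied with a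
  switched-off Cauchy kernel to give a test function.\<close>

locale cutoff = extension +
  fixes \<kappa> :: "complex \<Rightarrow> real" and r :: real
  assumes \<kappa>: "plane_alg (\<lambda>z. of_real (\<kappa> z))"
    and r0: "r > 0" and supp: "\<And>z. \<bar>Re z\<bar> > r \<or> \<bar>Im z\<bar> > r \<Longrightarrow> \<kappa> z = 0"
    and fc: "continuous_on UNIV f"
begin

abbreviation "X \<equiv> (\<lambda>z. of_real (\<kappa> z) :: complex)"
definition "K = cbox (Complex (-r) (-r)) (Complex r r)"

lemma K_iff: "z \<in> K \<longleftrightarrow> \<bar>Re z\<bar> \<le> r \<and> \<bar>Im z\<bar> \<le> r"
  by (auto simp: K_def cbox_def Basis_complex_def inner_complex_def)

lemma compact_K: "compact K" by (simp add: K_def)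

lemma smooth_X: "smooth_c X" by (rule plane_alg_smooth[OF \<kappa>])

lemma X_zero: "z \<notin> K \<Longrightarrow> X z = 0" using supp[of z] by (auto simp: K_iff not_le)

lemma closure_X: "closure {z. X z \<noteq> 0} \<subseteq> K"
  by (rule closure_minimal) (use X_zero in \<open>auto simp: compact_imp_closed compact_K\<close>)

lemma dbar_X_zero: assumes "z \<notin> K" shows "dbar X z = 0"
proof -
  have "z \<notin> closure {z. X z \<noteq> 0}" using assms closure_X by blast
  from dbar_zero_outside(1,2)[OF this] show ?thesis by (simp add: dbar_def)
qed

lemma continuous_X: "continuous_on UNIV X" by (rule smooth_cD(1)[OF smooth_X])

lemma continuous_dbar_X: "continuous_on UNIV (dbar X)"
  unfolding dbar_def[abs_def] using smooth_cD(4,5)[OF smooth_X] by (intro continuous_intros) auto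

lemma X_measurable [measurable]: "X \<in> borel_measurable borel" "dbar X \<in> borel_measurable borel"
  by (intro borel_measurable_continuous_onI continuous_X continuous_dbar_X)+

lemma X_bounded: "\<exists>B\<ge>0. \<forall>z. cmod (X z) * (1 + (cmod z)\<^sup>2) \<le> B"
proof -
  have "continuous_on K (\<lambda>z. cmod (X z) * (1 + (cmod z)\<^sup>2))"
    by (intro continuous_intros continuous_on_subset[OF continuous_X]) auto
  then have "bounded ((\<lambda>z. cmod (X z) * (1 + (cmod z)\<^sup>2)) ` K)"
    by (intro compact_imp_bounded compact_continuous_image compact_K)
  then obtain B where B: "\<And>z. z \<in> K \<Longrightarrow> \<bar>cmod (X z) * (1 + (cmod z)\<^sup>2)\<bar> \<le> B"
    unfolding bounded_iff by auto
  have "cmod (X z) * (1 + (cmod z)\<^sup>2) \<le> \<bar>B\<bar>" for z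
  proof (cases "z \<in> K")
    case True then show ?thesis using B[OF True] by linarith
  next
    case False then show ?thesis using X_zero[OF False] by simp
  qed
  then show ?thesis by (intro exI[of _ "\<bar>B\<bar>"]) simp
qed

text \<open>The compact support of the cutoff supplies all decay at infinity, so only
  \<open>cmod (k z) * Im z\<close> must stay bounded. A simple pole on the axis is allowed.\<close>

lemma h0_X_integrable:
  assumes k: "k \<in> borel_measurable borel" "\<And>z. z \<in> upper_half_plane \<Longrightarrow> cmod (k z) * Im z \<le> C" "C \<ge> 0"
  shows "integrable lborel (\<lambda>z. h0 z * (X z * k z))"
proof -
  obtain B where B: "B \<ge> 0" "\<And>z. cmod (X z) * (1 + (cmod z)\<^sup>2) \<le> B" using X_bounded by blast
  show ?thesis
  proof (rule dom_kernel_integrable[where C="B * C"])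
    fix z assume z: "z \<in> upper_half_plane"
    have "cmod (X z * k z) * Im z * (1 + (cmod z)\<^sup>2) = (cmod (X z) * (1 + (cmod z)\<^sup>2)) * (cmod (k z) * Im z)"
      by (simp add: norm_mult mult_ac)
    also have "\<dots> \<le> B * C"
      by (intro mult_mono B k z mult_nonneg_nonneg) (use z in \<open>auto simp: upper_half_plane_def\<close>)
    finally show "cmod (X z * k z) * Im z * (1 + (cmod z)\<^sup>2) \<le> B * C" .
  qed (use B k in auto)
qed

text \<open>The factor \<open>\<sigma> (Im z / d n - 1) / d n\<close> lives in the layer between the
  heights \<open>d n\<close> and \<open>2 * d n\<close> and has mass 1 in the vertical variable. The
  layer integral is therefore a weighted average of the line integrals \<open>I y\<close>, and these
  are continuous down to the axis because the pole is strictly below.\<close>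

lemma boundary_limit:
  fixes \<zeta> :: complex
  assumes \<zeta>: "Im \<zeta> < 0" and \<sigma>: "continuous_on UNIV \<sigma>" "\<And>t. t \<notin> {0..1} \<Longrightarrow> \<sigma> t = (0::real)" "(LINT t|lborel. \<sigma> t) = 1"
    and d: "d \<longlonglongrightarrow> 0" "\<And>n. d n > (0::real)"
  shows "(\<lambda>n. LINT z|lborel. indicator upper_half_plane z *\<^sub>R (F z * X z * (of_real (\<sigma> (Im z / d n - 1) / d n) / (z - \<zeta>))))
     \<longlonglongrightarrow> (LINT t|lborel. of_real (f t * \<kappa> (of_real t)) / (of_real t - \<zeta>))"
proof -
  define G where "G z = indicator closed_upper_half_plane z *\<^sub>R (F z * X z / (z - \<zeta>))" for z
  have cloG: "continuous_on closed_upper_half_plane (\<lambda>z. F z * X z / (z - \<zeta>))"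
    using \<zeta> by (intro continuous_on_divide continuous_on_mult Fc continuous_on_subset[OF continuous_X] continuous_intros)
       (auto simp: closed_upper_half_plane_def)
  have clo: "closed closed_upper_half_plane" unfolding closed_upper_half_plane_def by (rule closed_halfspace_Im_ge)
  have Gm [measurable]: "G \<in> borel_measurable borel"
    unfolding G_def[abs_def] using clo by (intro borel_measurable_continuous_on_indicator cloG) auto
  obtain M0 where M0: "\<forall>z\<in>closed_upper_half_plane. cmod (F z * X z) \<le> M0"
    using boundary_weighted_integrable(2)[OF continuous_X compact_K X_zero] by blast
  define M where "M = M0 / (- Im \<zeta>)"
  have M00: "0 \<le> M0" using M0[rule_format, of 0] by (auto simp: closed_upper_half_plane_def intro: order_trans[OF norm_ge_zero])
  have dist: "- Im \<zeta> \<le> cmod (z - \<zeta>)" if "Im z \<ge> 0" for z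
    using abs_Im_le_cmod[of "z - \<zeta>"] that by simp
  have GM: "cmod (G z) \<le> M * indicator {-r..r} (Re z)" for z
  proof (cases "z \<in> closed_upper_half_plane \<and> z \<in> K")
    case True
    then have "Im z \<ge> 0" by (simp add: closed_upper_half_plane_def)
    have "cmod (G z) = cmod (F z * X z) / cmod (z - \<zeta>)" using True by (simp add: G_def norm_divide norm_mult)
    also have "\<dots> \<le> M" unfolding M_def
      using True M0 dist[OF \<open>Im z \<ge> 0\<close>] \<zeta> M00 by (intro frac_le) auto
    finally show ?thesis using True by (auto simp: K_iff indicator_def abs_le_iff)
  next
    case False
    then have "G z = 0" using X_zero[of z] by (auto simp: G_def)
    moreover have "0 \<le> M" using M00 \<zeta> by (simp add: M_def divide_nonneg_neg)
    ultimately show ?thesis by simp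
  qed
  have indi: "integrable lborel (\<lambda>x. M * indicator {-r..r} (x::real))"
    using borel_integrable_compact[of "{-r..r}" "\<lambda>_. 1::real"] by simp
  define I where "I y = (LINT x|lborel. G (Complex x y))" for y
  have Im [measurable]: "I \<in> borel_measurable borel" unfolding I_def[abs_def] by measurable
  have Gi: "integrable lborel (\<lambda>x. G (Complex x y))" for y
  proof (rule Bochner_Integration.integrable_bound[OF indi])
    show "AE x in lborel. norm (G (Complex x y)) \<le> norm (M * indicator {-r..r} x)"
    proof (rule AE_I2)
      fix x show "norm (G (Complex x y)) \<le> norm (M * indicator {-r..r} x)"
        using GM[of "Complex x y"] by (simp del: norm_mult)
    qed
  qed measurable
  have IM: "cmod (I y) \<le> \<bar>2 * M * r\<bar>" for y
  proof -
    have "cmod (I y) \<le> (LINT x|lborel. cmod (G (Complex x y)))" unfolding I_def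
      by (rule Bochner_Integration.integral_norm_bound)
    also have "\<dots> \<le> (LINT x|lborel. M * indicator {-r..r} x)"
    proof (rule integral_mono)
      show "integrable lborel (\<lambda>x. cmod (G (Complex x y)))" using Gi by (rule integrable_norm)
      show "cmod (G (Complex x y)) \<le> M * indicator {-r..r} x" for x using GM[of "Complex x y"] by simp
    qed (rule indi)
    also have "\<dots> = 2 * M * r" using r0 by simp
    finally show ?thesis by simp
  qed
  have Ilim: "(\<lambda>n. I (d n * (1 + s))) \<longlonglongrightarrow> I 0" if s: "s \<ge> 0" for s
    unfolding I_def
  proof (rule integral_dominated_convergence[OF _ _ indi])
    show "AE x in lborel. norm (G (Complex x (d n * (1 + s)))) \<le> M * indicator {-r..r} x" for n
      using GM[of "Complex _ (d n * (1 + s))"] by (intro AE_I2) simp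
    show "AE x in lborel. (\<lambda>n. G (Complex x (d n * (1 + s)))) \<longlonglongrightarrow> G (Complex x 0)"
    proof (rule AE_I2)
      fix x
      have "(\<lambda>n. Complex x (d n * (1 + s))) \<longlonglongrightarrow> Complex x (0 * (1 + s))"
        by (intro tendsto_Complex tendsto_intros d)
      moreover have ev: "\<forall>\<^sub>F n in sequentially. Complex x (d n * (1 + s)) \<in> closed_upper_half_plane"
        using d(2) s by (intro always_eventually) (simp add: closed_upper_half_plane_def less_imp_le)
      ultimately have "(\<lambda>n. F (Complex x (d n * (1 + s))) * X (Complex x (d n * (1 + s))) / (Complex x (d n * (1 + s)) - \<zeta>))
         \<longlonglongrightarrow> F (Complex x 0) * X (Complex x 0) / (Complex x 0 - \<zeta>)"
        by (intro continuous_on_tendsto_compose[OF cloG]) (simp_all add: closed_upper_half_plane_def)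
      moreover have "G (Complex x (d n * (1 + s))) = F (Complex x (d n * (1 + s))) * X (Complex x (d n * (1 + s))) / (Complex x (d n * (1 + s)) - \<zeta>)" for n
        using d(2)[of n] s by (simp add: G_def closed_upper_half_plane_def)
      ultimately show "(\<lambda>n. G (Complex x (d n * (1 + s)))) \<longlonglongrightarrow> G (Complex x 0)"
        by (simp add: G_def closed_upper_half_plane_def)
    qed
  qed measurable
  have \<sigma>m [measurable]: "\<sigma> \<in> borel_measurable borel" by (rule borel_measurable_continuous_onI[OF \<sigma>(1)])
  have \<sigma>i: "integrable lborel \<sigma>"
    by (rule integrable_cont_compact[OF \<sigma>(1), of "{0..1}"]) (use \<sigma>(2) in auto)
  then have \<sigma>ic: "integrable lborel (\<lambda>s. complex_of_real (\<sigma> s))" by simp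
  have eq: "(LINT z|lborel. indicator upper_half_plane z *\<^sub>R (F z * X z * (of_real (\<sigma> (Im z / d n - 1) / d n) / (z - \<zeta>))))
    = (LINT s|lborel. of_real (\<sigma> s) * I (d n * (1 + s)))" for n
  proof -
    \<comment> \<open>The layer lies above the axis, so the open and the closed half-plane give the
      same integrand.\<close>
    have zero: "\<sigma> (y / d n - 1) = 0" if "y \<le> 0" for y
    proof (rule \<sigma>(2))
      have "y / d n \<le> 0" using that d(2)[of n] by (simp add: divide_nonpos_pos)
      then show "y / d n - 1 \<notin> {0..1}" by auto
    qed
    define Y where "Y z = G z * of_real (\<sigma> (Im z / d n - 1) / d n)" for z
    have "indicator upper_half_plane z *\<^sub>R (F z * X z * (of_real (\<sigma> (Im z / d n - 1) / d n) / (z - \<zeta>))) = Y z" for z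
    proof (cases "Im z > 0")
      case True
      then show ?thesis by (simp add: Y_def G_def upper_half_plane_def closed_upper_half_plane_def)
    next
      case False
      then show ?thesis using zero[of "Im z"] by (simp add: Y_def upper_half_plane_def)
    qed
    then have "(LINT z|lborel. indicator upper_half_plane z *\<^sub>R (F z * X z * (of_real (\<sigma> (Im z / d n - 1) / d n) / (z - \<zeta>)))) = integral\<^sup>L lborel Y"
      by simp
    also have "\<dots> = (LINT y|lborel. LINT x|lborel. Y (Complex x y))"
    proof (rule integral_complex(2))
      have cont: "continuous_on UNIV (\<lambda>z. \<sigma> (Im z / d n - 1) / d n)"
          by (intro continuous_on_divide continuous_on_compose2[OF \<sigma>(1)] continuous_intros) (use d(2)[of n] in auto)
        then have "bounded ((\<lambda>z. \<sigma> (Im z / d n - 1) / d n) ` K)"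
          by (intro compact_imp_bounded compact_continuous_image compact_K continuous_on_subset[OF cont]) auto
        then obtain B where B: "\<And>z. z \<in> K \<Longrightarrow> \<bar>\<sigma> (Im z / d n - 1) / d n\<bar> \<le> B" unfolding bounded_iff by auto
      show "integrable lborel Y"
      proof (rule Bochner_Integration.integrable_bound)
        show "integrable lborel (\<lambda>z. indicator K z *\<^sub>R (M * B))"
          by (rule borel_integrable_compact[OF compact_K]) simp
        show "AE z in lborel. norm (Y z) \<le> norm (indicator K z *\<^sub>R (M * B))"
        proof (rule AE_I2)
          fix z show "norm (Y z) \<le> norm (indicator K z *\<^sub>R (M * B))"
          proof (cases "z \<in> K")
            case True
            have "norm (Y z) = cmod (G z) * \<bar>\<sigma> (Im z / d n - 1) / d n\<bar>" unfolding Y_def norm_mult norm_of_real ..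
            also have "\<dots> \<le> M * B"
            proof (rule mult_mono)
              show "cmod (G z) \<le> M"
              proof -
                have "Re z \<in> {-r..r}" using True by (simp add: K_iff abs_le_iff)
                then show ?thesis using GM[of z] by simp
              qed
              show "0 \<le> M" using M00 \<zeta> by (simp add: M_def divide_nonneg_neg)
            qed (use B[OF True] in auto)
            finally show ?thesis using True by (simp del: norm_mult)
          next
            case False
            then show ?thesis using X_zero[OF False] by (simp add: Y_def G_def)
          qed
        qed
        show "Y \<in> borel_measurable lborel" unfolding Y_def[abs_def] by measurable
      qed
    qed
    also have "\<dots> = (LINT y|lborel. of_real (\<sigma> (y / d n - 1) / d n) * I y)"
      unfolding I_def Y_def by (simp add: mult.commute)
    \<comment> \<open>The substitution \<open>y = d n + d n * s\<close> maps the layer to the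
      support of \<sigma>.\<close>
    also have "\<dots> = \<bar>d n\<bar> *\<^sub>R (LINT s|lborel. of_real (\<sigma> ((d n + d n * s) / d n - 1) / d n) * I (d n + d n * s))"
      by (rule lborel_integral_real_affine) (use d(2)[of n] in simp)
    also have "\<dots> = (LINT s|lborel. \<bar>d n\<bar> *\<^sub>R (of_real (\<sigma> ((d n + d n * s) / d n - 1) / d n) * I (d n + d n * s)))"
      by (rule integral_scaleR_right[symmetric])
    also have "\<dots> = (LINT s|lborel. of_real (\<sigma> s) * I (d n * (1 + s)))"
    proof (intro Bochner_Integration.integral_cong refl)
      fix s
      have "(d n + d n * s) / d n - 1 = s" "d n + d n * s = d n * (1 + s)" using d(2)[of n] by (simp_all add: field_simps)
      then show "\<bar>d n\<bar> *\<^sub>R (of_real (\<sigma> ((d n + d n * s) / d n - 1) / d n) * I (d n + d n * s)) = of_real (\<sigma> s) * I (d n * (1 + s))"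
        using d(2)[of n] by (simp add: scaleR_conv_of_real)
    qed
    finally show ?thesis .
  qed
  have "(\<lambda>n. LINT s|lborel. complex_of_real (\<sigma> s) * I (d n * (1 + s))) \<longlonglongrightarrow> (LINT s|lborel. complex_of_real (\<sigma> s) * I 0)"
  proof (rule bounded_mult_limit[OF \<sigma>ic])
    show "norm (I (d n * (1 + s))) \<le> \<bar>2 * M * r\<bar>" for n s by (rule IM)
    fix s assume "complex_of_real (\<sigma> s) \<noteq> 0"
    then have "s \<ge> 0" using \<sigma>(2)[of s] by (cases "s \<in> {0..1}") auto
    then show "(\<lambda>n. I (d n * (1 + s))) \<longlonglongrightarrow> I 0" by (rule Ilim)
  qed measurable
  also have "(LINT s|lborel. complex_of_real (\<sigma> s) * I 0) = I 0"
    by (subst integral_mult_left_zero) (simp add: \<sigma>(3))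
  also have "I 0 = (LINT t|lborel. of_real (f t * \<kappa> (of_real t)) / (of_real t - \<zeta>))"
    unfolding I_def
  proof (intro Bochner_Integration.integral_cong refl)
    fix t :: real
    have "Complex t 0 = of_real t" by (simp add: complex_of_real_def)
    then show "G (Complex t 0) = of_real (f t * \<kappa> (of_real t)) / (of_real t - \<zeta>)"
      by (simp add: G_def closed_upper_half_plane_def Fr)
  qed
  finally show ?thesis unfolding eq .
qed

end

lemma solve_half_i:
  fixes a b J :: complex
  assumes "a + \<i> / 2 * J = - b"
  shows "J = 2 * \<i> * (a + b)"
proof -
  have "\<i> / 2 * J = (a + \<i> / 2 * J) - a" by simp
  also have "\<dots> = - (a + b)" unfolding assms by simp
  finally have e: "\<i> / 2 * J = - (a + b)" .
  have "J = - (2 * \<i>) * (\<i> / 2 * J)" by simp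
  also have "\<dots> = 2 * \<i> * (a + b)" unfolding e by (simp add: algebra_simps)
  finally show ?thesis .
qed

context cutoff
begin

text \<open>The test function is the cutoff times a vertical step times the Cauchy kernel with pole
  below the axis. Its d-bar derivative has one term from the cutoff and one from the step; as the
  step sharpens, the second turns into the boundary integral.\<close>

lemma cauchy_below:
  fixes x y :: real
  assumes y: "y > 0"
  defines "\<zeta> \<equiv> Complex x (- y)"
  shows "(LINT t|lborel. of_real (f t * \<kappa> (of_real t)) / (of_real t - \<zeta>)) =
    2 * \<i> * ((LINT z|lborel. indicator upper_half_plane z *\<^sub>R (F z * dbar X z) * (1 / (z - \<zeta>)))
        + (LINT z|lborel. h0 z * (X z * (1 / (z - \<zeta>)))))"
proof -
  obtain S \<sigma> :: "real \<Rightarrow> real" where S: "smooth_real S" "smooth_real \<sigma>" "\<And>t. (S has_real_derivative \<sigma> t) (at t)"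
    "\<And>t. t \<le> 0 \<Longrightarrow> S t = 0" "\<And>t. t \<ge> 1 \<Longrightarrow> S t = 1" "\<And>t. 0 \<le> S t" "\<And>t. S t \<le> 1"
    and \<sigma>: "\<And>t. t \<notin> {0..1} \<Longrightarrow> \<sigma> t = 0" "continuous_on UNIV \<sigma>" "(LINT t|lborel. \<sigma> t) = 1"
    using smooth_step_exists by blast
  have Sm [measurable]: "S \<in> borel_measurable borel"
    by (intro borel_measurable_continuous_onI continuous_at_imp_continuous_on ballI DERIV_isCont[OF S(3)])
  have \<sigma>m [measurable]: "\<sigma> \<in> borel_measurable borel" by (rule borel_measurable_continuous_onI[OF \<sigma>(2)])
  have \<zeta>: "Im \<zeta> < 0" using y by (simp add: \<zeta>_def)
  define d where "d n = 1 / (real n + 1)" for n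
  have d: "d n > 0" for n by (simp add: d_def)
  have dlim: "d \<longlonglongrightarrow> 0" unfolding d_def using lim_inverse_n' LIMSEQ_inverse_real_of_nat by (simp add: inverse_eq_divide add.commute)
  define s where "s n z = complex_of_real (S (Im z / d n - 1))" for n z
  have sm [measurable]: "s n \<in> borel_measurable borel" for n unfolding s_def[abs_def] by measurable
  have s1: "norm (s n z) \<le> 1" for n z using S(6,7) by (simp add: s_def)
  have slim: "(\<lambda>n. s n z) \<longlonglongrightarrow> 1" if "z \<in> upper_half_plane" for z
  proof -
    have z: "Im z > 0" using that by (simp add: upper_half_plane_def)
    have "\<forall>\<^sub>F n in sequentially. d n < Im z / 2" using order_tendstoD(2)[OF dlim, of "Im z / 2"] z by simp
    then have "\<forall>\<^sub>F n in sequentially. s n z = 1"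
    proof eventually_elim
      case (elim n)
      then have "Im z / d n - 1 \<ge> 1" using d[of n] by (simp add: pos_le_divide_eq)
      then show ?case using S(5) by (simp add: s_def)
    qed
    then show ?thesis by (rule tendsto_eventually)
  qed
  have nz: "z \<noteq> \<zeta>" if "z \<in> upper_half_plane" for z using that \<zeta> by (auto simp: upper_half_plane_def)
  \<comment> \<open>\<open>A\<close> and \<open>B\<close> are the limit integrands, with the step
    replaced by 1. The actual integrands are these times \<open>s n\<close>, which is bounded by
    1.\<close>
  define A where "A z = indicator upper_half_plane z *\<^sub>R (F z * dbar X z) * (1 / (z - \<zeta>))" for z
  define B where "B z = h0 z * (X z * (1 / (z - \<zeta>)))" for z
  have low: "y \<le> cmod (z - \<zeta>)" "Im z \<le> cmod (z - \<zeta>)" if "z \<in> upper_half_plane" for z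
    using dist_lower_ge(2,3)[of z y x] that y by (auto simp: upper_half_plane_def \<zeta>_def)
  have FXi: "integrable lborel (\<lambda>z. indicator upper_half_plane z *\<^sub>R (F z * dbar X z))"
    by (rule boundary_weighted_integrable(1)[OF continuous_dbar_X compact_K dbar_X_zero])
  have Ai: "integrable lborel A"
  proof (rule Bochner_Integration.integrable_bound)
    show "integrable lborel (\<lambda>z. indicator upper_half_plane z *\<^sub>R (F z * dbar X z) * of_real (1 / y))"
      using FXi by (rule integrable_mult_left)
    have [measurable]: "(\<lambda>z. indicator upper_half_plane z *\<^sub>R (F z * dbar X z)) \<in> borel_measurable borel" using FXi by auto
    show "A \<in> borel_measurable lborel" unfolding A_def[abs_def] by measurable
    show "AE z in lborel. norm (A z) \<le> norm (indicator upper_half_plane z *\<^sub>R (F z * dbar X z) * complex_of_real (1 / y))"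
    proof (rule AE_I2)
      fix z show "norm (A z) \<le> norm (indicator upper_half_plane z *\<^sub>R (F z * dbar X z) * complex_of_real (1 / y))"
      proof (cases "z \<in> upper_half_plane")
        case True
        have "cmod (1 / (z - \<zeta>)) \<le> 1 / y" using low(1)[OF True] y by (simp add: norm_divide frac_le)
        then have "cmod (indicator upper_half_plane z *\<^sub>R (F z * dbar X z)) * cmod (1 / (z - \<zeta>)) \<le> cmod (indicator upper_half_plane z *\<^sub>R (F z * dbar X z)) * (1 / y)"
          by (intro mult_left_mono) auto
        moreover have "cmod (complex_of_real (1 / y)) = 1 / y" using y by (simp add: norm_divide)
        ultimately show ?thesis unfolding A_def norm_mult[of _ "1 / (z - \<zeta>)"] norm_mult[of _ "of_real (1 / y)"] by (simp only:)
      qed (simp add: A_def)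
    qed
  qed
  have Bi: "integrable lborel B" unfolding B_def
  proof (rule h0_X_integrable[where C=1])
    fix z assume z: "z \<in> upper_half_plane"
    then have "0 < cmod (z - \<zeta>)" using nz by simp
    then show "cmod (1 / (z - \<zeta>)) * Im z \<le> 1" using low(2)[OF z] by (simp add: norm_divide divide_le_eq)
  qed auto
  have T1: "(\<lambda>n. LINT z|lborel. A z * s n z) \<longlonglongrightarrow> (LINT z|lborel. A z * 1)"
  proof (rule bounded_mult_limit[OF Ai _ _ s1])
    fix z assume "A z \<noteq> 0"
    then show "(\<lambda>n. s n z) \<longlonglongrightarrow> 1" by (intro slim) (auto simp: A_def indicator_def split: if_splits)
  qed auto
  have T3: "(\<lambda>n. LINT z|lborel. B z * s n z) \<longlonglongrightarrow> (LINT z|lborel. B z * 1)"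
  proof (rule bounded_mult_limit[OF Bi _ _ s1])
    fix z assume "B z \<noteq> 0"
    then show "(\<lambda>n. s n z) \<longlonglongrightarrow> 1" by (intro slim) (auto simp: B_def h0_def split: if_splits)
  qed auto
  define E where "E n = (\<lambda>z. indicator upper_half_plane z *\<^sub>R (F z * X z * (of_real (\<sigma> (Im z / d n - 1) / d n) / (z - \<zeta>))))" for n
  have T2: "(\<lambda>n. integral\<^sup>L lborel (E n)) \<longlonglongrightarrow> (LINT t|lborel. of_real (f t * \<kappa> (of_real t)) / (of_real t - \<zeta>))"
    unfolding E_def
  proof (rule boundary_limit[where \<sigma>=\<sigma> and d=d and \<zeta>=\<zeta>])
    show "Im \<zeta> < 0" "continuous_on UNIV \<sigma>" "(LINT t|lborel. \<sigma> t) = 1" "d \<longlonglongrightarrow> 0" by fact+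
    show "\<sigma> t = 0" if "t \<notin> {0..1}" for t using \<sigma>(1)[OF that] .
    show "0 < d n" for n by (rule d)
  qed
  have id: "(LINT z|lborel. A z * s n z) + \<i> / 2 * integral\<^sup>L lborel (E n) = - (LINT z|lborel. B z * s n z)" for n
  proof -
    \<comment> \<open>This step is 0 below height \<open>d n\<close> and 1 from height
      \<open>2 * d n\<close> on.\<close>
    define \<beta> where "\<beta> t = S (t / d n - 1)" for t
    have \<beta>: "smooth_real \<beta>"
    proof -
      have "smooth_real (\<lambda>t. 1 * S (1 / d n * t + - 1))" by (rule smooth_real_affine[OF S(1)])
      moreover have "(\<lambda>t. 1 * S (1 / d n * t + - 1)) = \<beta>" by (simp add: \<beta>_def fun_eq_iff)
      ultimately show ?thesis by simp
    qed
    have \<beta>0: "\<beta> t = 0" if "t < d n" for t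
    proof -
      have "t / d n \<le> 1" using that d[of n] by (simp add: pos_divide_le_eq)
      then show ?thesis by (simp add: \<beta>_def S(4))
    qed
    have \<beta>': "(\<beta> has_real_derivative \<sigma> (t / d n - 1) / d n) (at t)" for t
    proof -
      have "((\<lambda>t. S (t / d n - 1)) has_real_derivative \<sigma> (t / d n - 1) * (1 / d n)) (at t)"
        by (rule DERIV_chain2[OF S(3)]) (use d[of n] in \<open>auto intro!: derivative_eq_intros\<close>)
      then show ?thesis by (simp add: \<beta>_def[abs_def])
    qed
    define W where "W z = of_real (\<beta> (Im z)) * (1 / (z - \<zeta>))" for z
    have Wa: "plane_alg W"
      using plane_alg.pole[OF \<beta> \<beta>0, where \<zeta>=\<zeta> and m=1] \<zeta> d[of n] by (simp add: W_def[abs_def])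
    define \<phi> where "\<phi> z = X z * W z" for z
    have \<phi>a: "plane_alg \<phi>" unfolding \<phi>_def[abs_def] by (rule plane_alg.mult[OF \<kappa> Wa])
    have \<phi>0: "\<phi> z = 0" if "z \<notin> K \<inter> {z. d n \<le> Im z}" for z
      using that X_zero[of z] \<beta>0[of "Im z"] by (auto simp: \<phi>_def W_def)
    have cl: "closure {z. \<phi> z \<noteq> 0} \<subseteq> K \<inter> {z. d n \<le> Im z}"
    proof (rule closure_minimal)
      show "closed (K \<inter> {z. d n \<le> Im z})"
        by (intro closed_Int compact_imp_closed compact_K closed_halfspace_Im_ge)
    qed (use \<phi>0 in blast)
    have tf: "test_function upper_half_plane \<phi>" unfolding test_function_def
    proof (intro conjI)
      show "smooth_c \<phi>" by (rule plane_alg_smooth[OF \<phi>a])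
      have "compact (K \<inter> {z. d n \<le> Im z})" by (intro compact_Int_closed compact_K closed_halfspace_Im_ge)
      then have "compact (closure {z. \<phi> z \<noteq> 0} \<inter> (K \<inter> {z. d n \<le> Im z}))" by (rule closed_Int_compact[OF closed_closure])
      moreover have "closure {z. \<phi> z \<noteq> 0} \<inter> (K \<inter> {z. d n \<le> Im z}) = closure {z. \<phi> z \<noteq> 0}" using cl by blast
      ultimately show "compact (closure {z. \<phi> z \<noteq> 0})" by simp
      have "z \<in> upper_half_plane" if "z \<in> K \<inter> {z. d n \<le> Im z}" for z
        using that d[of n] by (simp add: upper_half_plane_def)
      then show "closure {z. \<phi> z \<noteq> 0} \<subseteq> upper_half_plane" using cl by blast
    qed
    have db: "dbar \<phi> z = dbar X z * (s n z * (1 / (z - \<zeta>))) + X z * (\<i> / 2 * of_real (\<sigma> (Im z / d n - 1) / d n) / (z - \<zeta>))"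
      if "z \<in> upper_half_plane" for z
      unfolding \<phi>_def[abs_def] dbar_mult[OF smooth_X plane_alg_smooth[OF Wa]]
      using dbar_pole[OF \<beta>' nz[OF that]] by (simp add: W_def[abs_def] s_def \<beta>_def)
    have l: "(LINT z:upper_half_plane|lborel. F z * dbar \<phi> z) = (LINT z|lborel. A z * s n z + \<i> / 2 * E n z)"
      unfolding set_lebesgue_integral_def
    proof (intro Bochner_Integration.integral_cong refl)
      fix z show "indicator upper_half_plane z *\<^sub>R (F z * dbar \<phi> z) = A z * s n z + \<i> / 2 * E n z"
      proof (cases "z \<in> upper_half_plane")
        case True
        show ?thesis unfolding db[OF True] using True by (simp add: A_def E_def algebra_simps)
      qed (simp add: A_def E_def)
    qed
    have rr: "(LINT z:upper_half_plane|lborel. h z * \<phi> z) = (LINT z|lborel. B z * s n z)"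
      unfolding set_lebesgue_integral_def
      by (intro Bochner_Integration.integral_cong refl) (auto simp: B_def \<phi>_def W_def s_def \<beta>_def h0_def indicator_def)
    have iA: "integrable lborel (\<lambda>z. A z * s n z)"
    proof (rule Bochner_Integration.integrable_bound[OF Ai])
      show "(\<lambda>z. A z * s n z) \<in> borel_measurable lborel" using Ai by measurable
      show "AE z in lborel. norm (A z * s n z) \<le> norm (A z)"
        using s1 by (intro AE_I2) (simp add: norm_mult mult_left_le)
    qed
    have iAE: "integrable lborel (\<lambda>z. A z * s n z + \<i> / 2 * E n z)"
    proof -
      have "integrable lborel (\<lambda>z. indicator upper_half_plane z *\<^sub>R (F z * dbar \<phi> z))"
      proof (rule boundary_weighted_integrable(1))
        show "continuous_on UNIV (dbar \<phi>)"
          unfolding dbar_def[abs_def] using smooth_cD(4,5)[OF plane_alg_smooth[OF \<phi>a]] by (intro continuous_intros) auto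
        show "compact K" by (rule compact_K)
        fix z assume "z \<notin> K"
        then have "z \<notin> closure {z. \<phi> z \<noteq> 0}" using cl by blast
        from dbar_zero_outside(1,2)[OF this] show "dbar \<phi> z = 0" by (simp add: dbar_def)
      qed
      moreover have "(\<lambda>z. indicator upper_half_plane z *\<^sub>R (F z * dbar \<phi> z)) = (\<lambda>z. A z * s n z + \<i> / 2 * E n z)"
      proof
        fix z show "indicator upper_half_plane z *\<^sub>R (F z * dbar \<phi> z) = A z * s n z + \<i> / 2 * E n z"
        proof (cases "z \<in> upper_half_plane")
          case True
          show ?thesis unfolding db[OF True] using True by (simp add: A_def E_def algebra_simps)
        qed (simp add: A_def E_def)
      qed
      ultimately show ?thesis by simp
    qed
    have iE: "integrable lborel (\<lambda>z. \<i> / 2 * E n z)"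
      using Bochner_Integration.integrable_diff[OF iAE iA] by simp
    have "(LINT z|lborel. A z * s n z + \<i> / 2 * E n z) = - (LINT z|lborel. B z * s n z)"
      using wd tf unfolding weak_dbar_def l[symmetric] rr[symmetric] by blast
    moreover have "(LINT z|lborel. A z * s n z + \<i> / 2 * E n z) = (LINT z|lborel. A z * s n z) + \<i> / 2 * integral\<^sup>L lborel (E n)"
      by (subst Bochner_Integration.integral_add[OF iA iE]) simp
    ultimately show ?thesis by simp
  qed
  have "(\<lambda>n. (LINT z|lborel. A z * s n z) + \<i> / 2 * integral\<^sup>L lborel (E n)) \<longlonglongrightarrow>
    (LINT z|lborel. A z * 1) + \<i> / 2 * (LINT t|lborel. of_real (f t * \<kappa> (of_real t)) / (of_real t - \<zeta>))"
    by (intro tendsto_add tendsto_mult_left T1 T2)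
  moreover have "(\<lambda>n. - (LINT z|lborel. B z * s n z)) \<longlonglongrightarrow> - (LINT z|lborel. B z * 1)"
    by (intro tendsto_minus T3)
  ultimately have "(LINT z|lborel. A z * 1) + \<i> / 2 * (LINT t|lborel. of_real (f t * \<kappa> (of_real t)) / (of_real t - \<zeta>)) = - (LINT z|lborel. B z * 1)"
    unfolding id by (rule LIMSEQ_unique)
  from solve_half_i[OF this] show ?thesis unfolding A_def B_def by simp
qed

lemma h0_X_pole_integrable: "integrable lborel (\<lambda>z. h0 z * (X z * (1 / (z - of_real x))))"
proof (rule h0_X_integrable[where C=1])
  fix z assume z: "z \<in> upper_half_plane"
  then have nz: "z \<noteq> of_real x" by (auto simp: upper_half_plane_def)
  have "Im z \<le> cmod (z - of_real x)" using abs_Im_le_cmod[of "z - of_real x"] by simp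
  then show "cmod (1 / (z - of_real x)) * Im z \<le> 1" using nz by (simp add: norm_divide divide_le_eq)
qed auto

lemma F_dbar_X_integrable: "integrable lborel (\<lambda>z. indicator upper_half_plane z *\<^sub>R (F z * dbar X z))"
  by (rule boundary_weighted_integrable(1)[OF continuous_dbar_X compact_K dbar_X_zero])

lemma F_dbar_X_pole_integrable:
  assumes d: "d > 0" "\<And>z. cmod (z - of_real x) < d \<Longrightarrow> dbar X z = 0"
  shows "integrable lborel (\<lambda>z. indicator upper_half_plane z *\<^sub>R (F z * dbar X z) * (1 / (z - of_real x)))"
proof (rule Bochner_Integration.integrable_bound)
  show "integrable lborel (\<lambda>z. norm (indicator upper_half_plane z *\<^sub>R (F z * dbar X z)) * (1 / d))"
    using F_dbar_X_integrable by (intro integrable_mult_left integrable_norm)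
  have [measurable]: "(\<lambda>z. indicator upper_half_plane z *\<^sub>R (F z * dbar X z)) \<in> borel_measurable borel" using F_dbar_X_integrable by auto
  show "(\<lambda>z. indicator upper_half_plane z *\<^sub>R (F z * dbar X z) * (1 / (z - of_real x))) \<in> borel_measurable lborel" by measurable
  show "AE z in lborel. norm (indicator upper_half_plane z *\<^sub>R (F z * dbar X z) * (1 / (z - of_real x))) \<le>
      norm (norm (indicator upper_half_plane z *\<^sub>R (F z * dbar X z)) * (1 / d))"
  proof (rule AE_I2)
    fix z
    show "norm (indicator upper_half_plane z *\<^sub>R (F z * dbar X z) * (1 / (z - of_real x))) \<le>
      norm (norm (indicator upper_half_plane z *\<^sub>R (F z * dbar X z)) * (1 / d))"
    proof (cases "dbar X z = 0")
      case False
      then have "d \<le> cmod (z - of_real x)" using d(2)[of z] by (meson not_le)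
      then have "cmod (1 / (z - of_real x)) \<le> 1 / d" using d(1) by (simp add: norm_divide frac_le)
      then have "norm (indicator upper_half_plane z *\<^sub>R (F z * dbar X z)) * cmod (1 / (z - of_real x)) \<le> norm (indicator upper_half_plane z *\<^sub>R (F z * dbar X z)) * (1 / d)"
        by (intro mult_left_mono) auto
      then show ?thesis unfolding norm_mult[of _ "1 / (z - of_real x)"] by (rule order_trans) (metis abs_ge_self real_norm_def)
    qed simp
  qed
qed

text \<open>The Cauchy-Pompeiu formula for the reflected function. Taking the imaginary part removes the
  principal value, because \<open>f\<close> and the cutoff are real on the line; what remains is the Poisson kernel.\<close>

lemma cauchy_pompeiu_boundary:
  assumes d: "d > 0" "\<And>z. cmod (z - of_real x) < d \<Longrightarrow> dbar X z = 0"
  shows "pi * (f x * \<kappa> (of_real x)) = - 2 * Re ((LINT z|lborel. indicator upper_half_plane z *\<^sub>R (F z * dbar X z) * (1 / (z - of_real x)))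
        + (LINT z|lborel. h0 z * (X z * (1 / (z - of_real x)))))"
proof -
  define y where "y n = 1 / (real n + 1)" for n
  have y: "y n > 0" for n by (simp add: y_def)
  have ylim: "y \<longlonglongrightarrow> 0" unfolding y_def using LIMSEQ_inverse_real_of_nat by (simp add: inverse_eq_divide add.commute)
  define \<zeta> where "\<zeta> n = Complex x (- y n)" for n
  have \<zeta>lim: "\<zeta> \<longlonglongrightarrow> of_real x"
  proof -
    have "(\<lambda>n. Complex x (- y n)) \<longlonglongrightarrow> Complex x (- 0)" by (intro tendsto_Complex tendsto_intros ylim)
    then show ?thesis by (simp add: \<zeta>_def[abs_def] complex_of_real_def)
  qed
  have low: "cmod (z - of_real x) \<le> cmod (z - \<zeta> n)" if "z \<in> upper_half_plane" for z n
    using dist_lower_ge(1)[of z "y n" x] that y[of n] by (simp add: upper_half_plane_def \<zeta>_def)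
  have nz: "z \<noteq> of_real x" if "z \<in> upper_half_plane" for z using that by (auto simp: upper_half_plane_def)
  have nz\<zeta>: "z \<noteq> \<zeta> n" if "z \<in> upper_half_plane" for z n
    using that y[of n] by (auto simp: upper_half_plane_def \<zeta>_def)
  have lim: "(\<lambda>n. 1 / (z - \<zeta> n)) \<longlonglongrightarrow> 1 / (z - of_real x)" if "z \<in> upper_half_plane" for z
    using nz[OF that] by (intro tendsto_divide tendsto_diff tendsto_const \<zeta>lim) simp
  have FXi: "integrable lborel (\<lambda>z. indicator upper_half_plane z *\<^sub>R (F z * dbar X z))"
    by (rule boundary_weighted_integrable(1)[OF continuous_dbar_X compact_K dbar_X_zero])
  have T1: "(\<lambda>n. LINT z|lborel. indicator upper_half_plane z *\<^sub>R (F z * dbar X z) * (1 / (z - \<zeta> n))) \<longlonglongrightarrow>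
     (LINT z|lborel. indicator upper_half_plane z *\<^sub>R (F z * dbar X z) * (1 / (z - of_real x)))"
  \<comment> \<open>\<open>dbar X\<close> vanishes near \<open>x\<close>, so where it is nonzero all
    kernels are bounded by \<open>1 / d\<close>.\<close>
  proof (rule bounded_mult_limit[OF FXi, where C="1 / d"])
    fix z assume a: "indicator upper_half_plane z *\<^sub>R (F z * dbar X z) \<noteq> 0"
    then have z: "z \<in> upper_half_plane" and dX: "dbar X z \<noteq> 0" by (cases "z \<in> upper_half_plane"; force)+
    from lim[OF z] show "(\<lambda>n. 1 / (z - \<zeta> n)) \<longlonglongrightarrow> 1 / (z - of_real x)" .
    fix n
    have "\<not> cmod (z - of_real x) < d" using d(2)[of z] dX by blast
    then have "d \<le> cmod (z - \<zeta> n)" using low[OF z, of n] by linarith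
    then show "norm (1 / (z - \<zeta> n)) \<le> 1 / d" using d(1) by (simp add: norm_divide frac_le)
  qed measurable
  note Bi = h0_X_pole_integrable[of x]
  \<comment> \<open>The kernels are not uniformly bounded near \<open>x\<close>. The product with
    the limit kernel is taken as the integrable factor, and the remaining quotients are bounded by 1
    because lowering the pole only increases the distance.\<close>
  have "(\<lambda>n. LINT z|lborel. h0 z * (X z * (1 / (z - of_real x))) * ((z - of_real x) / (z - \<zeta> n))) \<longlonglongrightarrow>
     (LINT z|lborel. h0 z * (X z * (1 / (z - of_real x))) * 1)"
  proof (rule bounded_mult_limit[OF Bi, where C=1])
    fix z assume "h0 z * (X z * (1 / (z - of_real x))) \<noteq> 0"
    then have z: "z \<in> upper_half_plane" by (auto simp: h0_def split: if_splits)
    have "(\<lambda>n. (z - of_real x) * (1 / (z - \<zeta> n))) \<longlonglongrightarrow> (z - of_real x) * (1 / (z - of_real x))"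
      by (intro tendsto_mult_left lim z)
    then show "(\<lambda>n. (z - of_real x) / (z - \<zeta> n)) \<longlonglongrightarrow> 1" using nz[OF z] by simp
    fix n
    show "norm ((z - of_real x) / (z - \<zeta> n)) \<le> 1" using low[OF z, of n] nz\<zeta>[OF z, of n] by (simp add: norm_divide divide_le_eq)
  qed measurable
  moreover have "(LINT z|lborel. h0 z * (X z * (1 / (z - of_real x))) * ((z - of_real x) / (z - \<zeta> n))) = (LINT z|lborel. h0 z * (X z * (1 / (z - \<zeta> n))))" for n
  proof (intro Bochner_Integration.integral_cong refl)
    fix z show "h0 z * (X z * (1 / (z - of_real x))) * ((z - of_real x) / (z - \<zeta> n)) = h0 z * (X z * (1 / (z - \<zeta> n)))"
      using nz[of z] by (cases "z \<in> upper_half_plane") (auto simp: h0_def)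
  qed
  ultimately have T3: "(\<lambda>n. LINT z|lborel. h0 z * (X z * (1 / (z - \<zeta> n)))) \<longlonglongrightarrow> (LINT z|lborel. h0 z * (X z * (1 / (z - of_real x))))" by simp
  define k where "k t = f t * \<kappa> (of_real t)" for t
  have "continuous_on UNIV (\<lambda>z. Re (X z))" by (rule continuous_on_Re[OF continuous_X])
  then have \<kappa>c: "continuous_on UNIV \<kappa>" by simp
  have kc: "continuous_on UNIV k" unfolding k_def
    by (intro continuous_on_mult fc continuous_on_compose2[OF \<kappa>c] continuous_intros) auto
  have k0: "k t = 0" if "t \<notin> {-r..r}" for t
  proof -
    have "\<bar>t\<bar> > r" using that by (auto simp: abs_le_iff not_le)
    then show ?thesis using supp[of "of_real t"] by (simp add: k_def)
  qed
  have ki: "integrable lborel k" by (rule integrable_cont_compact[OF kc, of "{-r..r}"]) (use k0 in auto)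
  have "bounded (k ` {-r..r})" by (intro compact_imp_bounded compact_continuous_image continuous_on_subset[OF kc]) auto
  then obtain M where M: "\<And>t. t \<in> {-r..r} \<Longrightarrow> \<bar>k t\<bar> \<le> M" unfolding bounded_iff by (metis imageI real_norm_def)
  have kM: "\<bar>k t\<bar> \<le> \<bar>M\<bar>" for t using M[of t] k0[of t] by (cases "t \<in> {-r..r}") force+
  \<comment> \<open>The numerator is real on the line, so only the kernel contributes an imaginary
    part, namely minus the Poisson kernel.\<close>
  have ImI: "Im (LINT t|lborel. of_real (k t) / (of_real t - \<zeta> n)) = - (LINT t|lborel. k t * (y n / ((t - x)\<^sup>2 + (y n)\<^sup>2)))" for n
  proof -
    have "integrable lborel (\<lambda>t. complex_of_real (k t) / (of_real t - \<zeta> n))"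
    proof (rule integrable_cont_compact[of _ "{-r..r}"])
      show "continuous_on UNIV (\<lambda>t. complex_of_real (k t) / (of_real t - \<zeta> n))"
        using y[of n] by (intro continuous_on_divide continuous_on_of_real kc continuous_intros) (auto simp: complex_eq_iff \<zeta>_def)
    qed (use k0 in auto)
    then have "Im (LINT t|lborel. of_real (k t) / (of_real t - \<zeta> n)) = (LINT t|lborel. Im (of_real (k t) / (of_real t - \<zeta> n)))"
      by (rule integral_Im[symmetric])
    also have "\<dots> = (LINT t|lborel. - (k t * (y n / ((t - x)\<^sup>2 + (y n)\<^sup>2))))"
      by (intro Bochner_Integration.integral_cong refl) (simp add: Im_divide \<zeta>_def)
    finally show ?thesis by simp
  qed
  have "(\<lambda>n. - (LINT t|lborel. k t * (y n / ((t - x)\<^sup>2 + (y n)\<^sup>2)))) \<longlonglongrightarrow> - (pi * k x)"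
    by (intro tendsto_minus poisson_limit[OF kc kM ylim y])
  then have L1: "(\<lambda>n. Im (LINT t|lborel. of_real (k t) / (of_real t - \<zeta> n))) \<longlonglongrightarrow> - (pi * k x)" by (simp add: ImI)
  let ?R = "(LINT z|lborel. indicator upper_half_plane z *\<^sub>R (F z * dbar X z) * (1 / (z - of_real x)))
        + (LINT z|lborel. h0 z * (X z * (1 / (z - of_real x))))"
  have "(\<lambda>n. Im (2 * \<i> * ((LINT z|lborel. indicator upper_half_plane z *\<^sub>R (F z * dbar X z) * (1 / (z - \<zeta> n)))
        + (LINT z|lborel. h0 z * (X z * (1 / (z - \<zeta> n))))))) \<longlonglongrightarrow> Im (2 * \<i> * ?R)"
    by (intro tendsto_Im tendsto_mult_left tendsto_add T1 T3)
  moreover have "(LINT t|lborel. of_real (k t) / (of_real t - \<zeta> n)) = 2 * \<i> * ((LINT z|lborel. indicator upper_half_plane z *\<^sub>R (F z * dbar X z) * (1 / (z - \<zeta> n)))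
        + (LINT z|lborel. h0 z * (X z * (1 / (z - \<zeta> n)))))" for n
    unfolding k_def \<zeta>_def by (rule cauchy_below[OF y])
  ultimately have "(\<lambda>n. Im (LINT t|lborel. of_real (k t) / (of_real t - \<zeta> n))) \<longlonglongrightarrow> Im (2 * \<i> * ?R)" by simp
  from LIMSEQ_unique[OF L1 this] have "- (pi * k x) = 2 * Re ?R" by simp
  then show ?thesis unfolding k_def by linarith
qed

end

section \<open>The potential of the weak derivative\<close>

text \<open>A product of four one-dimensional steps. Dilations are part of the statement because
  they are absorbed by affine substitutions in the steps.\<close>

lemma square_cutoff_exists:
  obtains \<kappa> :: "complex \<Rightarrow> real" where
    "\<And>R. R > 0 \<Longrightarrow> plane_alg (\<lambda>z. of_real (\<kappa> (z / of_real R)))"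
    "\<And>z. \<bar>Re z\<bar> > 2 \<or> \<bar>Im z\<bar> > 2 \<Longrightarrow> \<kappa> z = 0"
    "\<And>z. \<bar>Re z\<bar> \<le> 1 \<Longrightarrow> \<bar>Im z\<bar> \<le> 1 \<Longrightarrow> \<kappa> z = 1"
    "\<And>z. \<bar>\<kappa> z\<bar> \<le> 1"
proof -
  obtain S \<sigma> :: "real \<Rightarrow> real" where S': "smooth_real S" "smooth_real \<sigma>" "\<And>t. (S has_real_derivative \<sigma> t) (at t)"
    "\<And>t. t \<le> 0 \<Longrightarrow> S t = 0" "\<And>t. t \<ge> 1 \<Longrightarrow> S t = 1" "\<And>t. 0 \<le> S t" "\<And>t. S t \<le> 1"
    and \<sigma>: "\<And>t. t \<notin> {0..1} \<Longrightarrow> \<sigma> t = 0" "continuous_on UNIV \<sigma>" "(LINT t|lborel. \<sigma> t) = 1"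
    using smooth_step_exists by blast
  note S = S'(1,4-7)
  define \<kappa> where "\<kappa> z = S (2 - Re z) * S (2 + Re z) * (S (2 - Im z) * S (2 + Im z))" for z
  have sm: "smooth_real (\<lambda>t. S (2 + a * t))" for a
  proof -
    have "smooth_real (\<lambda>t. 1 * S (a * t + 2))" by (rule smooth_real_affine[OF S(1)])
    then show ?thesis by (simp add: add.commute)
  qed
  show ?thesis
  proof (rule that[of \<kappa>])
    fix R :: real assume R: "R > 0"
    have "plane_alg (\<lambda>z. of_real (S (2 + (- 1 / R) * Re z)) * of_real (S (2 + (1 / R) * Re z)) *
        (of_real (S (2 + (- 1 / R) * Im z)) * of_real (S (2 + (1 / R) * Im z))))"
      by (intro plane_alg.mult plane_alg.re[OF sm] plane_alg.im[OF sm])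
    moreover have "(\<lambda>z. of_real (S (2 + (- 1 / R) * Re z)) * of_real (S (2 + (1 / R) * Re z)) *
        (of_real (S (2 + (- 1 / R) * Im z)) * of_real (S (2 + (1 / R) * Im z)))) = (\<lambda>z. complex_of_real (\<kappa> (z / of_real R)))"
      by (rule ext) (simp add: \<kappa>_def)
    ultimately show "plane_alg (\<lambda>z. of_real (\<kappa> (z / of_real R)))" by (simp only:)
  next
    fix z :: complex assume "\<bar>Re z\<bar> > 2 \<or> \<bar>Im z\<bar> > 2"
    then consider "2 - Re z \<le> 0" | "2 + Re z \<le> 0" | "2 - Im z \<le> 0" | "2 + Im z \<le> 0" by linarith
    then show "\<kappa> z = 0" by cases (simp_all add: \<kappa>_def S(2))
  next
    fix z :: complex assume "\<bar>Re z\<bar> \<le> 1" "\<bar>Im z\<bar> \<le> 1"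
    then have "1 \<le> 2 - Re z" "1 \<le> 2 + Re z" "1 \<le> 2 - Im z" "1 \<le> 2 + Im z" by linarith+
    then show "\<kappa> z = 1" by (simp add: \<kappa>_def S(3))
  next
    fix z :: complex
    have "0 \<le> \<kappa> z" unfolding \<kappa>_def by (intro mult_nonneg_nonneg S(4))
    moreover have "\<kappa> z \<le> 1" unfolding \<kappa>_def by (intro mult_le_one mult_nonneg_nonneg S(4) S(5))
    ultimately show "\<bar>\<kappa> z\<bar> \<le> 1" by simp
  qed
qed

lemma dbar_scale:
  assumes s: "smooth_c \<phi>" and R: "R > 0"
  shows "dbar (\<lambda>z. \<phi> (z / of_real R)) z = dbar \<phi> (z / of_real R) / of_real R"
proof -
  have t: "((\<lambda>t. t / R) has_vector_derivative 1 / R) (at 0)" by (auto intro!: derivative_eq_intros)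
  have 1: "((\<lambda>t::real. \<phi> (z / of_real R + of_real t)) has_vector_derivative px \<phi> (z / of_real R)) (at (0 / R))"
    using smooth_cD(6)[OF s] by simp
  have 2: "((\<lambda>t::real. \<phi> (z / of_real R + \<i> * of_real t)) has_vector_derivative py \<phi> (z / of_real R)) (at (0 / R))"
    using smooth_cD(7)[OF s] by simp
  have "px (\<lambda>z. \<phi> (z / of_real R)) z = (1 / R) *\<^sub>R px \<phi> (z / of_real R)"
    unfolding px_def[of "\<lambda>z. \<phi> (z / of_real R)"]
    using vector_diff_chain_at[OF t 1] by (intro vector_derivative_at) (simp add: o_def add_divide_distrib)
  moreover have "py (\<lambda>z. \<phi> (z / of_real R)) z = (1 / R) *\<^sub>R py \<phi> (z / of_real R)"
    unfolding py_def[of "\<lambda>z. \<phi> (z / of_real R)"]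
    using vector_diff_chain_at[OF t 2] by (intro vector_derivative_at) (simp add: o_def add_divide_distrib)
  ultimately show ?thesis by (simp only: dbar_def) (simp add: scaleR_conv_of_real add_divide_distrib mult.commute)
qed

lemma dbar_locally_constant:
  assumes "open U" "z \<in> U" "\<And>w. w \<in> U \<Longrightarrow> \<phi> w = c"
  shows "dbar \<phi> z = 0"
proof -
  have "((\<lambda>t::real. \<phi> (z + e * of_real t)) has_vector_derivative 0) (at 0)" for e
  proof (rule partial_cong[where f="\<lambda>_. c" and S=U])
    show "c = \<phi> w" if "w \<in> U" for w using assms(3)[OF that] by simp
  qed (use assms in auto)
  from this[of 1] this[of \<i>] have "px \<phi> z = 0" "py \<phi> z = 0" unfolding px_def py_def by (auto intro: vector_derivative_at)
  then show ?thesis by (simp add: dbar_def)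
qed

text \<open>The Cauchy kernel minus its linear interpolation (in \<open>\<zeta>\<close>) at the nodes 0 and 1.\<close>

definition ckernel :: "complex \<Rightarrow> complex \<Rightarrow> complex" where
  "ckernel \<zeta> w = 1 / (w - \<zeta>) - (1 - \<zeta>) / w - \<zeta> / (w - 1)"

text \<open>The error formula for linear interpolation at 0 and 1. The numerator does not contain
  \<open>w\<close>, so it faces three linear factors in \<open>w\<close> and the decay is
  cubic.\<close>

lemma ckernel_eq:
  assumes "w \<noteq> \<zeta>" "w \<noteq> 0" "w \<noteq> 1"
  shows "ckernel \<zeta> w = \<zeta> * (\<zeta> - 1) / (w * (w - 1) * (w - \<zeta>))"
proof -
  define a b where "a = w - \<zeta>" and "b = w - 1"
  have nz: "a \<noteq> 0" "b \<noteq> 0" using assms by (auto simp: a_def b_def)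
  have "1 / a - (1 - \<zeta>) / w - \<zeta> / b = (w * b - (1 - \<zeta>) * (a * b) - \<zeta> * (w * a)) / (w * b * a)"
    using nz assms(2) by (simp add: diff_divide_distrib)
  also have "w * b - (1 - \<zeta>) * (a * b) - \<zeta> * (w * a) = \<zeta> * (\<zeta> - 1)"
    by (simp add: a_def b_def algebra_simps)
  finally show ?thesis by (simp add: ckernel_def a_def b_def)
qed

lemma ckernel_far:
  assumes z: "cmod \<zeta> \<le> M" and w: "cmod w \<ge> 2 * (M + 1)"
  shows "cmod (ckernel \<zeta> w) \<le> 4 * (M * (M + 1)) / cmod w ^ 3"
proof -
  define \<rho> where "\<rho> = cmod w"
  have M0: "0 \<le> M" using z norm_ge_zero[of \<zeta>] by linarith
  have \<rho>: "\<rho> \<ge> 2 * (M + 1)" "\<rho> > 0" using w M0 by (auto simp: \<rho>_def)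
  \<comment> \<open>For \<open>cmod w\<close> at least \<open>2 * (M + 1)\<close>, both \<zeta> and
    1 lie in the disc about 0 whose radius is half of \<open>cmod w\<close>.\<close>
  have a: "cmod (w - \<zeta>) \<ge> \<rho> / 2" using norm_triangle_ineq2[of w \<zeta>] z \<rho> by (simp add: \<rho>_def)
  have b: "cmod (w - 1) \<ge> \<rho> / 2" using norm_triangle_ineq2[of w 1] \<rho> M0 by (simp add: \<rho>_def)
  have nz: "w \<noteq> \<zeta>" "w \<noteq> 0" "w \<noteq> 1" using a b \<rho> by (auto simp: \<rho>_def)
  have "cmod (\<zeta> - 1) \<le> M + 1" using norm_triangle_ineq4[of \<zeta> 1] z by simp
  then have num: "cmod \<zeta> * cmod (\<zeta> - 1) \<le> M * (M + 1)" using z M0 by (intro mult_mono) auto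
  have den: "\<rho> * (\<rho> / 2) * (\<rho> / 2) \<le> cmod w * cmod (w - 1) * cmod (w - \<zeta>)"
    using a b \<rho> by (intro mult_mono) (auto simp: \<rho>_def)
  have "cmod (ckernel \<zeta> w) = cmod \<zeta> * cmod (\<zeta> - 1) / (cmod w * cmod (w - 1) * cmod (w - \<zeta>))"
    unfolding ckernel_eq[OF nz] by (simp add: norm_mult norm_divide)
  also have "\<dots> \<le> M * (M + 1) / (\<rho> * (\<rho> / 2) * (\<rho> / 2))"
    using num den \<rho> M0 by (intro frac_le) auto
  also have "\<dots> = 4 * (M * (M + 1)) / \<rho> ^ 3" using \<rho> by (simp add: power3_eq_cube)
  finally show ?thesis by (simp add: \<rho>_def)
qed

definition ckernel_const :: "real \<Rightarrow> real" where
  "ckernel_const M = (2 + 2 * M) * (1 + (2 * (M + 1))\<^sup>2) + 8 * (M * (M + 1))"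

text \<open>All three poles lie in the closed lower half-plane, so each fraction times
  \<open>Im w\<close> is bounded by its coefficient, which settles bounded \<open>w\<close>. Far out
  the cubic decay absorbs \<open>Im w\<close> and the square. \<open>ckernel_const\<close> adds the
  two bounds; it does not deteriorate as \<zeta> approaches the axis.\<close>

lemma ckernel_bound:
  assumes z: "cmod \<zeta> \<le> M" "Im \<zeta> \<le> 0" and w: "w \<in> upper_half_plane"
  shows "cmod (ckernel \<zeta> w) * Im w * (1 + (cmod w)\<^sup>2) \<le> ckernel_const M"
proof -
  have M0: "0 \<le> M" using z(1) norm_ge_zero[of \<zeta>] by linarith
  have v: "Im w > 0" using w by (simp add: upper_half_plane_def)
  show ?thesis
  proof (cases "cmod w \<ge> 2 * (M + 1)")
    case True
    have "1 \<le> 2 * (M + 1)" using M0 by simp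
    then have w1: "cmod w \<ge> 1" using True by (rule order_trans)
    then have w2: "cmod w > 0" by (rule less_le_trans[OF zero_less_one])
    have "cmod (ckernel \<zeta> w) * Im w * (1 + (cmod w)\<^sup>2) \<le> (4 * (M * (M + 1)) / cmod w ^ 3) * cmod w * (2 * (cmod w)\<^sup>2)"
    proof (intro mult_mono ckernel_far z(1) True mult_nonneg_nonneg)
      show "Im w \<le> cmod w" using abs_Im_le_cmod[of w] by simp
      show "1 + (cmod w)\<^sup>2 \<le> 2 * (cmod w)\<^sup>2" using power_mono[OF w1(1), of 2] by simp
    qed (use v M0 in auto)
    also have "\<dots> = 8 * (M * (M + 1))" using w2 by (simp add: power3_eq_cube power2_eq_square)
    also have "\<dots> \<le> ckernel_const M" using M0 by (simp add: ckernel_const_def)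
    finally show ?thesis .
  next
    case False
    have q: "cmod (c / (w - a)) * Im w \<le> cmod c" if "Im a \<le> 0" for a c
    proof -
      have p: "Im w \<le> cmod (w - a)" using abs_Im_le_cmod[of "w - a"] that by simp
      then have "cmod c * Im w \<le> cmod c * cmod (w - a)" by (intro mult_left_mono) auto
      moreover have "cmod (w - a) > 0" using p v by linarith
      ultimately show ?thesis by (simp add: norm_divide divide_le_eq)
    qed
    have "cmod (ckernel \<zeta> w) \<le> cmod (1 / (w - \<zeta>)) + cmod ((1 - \<zeta>) / (w - 0)) + cmod (\<zeta> / (w - 1))"
      unfolding ckernel_def using norm_triangle_ineq4[of "1 / (w - \<zeta>) - (1 - \<zeta>) / w" "\<zeta> / (w - 1)"]
        norm_triangle_ineq4[of "1 / (w - \<zeta>)" "(1 - \<zeta>) / w"] by simp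
    then have "cmod (ckernel \<zeta> w) * Im w \<le> (cmod (1 / (w - \<zeta>)) + cmod ((1 - \<zeta>) / (w - 0)) + cmod (\<zeta> / (w - 1))) * Im w"
      using v by (intro mult_right_mono) auto
    also have "\<dots> \<le> 1 + cmod (1 - \<zeta>) + cmod \<zeta>"
      using q[of \<zeta> 1] q[of 0 "1 - \<zeta>"] q[of 1 \<zeta>] z by (simp add: distrib_right)
    also have "\<dots> \<le> 2 + 2 * M" using norm_triangle_ineq4[of 1 \<zeta>] z by simp
    finally have 1: "cmod (ckernel \<zeta> w) * Im w \<le> 2 + 2 * M" .
    have "(cmod w)\<^sup>2 \<le> (2 * (M + 1))\<^sup>2" using False by (intro power_mono) auto
    then have "cmod (ckernel \<zeta> w) * Im w * (1 + (cmod w)\<^sup>2) \<le> (2 + 2 * M) * (1 + (2 * (M + 1))\<^sup>2)"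
      using 1 M0 v by (intro mult_mono) auto
    also have "\<dots> \<le> ckernel_const M" using M0 by (simp add: ckernel_const_def)
    finally show ?thesis .
  qed
qed

lemma ckernel_const_nonneg: "M \<ge> 0 \<Longrightarrow> ckernel_const M \<ge> 0" by (simp add: ckernel_const_def)

lemma ckernel_measurable [measurable]: "ckernel \<zeta> \<in> borel_measurable borel"
  unfolding ckernel_def[abs_def] by measurable

context extension
begin

definition V :: "complex \<Rightarrow> complex" where "V \<zeta> = (LINT w|lborel. h0 w * ckernel \<zeta> w)"

lemma V_integrable: "Im \<zeta> \<le> 0 \<Longrightarrow> integrable lborel (\<lambda>w. h0 w * ckernel \<zeta> w)"
  by (rule dom_kernel_integrable[OF ckernel_bound[of \<zeta> "cmod \<zeta>"] ckernel_const_nonneg]) auto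

end

context cutoff
begin

text \<open>The weights 1, \<open>1 - x\<close> and \<open>x\<close> are those of the kernel, so the
  boundary formulas at the three nodes add up to integrals against \<open>ckernel\<close>. The
  combination is formed before the cutoff is removed, because a single Cauchy kernel decays too
  slowly for that limit.\<close>

lemma three_point:
  assumes one: "\<kappa> (of_real x) = 1" "\<kappa> 0 = 1" "\<kappa> 1 = 1"
    and d: "\<And>z. cmod (z - of_real x) < 1 \<Longrightarrow> dbar X z = 0" "\<And>z. cmod (z - 0) < 1 \<Longrightarrow> dbar X z = 0" "\<And>z. cmod (z - 1) < 1 \<Longrightarrow> dbar X z = 0"
  shows "pi * (f x - (1 - x) * f 0 - x * f 1) = - 2 * Re ((LINT z|lborel. indicator upper_half_plane z *\<^sub>R (F z * dbar X z) * ckernel (of_real x) z)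
     + (LINT z|lborel. h0 z * ckernel (of_real x) z * X z))"
proof -
  have ck: "Y * ckernel (of_real x) z = Y * (1 / (z - of_real x)) - of_real (1 - x) * (Y * (1 / (z - of_real 0))) - of_real x * (Y * (1 / (z - of_real 1)))" for Y z
    by (simp add: ckernel_def right_diff_distrib) (simp add: algebra_simps)
  define a where "a p = (LINT z|lborel. indicator upper_half_plane z *\<^sub>R (F z * dbar X z) * (1 / (z - of_real p)))" for p :: real
  define b where "b p = (LINT z|lborel. h0 z * (X z * (1 / (z - of_real p))))" for p :: real
  have d0: "\<And>z. cmod (z - of_real 0) < 1 \<Longrightarrow> dbar X z = 0" and d1: "\<And>z. cmod (z - of_real 1) < 1 \<Longrightarrow> dbar X z = 0" using d by auto
  have ia: "integrable lborel (\<lambda>z. indicator upper_half_plane z *\<^sub>R (F z * dbar X z) * (1 / (z - of_real x)))"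
    "integrable lborel (\<lambda>z. indicator upper_half_plane z *\<^sub>R (F z * dbar X z) * (1 / (z - of_real 0)))"
    "integrable lborel (\<lambda>z. indicator upper_half_plane z *\<^sub>R (F z * dbar X z) * (1 / (z - of_real 1)))"
    by (rule F_dbar_X_pole_integrable[OF zero_less_one], erule d d0 d1)+
  note ib = h0_X_pole_integrable[of x] h0_X_pole_integrable[of 0] h0_X_pole_integrable[of 1]
  have p: "pi * f x = - 2 * Re (a x + b x)" "pi * f 0 = - 2 * Re (a 0 + b 0)" "pi * f 1 = - 2 * Re (a 1 + b 1)"
    using cauchy_pompeiu_boundary[where x=x, OF zero_less_one d(1)] cauchy_pompeiu_boundary[where x=0, OF zero_less_one d0] cauchy_pompeiu_boundary[where x=1, OF zero_less_one d1] one
    by (simp_all add: a_def b_def)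
  have "(LINT z|lborel. indicator upper_half_plane z *\<^sub>R (F z * dbar X z) * ckernel (of_real x) z)
    = (LINT z|lborel. indicator upper_half_plane z *\<^sub>R (F z * dbar X z) * (1 / (z - of_real x)) - of_real (1 - x) * (indicator upper_half_plane z *\<^sub>R (F z * dbar X z) * (1 / (z - of_real 0)))
        - of_real x * (indicator upper_half_plane z *\<^sub>R (F z * dbar X z) * (1 / (z - of_real 1))))"
    by (intro Bochner_Integration.integral_cong refl ck)
  also have "\<dots> = a x - of_real (1 - x) * a 0 - of_real x * a 1"
    unfolding a_def by (rule integral_diff3[OF ia])
  finally have A: "(LINT z|lborel. indicator upper_half_plane z *\<^sub>R (F z * dbar X z) * ckernel (of_real x) z) = a x - of_real (1 - x) * a 0 - of_real x * a 1" .
  have "(LINT z|lborel. h0 z * ckernel (of_real x) z * X z)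
    = (LINT z|lborel. h0 z * (X z * (1 / (z - of_real x))) - of_real (1 - x) * (h0 z * (X z * (1 / (z - of_real 0)))) - of_real x * (h0 z * (X z * (1 / (z - of_real 1)))))"
    by (intro Bochner_Integration.integral_cong refl) (simp only: ck[of "h0 _ * X _", simplified mult.assoc] mult.assoc mult.commute[of "ckernel _ _" "X _"])
  also have "\<dots> = b x - of_real (1 - x) * b 0 - of_real x * b 1"
    unfolding b_def by (rule integral_diff3[OF ib])
  finally have B: "(LINT z|lborel. h0 z * ckernel (of_real x) z * X z) = b x - of_real (1 - x) * b 0 - of_real x * b 1" .
  have "pi * (f x - (1 - x) * f 0 - x * f 1) = pi * f x - (1 - x) * (pi * f 0) - x * (pi * f 1)" by (simp add: algebra_simps)
  also have "\<dots> = - 2 * Re ((a x - of_real (1 - x) * a 0 - of_real x * a 1) + (b x - of_real (1 - x) * b 0 - of_real x * b 1))"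
    unfolding p by (simp add: algebra_simps)
  finally show ?thesis unfolding A B .
qed

end

context extension
begin

lemma F_far:
  assumes "e > 0"
  shows "\<exists>R0. \<forall>z\<in>closed_upper_half_plane. cmod z \<ge> R0 \<longrightarrow> cmod (F z) \<le> e * (cmod z)\<^sup>2"
proof -
  have "\<forall>\<^sub>F z in inf at_infinity (principal closed_upper_half_plane). norm (F z) \<le> e * norm (z\<^sup>2)"
    using landau_o.smallD[OF Fo assms] .
  then show ?thesis unfolding eventually_inf_principal eventually_at_infinity by (auto simp: norm_power)
qed

text \<open>The cutoff is dilated by R. The \<open>h0\<close> integral converges to
  \<open>V\<close>. The other integrand is at most \<open>\<epsilon> * C1 / R^2\<close> on a square
  of area 16 R^2, since \<open>F\<close> is at most \<open>\<epsilon> * (cmod z)^2\<close>, the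
  derivative of the cutoff is of order 1 / R and the kernel of order 1 / |z|^3.\<close>

lemma representation:
  assumes fc: "continuous_on UNIV f"
  shows "f x = (1 - x) * f 0 + x * f 1 - 2 / pi * Re (V (of_real x))"
proof -
  obtain \<kappa> :: "complex \<Rightarrow> real" where \<kappa>: "\<And>R. R > 0 \<Longrightarrow> plane_alg (\<lambda>z. of_real (\<kappa> (z / of_real R)))"
    "\<And>z. \<bar>Re z\<bar> > 2 \<or> \<bar>Im z\<bar> > 2 \<Longrightarrow> \<kappa> z = 0"
    "\<And>z. \<bar>Re z\<bar> \<le> 1 \<Longrightarrow> \<bar>Im z\<bar> \<le> 1 \<Longrightarrow> \<kappa> z = 1" "\<And>z. \<bar>\<kappa> z\<bar> \<le> 1"
    using square_cutoff_exists by blast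
  have loc: "cutoff F h f (\<lambda>z. \<kappa> (z / of_real R)) (2 * R)" if R: "R > 0" for R
  proof unfold_locales
    show "plane_alg (\<lambda>z. of_real (\<kappa> (z / of_real R)))" by (rule \<kappa>(1)[OF R])
    show "0 < 2 * R" using R by simp
    show "\<kappa> (z / of_real R) = 0" if "\<bar>Re z\<bar> > 2 * R \<or> \<bar>Im z\<bar> > 2 * R" for z
    proof (rule \<kappa>(2))
      show "\<bar>Re (z / of_real R)\<bar> > 2 \<or> \<bar>Im (z / of_real R)\<bar> > 2"
        using that R by (simp add: pos_less_divide_eq abs_divide)
    qed
  qed (rule fc)
  let ?X = "\<lambda>R z. complex_of_real (\<kappa> (z / of_real R))"
  have one: "\<kappa> (z / of_real R) = 1" if "\<bar>Re z\<bar> \<le> R" "\<bar>Im z\<bar> \<le> R" "R > 0" for z R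
    by (rule \<kappa>(3)) (use that in \<open>simp_all add: abs_divide\<close>)
  have db0: "dbar (?X R) z = 0" if "cmod z < R" for z R
  proof (rule dbar_locally_constant)
    show "open (ball (0::complex) R)" "z \<in> ball 0 R" using that by auto
    fix w :: complex assume w: "w \<in> ball 0 R"
    then have "cmod w < R" by simp
    moreover from this have "R > 0" using norm_ge_zero[of w] by linarith
    ultimately show "?X R w = 1" using one[of w R] abs_Re_le_cmod[of w] abs_Im_le_cmod[of w] by simp
  qed
  have s1: "smooth_c (\<lambda>z. of_real (\<kappa> z))" using plane_alg_smooth[OF \<kappa>(1)[of 1]] by simp
  have "\<exists>C0\<ge>0. \<forall>z. cmod (dbar (\<lambda>z. of_real (\<kappa> z)) z) \<le> C0"
  proof -
    interpret c: cutoff F h f "\<lambda>z. \<kappa> (z / of_real 1)" "2 * 1" by (rule loc) simp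
    have c: "continuous_on UNIV (dbar (\<lambda>z. of_real (\<kappa> z)))" using c.continuous_dbar_X by simp
    have "bounded (dbar (\<lambda>z. of_real (\<kappa> z)) ` c.K)"
      by (intro compact_imp_bounded compact_continuous_image continuous_on_subset[OF c] c.compact_K) simp
    then obtain B where B: "\<And>z. z \<in> c.K \<Longrightarrow> cmod (dbar (\<lambda>z. of_real (\<kappa> z)) z) \<le> B" unfolding bounded_iff by blast
    have "cmod (dbar (\<lambda>z. of_real (\<kappa> z)) z) \<le> \<bar>B\<bar>" for z
    proof (cases "z \<in> c.K")
      case True
      then show ?thesis using B[OF True] by linarith
    next
      case False
      then show ?thesis using c.dbar_X_zero[OF False] by simp
    qed
    then show ?thesis by (intro exI[of _ "\<bar>B\<bar>"]) simp
  qed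
  then obtain C0 where C0: "C0 \<ge> 0" "\<And>z. cmod (dbar (\<lambda>z. of_real (\<kappa> z)) z) \<le> C0" by blast
  have dbR: "cmod (dbar (?X R) z) \<le> C0 / R" if R: "R > 0" for R z
    unfolding dbar_scale[OF s1 R] using C0(2)[of "z / of_real R"] R by (simp add: norm_divide divide_right_mono)
  define k where "k = ckernel (of_real x)"
  define A where "A R = (LINT z|lborel. indicator upper_half_plane z *\<^sub>R (F z * dbar (?X R) z) * k z)" for R
  define B where "B R = (LINT z|lborel. h0 z * k z * ?X R z)" for R
  \<comment> \<open>From \<open>\<bar>x\<bar> + 2\<close> on, the unit discs about all three nodes
    lie where the cutoff is 1.\<close>
  have AB: "pi * (f x - (1 - x) * f 0 - x * f 1) = - 2 * Re (A R + B R)" if R: "R \<ge> \<bar>x\<bar> + 2" for R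
  proof -
    have R0: "R > 0" using R by linarith
    interpret c: cutoff F h f "\<lambda>z. \<kappa> (z / of_real R)" "2 * R" by (rule loc[OF R0])
    have near: "dbar (?X R) z = 0" if "cmod (z - of_real p) < 1" "\<bar>p\<bar> \<le> \<bar>x\<bar> + 1" for p z
    proof (rule db0)
      have "cmod z \<le> cmod (z - of_real p) + \<bar>p\<bar>" using norm_triangle_sub[of z "of_real p"] by simp
      then show "cmod z < R" using that R by linarith
    qed
    show ?thesis unfolding A_def B_def k_def
    proof (rule c.three_point)
      show "\<kappa> (of_real x / of_real R) = 1" "\<kappa> (0 / of_real R) = 1" "\<kappa> (1 / of_real R) = 1"
        using R R0 one[of "of_real x" R] one[of 0 R] one[of 1 R] by simp_all
      show "dbar (?X R) z = 0" if "cmod (z - of_real x) < 1" for z by (rule near[OF that]) simp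
      show "dbar (?X R) z = 0" if "cmod (z - 0) < 1" for z by (rule near[of z 0]) (use that in auto)
      show "dbar (?X R) z = 0" if "cmod (z - 1) < 1" for z by (rule near[of z 1]) (use that in auto)
    qed
  qed
  have Blim: "(\<lambda>n. B (real n + 1)) \<longlonglongrightarrow> V (of_real x)"
  proof -
    have "(\<lambda>n. LINT z|lborel. (h0 z * k z) * ?X (real n + 1) z) \<longlonglongrightarrow> (LINT z|lborel. (h0 z * k z) * 1)"
    proof (rule bounded_mult_limit[where C=1])
      show "integrable lborel (\<lambda>z. h0 z * k z)" unfolding k_def by (rule V_integrable) simp
      show "?X (real n + 1) \<in> borel_measurable lborel" for n
      proof -
        have p: "0 < real n + 1" by simp
        interpret c: cutoff F h f "\<lambda>z. \<kappa> (z / of_real (real n + 1))" "2 * (real n + 1)" by (rule loc[OF p])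
        show ?thesis using c.X_measurable(1) by simp
      qed
      show "norm (?X (real n + 1) z) \<le> 1" for n z using \<kappa>(4) by simp
      fix z :: complex
      have "\<forall>\<^sub>F n in sequentially. ?X (real n + 1) z = 1"
        using eventually_ge_at_top[of "nat \<lceil>cmod z\<rceil>"]
      proof eventually_elim
        case (elim n)
        then have "cmod z \<le> real n + 1" by linarith
        then have "\<kappa> (z / of_real (real n + 1)) = 1"
          using abs_Re_le_cmod[of z] abs_Im_le_cmod[of z] by (intro one) linarith+
        then show ?case by (simp only: of_real_1)
      qed
      then show "(\<lambda>n. ?X (real n + 1) z) \<longlonglongrightarrow> 1" by (rule tendsto_eventually)
    qed simp
    then show ?thesis by (simp add: B_def V_def k_def)
  qed
  have Alim: "(\<lambda>n. A (real n + 1)) \<longlonglongrightarrow> 0"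
  proof (rule LIMSEQ_I)
    fix e :: real assume e: "e > 0"
    define M where "M = \<bar>x\<bar>"
    define C1 where "C1 = C0 * (4 * (M * (M + 1)))"
    have M0: "M \<ge> 0" by (simp add: M_def)
    have C1: "C1 \<ge> 0" using C0(1) M0 by (simp add: C1_def)
    \<comment> \<open>Area times integrand is \<open>16 * \<epsilon> * C1\<close>; the denominator
      makes this less than \<open>e\<close>, also for \<open>C1 = 0\<close>.\<close>
    define \<epsilon> where "\<epsilon> = e / (32 * (C1 + 1))"
    have \<epsilon>: "\<epsilon> > 0" using e C1 by (simp add: \<epsilon>_def)
    obtain R0 where R0: "\<forall>z\<in>closed_upper_half_plane. cmod z \<ge> R0 \<longrightarrow> cmod (F z) \<le> \<epsilon> * (cmod z)\<^sup>2" using F_far[OF \<epsilon>] by blast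
    have "norm (A R) < e" if R: "R \<ge> R0" "R \<ge> 2 * (M + 1)" for R
    proof -
      have "0 < 2 * (M + 1)" using M0 by simp
      then have Rp: "R > 0" using R(2) by (rule less_le_trans)
      interpret c: cutoff F h f "\<lambda>z. \<kappa> (z / of_real R)" "2 * R" by (rule loc[OF Rp])
      have pt: "norm (indicator upper_half_plane z *\<^sub>R (F z * dbar (?X R) z) * k z) \<le> indicator c.K z * (\<epsilon> * C1 / R\<^sup>2)" for z
      proof (cases "z \<in> upper_half_plane \<and> dbar (?X R) z \<noteq> 0")
        case True
        have zK: "z \<in> c.K" using True c.dbar_X_zero by blast
        have zR: "cmod z \<ge> R" using True db0[of z R] by (meson not_le)
        have zp: "cmod z > 0" using zR Rp by linarith
        have "z \<in> closed_upper_half_plane" using True by (simp add: upper_half_plane_def closed_upper_half_plane_def)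
        then have Fz: "cmod (F z) \<le> \<epsilon> * (cmod z)\<^sup>2" using R0 zR R(1) by auto
        have kz: "cmod (k z) \<le> 4 * (M * (M + 1)) / cmod z ^ 3" unfolding k_def
          by (rule ckernel_far) (use zR R(2) in \<open>auto simp: M_def\<close>)
        have "norm (indicator upper_half_plane z *\<^sub>R (F z * dbar (?X R) z) * k z) = cmod (F z) * cmod (dbar (?X R) z) * cmod (k z)"
          using True by (simp add: norm_mult)
        also have "\<dots> \<le> (\<epsilon> * (cmod z)\<^sup>2) * (C0 / R) * (4 * (M * (M + 1)) / cmod z ^ 3)"
          by (intro mult_mono Fz kz dbR Rp) (use \<epsilon> C0 Rp in auto)
        also have "\<dots> = \<epsilon> * C1 / (R * cmod z)" using zp by (simp add: C1_def power2_eq_square power3_eq_cube)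
        also have "\<dots> \<le> \<epsilon> * C1 / (R * R)" using zR Rp \<epsilon> C1 by (intro frac_le mult_left_mono) auto
        finally show ?thesis using zK by (simp add: power2_eq_square)
      qed (use \<epsilon> C1 in auto)
      have Ki: "integrable lborel (\<lambda>z. indicator c.K z * (\<epsilon> * C1 / R\<^sup>2))"
        using borel_integrable_compact[OF c.compact_K, of "\<lambda>_. \<epsilon> * C1 / R\<^sup>2"] by simp
      have mK: "measure lborel c.K = (4 * R) * (4 * R)"
        using Rp by (simp add: c.K_def measure_lborel_cbox_eq Basis_complex_def)
      have "norm (A R) \<le> (LINT z|lborel. norm (indicator upper_half_plane z *\<^sub>R (F z * dbar (?X R) z) * k z))"
        unfolding A_def by (rule Bochner_Integration.integral_norm_bound)
      also have "\<dots> \<le> (LINT z|lborel. indicator c.K z * (\<epsilon> * C1 / R\<^sup>2))"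
      proof (rule integral_mono')
        show "integrable lborel (\<lambda>z. indicator c.K z * (\<epsilon> * C1 / R\<^sup>2))" by (rule Ki)
        show "0 \<le> indicator c.K z * (\<epsilon> * C1 / R\<^sup>2)" for z using \<epsilon> C1 by simp
      qed (rule pt)
      also have "\<dots> = measure lborel c.K * (\<epsilon> * C1 / R\<^sup>2)" by simp
      also have "\<dots> = 16 * \<epsilon> * C1" unfolding mK using Rp by (simp add: power2_eq_square)
      also have "\<dots> = e * (C1 / (2 * (C1 + 1)))"
      proof -
        have "C1 + 1 \<noteq> 0" using C1 by simp
        then show ?thesis by (simp add: \<epsilon>_def divide_simps del: distrib_left_numeral)
      qed
      also have "\<dots> < e * 1" using C1 e by (intro mult_strict_left_mono) (simp_all add: divide_less_eq)
      finally show ?thesis by simp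
    qed
    moreover have "\<exists>n0. \<forall>n\<ge>n0. real n + 1 \<ge> R0 \<and> real n + 1 \<ge> 2 * (M + 1)"
    proof (intro exI[of _ "nat \<lceil>R0\<rceil> + nat \<lceil>2 * (M + 1)\<rceil>"] allI impI conjI)
      fix n assume n: "nat \<lceil>R0\<rceil> + nat \<lceil>2 * (M + 1)\<rceil> \<le> n"
      have "real (nat \<lceil>R0\<rceil>) \<le> real n" "real (nat \<lceil>2 * (M + 1)\<rceil>) \<le> real n"
        using add_leD1[OF n] add_leD2[OF n] by (simp_all only: of_nat_le_iff)
      then show "R0 \<le> real n + 1" "2 * (M + 1) \<le> real n + 1"
        using real_nat_ceiling_ge[of R0] real_nat_ceiling_ge[of "2 * (M + 1)"] by argo+
    qed
    ultimately show "\<exists>n0. \<forall>n\<ge>n0. norm (A (real n + 1) - 0) < e" by (metis diff_zero)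
  qed
  have "(\<lambda>n. - 2 * Re (A (real n + 1) + B (real n + 1))) \<longlonglongrightarrow> - 2 * Re (0 + V (of_real x))"
    by (intro tendsto_intros Alim Blim)
  moreover have "\<forall>\<^sub>F n in sequentially. - 2 * Re (A (real n + 1) + B (real n + 1)) = pi * (f x - (1 - x) * f 0 - x * f 1)"
    using eventually_ge_at_top[of "nat \<lceil>\<bar>x\<bar> + 2\<rceil>"]
  proof eventually_elim
    case (elim n)
    then have "\<bar>x\<bar> + 2 \<le> real n + 1" by linarith
    from AB[OF this] show ?case by (rule sym)
  qed
  ultimately have "(\<lambda>n. pi * (f x - (1 - x) * f 0 - x * f 1)) \<longlonglongrightarrow> - 2 * Re (0 + V (of_real x))"
    by (rule Lim_transform_eventually)
  then have "pi * (f x - (1 - x) * f 0 - x * f 1) = - 2 * Re (V (of_real x))" by (simp add: LIMSEQ_const_iff)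
  then have "pi * (f x - (1 - x) * f 0 - x * f 1) / pi = - 2 * Re (V (of_real x)) / pi" by (simp only:)
  then have "f x - (1 - x) * f 0 - x * f 1 = - 2 * Re (V (of_real x)) / pi" by (simp only: nonzero_mult_div_cancel_left[OF pi_neq_zero])
  then show ?thesis by simp
qed

end

section \<open>Holomorphy of the potential in the lower half-plane\<close>

lemma has_field_derivative_quadratic:
  fixes g :: "complex \<Rightarrow> complex"
  assumes r: "r > 0" and b: "\<And>\<delta>. cmod \<delta> < r \<Longrightarrow> cmod (g (\<zeta> + \<delta>) - g \<zeta> - \<delta> * D) \<le> C * (cmod \<delta>)\<^sup>2"
  shows "(g has_field_derivative D) (at \<zeta>)"
proof -
  have "((\<lambda>\<delta>. (g (\<zeta> + \<delta>) - g \<zeta>) / \<delta> - D) \<longlongrightarrow> 0) (at 0)"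
  proof (rule Lim_null_comparison)
    have "\<forall>\<^sub>F \<delta> in at (0::complex). cmod \<delta> < r \<and> \<delta> \<noteq> 0"
      unfolding eventually_at using r by (intro exI[of _ r]) (auto simp: dist_norm)
    then show "\<forall>\<^sub>F \<delta> in at 0. norm ((g (\<zeta> + \<delta>) - g \<zeta>) / \<delta> - D) \<le> C * cmod \<delta>"
    proof eventually_elim
      case (elim \<delta>)
      then have "(g (\<zeta> + \<delta>) - g \<zeta>) / \<delta> - D = (g (\<zeta> + \<delta>) - g \<zeta> - \<delta> * D) / \<delta>" by (simp add: diff_divide_distrib)
      then have "norm ((g (\<zeta> + \<delta>) - g \<zeta>) / \<delta> - D) = cmod (g (\<zeta> + \<delta>) - g \<zeta> - \<delta> * D) / cmod \<delta>" by (simp add: norm_divide)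
      also have "\<dots> \<le> C * (cmod \<delta>)\<^sup>2 / cmod \<delta>" using b elim by (intro divide_right_mono) auto
      finally show ?case using elim by (simp add: power2_eq_square)
    qed
    have "((\<lambda>\<delta>::complex. C * cmod \<delta>) \<longlongrightarrow> C * cmod 0) (at 0)" by (intro tendsto_intros)
    then show "((\<lambda>\<delta>::complex. C * cmod \<delta>) \<longlongrightarrow> 0) (at 0)" by simp
  qed
  then have "((\<lambda>\<delta>. (g (\<zeta> + \<delta>) - g \<zeta>) / \<delta>) \<longlongrightarrow> D) (at 0)" by (simp add: LIM_zero_iff)
  then show ?thesis by (simp add: DERIV_def)
qed

text \<open>\<open>1 + cmod w\<close> is at most \<open>cmod (w - \<zeta>)\<close> plus
  \<open>1 + M\<close>, and the depth \<eta> converts this constant into a multiple of the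
  distance.\<close>

lemma lower_dist:
  assumes "Im \<zeta> \<le> - \<eta>" "\<eta> > 0" "cmod \<zeta> \<le> M" "w \<in> upper_half_plane"
  shows "\<eta> \<le> cmod (w - \<zeta>)" "1 + cmod w \<le> (1 + (1 + M) / \<eta>) * cmod (w - \<zeta>)"
proof -
  have M: "0 \<le> M" using assms(3) norm_ge_zero[of \<zeta>] by linarith
  show 1: "\<eta> \<le> cmod (w - \<zeta>)" using abs_Im_le_cmod[of "w - \<zeta>"] assms by (simp add: upper_half_plane_def)
  have "(1 + M) / \<eta> * \<eta> \<le> (1 + M) / \<eta> * cmod (w - \<zeta>)" using 1 M assms(2) by (intro mult_left_mono) auto
  then have "1 + M \<le> (1 + M) / \<eta> * cmod (w - \<zeta>)" using assms(2) by simp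
  moreover have "cmod w \<le> cmod (w - \<zeta>) + M" using norm_triangle_sub[of w \<zeta>] assms(3) by simp
  ultimately show "1 + cmod w \<le> (1 + (1 + M) / \<eta>) * cmod (w - \<zeta>)" by (simp add: distrib_right)
qed

text \<open>Three factors suffice: \<open>Im w * (1 + (cmod w)^2)\<close> is at most the cube of
  \<open>1 + cmod w\<close>, and each power is paid by one pole through
  \<open>lower_dist\<close>.\<close>

lemma inverse_cubic_bound:
  assumes \<zeta>: "\<And>\<zeta>. \<zeta> \<in> {a, b, c} \<Longrightarrow> Im \<zeta> \<le> - \<eta> \<and> cmod \<zeta> \<le> M" and \<eta>: "\<eta> > 0" and w: "w \<in> upper_half_plane"
  shows "cmod (1 / ((w - a) * (w - b) * (w - c))) * Im w * (1 + (cmod w)\<^sup>2) \<le> (1 + (1 + M) / \<eta>) ^ 3"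
proof -
  define L where "L = 1 + (1 + M) / \<eta>"
  have d: "\<eta> \<le> cmod (w - \<zeta>)" "1 + cmod w \<le> L * cmod (w - \<zeta>)" if "\<zeta> \<in> {a, b, c}" for \<zeta>
    using lower_dist[OF _ \<eta> _ w, of \<zeta> M] \<zeta>[OF that] by (auto simp: L_def)
  have p: "cmod (w - a) > 0" "cmod (w - b) > 0" "cmod (w - c) > 0" using d(1)[of a] d(1)[of b] d(1)[of c] \<eta> by auto
  have L0: "0 \<le> L"
  proof -
    have "0 < L * cmod (w - a)" using d(2)[of a] norm_ge_zero[of w] by (simp add: less_le_trans[rotated] add_pos_nonneg)
    then show ?thesis using p(1) by (simp add: zero_less_mult_iff)
  qed
  have v: "0 < Im w" "Im w \<le> 1 + cmod w" using w abs_Im_le_cmod[of w] by (auto simp: upper_half_plane_def)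
  have "Im w * (1 + (cmod w)\<^sup>2) \<le> (1 + cmod w) * ((1 + cmod w) * (1 + cmod w))"
    using v by (intro mult_mono) (auto simp: power2_eq_square algebra_simps)
  also have "\<dots> \<le> (L * cmod (w - a)) * ((L * cmod (w - b)) * (L * cmod (w - c)))"
    using d(2)[of a] d(2)[of b] d(2)[of c] L0 by (intro mult_mono mult_nonneg_nonneg) auto
  also have "\<dots> = L ^ 3 * (cmod (w - a) * cmod (w - b) * cmod (w - c))" by (simp add: power3_eq_cube)
  finally have "Im w * (1 + (cmod w)\<^sup>2) / (cmod (w - a) * cmod (w - b) * cmod (w - c)) \<le> L ^ 3"
    using p by (simp add: pos_divide_le_eq)
  then show ?thesis by (simp add: norm_divide norm_mult L_def mult_ac)
qed

context extension
begin

text \<open>The summands \<open>1 / w - 1 / (w - 1)\<close> are the contribution of the linear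
  interpolation in \<open>ckernel\<close>; being independent of \<zeta>, they disappear from
  \<open>V2\<close>.\<close>

definition V1 :: "complex \<Rightarrow> complex" where
  "V1 \<zeta> = (LINT w|lborel. h0 w * (1 / (w - \<zeta>)\<^sup>2 + 1 / w - 1 / (w - 1)))"

definition V2 :: "complex \<Rightarrow> complex" where
  "V2 \<zeta> = (LINT w|lborel. h0 w * (2 / (w - \<zeta>) ^ 3))"

lemma dom_kernel_integral_bound:
  assumes b: "\<And>w. w \<in> upper_half_plane \<Longrightarrow> cmod (k w) * Im w * (1 + (cmod w)\<^sup>2) \<le> C" and C: "C \<ge> 0"
    and m: "k \<in> borel_measurable borel"
  shows "cmod (LINT w|lborel. h0 w * k w) \<le> C * integral\<^sup>L lborel dom"
proof -
  have "cmod (LINT w|lborel. h0 w * k w) \<le> (LINT w|lborel. cmod (h0 w * k w))"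
    by (rule Bochner_Integration.integral_norm_bound)
  also have "\<dots> \<le> (LINT w|lborel. C * dom w)"
  proof (rule integral_mono)
    show "integrable lborel (\<lambda>w. cmod (h0 w * k w))" using dom_kernel_integrable[OF b C m] by (rule integrable_norm)
    show "integrable lborel (\<lambda>w. C * dom w)" using dom_integrable by simp
    show "cmod (h0 w * k w) \<le> C * dom w" for w by (rule dom_bound[OF b C])
  qed
  also have "\<dots> = C * integral\<^sup>L lborel dom" by simp
  finally show ?thesis .
qed

lemma cubic_integral:
  assumes \<zeta>: "\<And>\<zeta>. \<zeta> \<in> {a, b, c} \<Longrightarrow> Im \<zeta> \<le> - \<eta> \<and> cmod \<zeta> \<le> M" and \<eta>: "\<eta> > 0" and M: "M \<ge> 0"
  shows "integrable lborel (\<lambda>w. h0 w * (1 / ((w - a) * (w - b) * (w - c))))"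
    "cmod (LINT w|lborel. h0 w * (1 / ((w - a) * (w - b) * (w - c)))) \<le> (1 + (1 + M) / \<eta>) ^ 3 * integral\<^sup>L lborel dom"
proof -
  have L: "0 \<le> (1 + (1 + M) / \<eta>) ^ 3" using \<eta> M by simp
  note b = inverse_cubic_bound[OF \<zeta> \<eta>]
  show "integrable lborel (\<lambda>w. h0 w * (1 / ((w - a) * (w - b) * (w - c))))"
    by (rule dom_kernel_integrable[OF b L]) auto
  show "cmod (LINT w|lborel. h0 w * (1 / ((w - a) * (w - b) * (w - c)))) \<le> (1 + (1 + M) / \<eta>) ^ 3 * integral\<^sup>L lborel dom"
    by (rule dom_kernel_integral_bound[OF b L]) auto
qed

lemma near_point:
  assumes "Im \<zeta> = - 2 * \<eta>" "cmod \<delta> < \<eta>"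
  shows "Im (\<zeta> + \<delta>) \<le> - \<eta> \<and> cmod (\<zeta> + \<delta>) \<le> cmod \<zeta> + \<eta>"
  using abs_Im_le_cmod[of \<delta>] norm_triangle_ineq[of \<zeta> \<delta>] assms by auto

text \<open>Second-order Taylor remainder in \<delta>. The letters \<open>p\<close> and
  \<open>q\<close> stand for the fractions at the two nodes; their terms are affine in \<zeta> and
  cancel.\<close>

lemma remainder_identity1:
  fixes a \<delta> p q :: complex
  assumes "a \<noteq> 0" "a - \<delta> \<noteq> 0"
  shows "(1 / (a - \<delta>) - (1 - (\<zeta> + \<delta>)) * p - (\<zeta> + \<delta>) * q) - (1 / a - (1 - \<zeta>) * p - \<zeta> * q) - \<delta> * (1 / a\<^sup>2 + p - q) = \<delta>\<^sup>2 * (1 / (a * a * (a - \<delta>)))"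
proof -
  have "1 / (a - \<delta>) - 1 / a - \<delta> * (1 / a\<^sup>2) = \<delta>\<^sup>2 * (1 / (a * a * (a - \<delta>)))"
    using assms by (simp add: divide_simps) (simp add: algebra_simps power2_eq_square)
  then show ?thesis by (simp add: algebra_simps)
qed

lemma remainder_identity2:
  fixes a \<delta> p q :: complex
  assumes "a \<noteq> 0" "a - \<delta> \<noteq> 0"
  shows "(1 / (a - \<delta>)\<^sup>2 + p - q) - (1 / a\<^sup>2 + p - q) - \<delta> * (2 / a ^ 3) = \<delta>\<^sup>2 * (1 / (a * a * (a - \<delta>)) * (1 / (a - \<delta>) + 2 / a))"
proof -
  define b p q where "b = a - \<delta>" and "p = 1 / a" and "q = 1 / b"
  \<comment> \<open>With the reciprocals as unknowns the claim is a polynomial identity modulo these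
    two equations.\<close>
  have "a * p = 1" "b * q = 1" using assms by (simp_all add: b_def p_def q_def)
  then have "q\<^sup>2 - p\<^sup>2 - (a - b) * (2 * p ^ 3) = (a - b)\<^sup>2 * (p * p * q * (q + 2 * p))" by algebra
  moreover have "\<delta> = a - b" by (simp add: b_def)
  ultimately show ?thesis by (simp add: b_def[symmetric] p_def q_def power_one_over)
qed

text \<open>The kernel is not of the product form covered by \<open>cubic_integral\<close>. It is
  recovered from a difference quotient of \<open>ckernel\<close> and a cubic remainder, for one
  fixed nonzero \<delta>.\<close>

lemma V1_integrable:
  assumes "Im \<zeta> < 0"
  shows "integrable lborel (\<lambda>w. h0 w * (1 / (w - \<zeta>)\<^sup>2 + 1 / w - 1 / (w - 1)))"
proof -
  define \<eta> where "\<eta> = - Im \<zeta> / 2"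
  have \<eta>: "\<eta> > 0" "Im \<zeta> = - 2 * \<eta>" using assms by (auto simp: \<eta>_def)
  define \<delta> where "\<delta> = complex_of_real (\<eta> / 2)"
  have \<delta>: "cmod \<delta> < \<eta>" "\<delta> \<noteq> 0" using \<eta> by (auto simp: \<delta>_def)
  note n = near_point[OF \<eta>(2) \<delta>(1)] near_point[OF \<eta>(2), of 0]
  have c: "integrable lborel (\<lambda>w. h0 w * (1 / ((w - \<zeta>) * (w - \<zeta>) * (w - (\<zeta> + \<delta>)))))"
    by (rule cubic_integral(1)[where \<eta>=\<eta> and M="cmod \<zeta> + \<eta>"]) (use n \<eta> in auto)
  have i: "integrable lborel (\<lambda>w. h0 w * ckernel (\<zeta> + \<delta>) w)" "integrable lborel (\<lambda>w. h0 w * ckernel \<zeta> w)"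
    using n \<eta> by (auto intro!: V_integrable)
  have "integrable lborel (\<lambda>w. (1 / \<delta>) * (h0 w * ckernel (\<zeta> + \<delta>) w - h0 w * ckernel \<zeta> w - \<delta>\<^sup>2 * (h0 w * (1 / ((w - \<zeta>) * (w - \<zeta>) * (w - (\<zeta> + \<delta>)))))))"
    by (intro integrable_mult_right Bochner_Integration.integrable_diff i c)
  moreover have "(1 / \<delta>) * (h0 w * ckernel (\<zeta> + \<delta>) w - h0 w * ckernel \<zeta> w - \<delta>\<^sup>2 * (h0 w * (1 / ((w - \<zeta>) * (w - \<zeta>) * (w - (\<zeta> + \<delta>))))))
     = h0 w * (1 / (w - \<zeta>)\<^sup>2 + 1 / w - 1 / (w - 1))" for w
  proof (cases "w \<in> upper_half_plane")
    case True
    have nz: "w - \<zeta> \<noteq> 0" "w - \<zeta> - \<delta> \<noteq> 0"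
      using lower_dist(1)[of \<zeta> \<eta> "cmod \<zeta> + \<eta>" w] lower_dist(1)[of "\<zeta> + \<delta>" \<eta> "cmod \<zeta> + \<eta>" w] n \<eta> True
      by (auto simp: diff_diff_add)
    have "ckernel (\<zeta> + \<delta>) w - ckernel \<zeta> w - \<delta> * (1 / (w - \<zeta>)\<^sup>2 + 1 / w - 1 / (w - 1)) = \<delta>\<^sup>2 * (1 / ((w - \<zeta>) * (w - \<zeta>) * (w - (\<zeta> + \<delta>))))"
      using remainder_identity1[OF nz, of \<zeta> "1 / w" "1 / (w - 1)"] by (simp add: ckernel_def diff_diff_add)
    then have e: "ckernel (\<zeta> + \<delta>) w - ckernel \<zeta> w - \<delta>\<^sup>2 * (1 / ((w - \<zeta>) * (w - \<zeta>) * (w - (\<zeta> + \<delta>)))) = \<delta> * (1 / (w - \<zeta>)\<^sup>2 + 1 / w - 1 / (w - 1))"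
      by (metis diff_diff_eq2 diff_add_cancel add_diff_cancel_left' diff_eq_eq)
    have "(1 / \<delta>) * (h0 w * ckernel (\<zeta> + \<delta>) w - h0 w * ckernel \<zeta> w - \<delta>\<^sup>2 * (h0 w * (1 / ((w - \<zeta>) * (w - \<zeta>) * (w - (\<zeta> + \<delta>))))))
      = (1 / \<delta>) * h0 w * (ckernel (\<zeta> + \<delta>) w - ckernel \<zeta> w - \<delta>\<^sup>2 * (1 / ((w - \<zeta>) * (w - \<zeta>) * (w - (\<zeta> + \<delta>)))))"
      by (simp only: right_diff_distrib mult_ac)
    also have "\<dots> = h0 w * (1 / (w - \<zeta>)\<^sup>2 + 1 / w - 1 / (w - 1))" unfolding e using \<delta>(2) by simp
    finally show ?thesis .
  qed (simp add: h0_def)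
  ultimately show ?thesis by simp
qed

lemma V_derivative:
  assumes "Im \<zeta> < 0"
  shows "(V has_field_derivative V1 \<zeta>) (at \<zeta>)"
proof -
  define \<eta> where "\<eta> = - Im \<zeta> / 2"
  have \<eta>: "\<eta> > 0" "Im \<zeta> = - 2 * \<eta>" using assms by (auto simp: \<eta>_def)
  show ?thesis
  proof (rule has_field_derivative_quadratic[OF \<eta>(1)])
    fix \<delta> assume \<delta>: "cmod \<delta> < \<eta>"
    note n = near_point[OF \<eta>(2) \<delta>] near_point[OF \<eta>(2), of 0]
    let ?q = "\<lambda>w. h0 w * (1 / ((w - \<zeta>) * (w - \<zeta>) * (w - (\<zeta> + \<delta>))))"
    have c: "integrable lborel ?q" "cmod (integral\<^sup>L lborel ?q) \<le> (1 + (1 + (cmod \<zeta> + \<eta>)) / \<eta>) ^ 3 * integral\<^sup>L lborel dom"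
      by (rule cubic_integral[where \<eta>=\<eta> and M="cmod \<zeta> + \<eta>"]; use n \<eta> in auto)+
    have i: "integrable lborel (\<lambda>w. h0 w * ckernel (\<zeta> + \<delta>) w)" "integrable lborel (\<lambda>w. h0 w * ckernel \<zeta> w)"
      using n \<eta> by (auto intro!: V_integrable)
    note i1 = V1_integrable[OF assms]
    have "V (\<zeta> + \<delta>) - V \<zeta> - \<delta> * V1 \<zeta> = (LINT w|lborel. h0 w * ckernel (\<zeta> + \<delta>) w - 1 * (h0 w * ckernel \<zeta> w) - \<delta> * (h0 w * (1 / (w - \<zeta>)\<^sup>2 + 1 / w - 1 / (w - 1))))"
      unfolding V_def V1_def using i i1 by simp
    also have "\<dots> = (LINT w|lborel. \<delta>\<^sup>2 * ?q w)"
    proof (intro Bochner_Integration.integral_cong refl)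
      fix w
      show "h0 w * ckernel (\<zeta> + \<delta>) w - 1 * (h0 w * ckernel \<zeta> w) - \<delta> * (h0 w * (1 / (w - \<zeta>)\<^sup>2 + 1 / w - 1 / (w - 1))) = \<delta>\<^sup>2 * ?q w"
      proof (cases "w \<in> upper_half_plane")
        case True
        have nz: "w - \<zeta> \<noteq> 0" "w - \<zeta> - \<delta> \<noteq> 0"
          using lower_dist(1)[of \<zeta> \<eta> "cmod \<zeta> + \<eta>" w] lower_dist(1)[of "\<zeta> + \<delta>" \<eta> "cmod \<zeta> + \<eta>" w] n \<eta> True
          by (auto simp: diff_diff_add)
        have e: "ckernel (\<zeta> + \<delta>) w - ckernel \<zeta> w - \<delta> * (1 / (w - \<zeta>)\<^sup>2 + 1 / w - 1 / (w - 1)) = \<delta>\<^sup>2 * (1 / ((w - \<zeta>) * (w - \<zeta>) * (w - (\<zeta> + \<delta>))))"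
          using remainder_identity1[OF nz, of \<zeta> "1 / w" "1 / (w - 1)"] by (simp add: ckernel_def diff_diff_add)
        have "h0 w * ckernel (\<zeta> + \<delta>) w - 1 * (h0 w * ckernel \<zeta> w) - \<delta> * (h0 w * (1 / (w - \<zeta>)\<^sup>2 + 1 / w - 1 / (w - 1)))
          = h0 w * (ckernel (\<zeta> + \<delta>) w - ckernel \<zeta> w - \<delta> * (1 / (w - \<zeta>)\<^sup>2 + 1 / w - 1 / (w - 1)))"
          by (simp only: right_diff_distrib mult_1 mult.left_commute[of \<delta>])
        then show ?thesis unfolding e by (simp only: mult.left_commute)
      qed (simp add: h0_def)
    qed
    also have "\<dots> = \<delta>\<^sup>2 * integral\<^sup>L lborel ?q" by (rule integral_mult_right_zero)
    finally have "cmod (V (\<zeta> + \<delta>) - V \<zeta> - \<delta> * V1 \<zeta>) = (cmod \<delta>)\<^sup>2 * cmod (integral\<^sup>L lborel ?q)" by (simp only: norm_mult norm_power)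
    also have "\<dots> \<le> (cmod \<delta>)\<^sup>2 * ((1 + (1 + (cmod \<zeta> + \<eta>)) / \<eta>) ^ 3 * integral\<^sup>L lborel dom)"
      by (rule mult_left_mono[OF c(2)]) simp
    finally show "cmod (V (\<zeta> + \<delta>) - V \<zeta> - \<delta> * V1 \<zeta>) \<le> ((1 + (1 + (cmod \<zeta> + \<eta>)) / \<eta>) ^ 3 * integral\<^sup>L lborel dom) * (cmod \<delta>)\<^sup>2"
      by (simp only: mult.commute)
  qed
qed

lemma V1_derivative:
  assumes "Im \<zeta> < 0"
  shows "(V1 has_field_derivative V2 \<zeta>) (at \<zeta>)"
proof -
  define \<eta> where "\<eta> = - Im \<zeta> / 2"
  have \<eta>: "\<eta> > 0" "Im \<zeta> = - 2 * \<eta>" using assms by (auto simp: \<eta>_def)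
  \<comment> \<open>Compared with the cubic kernel, the remainder has the extra factor
    \<open>1 / (w - (\<zeta> + \<delta>)) + 2 / (w - \<zeta>)\<close>, whose modulus is at most
    \<open>3 / \<eta>\<close>.\<close>
  define C where "C = (1 + (1 + (cmod \<zeta> + \<eta>)) / \<eta>) ^ 3 * (3 / \<eta>)"
  have C0: "C \<ge> 0" using \<eta>(1) by (simp add: C_def)
  show ?thesis
  proof (rule has_field_derivative_quadratic[OF \<eta>(1)])
    fix \<delta> assume \<delta>: "cmod \<delta> < \<eta>"
    note n = near_point[OF \<eta>(2) \<delta>] near_point[OF \<eta>(2), of 0]
    let ?k = "\<lambda>w. 1 / ((w - \<zeta>) * (w - \<zeta>) * (w - (\<zeta> + \<delta>))) * (1 / (w - (\<zeta> + \<delta>)) + 2 / (w - \<zeta>))"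
    have kb: "cmod (?k w) * Im w * (1 + (cmod w)\<^sup>2) \<le> C" if w: "w \<in> upper_half_plane" for w
    proof -
      have l: "\<eta> \<le> cmod (w - \<zeta>)" "\<eta> \<le> cmod (w - (\<zeta> + \<delta>))"
        using lower_dist(1)[of \<zeta> \<eta> "cmod \<zeta> + \<eta>" w] lower_dist(1)[of "\<zeta> + \<delta>" \<eta> "cmod \<zeta> + \<eta>" w] n \<eta> w by auto
      have "cmod (1 / (w - (\<zeta> + \<delta>)) + 2 / (w - \<zeta>)) \<le> 1 / cmod (w - (\<zeta> + \<delta>)) + 2 / cmod (w - \<zeta>)"
        using norm_triangle_ineq[of "1 / (w - (\<zeta> + \<delta>))" "2 / (w - \<zeta>)"] by (simp add: norm_divide)
      also have "\<dots> \<le> 1 / \<eta> + 2 / \<eta>" using l \<eta>(1) by (intro add_mono frac_le) auto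
      finally have k2: "cmod (1 / (w - (\<zeta> + \<delta>)) + 2 / (w - \<zeta>)) \<le> 3 / \<eta>" by simp
      have k1: "cmod (1 / ((w - \<zeta>) * (w - \<zeta>) * (w - (\<zeta> + \<delta>)))) * Im w * (1 + (cmod w)\<^sup>2) \<le> (1 + (1 + (cmod \<zeta> + \<eta>)) / \<eta>) ^ 3"
        by (rule inverse_cubic_bound[OF _ \<eta>(1) w]) (use n \<eta> in auto)
      have "cmod (?k w) * Im w * (1 + (cmod w)\<^sup>2) = (cmod (1 / ((w - \<zeta>) * (w - \<zeta>) * (w - (\<zeta> + \<delta>)))) * Im w * (1 + (cmod w)\<^sup>2)) * cmod (1 / (w - (\<zeta> + \<delta>)) + 2 / (w - \<zeta>))"
        by (simp only: norm_mult mult_ac)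
      also have "\<dots> \<le> C" unfolding C_def
        using w \<eta>(1) by (intro mult_mono k1 k2) auto
      finally show ?thesis .
    qed
    have i3: "integrable lborel (\<lambda>w. h0 w * (2 / (w - \<zeta>) ^ 3))"
    proof -
      have "integrable lborel (\<lambda>w. h0 w * (1 / ((w - \<zeta>) * (w - \<zeta>) * (w - \<zeta>))))"
        by (rule cubic_integral(1)[where \<eta>=\<eta> and M="cmod \<zeta> + \<eta>"]) (use n \<eta> in auto)
      from integrable_mult_right[OF this, of 2] show ?thesis by (simp add: power3_eq_cube mult_ac)
    qed
    have i: "integrable lborel (\<lambda>w. h0 w * (1 / (w - (\<zeta> + \<delta>))\<^sup>2 + 1 / w - 1 / (w - 1)))" "integrable lborel (\<lambda>w. h0 w * (1 / (w - \<zeta>)\<^sup>2 + 1 / w - 1 / (w - 1)))"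
      using n \<eta> by (auto intro!: V1_integrable)
    have "V1 (\<zeta> + \<delta>) - V1 \<zeta> - \<delta> * V2 \<zeta> = (LINT w|lborel. h0 w * (1 / (w - (\<zeta> + \<delta>))\<^sup>2 + 1 / w - 1 / (w - 1)) - 1 * (h0 w * (1 / (w - \<zeta>)\<^sup>2 + 1 / w - 1 / (w - 1))) - \<delta> * (h0 w * (2 / (w - \<zeta>) ^ 3)))"
      unfolding V1_def V2_def integral_diff3[OF i i3] by simp
    also have "\<dots> = (LINT w|lborel. \<delta>\<^sup>2 * (h0 w * ?k w))"
    proof (intro Bochner_Integration.integral_cong refl)
      fix w
      show "h0 w * (1 / (w - (\<zeta> + \<delta>))\<^sup>2 + 1 / w - 1 / (w - 1)) - 1 * (h0 w * (1 / (w - \<zeta>)\<^sup>2 + 1 / w - 1 / (w - 1))) - \<delta> * (h0 w * (2 / (w - \<zeta>) ^ 3)) = \<delta>\<^sup>2 * (h0 w * ?k w)"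
      proof (cases "w \<in> upper_half_plane")
        case True
        have nz: "w - \<zeta> \<noteq> 0" "w - \<zeta> - \<delta> \<noteq> 0"
          using lower_dist(1)[of \<zeta> \<eta> "cmod \<zeta> + \<eta>" w] lower_dist(1)[of "\<zeta> + \<delta>" \<eta> "cmod \<zeta> + \<eta>" w] n \<eta> True
          by (auto simp: diff_diff_add)
        have e: "(1 / (w - (\<zeta> + \<delta>))\<^sup>2 + 1 / w - 1 / (w - 1)) - (1 / (w - \<zeta>)\<^sup>2 + 1 / w - 1 / (w - 1)) - \<delta> * (2 / (w - \<zeta>) ^ 3) = \<delta>\<^sup>2 * ?k w"
          using remainder_identity2[OF nz, of "1 / w" "1 / (w - 1)"] by (simp only: diff_diff_add)
        have "h0 w * (1 / (w - (\<zeta> + \<delta>))\<^sup>2 + 1 / w - 1 / (w - 1)) - 1 * (h0 w * (1 / (w - \<zeta>)\<^sup>2 + 1 / w - 1 / (w - 1))) - \<delta> * (h0 w * (2 / (w - \<zeta>) ^ 3))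
          = h0 w * ((1 / (w - (\<zeta> + \<delta>))\<^sup>2 + 1 / w - 1 / (w - 1)) - (1 / (w - \<zeta>)\<^sup>2 + 1 / w - 1 / (w - 1)) - \<delta> * (2 / (w - \<zeta>) ^ 3))"
          by (simp only: right_diff_distrib mult_1 mult.left_commute[of \<delta>])
        then show ?thesis unfolding e by (simp only: mult.left_commute)
      qed (simp add: h0_def)
    qed
    also have "\<dots> = \<delta>\<^sup>2 * (LINT w|lborel. h0 w * ?k w)" by (rule integral_mult_right_zero)
    finally have "cmod (V1 (\<zeta> + \<delta>) - V1 \<zeta> - \<delta> * V2 \<zeta>) = (cmod \<delta>)\<^sup>2 * cmod (LINT w|lborel. h0 w * ?k w)" by (simp only: norm_mult norm_power)
    also have "\<dots> \<le> (cmod \<delta>)\<^sup>2 * (C * integral\<^sup>L lborel dom)"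
      by (intro mult_left_mono dom_kernel_integral_bound kb C0) auto
    finally show "cmod (V1 (\<zeta> + \<delta>) - V1 \<zeta> - \<delta> * V2 \<zeta>) \<le> (C * integral\<^sup>L lborel dom) * (cmod \<delta>)\<^sup>2"
      by (simp only: mult.commute)
  qed
qed

text \<open>\<open>ckernel_bound\<close> is uniform up to the axis on bounded sets, so one multiple
  of \<open>dom\<close> dominates the whole sequence.\<close>

lemma V_vertical_limit:
  assumes y: "y \<longlonglongrightarrow> 0" "\<And>n. y n > 0"
  shows "(\<lambda>n. V (Complex x (- y n))) \<longlonglongrightarrow> V (of_real x)"
proof -
  obtain B where B: "\<And>n. y n \<le> B" using convergent_imp_bounded[OF y(1)] unfolding bounded_iff by (metis abs_le_D1 rangeI real_norm_def)
  define M where "M = \<bar>x\<bar> + \<bar>B\<bar>"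
  have "cmod (Complex x (- y n)) \<le> M" for n
  proof -
    have "cmod (Complex x (- y n)) \<le> \<bar>x\<bar> + \<bar>- y n\<bar>" using cmod_le[of "Complex x (- y n)"] by simp
    then show ?thesis using B[of n] y(2)[of n] by (simp add: M_def)
  qed
  note b = ckernel_bound[OF this]
  have M0: "0 \<le> M" by (simp add: M_def)
  show ?thesis unfolding V_def
  proof (rule integral_dominated_convergence)
  show "integrable lborel (\<lambda>w. ckernel_const M * dom w)" using dom_integrable by simp
  show "AE w in lborel. norm (h0 w * ckernel (Complex x (- y n)) w) \<le> ckernel_const M * dom w" for n
    by (intro AE_I2 dom_bound b ckernel_const_nonneg M0) (use y(2)[of n] in auto)
  show "AE w in lborel. (\<lambda>n. h0 w * ckernel (Complex x (- y n)) w) \<longlonglongrightarrow> h0 w * ckernel (of_real x) w"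
  proof (rule AE_I2)
    fix w
    show "(\<lambda>n. h0 w * ckernel (Complex x (- y n)) w) \<longlonglongrightarrow> h0 w * ckernel (of_real x) w"
    proof (cases "w \<in> upper_half_plane")
      case True
      have "(\<lambda>n. Complex x (- y n)) \<longlonglongrightarrow> Complex x (- 0)" by (intro tendsto_Complex tendsto_intros y)
      then have z: "(\<lambda>n. Complex x (- y n)) \<longlonglongrightarrow> of_real x" by (simp add: complex_of_real_def)
      have nz: "w - of_real x \<noteq> 0" using True by (auto simp: upper_half_plane_def complex_eq_iff)
      show ?thesis unfolding ckernel_def divide_inverse
        by (intro tendsto_mult tendsto_diff tendsto_const tendsto_inverse z nz)
    qed (simp add: h0_def)
  qed
  qed measurable
qed

lemma V2_measurable [measurable]: "V2 \<in> borel_measurable borel"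
  unfolding V2_def[abs_def] by measurable

lemma V2_bound:
  assumes "y > 0"
  shows "ennreal (cmod (V2 (Complex x (- y)))) \<le> (\<integral>\<^sup>+w. ennreal (2 * cmod (h0 w) / cmod (w - Complex x (- y)) ^ 3) \<partial>lborel)"
proof -
  have "ennreal (cmod (V2 (Complex x (- y)))) \<le> (\<integral>\<^sup>+w. ennreal (cmod (h0 w * (2 / (w - Complex x (- y)) ^ 3))) \<partial>lborel)"
  proof (cases "integrable lborel (\<lambda>w. h0 w * (2 / (w - Complex x (- y)) ^ 3))")
    case True
    then show ?thesis unfolding V2_def by (rule integral_norm_bound_ennreal)
  next
    case False
    then show ?thesis unfolding V2_def by (simp add: not_integrable_integral_eq)
  qed
  also have "\<dots> = (\<integral>\<^sup>+w. ennreal (2 * cmod (h0 w) / cmod (w - Complex x (- y)) ^ 3) \<partial>lborel)"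
    by (simp add: norm_mult norm_divide norm_power mult_ac)
  finally show ?thesis .
qed

end

section \<open>Integral estimates for the cubic kernel\<close>

text \<open>Fatou along the half-lines from \<open>1 / (n + 1)\<close> on; integrands that are
  singular at 0 can then be treated by primitives away from 0.\<close>

lemma nn_integral_open_le:
  fixes f :: "real \<Rightarrow> ennreal"
  assumes [measurable]: "f \<in> borel_measurable borel" and b: "\<And>a. a > 0 \<Longrightarrow> (\<integral>\<^sup>+y. f y * indicator {a..} y \<partial>lborel) \<le> B"
  shows "(\<integral>\<^sup>+y. f y * indicator {0<..} y \<partial>lborel) \<le> B"
proof -
  have "(\<integral>\<^sup>+y. f y * indicator {0<..} y \<partial>lborel) \<le> (\<integral>\<^sup>+y. liminf (\<lambda>n. f y * indicator {1 / (real n + 1)..} y) \<partial>lborel)"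
  proof (intro nn_integral_mono)
    fix y :: real
    show "f y * indicator {0<..} y \<le> liminf (\<lambda>n. f y * indicator {1 / (real n + 1)..} y)"
    proof (cases "y > 0")
      case True
      have "\<forall>\<^sub>F n in sequentially. f y \<le> f y * indicator {1 / (real n + 1)..} y"
        using eventually_ge_at_top[of "nat \<lceil>1 / y\<rceil>"]
      proof eventually_elim
        case (elim n)
        then have "1 / y \<le> real n" by linarith
        then have "1 / (real n + 1) \<le> y" using True by (simp add: field_simps)
        then show ?case by simp
      qed
      then have "f y \<le> liminf (\<lambda>n. f y * indicator {1 / (real n + 1)..} y)" by (rule Liminf_bounded)
      then show ?thesis using True by simp
    qed simp
  qed
  also have "\<dots> \<le> liminf (\<lambda>n. \<integral>\<^sup>+y. f y * indicator {1 / (real n + 1)..} y \<partial>lborel)"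
    by (rule nn_integral_liminf) measurable
  also have "\<dots> \<le> B"
    by (rule Liminf_le) (simp_all add: b)
  finally show ?thesis .
qed

text \<open>The primitive is \<open>2 / sqrt v * arctan (sqrt y / sqrt v)\<close>, whose total
  increase over the half-line is \<open>pi / sqrt v\<close>.\<close>

lemma nn_integral_inverse_sqrt_shift:
  assumes v: "v > 0"
  shows "(\<integral>\<^sup>+y. ennreal (1 / (sqrt y * (v + y))) * indicator {0<..} y \<partial>lborel) \<le> ennreal (pi / sqrt v)"
proof (rule nn_integral_open_le)
  fix a :: real assume a: "a > 0"
  define G where "G y = 2 / sqrt v * arctan (sqrt y / sqrt v)" for y
  have "(\<integral>\<^sup>+y. ennreal (1 / (sqrt y * (v + y))) * indicator {a..} y \<partial>lborel) = ennreal (2 / sqrt v * (pi / 2) - G a)"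
  proof (rule nn_integral_FTC_atLeast)
    fix y assume "a \<le> y"
    then have y: "y > 0" using a by simp
    have "(sqrt y / sqrt v)\<^sup>2 = y / v" using y v by (simp add: power_divide)
    moreover have "1 + y / v = (v + y) / v" using v by (simp add: add_divide_distrib)
    ultimately have d: "1 / (1 + (sqrt y / sqrt v)\<^sup>2) = v / (v + y)" by simp
    have "((\<lambda>y. sqrt y / sqrt v) has_real_derivative inverse (sqrt y) / 2 / sqrt v) (at y)"
      by (rule DERIV_cdivide[OF DERIV_real_sqrt[OF y]])
    from DERIV_cmult[OF DERIV_chain2[OF DERIV_arctan this], of "2 / sqrt v"]
    have Gd: "(G has_real_derivative 2 / sqrt v * ((1 / (1 + (sqrt y / sqrt v)\<^sup>2)) * (inverse (sqrt y) / 2 / sqrt v))) (at y)"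
      unfolding G_def inverse_eq_divide[of "1 + (sqrt y / sqrt v)\<^sup>2"] .
    have eq: "2 / sqrt v * ((1 / (1 + (sqrt y / sqrt v)\<^sup>2)) * (inverse (sqrt y) / 2 / sqrt v)) = 1 / (sqrt y * (v + y))"
    proof -
      have h: "2 / s * (s * s / q * (inverse t / 2 / s)) = 1 / (t * q)" if "s > 0" "t > 0" "q > 0" for s t q :: real
        using that by (simp add: field_simps)
      have "sqrt v * sqrt v = v" using v by simp
      then show ?thesis unfolding d using h[of "sqrt v" "sqrt y" "v + y"] y v by simp
    qed
    show "(G has_real_derivative 1 / (sqrt y * (v + y))) (at y)" using Gd unfolding eq .
    show "0 \<le> 1 / (sqrt y * (v + y))" using y v by simp
  next
    have "filterlim (\<lambda>y. 1 / sqrt v * sqrt y) at_top at_top"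
      by (rule filterlim_tendsto_pos_mult_at_top[OF tendsto_const _ sqrt_at_top]) (use v in simp)
    then have "filterlim (\<lambda>y. sqrt y / sqrt v) at_top at_top" by (simp only: times_divide_eq_left mult_1)
    then have "((\<lambda>y. arctan (sqrt y / sqrt v)) \<longlongrightarrow> pi / 2) at_top" by (rule filterlim_compose[OF tendsto_arctan_at_top])
    then show "(G \<longlongrightarrow> 2 / sqrt v * (pi / 2)) at_top" unfolding G_def by (intro tendsto_mult_left)
  qed measurable
  also have "\<dots> \<le> ennreal (pi / sqrt v)"
  proof (rule ennreal_leI)
    have "0 \<le> G a" using a v by (simp add: G_def zero_le_arctan_iff)
    then show "2 / sqrt v * (pi / 2) - G a \<le> pi / sqrt v" by simp
  qed
  finally show "(\<integral>\<^sup>+y. ennreal (1 / (sqrt y * (v + y))) * indicator {a..} y \<partial>lborel) \<le> ennreal (pi / sqrt v)" .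
qed measurable

lemma nn_integral_inverse_three_halves:
  assumes a: "a > 0"
  shows "(\<integral>\<^sup>+r. ennreal (1 / (r * sqrt r)) * indicator {a..} r \<partial>lborel) = ennreal (2 / sqrt a)"
proof -
  have "(\<integral>\<^sup>+r. ennreal (1 / (r * sqrt r)) * indicator {a..} r \<partial>lborel) = ennreal (0 - (- 2 / sqrt a))"
  proof (rule nn_integral_FTC_atLeast)
    fix y assume "a \<le> y"
    then have y: "y > 0" using a by simp
    have "sqrt y \<noteq> 0" using y by simp
    from DERIV_cmult[OF DERIV_inverse'[OF DERIV_real_sqrt[OF y] this], of "- 2"]
    have "((\<lambda>y. - 2 * inverse (sqrt y)) has_real_derivative - 2 * (- (inverse (sqrt y) * (inverse (sqrt y) / 2) * inverse (sqrt y)))) (at y)" .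
    also have "- 2 * (- (inverse (sqrt y) * (inverse (sqrt y) / 2) * inverse (sqrt y))) = 1 / (sqrt y * sqrt y * sqrt y)"
      by (simp only: divide_inverse inverse_mult_distrib) simp
    also have "sqrt y * sqrt y = y" using y by simp
    finally show "((\<lambda>y. - 2 / sqrt y) has_real_derivative 1 / (y * sqrt y)) (at y)" by (simp only: divide_inverse[of "- 2"])
    show "0 \<le> 1 / (y * sqrt y)" using y by simp
  next
    show "((\<lambda>y::real. - 2 / sqrt y) \<longlongrightarrow> 0) at_top"
      by (intro tendsto_divide_0[OF tendsto_const] filterlim_at_top_imp_at_infinity sqrt_at_top)
  qed measurable
  then show ?thesis by simp
qed

lemma nn_integral_inverse_sqrt_Icc:
  assumes r: "r > 0"
  shows "(\<integral>\<^sup>+y. ennreal (1 / sqrt y) * indicator {0<..r} y \<partial>lborel) \<le> ennreal (2 * sqrt r)"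
proof -
  have "(\<integral>\<^sup>+y. (ennreal (1 / sqrt y) * indicator {..r} y) * indicator {0<..} y \<partial>lborel) \<le> ennreal (2 * sqrt r)"
  proof (rule nn_integral_open_le)
    fix a :: real assume a: "a > 0"
    show "(\<integral>\<^sup>+y. (ennreal (1 / sqrt y) * indicator {..r} y) * indicator {a..} y \<partial>lborel) \<le> ennreal (2 * sqrt r)"
    proof (cases "a \<le> r")
      case True
      have "(\<integral>\<^sup>+y. (ennreal (1 / sqrt y) * indicator {..r} y) * indicator {a..} y \<partial>lborel) = (\<integral>\<^sup>+y. ennreal (1 / sqrt y) * indicator {a..r} y \<partial>lborel)"
        by (intro nn_integral_cong) (auto simp: indicator_def)
      also have "\<dots> = ennreal (2 * sqrt r - 2 * sqrt a)"
      proof (rule nn_integral_FTC_Icc)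
        fix y assume "y \<in> {a..r}"
        then have y: "y > 0" using a by simp
        have "2 * (inverse (sqrt y) / 2) = 1 / sqrt y" by (simp only: inverse_eq_divide) simp
        then show "((\<lambda>y. 2 * sqrt y) has_real_derivative 1 / sqrt y) (at y)"
          using DERIV_cmult[OF DERIV_real_sqrt[OF y], of 2] by (simp only:)
        show "0 \<le> 1 / sqrt y" using y by simp
      next
        show "a \<le> r" by (rule True)
      qed measurable
      also have "\<dots> \<le> ennreal (2 * sqrt r)" using a by (intro ennreal_leI) simp
      finally show ?thesis .
    next
      case False
      have "(\<integral>\<^sup>+y. (ennreal (1 / sqrt y) * indicator {..r} y) * indicator {a..} y \<partial>lborel) = (\<integral>\<^sup>+y. 0 \<partial>(lborel :: real measure))"
      proof (intro nn_integral_cong)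
        fix x
        have "\<not> (a \<le> x \<and> x \<le> r)" using False by linarith
        then show "(ennreal (1 / sqrt x) * indicator {..r} x) * indicator {a..} x = 0" by (auto simp: indicator_def)
      qed
      then show ?thesis by simp
    qed
  qed measurable
  also have "(\<integral>\<^sup>+y. (ennreal (1 / sqrt y) * indicator {..r} y) * indicator {0<..} y \<partial>lborel) = (\<integral>\<^sup>+y. ennreal (1 / sqrt y) * indicator {0<..r} y \<partial>lborel)"
    by (intro nn_integral_cong) (auto simp: indicator_def)
  finally show ?thesis .
qed

lemma nn_integral_poisson:
  assumes Y: "Y > 0"
  shows "(\<integral>\<^sup>+u. ennreal (1 / ((u - x)\<^sup>2 + Y\<^sup>2)) \<partial>lborel) = ennreal (pi / Y)"
proof -
  have "(\<integral>\<^sup>+u. ennreal (1 / ((u - x)\<^sup>2 + Y\<^sup>2)) \<partial>lborel) = ennreal \<bar>Y\<bar> * (\<integral>\<^sup>+s. ennreal (1 / ((x + Y * s - x)\<^sup>2 + Y\<^sup>2)) \<partial>lborel)"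
    by (rule nn_integral_real_affine) (use Y in auto)
  also have "(\<integral>\<^sup>+s. ennreal (1 / ((x + Y * s - x)\<^sup>2 + Y\<^sup>2)) \<partial>lborel) = (\<integral>\<^sup>+s. ennreal (1 / Y\<^sup>2) * ennreal (1 / (1 + s\<^sup>2)) \<partial>lborel)"
  proof (intro nn_integral_cong)
    fix s :: real
    have "(x + Y * s - x)\<^sup>2 + Y\<^sup>2 = Y\<^sup>2 * (1 + s\<^sup>2)" by (simp add: power2_eq_square algebra_simps)
    then have "1 / ((x + Y * s - x)\<^sup>2 + Y\<^sup>2) = 1 / Y\<^sup>2 * (1 / (1 + s\<^sup>2))" by simp
    then show "ennreal (1 / ((x + Y * s - x)\<^sup>2 + Y\<^sup>2)) = ennreal (1 / Y\<^sup>2) * ennreal (1 / (1 + s\<^sup>2))"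
      by (simp only:) (rule ennreal_mult; simp)
  qed
  also have "\<dots> = ennreal (1 / Y\<^sup>2) * (\<integral>\<^sup>+s. ennreal (1 / (1 + s\<^sup>2)) \<partial>lborel)" by (rule nn_integral_cmult) measurable
  also have "(\<integral>\<^sup>+s. ennreal (1 / (1 + s\<^sup>2)) \<partial>lborel) = ennreal pi"
    using nn_integral_eq_integral[OF integral_inverse_one_plus_sq(1)] integral_inverse_one_plus_sq(2) by simp
  also have "ennreal \<bar>Y\<bar> * (ennreal (1 / Y\<^sup>2) * ennreal pi) = ennreal (pi / Y)"
    using Y by (simp add: ennreal_mult[symmetric] power2_eq_square)
  finally show ?thesis .
qed

text \<open>One of the three factors is bounded below by its imaginary part \<open>v + y\<close>;
  the remaining square is a Poisson kernel, explicitly integrable in \<open>u\<close> or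
  \<open>x\<close>.\<close>

lemma cubic_kernel_le:
  assumes v: "v > 0" and y: "y > 0"
  shows "1 / cmod (Complex u v - Complex x (- y)) ^ 3 \<le> 1 / (v + y) * (1 / ((u - x)\<^sup>2 + (v + y)\<^sup>2))"
proof -
  define n where "n = cmod (Complex u v - Complex x (- y))"
  have sq: "n\<^sup>2 = (u - x)\<^sup>2 + (v + y)\<^sup>2" unfolding n_def cmod_power2 by simp
  have n: "v + y \<le> n" using abs_Im_le_cmod[of "Complex u v - Complex x (- y)"] v y by (simp add: n_def)
  have "(v + y) * n\<^sup>2 \<le> n * n\<^sup>2" using n by (intro mult_right_mono) auto
  then have "1 / (n * n\<^sup>2) \<le> 1 / ((v + y) * n\<^sup>2)" using n v y by (intro frac_le mult_pos_pos) auto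
  then show ?thesis unfolding n_def[symmetric] sq[symmetric] by (simp add: power3_eq_cube power2_eq_square)
qed

lemma cubic_kernel_line_integral:
  assumes v: "v > 0" and y: "y > 0"
  shows "(\<integral>\<^sup>+u. ennreal (1 / cmod (Complex u v - Complex x (- y)) ^ 3) \<partial>lborel) \<le> ennreal (pi / (v + y)\<^sup>2)"
    and "(\<integral>\<^sup>+x. ennreal (1 / cmod (Complex u v - Complex x (- y)) ^ 3) \<partial>lborel) \<le> ennreal (pi / (v + y)\<^sup>2)"
proof -
  have vy: "v + y > 0" using v y by simp
  have c: "(\<integral>\<^sup>+u. ennreal (1 / (v + y) * (1 / ((u - x)\<^sup>2 + (v + y)\<^sup>2))) \<partial>lborel) = ennreal (pi / (v + y)\<^sup>2)" for x
  proof -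
    have "(\<integral>\<^sup>+u. ennreal (1 / (v + y) * (1 / ((u - x)\<^sup>2 + (v + y)\<^sup>2))) \<partial>lborel) = (\<integral>\<^sup>+u. ennreal (1 / (v + y)) * ennreal (1 / ((u - x)\<^sup>2 + (v + y)\<^sup>2)) \<partial>lborel)"
      using vy by (intro nn_integral_cong ennreal_mult) auto
    also have "\<dots> = ennreal (1 / (v + y)) * ennreal (pi / (v + y))"
      by (subst nn_integral_cmult) (auto simp: nn_integral_poisson[OF vy])
    also have "\<dots> = ennreal (pi / (v + y)\<^sup>2)" using vy by (simp add: ennreal_mult[symmetric] power2_eq_square)
    finally show ?thesis .
  qed
  have "(\<integral>\<^sup>+u. ennreal (1 / cmod (Complex u v - Complex x (- y)) ^ 3) \<partial>lborel) \<le> (\<integral>\<^sup>+u. ennreal (1 / (v + y) * (1 / ((u - x)\<^sup>2 + (v + y)\<^sup>2))) \<partial>lborel)"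
    by (intro nn_integral_mono ennreal_leI cubic_kernel_le v y)
  then show "(\<integral>\<^sup>+u. ennreal (1 / cmod (Complex u v - Complex x (- y)) ^ 3) \<partial>lborel) \<le> ennreal (pi / (v + y)\<^sup>2)" unfolding c .
  have "(\<integral>\<^sup>+x. ennreal (1 / cmod (Complex u v - Complex x (- y)) ^ 3) \<partial>lborel) \<le> (\<integral>\<^sup>+x. ennreal (1 / (v + y) * (1 / ((x - u)\<^sup>2 + (v + y)\<^sup>2))) \<partial>lborel)"
    using cubic_kernel_le[OF v y, of u] by (intro nn_integral_mono ennreal_leI) (simp add: power2_commute[of u])
  then show "(\<integral>\<^sup>+x. ennreal (1 / cmod (Complex u v - Complex x (- y)) ^ 3) \<partial>lborel) \<le> ennreal (pi / (v + y)\<^sup>2)" unfolding c .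
qed

lemma sq_le_schur:
  assumes [measurable]: "u \<in> borel_measurable M" "v \<in> borel_measurable M"
    and "\<And>x. g x \<le> u x * v x"
  shows "(\<integral>\<^sup>+x. g x \<partial>M)\<^sup>2 \<le> (\<integral>\<^sup>+x. (u x)\<^sup>2 \<partial>M) * (\<integral>\<^sup>+x. (v x)\<^sup>2 \<partial>M)"
proof -
  have "(\<integral>\<^sup>+x. g x \<partial>M)\<^sup>2 \<le> (\<integral>\<^sup>+x. u x * v x \<partial>M)\<^sup>2" by (intro power_mono nn_integral_mono assms) simp
  also have "\<dots> \<le> (\<integral>\<^sup>+x. (u x)\<^sup>2 \<partial>M) * (\<integral>\<^sup>+x. (v x)\<^sup>2 \<partial>M)" by (rule Cauchy_Schwarz_nn_integral) measurable
  finally show ?thesis .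
qed

text \<open>Hardy's inequality; the Cauchy-Schwarz weight is \<open>y\<^sup>1\<^sup>/\<^sup>4\<close>.\<close>

lemma hardy:
  fixes R :: "real \<Rightarrow> real"
  assumes [measurable]: "R \<in> borel_measurable borel" and R0: "\<And>y. 0 \<le> R y"
  shows "(\<integral>\<^sup>+r. (ennreal (1 / r\<^sup>2) * indicator {0<..} r) * (\<integral>\<^sup>+y. ennreal (R y) * indicator {0<..r} y \<partial>lborel)\<^sup>2 \<partial>lborel)
    \<le> 4 * (\<integral>\<^sup>+y. ennreal ((R y)\<^sup>2) * indicator {0<..} y \<partial>lborel)"
proof -
  have pt: "(ennreal (1 / r\<^sup>2) * indicator {0<..} r) * (\<integral>\<^sup>+y. ennreal (R y) * indicator {0<..r} y \<partial>lborel)\<^sup>2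
     \<le> (\<integral>\<^sup>+y. 2 * (ennreal ((R y)\<^sup>2 * sqrt y) * indicator {0<..} y * (ennreal (1 / (r * sqrt r)) * indicator {y..} r)) \<partial>lborel)" for r
  proof (cases "r > 0")
    case True
    have "(\<integral>\<^sup>+y. ennreal (R y) * indicator {0<..r} y \<partial>lborel)\<^sup>2 \<le>
       (\<integral>\<^sup>+y. (ennreal (R y * sqrt (sqrt y)) * indicator {0<..r} y)\<^sup>2 \<partial>lborel) * (\<integral>\<^sup>+y. (ennreal (1 / sqrt (sqrt y)) * indicator {0<..r} y)\<^sup>2 \<partial>lborel)"
    proof (rule sq_le_schur)
      fix y
      show "ennreal (R y) * indicator {0<..r} y \<le> ennreal (R y * sqrt (sqrt y)) * indicator {0<..r} y * (ennreal (1 / sqrt (sqrt y)) * indicator {0<..r} y)"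
      proof (cases "y \<in> {0<..r}")
        case True
        then have "R y * sqrt (sqrt y) * (1 / sqrt (sqrt y)) = R y" by simp
        then show ?thesis using True R0[of y] by (simp add: ennreal_mult[symmetric])
      qed simp
    qed measurable
    also have "(\<integral>\<^sup>+y. (ennreal (1 / sqrt (sqrt y)) * indicator {0<..r} y)\<^sup>2 \<partial>lborel) = (\<integral>\<^sup>+y. ennreal (1 / sqrt y) * indicator {0<..r} y \<partial>lborel)"
    proof (intro nn_integral_cong)
      fix y show "(ennreal (1 / sqrt (sqrt y)) * indicator {0<..r} y)\<^sup>2 = ennreal (1 / sqrt y) * indicator {0<..r} y"
        by (cases "y \<in> {0<..r}") (simp_all add: ennreal_power power_divide)
    qed
    also have "(\<integral>\<^sup>+y. (ennreal (R y * sqrt (sqrt y)) * indicator {0<..r} y)\<^sup>2 \<partial>lborel) * \<dots> \<le>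
        (\<integral>\<^sup>+y. ennreal ((R y)\<^sup>2 * sqrt y) * indicator {0<..r} y \<partial>lborel) * ennreal (2 * sqrt r)"
    proof (rule mult_mono)
      show "(\<integral>\<^sup>+y. ennreal (1 / sqrt y) * indicator {0<..r} y \<partial>lborel) \<le> ennreal (2 * sqrt r)" by (rule nn_integral_inverse_sqrt_Icc[OF True])
      show "(\<integral>\<^sup>+y. (ennreal (R y * sqrt (sqrt y)) * indicator {0<..r} y)\<^sup>2 \<partial>lborel) \<le> (\<integral>\<^sup>+y. ennreal ((R y)\<^sup>2 * sqrt y) * indicator {0<..r} y \<partial>lborel)"
      proof (intro nn_integral_mono)
        fix y show "(ennreal (R y * sqrt (sqrt y)) * indicator {0<..r} y)\<^sup>2 \<le> ennreal ((R y)\<^sup>2 * sqrt y) * indicator {0<..r} y"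
          using R0[of y] by (cases "y \<in> {0<..r}") (simp_all add: ennreal_power power_mult_distrib)
      qed
    qed simp_all
    finally have "ennreal (1 / r\<^sup>2) * (\<integral>\<^sup>+y. ennreal (R y) * indicator {0<..r} y \<partial>lborel)\<^sup>2 \<le>
       ennreal (1 / r\<^sup>2) * ((\<integral>\<^sup>+y. ennreal ((R y)\<^sup>2 * sqrt y) * indicator {0<..r} y \<partial>lborel) * ennreal (2 * sqrt r))"
      by (rule mult_left_mono) simp
    also have "\<dots> = (ennreal (1 / r\<^sup>2) * ennreal (2 * sqrt r)) * (\<integral>\<^sup>+y. ennreal ((R y)\<^sup>2 * sqrt y) * indicator {0<..r} y \<partial>lborel)"
      by (simp only: mult_ac)
    also have "ennreal (1 / r\<^sup>2) * ennreal (2 * sqrt r) = 2 * ennreal (1 / (r * sqrt r))"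
    proof -
      have "1 / (s * s)\<^sup>2 * (2 * s) = 2 * (1 / (s * s * s))" if "s > 0" for s :: real
        using that by (simp add: power2_eq_square)
      from this[of "sqrt r"] have "1 / r\<^sup>2 * (2 * sqrt r) = 2 * (1 / (r * sqrt r))" using True by simp
      then have "ennreal (1 / r\<^sup>2) * ennreal (2 * sqrt r) = ennreal (2 * (1 / (r * sqrt r)))"
        using True by (subst ennreal_mult[symmetric]) simp_all
      also have "\<dots> = 2 * ennreal (1 / (r * sqrt r))" using True by (subst ennreal_mult) simp_all
      finally show ?thesis .
    qed
    also have "(2 * ennreal (1 / (r * sqrt r))) * (\<integral>\<^sup>+y. ennreal ((R y)\<^sup>2 * sqrt y) * indicator {0<..r} y \<partial>lborel)
      = (\<integral>\<^sup>+y. (2 * ennreal (1 / (r * sqrt r))) * (ennreal ((R y)\<^sup>2 * sqrt y) * indicator {0<..r} y) \<partial>lborel)"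
      by (rule nn_integral_cmult[symmetric]) measurable
    also have "\<dots> = (\<integral>\<^sup>+y. 2 * (ennreal ((R y)\<^sup>2 * sqrt y) * indicator {0<..} y * (ennreal (1 / (r * sqrt r)) * indicator {y..} r)) \<partial>lborel)"
      by (intro nn_integral_cong) (auto simp: indicator_def mult_ac)
    finally show ?thesis using True by simp
  qed simp
  have "(\<integral>\<^sup>+r. (ennreal (1 / r\<^sup>2) * indicator {0<..} r) * (\<integral>\<^sup>+y. ennreal (R y) * indicator {0<..r} y \<partial>lborel)\<^sup>2 \<partial>lborel)
    \<le> (\<integral>\<^sup>+r. \<integral>\<^sup>+y. 2 * (ennreal ((R y)\<^sup>2 * sqrt y) * indicator {0<..} y * (ennreal (1 / (r * sqrt r)) * indicator {y..} r)) \<partial>lborel \<partial>lborel)"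
    by (intro nn_integral_mono pt)
  also have "\<dots> = (\<integral>\<^sup>+y. \<integral>\<^sup>+r. 2 * (ennreal ((R y)\<^sup>2 * sqrt y) * indicator {0<..} y * (ennreal (1 / (r * sqrt r)) * indicator {y..} r)) \<partial>lborel \<partial>lborel)"
  proof (rule lborel_pair.Fubini')
    have "(\<lambda>(y, r). 2 * (ennreal ((R y)\<^sup>2 * sqrt y) * indicator {0<..} y * (ennreal (1 / (r * sqrt r)) * (if y \<le> r then 1 else 0)))) \<in> borel_measurable (lborel \<Otimes>\<^sub>M lborel)"
      by measurable
    then show "(\<lambda>(y, r). 2 * (ennreal ((R y)\<^sup>2 * sqrt y) * indicator {0<..} y * (ennreal (1 / (r * sqrt r)) * indicator {y..} r))) \<in> borel_measurable (lborel \<Otimes>\<^sub>M lborel)"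
      by (simp add: indicator_def of_bool_def)
  qed
  \<comment> \<open>The weight in \<open>r\<close> is now 2 r^(-3/2). Its integral from
    \<open>y\<close> on is 4 / sqrt y, which cancels the factor \<open>sqrt y\<close> and explains
    the constant 4.\<close>
  also have "\<dots> = (\<integral>\<^sup>+y. 4 * (ennreal ((R y)\<^sup>2) * indicator {0<..} y) \<partial>lborel)"
  proof (intro nn_integral_cong)
    fix y :: real
    show "(\<integral>\<^sup>+r. 2 * (ennreal ((R y)\<^sup>2 * sqrt y) * indicator {0<..} y * (ennreal (1 / (r * sqrt r)) * indicator {y..} r)) \<partial>lborel) = 4 * (ennreal ((R y)\<^sup>2) * indicator {0<..} y)"
    proof (cases "y > 0")
      case True
      have "(\<integral>\<^sup>+r. 2 * (ennreal ((R y)\<^sup>2 * sqrt y) * indicator {0<..} y * (ennreal (1 / (r * sqrt r)) * indicator {y..} r)) \<partial>lborel) =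
        (\<integral>\<^sup>+r. (2 * ennreal ((R y)\<^sup>2 * sqrt y)) * (ennreal (1 / (r * sqrt r)) * indicator {y..} r) \<partial>lborel)"
        using True by (simp add: mult_ac)
      also have "\<dots> = (2 * ennreal ((R y)\<^sup>2 * sqrt y)) * ennreal (2 / sqrt y)"
        by (subst nn_integral_cmult) (simp_all add: nn_integral_inverse_three_halves[OF True])
      also have "\<dots> = 2 * (ennreal ((R y)\<^sup>2 * sqrt y) * ennreal (2 / sqrt y))" by (simp only: mult.assoc)
      also have "ennreal ((R y)\<^sup>2 * sqrt y) * ennreal (2 / sqrt y) = ennreal (2 * (R y)\<^sup>2)"
        using True by (subst ennreal_mult[symmetric]) (simp_all add: mult.commute)
      also have "2 * ennreal (2 * (R y)\<^sup>2) = 4 * ennreal ((R y)\<^sup>2)"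
        by (subst ennreal_mult) (simp_all add: mult.assoc[symmetric])
      finally show ?thesis using True by simp
    qed simp
  qed
  also have "\<dots> = 4 * (\<integral>\<^sup>+y. ennreal ((R y)\<^sup>2) * indicator {0<..} y \<partial>lborel)" by (rule nn_integral_cmult) measurable
  finally show ?thesis .
qed

text \<open>First half of Schur's test: against the cubic kernel the weight
  \<open>sqrt (Im w)\<close> is turned into a multiple of \<open>1 / sqrt y\<close>. The horizontal
  integral leaves pi / (v + y)^2, and \<open>sqrt v <= sqrt (v + y)\<close>.\<close>

lemma schur_inner_integral:
  assumes y: "y > 0"
  shows "(\<integral>\<^sup>+w. indicator upper_half_plane w * ennreal (sqrt (Im w) / cmod (w - Complex x (- y)) ^ 3) \<partial>lborel) \<le> ennreal (2 * pi / sqrt y)"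
proof -
  have [measurable]: "upper_half_plane \<in> sets borel" using open_upper_half_plane by simp
  have "(\<integral>\<^sup>+w. indicator upper_half_plane w * ennreal (sqrt (Im w) / cmod (w - Complex x (- y)) ^ 3) \<partial>lborel)
     = (\<integral>\<^sup>+v. \<integral>\<^sup>+u. indicator upper_half_plane (Complex u v) * ennreal (sqrt v / cmod (Complex u v - Complex x (- y)) ^ 3) \<partial>lborel \<partial>lborel)"
    by (subst nn_integral_complex(2)) simp_all
  also have "\<dots> \<le> (\<integral>\<^sup>+v. ennreal pi * (ennreal (1 / ((v + y) * sqrt (v + y))) * indicator {0..} v) \<partial>lborel)"
  proof (intro nn_integral_mono)
    fix v
    show "(\<integral>\<^sup>+u. indicator upper_half_plane (Complex u v) * ennreal (sqrt v / cmod (Complex u v - Complex x (- y)) ^ 3) \<partial>lborel) \<le> ennreal pi * (ennreal (1 / ((v + y) * sqrt (v + y))) * indicator {0..} v)"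
    proof (cases "v > 0")
      case True
      have vy: "v + y > 0" using True y by simp
      have "(\<integral>\<^sup>+u. indicator upper_half_plane (Complex u v) * ennreal (sqrt v / cmod (Complex u v - Complex x (- y)) ^ 3) \<partial>lborel)
        = (\<integral>\<^sup>+u. ennreal (sqrt v) * ennreal (1 / cmod (Complex u v - Complex x (- y)) ^ 3) \<partial>lborel)"
        using True by (intro nn_integral_cong) (simp add: upper_half_plane_def ennreal_mult[symmetric])
      also have "\<dots> = ennreal (sqrt v) * (\<integral>\<^sup>+u. ennreal (1 / cmod (Complex u v - Complex x (- y)) ^ 3) \<partial>lborel)"
        by (rule nn_integral_cmult) measurable
      also have "\<dots> \<le> ennreal (sqrt v) * ennreal (pi / (v + y)\<^sup>2)"
        by (intro mult_left_mono cubic_kernel_line_integral(1) True y) simp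
      also have "\<dots> = ennreal (sqrt v * (pi / (v + y)\<^sup>2))" using vy True by (subst ennreal_mult) simp_all
      also have "\<dots> \<le> ennreal (pi * (1 / ((v + y) * sqrt (v + y))))"
      proof (rule ennreal_leI)
        have "sqrt v * (pi / (v + y)\<^sup>2) \<le> sqrt (v + y) * (pi / (v + y)\<^sup>2)"
          using True y by (intro mult_right_mono) simp_all
        also have "\<dots> = pi * (1 / ((v + y) * sqrt (v + y)))"
        proof -
          have "s * (pi / (s * s)\<^sup>2) = pi * (1 / (s * s * s))" if "s > 0" for s :: real
            using that by (simp add: power2_eq_square)
          from this[of "sqrt (v + y)"] show ?thesis using vy by simp
        qed
        finally show "sqrt v * (pi / (v + y)\<^sup>2) \<le> pi * (1 / ((v + y) * sqrt (v + y)))" .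
      qed
      also have "\<dots> = ennreal pi * ennreal (1 / ((v + y) * sqrt (v + y)))" using vy by (subst ennreal_mult) simp_all
      finally show ?thesis using True by simp
    next
      case False
      then show ?thesis by (simp add: upper_half_plane_def)
    qed
  qed
  also have "\<dots> = ennreal pi * (\<integral>\<^sup>+v. ennreal (1 / ((v + y) * sqrt (v + y))) * indicator {0..} v \<partial>lborel)"
    by (rule nn_integral_cmult) measurable
  also have "(\<integral>\<^sup>+v. ennreal (1 / ((v + y) * sqrt (v + y))) * indicator {0..} v \<partial>lborel) = (\<integral>\<^sup>+r. ennreal (1 / (r * sqrt r)) * indicator {y..} r \<partial>lborel)"
  proof -
    have "(\<integral>\<^sup>+r. ennreal (1 / (r * sqrt r)) * indicator {y..} r \<partial>lborel) = ennreal \<bar>1\<bar> * (\<integral>\<^sup>+v. ennreal (1 / ((y + 1 * v) * sqrt (y + 1 * v))) * indicator {y..} (y + 1 * v) \<partial>lborel)"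
      by (rule nn_integral_real_affine) auto
    also have "\<dots> = (\<integral>\<^sup>+v. ennreal (1 / ((v + y) * sqrt (v + y))) * indicator {0..} v \<partial>lborel)"
      by (simp add: indicator_def add.commute)
    finally show ?thesis by (rule sym)
  qed
  also have "\<dots> = ennreal (2 / sqrt y)" by (rule nn_integral_inverse_three_halves[OF y])
  also have "ennreal pi * ennreal (2 / sqrt y) = ennreal (2 * pi / sqrt y)" using y by (subst ennreal_mult[symmetric]) (simp_all add: mult.commute)
  finally show ?thesis .
qed

text \<open>Second half of Schur's test: integrating \<open>1 / sqrt y\<close> against the kernel
  gives v^(-3/2). Together with the v^(-1/2) left by the Cauchy-Schwarz splitting this is the weight
  v^(-2) of the hypothesis.\<close>

lemma schur_outer_integral:
  assumes v: "v > 0"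
  shows "(\<integral>\<^sup>+y. \<integral>\<^sup>+x. indicator {0<..} y * ennreal (1 / (sqrt y * cmod (Complex u v - Complex x (- y)) ^ 3)) \<partial>lborel \<partial>lborel) \<le> ennreal (pi\<^sup>2 / (v * sqrt v))"
proof -
  have "(\<integral>\<^sup>+y. \<integral>\<^sup>+x. indicator {0<..} y * ennreal (1 / (sqrt y * cmod (Complex u v - Complex x (- y)) ^ 3)) \<partial>lborel \<partial>lborel)
     \<le> (\<integral>\<^sup>+y. ennreal (pi / v) * (ennreal (1 / (sqrt y * (v + y))) * indicator {0<..} y) \<partial>lborel)"
  proof (intro nn_integral_mono)
    fix y
    show "(\<integral>\<^sup>+x. indicator {0<..} y * ennreal (1 / (sqrt y * cmod (Complex u v - Complex x (- y)) ^ 3)) \<partial>lborel) \<le> ennreal (pi / v) * (ennreal (1 / (sqrt y * (v + y))) * indicator {0<..} y)"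
    proof (cases "y > 0")
      case True
      have vy: "v + y > 0" using True v by simp
      have "(\<integral>\<^sup>+x. indicator {0<..} y * ennreal (1 / (sqrt y * cmod (Complex u v - Complex x (- y)) ^ 3)) \<partial>lborel)
        = (\<integral>\<^sup>+x. ennreal (1 / sqrt y) * ennreal (1 / cmod (Complex u v - Complex x (- y)) ^ 3) \<partial>lborel)"
        using True by (intro nn_integral_cong) (simp add: ennreal_mult[symmetric])
      also have "\<dots> = ennreal (1 / sqrt y) * (\<integral>\<^sup>+x. ennreal (1 / cmod (Complex u v - Complex x (- y)) ^ 3) \<partial>lborel)"
        by (rule nn_integral_cmult) measurable
      also have "\<dots> \<le> ennreal (1 / sqrt y) * ennreal (pi / (v + y)\<^sup>2)"
        by (intro mult_left_mono cubic_kernel_line_integral(2) True v) simp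
      also have "\<dots> = ennreal (1 / sqrt y * (pi / (v + y)\<^sup>2))" using vy True by (subst ennreal_mult) simp_all
      also have "\<dots> \<le> ennreal (pi / v * (1 / (sqrt y * (v + y))))"
      proof (rule ennreal_leI)
        have "pi / (v + y)\<^sup>2 \<le> pi / (v * (v + y))"
          using v True by (intro frac_le) (simp_all add: power2_eq_square)
        then have "1 / sqrt y * (pi / (v + y)\<^sup>2) \<le> 1 / sqrt y * (pi / (v * (v + y)))" using True by (intro mult_left_mono) simp_all
        also have "\<dots> = pi / v * (1 / (sqrt y * (v + y)))" by (simp add: mult_ac)
        finally show "1 / sqrt y * (pi / (v + y)\<^sup>2) \<le> pi / v * (1 / (sqrt y * (v + y)))" .
      qed
      also have "\<dots> = ennreal (pi / v) * ennreal (1 / (sqrt y * (v + y)))" using v vy True by (subst ennreal_mult) simp_all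
      finally show ?thesis using True by simp
    qed simp
  qed
  also have "\<dots> = ennreal (pi / v) * (\<integral>\<^sup>+y. ennreal (1 / (sqrt y * (v + y))) * indicator {0<..} y \<partial>lborel)"
    by (rule nn_integral_cmult) measurable
  also have "\<dots> \<le> ennreal (pi / v) * ennreal (pi / sqrt v)"
    by (intro mult_left_mono nn_integral_inverse_sqrt_shift v) simp
  also have "\<dots> = ennreal (pi\<^sup>2 / (v * sqrt v))" using v by (subst ennreal_mult[symmetric]) (simp_all add: power2_eq_square)
  finally show ?thesis .
qed

section \<open>Integrals of locally integrable functions\<close>

text \<open>Lebesgue differentiation along intervals starting at \<open>x\<close>; intervals ending
  at \<open>x\<close> are reached later by reflection.\<close>

lemma AE_has_derivative_right:
  fixes g :: "real \<Rightarrow> real"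
  assumes gi: "\<And>a b. set_integrable lborel {a..b} g"
  shows "AE x in lborel. \<forall>e>0. \<exists>d>0. \<forall>h. 0 < h \<and> h < d \<longrightarrow> \<bar>(LINT u:{x..x+h}|lborel. g u) / h - g x\<bar> < e"
proof -
  have int: "g integrable_on cbox a b" for a b
    using set_borel_integral_eq_integral(1)[OF gi[of a b]] by simp
  obtain N where N: "negligible N" "\<And>x e. x \<notin> N \<Longrightarrow> 0 < e \<Longrightarrow> \<exists>d>0. \<forall>h. 0 < h \<and> h < d \<longrightarrow>
      norm (integral (cbox x (x + h *\<^sub>R One)) g /\<^sub>R h ^ DIM(real) - g x) < e"
    using integrable_ccontinuous_explicit[OF int] by blast
  have "AE x in lebesgue. x \<notin> N" by (rule AE_not_in) (use N(1) in \<open>simp add: negligible_iff_null_sets\<close>)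
  then have "AE x in lborel. x \<notin> N" by (simp add: AE_completion_iff)
  then show ?thesis
  proof eventually_elim
    case (elim x)
    show ?case
    proof (intro allI impI)
      fix e :: real assume e: "e > 0"
      obtain d where d: "d > 0" "\<And>h. 0 < h \<and> h < d \<Longrightarrow> norm (integral (cbox x (x + h *\<^sub>R One)) g /\<^sub>R h ^ DIM(real) - g x) < e"
        using N(2)[OF elim e] by blast
      have "\<bar>(LINT u:{x..x+h}|lborel. g u) / h - g x\<bar> < e" if "0 < h \<and> h < d" for h
        using d(2)[OF that] set_borel_integral_eq_integral(2)[OF gi[of x "x + h"]] by (simp add: divide_inverse mult.commute)
      with d(1) show "\<exists>d>0. \<forall>h. 0 < h \<and> h < d \<longrightarrow> \<bar>(LINT u:{x..x+h}|lborel. g u) / h - g x\<bar> < e" by blast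
    qed
  qed
qed

lemma AE_lborel_uminus:
  assumes "AE x in lborel. P (x::real)"
  shows "AE x in lborel. P (- x)"
proof -
  have "AE x in distr lborel borel uminus. P (x::real)"
    using assms by (subst lborel_distr_uminus)
  then show ?thesis by (rule AE_distrD[rotated]) simp
qed

text \<open>Reflecting the line turns the left difference quotients of \<open>f\<close> into right
  ones for the reflected integrand \<open>k\<close>, so the one-sided statement is used
  twice.\<close>

lemma AE_has_derivative_of_integral:
  fixes f g :: "real \<Rightarrow> real"
  assumes gi: "\<And>a b. set_integrable lborel {a..b} g"
    and ftc: "\<And>a b. a \<le> b \<Longrightarrow> f b - f a = (LINT x:{a..b}|lborel. g x)"
  shows "AE x in lborel. (f has_real_derivative g x) (at x)"
proof -
  define k where "k u = g (- u)" for u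
  have k_eq: "indicator {a..b} (- x) *\<^sub>R g x = (\<lambda>u. indicator {a..b} u *\<^sub>R k u) (0 + (-1) * x)" for a b x by (simp add: k_def)
  have ind: "indicator {- b..- a} x *\<^sub>R g x = indicator {a..b} (- x) *\<^sub>R g x" for a b x :: real
    by (auto simp: indicator_def)
  have ki: "set_integrable lborel {a..b} k" for a b
  proof -
    have "integrable lborel (\<lambda>x. (\<lambda>u. indicator {a..b} u *\<^sub>R k u) (0 + (-1) * x))"
      using gi[of "- b" "- a"] unfolding set_integrable_def ind k_eq .
    then show ?thesis unfolding set_integrable_def by (subst (asm) lborel_integrable_real_affine_iff) simp_all
  qed
  have kf: "(LINT u:{- x..- x + h}|lborel. k u) = f x - f (x - h)" if "h > 0" for x h
  proof -
    have "(LINT u:{- x..- x + h}|lborel. k u) = \<bar>-1\<bar> *\<^sub>R (LINT u|lborel. (\<lambda>u. indicator {- x..- x + h} u *\<^sub>R k u) (0 + (-1) * u))"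
      unfolding set_lebesgue_integral_def by (rule lborel_integral_real_affine) simp
    also have "\<dots> = (LINT u:{x - h..x}|lborel. g u)"
      unfolding set_lebesgue_integral_def k_eq[symmetric] abs_neg_one scaleR_one
      by (intro Bochner_Integration.integral_cong) (auto simp: indicator_def)
    also have "\<dots> = f x - f (x - h)" using that by (intro ftc[symmetric]) simp
    finally show ?thesis .
  qed
  from AE_has_derivative_right[OF gi] AE_lborel_uminus[OF AE_has_derivative_right[OF ki]]
  show ?thesis
  proof eventually_elim
    case (elim x)
    show ?case unfolding DERIV_def
    proof (rule LIM_I)
      fix e :: real assume e: "e > 0"
      obtain d1 where d1: "d1 > 0" "\<And>h. 0 < h \<and> h < d1 \<Longrightarrow> \<bar>(LINT u:{x..x+h}|lborel. g u) / h - g x\<bar> < e"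
        using elim(1) e by blast
      obtain d2 where d2: "d2 > 0" "\<And>h. 0 < h \<and> h < d2 \<Longrightarrow> \<bar>(LINT u:{- x..- x+h}|lborel. k u) / h - k (- x)\<bar> < e"
        using elim(2) e by blast
      have "norm ((f (x + h) - f x) / h - g x) < e" if h: "h \<noteq> 0" "\<bar>h\<bar> < min d1 d2" for h
      proof (cases "h > 0")
        case True
        have "(LINT u:{x..x+h}|lborel. g u) = f (x + h) - f x" using True by (intro ftc[symmetric]) simp
        then show ?thesis using d1(2)[of h] True h by simp
      next
        case False
        then have n: "- h > 0" using h by simp
        have "\<bar>(f x - f (x - - h)) / (- h) - g x\<bar> < e" using d2(2)[of "- h"] n h unfolding kf[OF n] by (simp add: k_def)
        moreover have "(f x - f (x - - h)) / (- h) = (f (x + h) - f x) / h" using h by (simp add: divide_simps)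
        ultimately show ?thesis by simp
      qed
      then show "\<exists>s>0. \<forall>h. h \<noteq> 0 \<and> norm (h - 0) < s \<longrightarrow> norm ((f (x + h) - f x) / h - g x) < e"
        using d1(1) d2(1) by (intro exI[of _ "min d1 d2"]) auto
    qed
  qed
qed

text \<open>\<open>\<bar>g\<bar>\<close> is split into a part bounded by \<open>n\<close>,
  controlled by total length, and the excess \<open>m\<close> over \<open>n\<close>, whose whole
  integral is below \<open>e / 2\<close> for a suitable \<open>n\<close>.\<close>

lemma abs_continuous_on_integral:
  fixes f g :: "real \<Rightarrow> real"
  assumes gi: "\<And>a b. set_integrable lborel {a..b} g"
    and ftc: "\<And>a b. a \<le> b \<Longrightarrow> f b - f a = (LINT x:{a..b}|lborel. g x)"
  shows "abs_continuous_on a b f"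
  unfolding abs_continuous_on_def
proof (intro allI impI)
  fix e :: real assume e: "e > 0"
  define G where "G x = indicator {a..b} x * \<bar>g x\<bar>" for x
  have Gi: "integrable lborel G" using set_integrable_norm[OF gi[of a b]] by (simp add: set_integrable_def G_def[abs_def])
  have [measurable]: "G \<in> borel_measurable borel" using Gi by auto
  have "(\<lambda>n. LINT x|lborel. max (G x - real n) 0) \<longlonglongrightarrow> (LINT x|(lborel :: real measure). 0)"
  proof (rule integral_dominated_convergence[OF _ _ Gi])
    show "AE x in lborel. (\<lambda>n. max (G x - real n) 0) \<longlonglongrightarrow> 0"
    proof (rule AE_I2)
      fix x
      have "\<forall>\<^sub>F n in sequentially. max (G x - real n) 0 = 0"
        using eventually_ge_at_top[of "nat \<lceil>G x\<rceil>"]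
      proof eventually_elim
        case (elim n)
        then have "G x \<le> real n" by linarith
        then show ?case by simp
      qed
      then show "(\<lambda>n. max (G x - real n) 0) \<longlonglongrightarrow> 0" by (rule tendsto_eventually)
    qed
    show "AE x in lborel. norm (max (G x - real n) 0) \<le> G x" for n
      by (intro AE_I2) (simp add: G_def)
  qed auto
  then have "\<forall>\<^sub>F n in sequentially. (LINT x|lborel. max (G x - real n) 0) < e / 2"
    using e by (intro order_tendstoD(2)[where a="e/2"]) auto
  then obtain n where n: "(LINT x|lborel. max (G x - real n) 0) < e / 2" by (auto simp: eventually_sequentially)
  define m where "m x = max (G x - real n) 0" for x
  have m0: "m x \<ge> 0" for x by (simp add: m_def)
  have [measurable]: "m \<in> borel_measurable borel" unfolding m_def[abs_def] by measurable
  have mi: "integrable lborel m"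
    by (rule Bochner_Integration.integrable_bound[OF Gi]) (auto simp: m_def G_def)
  define \<delta> where "\<delta> = e / (2 * (real n + 1))"
  have \<delta>: "\<delta> > 0" using e by (simp add: \<delta>_def)
  have im: "integrable lborel (\<lambda>x. indicator A x * m x)" if "A \<in> sets borel" for A
    using integrable_mult_indicator[OF _ mi, of A] that by simp
  have one: "\<bar>f v - f u\<bar> \<le> real n * (v - u) + (LINT x|lborel. indicator {u<..<v} x * m x)" if uv: "a \<le> u" "u \<le> v" "v \<le> b" for u v
  proof -
    have "\<bar>f v - f u\<bar> = norm (LINT x:{u..v}|lborel. g x)" by (simp add: ftc[OF uv(2)])
    also have "\<dots> \<le> (LINT x:{u..v}|lborel. norm (g x))" by (rule set_integral_norm_bound[OF gi])
    also have "\<dots> \<le> (LINT x|lborel. indicator {u..v} x * real n + indicator {u..v} x * m x)"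
      unfolding set_lebesgue_integral_def
    proof (rule integral_mono)
      show "integrable lborel (\<lambda>x. indicator {u..v} x *\<^sub>R norm (g x))" using set_integrable_norm[OF gi[of u v]] by (simp add: set_integrable_def)
      show "integrable lborel (\<lambda>x. indicator {u..v} x * real n + indicator {u..v} x * m x)"
        using borel_integrable_compact[of "{u..v}" "\<lambda>_. real n"] im[of "{u..v}"] by simp
      show "indicator {u..v} x *\<^sub>R norm (g x) \<le> indicator {u..v} x * real n + indicator {u..v} x * m x" for x
        using uv by (auto simp: indicator_def m_def G_def)
    qed
    also have "\<dots> = real n * (v - u) + (LINT x|lborel. indicator {u..v} x * m x)"
      using borel_integrable_compact[of "{u..v}" "\<lambda>_. real n"] im[of "{u..v}"] uv by simp
    \<comment> \<open>Only the open intervals of the family are disjoint, so the endpoints are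
      removed before summation.\<close>
    also have "(LINT x|lborel. indicator {u..v} x * m x) = (LINT x|lborel. indicator {u<..<v} x * m x)"
    proof (rule integral_cong_AE)
      show "AE x in lborel. indicator {u..v} x * m x = indicator {u<..<v} x * m x"
        using AE_lborel_singleton[of u] AE_lborel_singleton[of v] by eventually_elim (auto simp: indicator_def)
    qed measurable
    finally show ?thesis .
  qed
  show "\<exists>\<delta>>0. \<forall>(N::nat) u v. (\<forall>i<N. a \<le> u i \<and> u i \<le> v i \<and> v i \<le> b) \<and>
        (\<forall>i<N. \<forall>j<N. i \<noteq> j \<longrightarrow> {u i<..<v i} \<inter> {u j<..<v j} = {}) \<and> (\<Sum>i<N. v i - u i) < \<delta>
        \<longrightarrow> (\<Sum>i<N. \<bar>f (v i) - f (u i)\<bar>) < e"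
  proof (rule exI[of _ \<delta>], intro conjI allI impI \<delta>, elim conjE)
    fix N :: nat and u v :: "nat \<Rightarrow> real"
    assume uv: "\<forall>i<N. a \<le> u i \<and> u i \<le> v i \<and> v i \<le> b"
      and disj: "\<forall>i<N. \<forall>j<N. i \<noteq> j \<longrightarrow> {u i<..<v i} \<inter> {u j<..<v j} = {}" and small: "(\<Sum>i<N. v i - u i) < \<delta>"
    have "(\<Sum>i<N. \<bar>f (v i) - f (u i)\<bar>) \<le> (\<Sum>i<N. real n * (v i - u i) + (LINT x|lborel. indicator {u i<..<v i} x * m x))"
      by (intro sum_mono one) (use uv in auto)
    also have "\<dots> = real n * (\<Sum>i<N. v i - u i) + (\<Sum>i<N. LINT x|lborel. indicator {u i<..<v i} x * m x)"
      by (simp add: sum.distrib sum_distrib_left)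
    also have "(\<Sum>i<N. LINT x|lborel. indicator {u i<..<v i} x * m x) = (LINT x|lborel. (\<Sum>i<N. indicator {u i<..<v i} x * m x))"
      by (rule Bochner_Integration.integral_sum[symmetric]) (simp add: im)
    also have "\<dots> \<le> integral\<^sup>L lborel m"
    proof (rule integral_mono[OF _ mi])
      show "integrable lborel (\<lambda>x. \<Sum>i<N. indicator {u i<..<v i} x * m x)"
        by (rule Bochner_Integration.integrable_sum) (simp add: im)
      fix x
      have d: "disjoint_family_on (\<lambda>i. {u i<..<v i}) {..<N}" using disj by (auto simp: disjoint_family_on_def)
      have "(\<Sum>i<N. indicator {u i<..<v i} x * m x) = (\<Sum>i<N. indicator {u i<..<v i} x) * m x" by (rule sum_distrib_right[symmetric])
      also have "(\<Sum>i<N. indicator {u i<..<v i} x) = (indicator (\<Union>i<N. {u i<..<v i}) x :: real)"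
        by (subst indicator_UN_disjoint[OF _ d]) simp_all
      also have "\<dots> * m x \<le> m x" using m0[of x] by (simp add: indicator_def)
      finally show "(\<Sum>i<N. indicator {u i<..<v i} x * m x) \<le> m x" .
    qed
    also have "integral\<^sup>L lborel m < e / 2" using n by (simp add: m_def[abs_def])
    also have "real n * (\<Sum>i<N. v i - u i) \<le> (real n + 1) * \<delta>"
      using small \<delta> uv by (intro mult_mono sum_nonneg) auto
    also have "(real n + 1) * \<delta> = e / 2"
    proof -
      have "q * (e / (2 * q)) = e / 2" if "q > 0" for q using that by simp
      from this[of "real n + 1"] show ?thesis unfolding \<delta>_def by simp
    qed
    finally show "(\<Sum>i<N. \<bar>f (v i) - f (u i)\<bar>) < e" by simp
  qed
qed

section \<open>The boundary trace of the potential\<close>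

context extension
begin

text \<open>The variable \<open>y\<close> is the depth below the axis; the value 0 for the remaining
  \<open>y\<close> allows integrals over the whole line.\<close>

definition R :: "real \<Rightarrow> real \<Rightarrow> real" where "R x y = (if y > 0 then cmod (V2 (Complex x (- y))) else 0)"

lemma R_measurable: "(\<lambda>p. R (fst p) (snd p)) \<in> borel_measurable (borel \<Otimes>\<^sub>M borel)"
  unfolding R_def by measurable

lemma R_measurable' [measurable (raw)]:
  assumes [measurable]: "p \<in> borel_measurable M" "q \<in> borel_measurable M"
  shows "(\<lambda>x. R (p x) (q x)) \<in> borel_measurable M"
proof -
  have "(\<lambda>x. (p x, q x)) \<in> M \<rightarrow>\<^sub>M borel \<Otimes>\<^sub>M borel" by measurable
  from measurable_compose[OF this R_measurable] show ?thesis by simp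
qed

lemma R_nonneg: "0 \<le> R x y" by (simp add: R_def)

text \<open>Cauchy-Schwarz with the kernel split evenly and a fourth root of \<open>Im w\<close>
  moved between the factors. The second factor is \<open>schur_inner_integral\<close>; the constant
  is the square of the 2 in \<open>V2\<close> times 2 pi.\<close>

lemma R_sq_bound:
  "ennreal ((R x y)\<^sup>2) \<le> (\<integral>\<^sup>+w. indicator upper_half_plane w * ennreal (8 * pi * (cmod (h0 w))\<^sup>2 / sqrt (Im w)) *
      (indicator {0<..} y * ennreal (1 / (sqrt y * cmod (w - Complex x (- y)) ^ 3))) \<partial>lborel)"
proof (cases "y > 0")
  case True
  have [measurable]: "upper_half_plane \<in> sets borel" using open_upper_half_plane by simp
  define n where "n w = cmod (w - Complex x (- y))" for w
  have [measurable]: "n \<in> borel_measurable borel" unfolding n_def[abs_def] by measurable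
  have np: "n w > 0" if "w \<in> upper_half_plane" for w
  proof -
    have "y \<le> n w" using dist_lower_ge(2)[of w y x] that True by (simp add: n_def upper_half_plane_def)
    then show ?thesis using True by (rule less_le_trans[rotated])
  qed
  define u where "u w = indicator upper_half_plane w * ennreal (2 * cmod (h0 w) / (sqrt (sqrt (Im w)) * sqrt (n w ^ 3)))" for w
  define v where "v w = indicator upper_half_plane w * ennreal (sqrt (sqrt (Im w)) / sqrt (n w ^ 3))" for w
  have "ennreal ((R x y)\<^sup>2) = (ennreal (cmod (V2 (Complex x (- y)))))\<^sup>2" using True by (simp add: R_def ennreal_power)
  also have "\<dots> \<le> (\<integral>\<^sup>+w. ennreal (2 * cmod (h0 w) / n w ^ 3) \<partial>lborel)\<^sup>2"
    unfolding n_def by (intro power_mono V2_bound True) simp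
  also have "\<dots> \<le> (\<integral>\<^sup>+w. (u w)\<^sup>2 \<partial>lborel) * (\<integral>\<^sup>+w. (v w)\<^sup>2 \<partial>lborel)"
  proof (rule sq_le_schur)
    show "u \<in> borel_measurable lborel" "v \<in> borel_measurable lborel" unfolding u_def[abs_def] v_def[abs_def] by measurable
    fix w
    show "ennreal (2 * cmod (h0 w) / n w ^ 3) \<le> u w * v w"
    proof (cases "w \<in> upper_half_plane")
      case w: True
      have h: "a / (s * t) * (s / t) = a / (t * t)" if "s > 0" for a s t :: real using that by simp
      have "2 * cmod (h0 w) / (sqrt (sqrt (Im w)) * sqrt (n w ^ 3)) * (sqrt (sqrt (Im w)) / sqrt (n w ^ 3)) = 2 * cmod (h0 w) / n w ^ 3"
        using w np[OF w] by (subst h) (simp_all add: upper_half_plane_def)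
      then show ?thesis using w np[OF w] by (simp add: u_def v_def ennreal_mult[symmetric] upper_half_plane_def)
    qed (simp add: h0_def)
  qed
  also have "(\<integral>\<^sup>+w. (v w)\<^sup>2 \<partial>lborel) = (\<integral>\<^sup>+w. indicator upper_half_plane w * ennreal (sqrt (Im w) / n w ^ 3) \<partial>lborel)"
  proof (intro nn_integral_cong)
    fix w show "(v w)\<^sup>2 = indicator upper_half_plane w * ennreal (sqrt (Im w) / n w ^ 3)"
      using np[of w] by (cases "w \<in> upper_half_plane") (simp_all add: v_def ennreal_power power_divide upper_half_plane_def)
  qed
  also have "\<dots> \<le> ennreal (2 * pi / sqrt y)" unfolding n_def by (rule schur_inner_integral[OF True])
  finally have "ennreal ((R x y)\<^sup>2) \<le> (\<integral>\<^sup>+w. (u w)\<^sup>2 \<partial>lborel) * ennreal (2 * pi / sqrt y)" by (simp add: mult_left_mono)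
  also have "\<dots> = (\<integral>\<^sup>+w. (u w)\<^sup>2 * ennreal (2 * pi / sqrt y) \<partial>lborel)"
    by (rule nn_integral_multc[symmetric]) (simp add: u_def[abs_def])
  also have "\<dots> = (\<integral>\<^sup>+w. indicator upper_half_plane w * ennreal (8 * pi * (cmod (h0 w))\<^sup>2 / sqrt (Im w)) *
      (indicator {0<..} y * ennreal (1 / (sqrt y * n w ^ 3))) \<partial>lborel)"
  proof (intro nn_integral_cong)
    fix w
    show "(u w)\<^sup>2 * ennreal (2 * pi / sqrt y) = indicator upper_half_plane w * ennreal (8 * pi * (cmod (h0 w))\<^sup>2 / sqrt (Im w)) *
      (indicator {0<..} y * ennreal (1 / (sqrt y * n w ^ 3)))"
    proof (cases "w \<in> upper_half_plane")
      case w: True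
      have "(2 * cmod (h0 w) / (sqrt (sqrt (Im w)) * sqrt (n w ^ 3)))\<^sup>2 = 4 * (cmod (h0 w))\<^sup>2 / (sqrt (Im w) * n w ^ 3)"
        using w np[OF w] by (simp add: power_divide power_mult_distrib upper_half_plane_def)
      moreover have "4 * a / (s * m) * (2 * pi / t) = 8 * pi * a / s * (1 / (t * m))" for a s m t :: real by (simp add: mult_ac)
      ultimately show ?thesis using w np[OF w] True
        by (simp add: u_def ennreal_power ennreal_mult[symmetric] upper_half_plane_def)
    qed (simp add: u_def)
  qed
  finally show ?thesis by (simp add: n_def)
qed (simp add: R_def)

definition D :: ennreal where "D = (\<integral>\<^sup>+x. \<integral>\<^sup>+y. ennreal ((R x y)\<^sup>2) \<partial>lborel \<partial>lborel)"

text \<open>Tonelli with \<open>w\<close> outermost; \<open>schur_outer_integral\<close> then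
  restores exactly the weighted norm of \<open>h0\<close>, with constant
  \<open>8 * pi ^ 3\<close>.\<close>

lemma D_finite: "D < \<infinity>"
proof -
  have [measurable]: "upper_half_plane \<in> sets borel" using open_upper_half_plane by simp
  let ?a = "\<lambda>w. indicator upper_half_plane w * ennreal (8 * pi * (cmod (h0 w))\<^sup>2 / sqrt (Im w))"
  let ?k = "\<lambda>w x y. indicator {0<..} y * ennreal (1 / (sqrt y * cmod (w - Complex x (- y)) ^ 3))"
  have "D = (\<integral>\<^sup>+y. \<integral>\<^sup>+x. ennreal ((R x y)\<^sup>2) \<partial>lborel \<partial>lborel)"
    unfolding D_def by (rule lborel_pair.Fubini') measurable
  also have "\<dots> \<le> (\<integral>\<^sup>+y. \<integral>\<^sup>+x. \<integral>\<^sup>+w. ?a w * ?k w x y \<partial>lborel \<partial>lborel \<partial>lborel)"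
    by (intro nn_integral_mono R_sq_bound)
  also have "\<dots> = (\<integral>\<^sup>+y. \<integral>\<^sup>+w. \<integral>\<^sup>+x. ?a w * ?k w x y \<partial>lborel \<partial>lborel \<partial>lborel)"
    by (intro nn_integral_cong lborel_pair.Fubini') measurable
  also have "\<dots> = (\<integral>\<^sup>+w. \<integral>\<^sup>+y. \<integral>\<^sup>+x. ?a w * ?k w x y \<partial>lborel \<partial>lborel \<partial>lborel)"
    by (intro lborel_pair.Fubini') measurable
  also have "\<dots> \<le> (\<integral>\<^sup>+w. ennreal (8 * pi ^ 3) * ennreal ((cmod (h0 w))\<^sup>2 / (Im w)\<^sup>2) \<partial>lborel)"
  proof (intro nn_integral_mono)
    fix w
    show "(\<integral>\<^sup>+y. \<integral>\<^sup>+x. ?a w * ?k w x y \<partial>lborel \<partial>lborel) \<le> ennreal (8 * pi ^ 3) * ennreal ((cmod (h0 w))\<^sup>2 / (Im w)\<^sup>2)"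
    proof (cases "w \<in> upper_half_plane")
      case True
      then have v: "Im w > 0" by (simp add: upper_half_plane_def)
      have "(\<integral>\<^sup>+y. \<integral>\<^sup>+x. ?a w * ?k w x y \<partial>lborel \<partial>lborel) = ?a w * (\<integral>\<^sup>+y. \<integral>\<^sup>+x. ?k w x y \<partial>lborel \<partial>lborel)"
        by (simp add: nn_integral_cmult)
      also have "\<dots> \<le> ?a w * ennreal (pi\<^sup>2 / (Im w * sqrt (Im w)))"
        using schur_outer_integral[OF v, of "Re w"] by (intro mult_left_mono) simp_all
      also have "\<dots> = ennreal (8 * pi * (cmod (h0 w))\<^sup>2 / sqrt (Im w) * (pi\<^sup>2 / (Im w * sqrt (Im w))))"
        using True v by (simp add: ennreal_mult[symmetric])
      also have "8 * pi * (cmod (h0 w))\<^sup>2 / sqrt (Im w) * (pi\<^sup>2 / (Im w * sqrt (Im w))) = 8 * pi ^ 3 * ((cmod (h0 w))\<^sup>2 / (Im w)\<^sup>2)"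
      proof -
        have "8 * pi * a / s * (pi\<^sup>2 / (s * s * s)) = 8 * pi ^ 3 * (a / (s * s)\<^sup>2)" for a s :: real
          by (simp add: power2_eq_square power3_eq_cube mult_ac)
        from this[of _ "sqrt (Im w)"] show ?thesis using v by simp
      qed
      also have "ennreal \<dots> = ennreal (8 * pi ^ 3) * ennreal ((cmod (h0 w))\<^sup>2 / (Im w)\<^sup>2)" by (rule ennreal_mult) simp_all
      finally show ?thesis .
    qed simp
  qed
  also have "\<dots> = ennreal (8 * pi ^ 3) * (\<integral>\<^sup>+w. ennreal ((cmod (h0 w))\<^sup>2 / (Im w)\<^sup>2) \<partial>lborel)"
    by (rule nn_integral_cmult) measurable
  also have "\<dots> < \<infinity>" using h0_weighted by (simp add: ennreal_mult_less_top)
  finally show ?thesis .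
qed

text \<open>Continuity of the integrand is what the fundamental theorem on segments requires. It
  follows from a local Lipschitz estimate based on the cubic bounds.\<close>

lemma V2_isCont:
  assumes "Im \<zeta> < 0"
  shows "isCont V2 \<zeta>"
proof -
  define \<eta> where "\<eta> = - Im \<zeta> / 2"
  have \<eta>: "\<eta> > 0" "Im \<zeta> = - 2 * \<eta>" using assms by (auto simp: \<eta>_def)
  define L where "L = (1 + (1 + (cmod \<zeta> + \<eta>)) / \<eta>) ^ 3"
  have L0: "L \<ge> 0" using \<eta>(1) by (simp add: L_def)
  define C where "C = L * (1 / \<eta>) + L * (2 / \<eta>)"
  have C0: "C \<ge> 0" using \<eta>(1) L0 by (simp add: C_def)
  have lip: "cmod (V2 (\<zeta> + \<delta>) - V2 \<zeta>) \<le> 2 * cmod \<delta> * (C * integral\<^sup>L lborel dom)" if \<delta>: "cmod \<delta> < \<eta>" for \<delta>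
  proof -
    note n = near_point[OF \<eta>(2) \<delta>] near_point[OF \<eta>(2), of 0]
    let ?a = "\<lambda>w. w - \<zeta>" and ?b = "\<lambda>w. w - (\<zeta> + \<delta>)"
    \<comment> \<open>Let p and q be the reciprocals of \<open>?a w\<close> and \<open>?b w\<close>.
      Then q - p = \<delta> p q, and factoring q^3 - p^3 gives this kernel, each summand of which
      contains a product of three reciprocals.\<close>
    let ?k = "\<lambda>w. 1 / (?a w * ?b w * ?b w) * (1 / ?b w) + 1 / (?a w * ?a w * ?b w) * (1 / ?b w + 1 / ?a w)"
    have i: "integrable lborel (\<lambda>w. h0 w * (2 / (w - z) ^ 3))" if "z \<in> {\<zeta>, \<zeta> + \<delta>}" for z
    proof -
      have "integrable lborel (\<lambda>w. h0 w * (1 / ((w - z) * (w - z) * (w - z))))"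
        by (rule cubic_integral(1)[where \<eta>=\<eta> and M="cmod \<zeta> + \<eta>"]) (use n \<eta> that in auto)
      from integrable_mult_right[OF this, of 2] show ?thesis by (simp add: power3_eq_cube mult_ac)
    qed
    have kb: "cmod (?k w) * Im w * (1 + (cmod w)\<^sup>2) \<le> C" if w: "w \<in> upper_half_plane" for w
    proof -
      have l: "\<eta> \<le> cmod (?a w)" "\<eta> \<le> cmod (?b w)"
        using lower_dist(1)[of \<zeta> \<eta> "cmod \<zeta> + \<eta>" w] lower_dist(1)[of "\<zeta> + \<delta>" \<eta> "cmod \<zeta> + \<eta>" w] n \<eta> w by auto
      have q: "cmod (1 / ?a w) \<le> 1 / \<eta>" "cmod (1 / ?b w) \<le> 1 / \<eta>" using l \<eta>(1) by (simp_all add: norm_divide frac_le)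
      then have q2: "cmod (1 / ?b w + 1 / ?a w) \<le> 2 / \<eta>" using norm_triangle_ineq[of "1 / ?b w" "1 / ?a w"] by simp
      define W where "W = Im w * (1 + (cmod w)\<^sup>2)"
      have W0: "W \<ge> 0" using w by (simp add: W_def upper_half_plane_def)
      have k1: "cmod (1 / (?a w * ?b w * ?b w)) * W \<le> L" "cmod (1 / (?a w * ?a w * ?b w)) * W \<le> L"
        unfolding L_def W_def mult.assoc[symmetric, of _ "Im w"]
        by (rule inverse_cubic_bound[OF _ \<eta>(1) w], use n \<eta> in auto)+
      have "cmod (?k w) \<le> cmod (1 / (?a w * ?b w * ?b w)) * cmod (1 / ?b w) + cmod (1 / (?a w * ?a w * ?b w)) * cmod (1 / ?b w + 1 / ?a w)"
        using norm_triangle_ineq[of "1 / (?a w * ?b w * ?b w) * (1 / ?b w)" "1 / (?a w * ?a w * ?b w) * (1 / ?b w + 1 / ?a w)"] by (simp only: norm_mult)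
      then have "cmod (?k w) * W \<le> (cmod (1 / (?a w * ?b w * ?b w)) * cmod (1 / ?b w) + cmod (1 / (?a w * ?a w * ?b w)) * cmod (1 / ?b w + 1 / ?a w)) * W"
        by (rule mult_right_mono[OF _ W0])
      also have "\<dots> = (cmod (1 / (?a w * ?b w * ?b w)) * W) * cmod (1 / ?b w) + (cmod (1 / (?a w * ?a w * ?b w)) * W) * cmod (1 / ?b w + 1 / ?a w)"
      proof -
        have "(p * a + q * b) * W = (p * W) * a + (q * W) * b" for p q a b :: real by (simp add: algebra_simps)
        then show ?thesis .
      qed
      also have "\<dots> \<le> C" unfolding C_def by (intro add_mono mult_mono k1 q q2 L0 norm_ge_zero)
      finally show ?thesis by (simp only: W_def mult.assoc)
    qed
    have "V2 (\<zeta> + \<delta>) - V2 \<zeta> = (LINT w|lborel. h0 w * (2 / (w - (\<zeta> + \<delta>)) ^ 3) - h0 w * (2 / (w - \<zeta>) ^ 3))"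
      unfolding V2_def by (rule Bochner_Integration.integral_diff[symmetric]) (rule i, simp)+
    also have "\<dots> = (LINT w|lborel. (2 * \<delta>) * (h0 w * ?k w))"
    proof (intro Bochner_Integration.integral_cong refl)
      fix w
      show "h0 w * (2 / (w - (\<zeta> + \<delta>)) ^ 3) - h0 w * (2 / (w - \<zeta>) ^ 3) = (2 * \<delta>) * (h0 w * ?k w)"
      proof (cases "w \<in> upper_half_plane")
        case True
        have nz: "?a w \<noteq> 0" "?b w \<noteq> 0"
          using lower_dist(1)[of \<zeta> \<eta> "cmod \<zeta> + \<eta>" w] lower_dist(1)[of "\<zeta> + \<delta>" \<eta> "cmod \<zeta> + \<eta>" w] n \<eta> True by auto
        have id: "2 * q ^ 3 - 2 * p ^ 3 = 2 * \<delta> * (p * q * q * q + p * p * q * (q + p))" if "a * p = 1" "b * q = 1" "\<delta> = a - b" for a b p q :: complex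
          using that by algebra
        have "2 * (1 / ?b w) ^ 3 - 2 * (1 / ?a w) ^ 3 = 2 * \<delta> * (1 / ?a w * (1 / ?b w) * (1 / ?b w) * (1 / ?b w) + 1 / ?a w * (1 / ?a w) * (1 / ?b w) * (1 / ?b w + 1 / ?a w))"
          by (rule id[of "?a w" _ "?b w"]) (use nz in auto)
        then have e: "2 / ?b w ^ 3 - 2 / ?a w ^ 3 = 2 * \<delta> * ?k w" by (simp add: power_one_over)
        have "h0 w * (2 / (w - (\<zeta> + \<delta>)) ^ 3) - h0 w * (2 / (w - \<zeta>) ^ 3) = h0 w * (2 / ?b w ^ 3 - 2 / ?a w ^ 3)" by (simp only: right_diff_distrib)
        then show ?thesis unfolding e by (simp only: mult_ac)
      qed (simp add: h0_def)
    qed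
    also have "\<dots> = (2 * \<delta>) * (LINT w|lborel. h0 w * ?k w)" by (rule integral_mult_right_zero)
    finally have "cmod (V2 (\<zeta> + \<delta>) - V2 \<zeta>) = 2 * cmod \<delta> * cmod (LINT w|lborel. h0 w * ?k w)" by (simp add: norm_mult)
    also have "\<dots> \<le> 2 * cmod \<delta> * (C * integral\<^sup>L lborel dom)"
      by (intro mult_left_mono dom_kernel_integral_bound kb C0) auto
    finally show ?thesis .
  qed
  have "((\<lambda>\<delta>. V2 (\<zeta> + \<delta>) - V2 \<zeta>) \<longlongrightarrow> 0) (at 0)"
  proof (rule Lim_null_comparison)
    have "\<forall>\<^sub>F \<delta> in at (0::complex). cmod \<delta> < \<eta>"
      unfolding eventually_at using \<eta>(1) by (intro exI[of _ \<eta>]) (auto simp: dist_norm)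
    then show "\<forall>\<^sub>F \<delta> in at 0. norm (V2 (\<zeta> + \<delta>) - V2 \<zeta>) \<le> 2 * cmod \<delta> * (C * integral\<^sup>L lborel dom)"
      by eventually_elim (rule lip)
    have "((\<lambda>\<delta>::complex. 2 * cmod \<delta> * (C * integral\<^sup>L lborel dom)) \<longlongrightarrow> 2 * cmod 0 * (C * integral\<^sup>L lborel dom)) (at 0)" by (intro tendsto_intros)
    then show "((\<lambda>\<delta>::complex. 2 * cmod \<delta> * (C * integral\<^sup>L lborel dom)) \<longlongrightarrow> 0) (at 0)" by simp
  qed
  then have "(\<lambda>\<delta>. V2 (\<zeta> + \<delta>)) \<midarrow>0\<rightarrow> V2 \<zeta>" by (simp add: LIM_zero_iff)
  then show ?thesis by (simp add: isCont_iff)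
qed

text \<open>The fundamental theorem along a path of unit speed, stated for any constant direction
  \<open>c\<close> so that vertical and horizontal segments share it.\<close>

lemma V1_line_increment:
  fixes p :: "real \<Rightarrow> complex"
  assumes p: "\<And>t. t \<in> {a..b} \<Longrightarrow> (p has_vector_derivative c) (at t)" "\<And>t. t \<in> {a..b} \<Longrightarrow> Im (p t) < 0"
    and c: "cmod c = 1" and ab: "a \<le> b"
  shows "ennreal (cmod (V1 (p b) - V1 (p a))) \<le> (\<integral>\<^sup>+t. ennreal (cmod (V2 (p t))) * indicator {a..b} t \<partial>lborel)"
proof -
  have pc: "continuous_on {a..b} p"
    by (intro continuous_at_imp_continuous_on ballI) (rule has_vector_derivative_continuous[OF p(1)])
  have cont: "continuous_on {a..b} (\<lambda>t. c * V2 (p t))"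
  proof (intro continuous_on_mult_left)
    have "continuous_on {\<zeta>. Im \<zeta> < 0} V2" by (intro continuous_at_imp_continuous_on ballI V2_isCont) simp
    then show "continuous_on {a..b} (\<lambda>t. V2 (p t))"
    proof (rule continuous_on_compose2[OF _ pc])
      show "p ` {a..b} \<subseteq> {\<zeta>. Im \<zeta> < 0}" using p(2) by blast
    qed
  qed
  have "(\<integral>t. indicator {a..b} t *\<^sub>R (c * V2 (p t)) \<partial>lborel) = V1 (p b) - V1 (p a)"
  proof -
    have "((\<lambda>t. V1 (p t)) has_vector_derivative c * V2 (p t)) (at t within {a..b})" if "a \<le> t" "t \<le> b" for t
    proof -
      have t: "t \<in> {a..b}" using that by simp
      have "((V1 \<circ> p) has_vector_derivative c * V2 (p t)) (at t)"
        by (rule field_vector_diff_chain_at[OF p(1)[OF t] V1_derivative[OF p(2)[OF t]]])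
      then have "((\<lambda>t. V1 (p t)) has_vector_derivative c * V2 (p t)) (at t)" by (simp only: o_def)
      then show ?thesis by (rule has_vector_derivative_at_within)
    qed
    from integral_FTC_Icc[where F="\<lambda>t. V1 (p t)" and f="\<lambda>t. c * V2 (p t)", OF ab this cont] show ?thesis .
  qed
  then have "ennreal (cmod (V1 (p b) - V1 (p a))) = ennreal (norm (\<integral>t. indicator {a..b} t *\<^sub>R (c * V2 (p t)) \<partial>lborel))" by simp
  also have "\<dots> \<le> (\<integral>\<^sup>+t. ennreal (norm (indicator {a..b} t *\<^sub>R (c * V2 (p t)))) \<partial>lborel)"
    by (rule integral_norm_bound_ennreal) (rule borel_integrable_compact[OF compact_Icc cont])
  also have "\<dots> = (\<integral>\<^sup>+t. ennreal (cmod (V2 (p t))) * indicator {a..b} t \<partial>lborel)"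
    by (intro nn_integral_cong) (simp add: norm_mult c indicator_def)
  finally show ?thesis .
qed

definition W :: "real \<Rightarrow> real \<Rightarrow> complex" where "W x y = V1 (Complex x (- y))"

lemma W_vertical:
  assumes "0 < a" "a \<le> b"
  shows "ennreal (cmod (W x b - W x a)) \<le> (\<integral>\<^sup>+y. ennreal (R x y) * indicator {a..b} y \<partial>lborel)"
proof -
  have "ennreal (cmod (V1 (Complex x (- b)) - V1 (Complex x (- a)))) \<le> (\<integral>\<^sup>+t. ennreal (cmod (V2 (Complex x (- t)))) * indicator {a..b} t \<partial>lborel)"
  proof (rule V1_line_increment[where c="- \<i>"])
    fix t assume "t \<in> {a..b}"
    then show "Im (Complex x (- t)) < 0" using assms by simp
    show "((\<lambda>t. Complex x (- t)) has_vector_derivative - \<i>) (at t)"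
      using DERIV_minus[OF DERIV_ident] unfolding has_vector_derivative_complex_iff by simp
  qed (use assms in auto)
  also have "\<dots> = (\<integral>\<^sup>+y. ennreal (R x y) * indicator {a..b} y \<partial>lborel)"
    using assms by (intro nn_integral_cong) (auto simp: R_def indicator_def)
  finally show ?thesis by (simp add: W_def)
qed

lemma W_horizontal:
  assumes "0 < y" "s \<le> t"
  shows "ennreal (cmod (W t y - W s y)) \<le> (\<integral>\<^sup>+x. ennreal (R x y) * indicator {s..t} x \<partial>lborel)"
proof -
  have "ennreal (cmod (V1 (Complex t (- y)) - V1 (Complex s (- y)))) \<le> (\<integral>\<^sup>+x. ennreal (cmod (V2 (Complex x (- y)))) * indicator {s..t} x \<partial>lborel)"
  proof (rule V1_line_increment[where c=1])
    fix x
    show "Im (Complex x (- y)) < 0" using assms by simp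
    show "((\<lambda>x. Complex x (- y)) has_vector_derivative 1) (at x)"
      unfolding has_vector_derivative_complex_iff by simp
  qed (use assms in auto)
  then show ?thesis using assms by (simp add: W_def R_def)
qed

end

section \<open>Energy of the trace by three-sided paths\<close>

lemma ennreal_sum3_sq: "(a + b + c)\<^sup>2 \<le> 3 * (a\<^sup>2 + b\<^sup>2 + c\<^sup>2)" for a b c :: ennreal
proof (cases "a = top \<or> b = top \<or> c = top")
  case True
  then have s: "a\<^sup>2 + b\<^sup>2 + c\<^sup>2 = top" by (auto simp: power2_eq_square ennreal_mult_eq_top_iff)
  have "3 * (a\<^sup>2 + b\<^sup>2 + c\<^sup>2) = top" unfolding s by (simp add: ennreal_mult_top)
  then show ?thesis by (simp only: top_greatest)
next
  case False
  then obtain x y z where x: "a = ennreal x" "b = ennreal y" "c = ennreal z" "x \<ge> 0" "y \<ge> 0" "z \<ge> 0"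
    by (cases a; cases b; cases c) auto
  have "0 \<le> (x - y)\<^sup>2 + (y - z)\<^sup>2 + (x - z)\<^sup>2" by simp
  then have "(x + y + z)\<^sup>2 \<le> 3 * (x\<^sup>2 + y\<^sup>2 + z\<^sup>2)" by (simp add: power2_eq_square algebra_simps)
  then have "ennreal ((x + y + z)\<^sup>2) \<le> ennreal (3 * (x\<^sup>2 + y\<^sup>2 + z\<^sup>2))" by (rule ennreal_leI)
  moreover have "ennreal ((x + y + z)\<^sup>2) = (a + b + c)\<^sup>2"
  proof -
    have e: "a + b + c = ennreal (x + y + z)" using x by simp
    show ?thesis unfolding e by (rule ennreal_power[symmetric]) (use x in simp)
  qed
  moreover have "ennreal (3 * (x\<^sup>2 + y\<^sup>2 + z\<^sup>2)) = 3 * (a\<^sup>2 + b\<^sup>2 + c\<^sup>2)"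
    using x by (subst ennreal_mult) (simp_all add: ennreal_power)
  ultimately show ?thesis by simp
qed

context extension
begin

definition J :: "real \<Rightarrow> ennreal" where "J x = (\<integral>\<^sup>+y. ennreal ((R x y)\<^sup>2) \<partial>lborel)"

text \<open>Bounds the change of \<open>V1\<close> on the vertical path from depth \<open>r\<close>
  up to the axis. The range is a condition in the integrand, which keeps joint measurability in
  \<open>x\<close> and \<open>r\<close> evident.\<close>

definition A :: "real \<Rightarrow> real \<Rightarrow> ennreal" where
  "A x r = (\<integral>\<^sup>+y. ennreal (if 0 < y \<and> y \<le> r then R x y else 0) \<partial>lborel)"

text \<open>The horizontal side is taken at a depth equal to its length \<open>r\<close>; this makes
  the scaling in \<open>B_bound\<close> exact.\<close>

definition B :: "real \<Rightarrow> real \<Rightarrow> ennreal" where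
  "B s r = (\<integral>\<^sup>+x. ennreal (if s \<le> x \<and> x \<le> s + r then R x r else 0) \<partial>lborel)"

lemma J_measurable [measurable]: "J \<in> borel_measurable borel"
  unfolding J_def[abs_def] by measurable

lemma A_measurable [measurable (raw)]:
  assumes [measurable]: "p \<in> borel_measurable M" "q \<in> borel_measurable M"
  shows "(\<lambda>x. A (p x) (q x)) \<in> borel_measurable M"
  unfolding A_def by measurable

lemma B_measurable [measurable (raw)]:
  assumes [measurable]: "p \<in> borel_measurable M" "q \<in> borel_measurable M"
  shows "(\<lambda>x. B (p x) (q x)) \<in> borel_measurable M"
  unfolding B_def by measurable

lemma A_sq:
  assumes "r > 0"
  shows "(A x r)\<^sup>2 \<le> J x * ennreal r"
proof -
  have "(A x r)\<^sup>2 \<le> (\<integral>\<^sup>+y. (ennreal (R x y))\<^sup>2 \<partial>lborel) * (\<integral>\<^sup>+y. (indicator {0<..r} y)\<^sup>2 \<partial>lborel)"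
    unfolding A_def by (rule sq_le_schur) (simp_all add: indicator_def)
  also have "(\<integral>\<^sup>+y. (indicator {0<..r} y)\<^sup>2 \<partial>lborel) = (\<integral>\<^sup>+y. indicator {0<..r} y \<partial>lborel)"
    by (intro nn_integral_cong) (simp add: indicator_def)
  also have "\<dots> = ennreal r" using assms by simp
  also have "(\<integral>\<^sup>+y. (ennreal (R x y))\<^sup>2 \<partial>lborel) = J x"
    unfolding J_def by (intro nn_integral_cong) (simp add: ennreal_power R_nonneg)
  finally show ?thesis .
qed

lemma B_sq:
  assumes "r > 0"
  shows "(B s r)\<^sup>2 \<le> ennreal r * (\<integral>\<^sup>+x. ennreal (if s \<le> x \<and> x \<le> s + r then (R x r)\<^sup>2 else 0) \<partial>lborel)"
proof -
  have "(B s r)\<^sup>2 \<le> (\<integral>\<^sup>+x. (ennreal (if s \<le> x \<and> x \<le> s + r then R x r else 0))\<^sup>2 \<partial>lborel) * (\<integral>\<^sup>+x. (indicator {s..s + r} x)\<^sup>2 \<partial>lborel)"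
    unfolding B_def by (rule sq_le_schur) (simp_all add: indicator_def)
  also have "(\<integral>\<^sup>+x. (indicator {s..s + r} x)\<^sup>2 \<partial>lborel) = (\<integral>\<^sup>+x. indicator {s..s + r} x \<partial>lborel)"
    by (intro nn_integral_cong) (simp add: indicator_def)
  also have "\<dots> = ennreal r" using assms by simp
  also have "(\<integral>\<^sup>+x. (ennreal (if s \<le> x \<and> x \<le> s + r then R x r else 0))\<^sup>2 \<partial>lborel) = (\<integral>\<^sup>+x. ennreal (if s \<le> x \<and> x \<le> s + r then (R x r)\<^sup>2 else 0) \<partial>lborel)"
    by (intro nn_integral_cong) (simp add: ennreal_power R_nonneg)
  finally show ?thesis by (simp only: mult.commute)
qed

lemma AE_J: "AE x in lborel. J x < \<infinity>"
proof -
  have "AE x in lborel. J x \<noteq> \<infinity>"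
    by (rule nn_integral_PInf_AE) (use D_finite in \<open>auto simp: D_def J_def\<close>)
  then show ?thesis by eventually_elim (simp add: less_top)
qed

lemma W_A:
  assumes "0 < a" "a \<le> b"
  shows "ennreal (cmod (W x b - W x a)) \<le> A x b"
proof (rule order_trans[OF W_vertical[OF assms]])
  show "(\<integral>\<^sup>+y. ennreal (R x y) * indicator {a..b} y \<partial>lborel) \<le> A x b"
    unfolding A_def using assms by (intro nn_integral_mono) (auto simp: indicator_def)
qed

lemma W_B:
  assumes "0 < r"
  shows "ennreal (cmod (W (s + r) r - W s r)) \<le> B s r"
proof -
  have "ennreal (cmod (W (s + r) r - W s r)) \<le> (\<integral>\<^sup>+x. ennreal (R x r) * indicator {s..s + r} x \<partial>lborel)"
    by (rule W_horizontal) (use assms in auto)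
  also have "\<dots> = B s r" unfolding B_def by (intro nn_integral_cong) (simp add: indicator_def)
  finally show ?thesis .
qed

text \<open>The sequence converges wherever \<open>J\<close> is finite, hence almost everywhere;
  elsewhere the value of \<open>lim\<close> is immaterial.\<close>

definition tr :: "real \<Rightarrow> complex" where "tr x = lim (\<lambda>n. W x (1 / (real n + 1)))"

lemma W_sqrt_bound:
  assumes j: "J x = ennreal j" "j \<ge> 0" and ab: "0 < a" "a \<le> b"
  shows "cmod (W x b - W x a) \<le> sqrt (j * b)"
proof -
  have "(ennreal (cmod (W x b - W x a)))\<^sup>2 \<le> (A x b)\<^sup>2" by (rule power_mono[OF W_A[OF ab]]) simp
  also have "\<dots> \<le> ennreal j * ennreal b" using A_sq[of b x] ab j(1) by simp
  also have "\<dots> = ennreal (j * b)" using j(2) ab by (subst ennreal_mult) simp_all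
  finally have "(cmod (W x b - W x a))\<^sup>2 \<le> j * b" using j(2) ab by (simp add: ennreal_power)
  then show ?thesis by (rule real_le_rsqrt)
qed

text \<open>By Cauchy-Schwarz, the values of \<open>W x\<close> at depths at most \<open>b\<close>
  differ from the value at \<open>b\<close> by at most \<open>sqrt (j * b)\<close>, which tends to 0
  with \<open>b\<close>; so the sequence is Cauchy.\<close>

lemma trace_limit:
  assumes "J x < \<infinity>"
  shows "(\<lambda>n. W x (1 / (real n + 1))) \<longlonglongrightarrow> tr x"
proof -
  obtain j where j: "J x = ennreal j" "j \<ge> 0" using assms by (cases "J x") auto
  have lim: "(\<lambda>n. sqrt (j * (1 / (real n + 1)))) \<longlonglongrightarrow> sqrt (j * 0)"
    using LIMSEQ_inverse_real_of_nat by (intro tendsto_intros) (simp add: inverse_eq_divide add.commute)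
  have "Cauchy (\<lambda>n. W x (1 / (real n + 1)))"
  proof (rule CauchyI)
    fix e :: real assume e: "e > 0"
    then have "\<forall>\<^sub>F n in sequentially. sqrt (j * (1 / (real n + 1))) < e" using order_tendstoD(2)[OF lim, of e] by simp
    then obtain N where N: "sqrt (j * (1 / (real N + 1))) < e" by (auto simp: eventually_sequentially)
    have *: "cmod (W x (1 / (real n + 1)) - W x (1 / (real m + 1))) < e" if "N \<le> n" "n \<le> m" for m n
    proof -
      have "cmod (W x (1 / (real n + 1)) - W x (1 / (real m + 1))) \<le> sqrt (j * (1 / (real n + 1)))"
        by (rule W_sqrt_bound[OF j]) (use that in \<open>auto intro: frac_le\<close>)
      also have "\<dots> \<le> sqrt (j * (1 / (real N + 1)))"
        using that j(2) by (intro real_sqrt_le_mono mult_left_mono frac_le) auto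
      finally show ?thesis using N by simp
    qed
    have "cmod (W x (1 / (real m + 1)) - W x (1 / (real n + 1))) < e" if "N \<le> m" "N \<le> n" for m n
      using *[of m n] *[of n m] that by (cases "n \<le> m") (auto simp: norm_minus_commute)
    then show "\<exists>M. \<forall>m\<ge>M. \<forall>n\<ge>M. norm (W x (1 / (real m + 1)) - W x (1 / (real n + 1))) < e" by blast
  qed
  then show ?thesis unfolding tr_def by (simp add: Cauchy_convergent_iff convergent_LIMSEQ_iff)
qed

lemma trace_A:
  assumes "J x < \<infinity>" "r > 0"
  shows "ennreal (cmod (tr x - W x r)) \<le> A x r"
proof -
  have l: "(\<lambda>n. ennreal (cmod (W x (1 / (real n + 1)) - W x r))) \<longlonglongrightarrow> ennreal (cmod (tr x - W x r))"
    by (intro tendsto_ennrealI tendsto_norm tendsto_diff trace_limit assms tendsto_const)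
  show ?thesis
  proof (rule tendsto_upperbound[OF l])
    show "\<forall>\<^sub>F n in sequentially. ennreal (cmod (W x (1 / (real n + 1)) - W x r)) \<le> A x r"
      using eventually_ge_at_top[of "nat \<lceil>1 / r\<rceil>"]
    proof eventually_elim
      case (elim n)
      then have "1 / r \<le> real n" by linarith
      then have "1 / (real n + 1) \<le> r" using assms(2) by (simp add: field_simps)
      from W_A[OF _ this, of x] show ?case by (simp add: norm_minus_commute)
    qed
  qed simp
qed

lemma V1_measurable [measurable]: "V1 \<in> borel_measurable borel"
  unfolding V1_def[abs_def] by measurable

lemma W_measurable [measurable (raw)]:
  assumes [measurable]: "p \<in> borel_measurable M" "q \<in> borel_measurable M"
  shows "(\<lambda>x. W (p x) (q x)) \<in> borel_measurable M"
  unfolding W_def by measurable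

lemma tr_measurable [measurable]: "tr \<in> borel_measurable borel"
  unfolding tr_def[abs_def] by (rule borel_measurable_lim_metric) measurable

text \<open>From one boundary point down to depth \<open>r\<close>, across a horizontal segment of
  length \<open>r\<close>, and up again: three sides of a square. The depth equals the distance of
  the points, so Hardy's inequality fits the vertical sides.\<close>

lemma trace_difference:
  assumes s: "J s < \<infinity>" and t: "J (s + r) < \<infinity>" and r: "r > 0"
  shows "ennreal ((cmod (tr s - tr (s + r)))\<^sup>2) \<le> 3 * ((A s r)\<^sup>2 + (A (s + r) r)\<^sup>2 + (B s r)\<^sup>2)"
proof -
  have "cmod (tr s - tr (s + r)) \<le> cmod (tr s - W s r) + cmod (tr (s + r) - W (s + r) r) + cmod (W (s + r) r - W s r)"
    using norm_triangle_ineq4[of "(tr s - W s r) - (W (s + r) r - W s r)" "tr (s + r) - W (s + r) r"] norm_triangle_ineq4[of "tr s - W s r" "W (s + r) r - W s r"] by simp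
  then have "ennreal (cmod (tr s - tr (s + r))) \<le> ennreal (cmod (tr s - W s r) + cmod (tr (s + r) - W (s + r) r) + cmod (W (s + r) r - W s r))"
    by (rule ennreal_leI)
  also have "\<dots> = ennreal (cmod (tr s - W s r)) + ennreal (cmod (tr (s + r) - W (s + r) r)) + ennreal (cmod (W (s + r) r - W s r))"
    by (simp add: ennreal_plus[symmetric] del: ennreal_plus)
  also have "\<dots> \<le> A s r + A (s + r) r + B s r"
    by (intro add_mono trace_A W_B s t r)
  finally have "(ennreal (cmod (tr s - tr (s + r))))\<^sup>2 \<le> (A s r + A (s + r) r + B s r)\<^sup>2" by (rule power_mono) simp
  also have "\<dots> \<le> 3 * ((A s r)\<^sup>2 + (A (s + r) r)\<^sup>2 + (B s r)\<^sup>2)" by (rule ennreal_sum3_sq)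
  finally show ?thesis by (simp add: ennreal_power)
qed

definition k :: "real \<Rightarrow> ennreal" where "k r = ennreal (1 / r\<^sup>2) * indicator {0<..} r"

lemma k_measurable [measurable]: "k \<in> borel_measurable borel" unfolding k_def[abs_def] by measurable

lemma A_hardy: "(\<integral>\<^sup>+s. \<integral>\<^sup>+r. k r * (A s r)\<^sup>2 \<partial>lborel \<partial>lborel) \<le> 4 * D"
proof -
  have "(\<integral>\<^sup>+r. k r * (A s r)\<^sup>2 \<partial>lborel) \<le> 4 * J s" for s
  proof -
    have "A s r = (\<integral>\<^sup>+y. ennreal (R s y) * indicator {0<..r} y \<partial>lborel)" for r
      unfolding A_def by (intro nn_integral_cong) (auto simp: indicator_def)
    then have "(\<integral>\<^sup>+r. k r * (A s r)\<^sup>2 \<partial>lborel) \<le> 4 * (\<integral>\<^sup>+y. ennreal ((R s y)\<^sup>2) * indicator {0<..} y \<partial>lborel)"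
      unfolding k_def using hardy[of "R s"] R_nonneg by simp
    also have "\<dots> \<le> 4 * J s" unfolding J_def by (intro mult_left_mono nn_integral_mono) (auto simp: indicator_def)
    finally show ?thesis .
  qed
  then have "(\<integral>\<^sup>+s. \<integral>\<^sup>+r. k r * (A s r)\<^sup>2 \<partial>lborel \<partial>lborel) \<le> (\<integral>\<^sup>+s. 4 * J s \<partial>lborel)" by (intro nn_integral_mono)
  also have "\<dots> = 4 * D" unfolding D_def J_def[symmetric] by (rule nn_integral_cmult) measurable
  finally show ?thesis .
qed

text \<open>For fixed \<open>r\<close> a translation in \<open>s\<close> removes the shift; Tonelli
  puts \<open>s\<close> inside for this purpose and back outside afterwards.\<close>

lemma A_hardy_shift: "(\<integral>\<^sup>+s. \<integral>\<^sup>+r. k r * (A (s + r) r)\<^sup>2 \<partial>lborel \<partial>lborel) \<le> 4 * D"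
proof -
  have "(\<integral>\<^sup>+s. \<integral>\<^sup>+r. k r * (A (s + r) r)\<^sup>2 \<partial>lborel \<partial>lborel) = (\<integral>\<^sup>+r. \<integral>\<^sup>+s. k r * (A (s + r) r)\<^sup>2 \<partial>lborel \<partial>lborel)"
    by (rule lborel_pair.Fubini') measurable
  also have "\<dots> = (\<integral>\<^sup>+r. \<integral>\<^sup>+s. k r * (A s r)\<^sup>2 \<partial>lborel \<partial>lborel)"
  proof (rule nn_integral_cong)
    fix r
    have "(\<integral>\<^sup>+s. k r * (A s r)\<^sup>2 \<partial>lborel) = ennreal \<bar>1\<bar> * (\<integral>\<^sup>+s. k r * (A (r + 1 * s) r)\<^sup>2 \<partial>lborel)"
      by (rule nn_integral_real_affine) (auto intro!: borel_measurable_times_ennreal)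
    then show "(\<integral>\<^sup>+s. k r * (A (s + r) r)\<^sup>2 \<partial>lborel) = (\<integral>\<^sup>+s. k r * (A s r)\<^sup>2 \<partial>lborel)" by (simp add: add.commute)
  qed
  also have "\<dots> = (\<integral>\<^sup>+s. \<integral>\<^sup>+r. k r * (A s r)\<^sup>2 \<partial>lborel \<partial>lborel)"
    by (rule lborel_pair.Fubini') measurable
  also have "\<dots> \<le> 4 * D" by (rule A_hardy)
  finally show ?thesis .
qed

lemma B_bound: "(\<integral>\<^sup>+s. \<integral>\<^sup>+r. k r * (B s r)\<^sup>2 \<partial>lborel \<partial>lborel) \<le> D"
proof -
  have "(\<integral>\<^sup>+s. \<integral>\<^sup>+r. k r * (B s r)\<^sup>2 \<partial>lborel \<partial>lborel) = (\<integral>\<^sup>+r. \<integral>\<^sup>+s. k r * (B s r)\<^sup>2 \<partial>lborel \<partial>lborel)"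
    by (rule lborel_pair.Fubini') measurable
  also have "\<dots> \<le> (\<integral>\<^sup>+r. \<integral>\<^sup>+x. ennreal ((R x r)\<^sup>2) \<partial>lborel \<partial>lborel)"
  proof (rule nn_integral_mono)
    fix r
    show "(\<integral>\<^sup>+s. k r * (B s r)\<^sup>2 \<partial>lborel) \<le> (\<integral>\<^sup>+x. ennreal ((R x r)\<^sup>2) \<partial>lborel)"
    proof (cases "r > 0")
      case True
      \<comment> \<open>One factor \<open>r\<close> comes from Cauchy-Schwarz, the other from the
        length of the set of \<open>s\<close> whose segment contains \<open>x\<close>; together they
        cancel the weight 1 / r^2.\<close>
      have kr: "k r * ennreal r * ennreal r = 1" using True by (simp add: k_def ennreal_mult[symmetric] power2_eq_square)
      have "(\<integral>\<^sup>+s. k r * (B s r)\<^sup>2 \<partial>lborel) \<le> (\<integral>\<^sup>+s. k r * ennreal r * (\<integral>\<^sup>+x. ennreal (if s \<le> x \<and> x \<le> s + r then (R x r)\<^sup>2 else 0) \<partial>lborel) \<partial>lborel)"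
        unfolding mult.assoc by (intro nn_integral_mono mult_left_mono B_sq True) simp
      also have "\<dots> = k r * ennreal r * (\<integral>\<^sup>+s. \<integral>\<^sup>+x. ennreal (if s \<le> x \<and> x \<le> s + r then (R x r)\<^sup>2 else 0) \<partial>lborel \<partial>lborel)"
        by (rule nn_integral_cmult) measurable
      also have "(\<integral>\<^sup>+s. \<integral>\<^sup>+x. ennreal (if s \<le> x \<and> x \<le> s + r then (R x r)\<^sup>2 else 0) \<partial>lborel \<partial>lborel) = (\<integral>\<^sup>+x. \<integral>\<^sup>+s. ennreal (if s \<le> x \<and> x \<le> s + r then (R x r)\<^sup>2 else 0) \<partial>lborel \<partial>lborel)"
        by (rule lborel_pair.Fubini') measurable
      also have "\<dots> = (\<integral>\<^sup>+x. ennreal r * ennreal ((R x r)\<^sup>2) \<partial>lborel)"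
      proof (intro nn_integral_cong)
        fix x
        have "(\<integral>\<^sup>+s. ennreal (if s \<le> x \<and> x \<le> s + r then (R x r)\<^sup>2 else 0) \<partial>lborel) = (\<integral>\<^sup>+s. ennreal ((R x r)\<^sup>2) * indicator {x - r..x} s \<partial>lborel)"
          by (intro nn_integral_cong) (auto simp: indicator_def)
        also have "\<dots> = ennreal ((R x r)\<^sup>2) * ennreal r" using True by (subst nn_integral_cmult) auto
        finally show "(\<integral>\<^sup>+s. ennreal (if s \<le> x \<and> x \<le> s + r then (R x r)\<^sup>2 else 0) \<partial>lborel) = ennreal r * ennreal ((R x r)\<^sup>2)" by (simp only: mult.commute)
      qed
      also have "\<dots> = ennreal r * (\<integral>\<^sup>+x. ennreal ((R x r)\<^sup>2) \<partial>lborel)" by (rule nn_integral_cmult) measurable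
      also have "k r * ennreal r * \<dots> = (\<integral>\<^sup>+x. ennreal ((R x r)\<^sup>2) \<partial>lborel)"
        unfolding mult.assoc[of "k r * ennreal r", symmetric] kr by simp
      finally show ?thesis .
    qed (simp add: k_def)
  qed
  also have "\<dots> = D" unfolding D_def by (rule lborel_pair.Fubini') measurable
  finally show ?thesis .
qed

text \<open>With \<open>t = s + r\<close> the three sides contribute 4, 4 and 1 times
  \<open>D\<close>, and squaring a sum of three terms costs 3: hence 27.\<close>

lemma trace_half_plane:
  "(\<integral>\<^sup>+s. \<integral>\<^sup>+t. indicator {0<..} (t - s) * ennreal ((cmod (tr s - tr t))\<^sup>2 / (s - t)\<^sup>2) \<partial>lborel \<partial>lborel) \<le> 27 * D"
proof -
  have "(\<integral>\<^sup>+s. \<integral>\<^sup>+t. indicator {0<..} (t - s) * ennreal ((cmod (tr s - tr t))\<^sup>2 / (s - t)\<^sup>2) \<partial>lborel \<partial>lborel)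
    \<le> (\<integral>\<^sup>+s. \<integral>\<^sup>+t. k (t - s) * (3 * ((A s (t - s))\<^sup>2 + (A (s + (t - s)) (t - s))\<^sup>2 + (B s (t - s))\<^sup>2)) \<partial>lborel \<partial>lborel)"
  proof (rule nn_integral_mono_AE)
    show "AE s in lborel. (\<integral>\<^sup>+t. indicator {0<..} (t - s) * ennreal ((cmod (tr s - tr t))\<^sup>2 / (s - t)\<^sup>2) \<partial>lborel)
      \<le> (\<integral>\<^sup>+t. k (t - s) * (3 * ((A s (t - s))\<^sup>2 + (A (s + (t - s)) (t - s))\<^sup>2 + (B s (t - s))\<^sup>2)) \<partial>lborel)"
      using AE_J
    proof eventually_elim
      case (elim s)
      show ?case
      proof (rule nn_integral_mono_AE)
        show "AE t in lborel. indicator {0<..} (t - s) * ennreal ((cmod (tr s - tr t))\<^sup>2 / (s - t)\<^sup>2)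
          \<le> k (t - s) * (3 * ((A s (t - s))\<^sup>2 + (A (s + (t - s)) (t - s))\<^sup>2 + (B s (t - s))\<^sup>2))"
          using AE_J
        proof eventually_elim
          case (elim t)
          show ?case
          proof (cases "t - s > 0")
            case True
            have "ennreal ((cmod (tr s - tr t))\<^sup>2 / (s - t)\<^sup>2) = ennreal (1 / (t - s)\<^sup>2) * ennreal ((cmod (tr s - tr t))\<^sup>2)"
              by (subst ennreal_mult[symmetric]) (simp_all add: power2_commute[of s t])
            also have "\<dots> \<le> ennreal (1 / (t - s)\<^sup>2) * (3 * ((A s (t - s))\<^sup>2 + (A (s + (t - s)) (t - s))\<^sup>2 + (B s (t - s))\<^sup>2))"
              using trace_difference[OF \<open>J s < \<infinity>\<close> _ True] elim by (intro mult_left_mono) simp_all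
            finally show ?thesis using True by (simp add: k_def)
          qed simp
        qed
      qed
    qed
  qed
  also have "\<dots> = (\<integral>\<^sup>+s. \<integral>\<^sup>+r. k r * (3 * ((A s r)\<^sup>2 + (A (s + r) r)\<^sup>2 + (B s r)\<^sup>2)) \<partial>lborel \<partial>lborel)"
  proof (rule nn_integral_cong)
    fix s
    have "(\<integral>\<^sup>+t. k (t - s) * (3 * ((A s (t - s))\<^sup>2 + (A (s + (t - s)) (t - s))\<^sup>2 + (B s (t - s))\<^sup>2)) \<partial>lborel)
      = ennreal \<bar>1\<bar> * (\<integral>\<^sup>+r. k (s + 1 * r - s) * (3 * ((A s (s + 1 * r - s))\<^sup>2 + (A (s + (s + 1 * r - s)) (s + 1 * r - s))\<^sup>2 + (B s (s + 1 * r - s))\<^sup>2)) \<partial>lborel)"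
      by (rule nn_integral_real_affine) measurable
    then show "(\<integral>\<^sup>+t. k (t - s) * (3 * ((A s (t - s))\<^sup>2 + (A (s + (t - s)) (t - s))\<^sup>2 + (B s (t - s))\<^sup>2)) \<partial>lborel)
      = (\<integral>\<^sup>+r. k r * (3 * ((A s r)\<^sup>2 + (A (s + r) r)\<^sup>2 + (B s r)\<^sup>2)) \<partial>lborel)" by simp
  qed
  also have "\<dots> = (\<integral>\<^sup>+s. 3 * ((\<integral>\<^sup>+r. k r * (A s r)\<^sup>2 \<partial>lborel) + (\<integral>\<^sup>+r. k r * (A (s + r) r)\<^sup>2 \<partial>lborel) + (\<integral>\<^sup>+r. k r * (B s r)\<^sup>2 \<partial>lborel)) \<partial>lborel)"
  proof (rule nn_integral_cong)
    fix s
    have "k r * (3 * ((A s r)\<^sup>2 + (A (s + r) r)\<^sup>2 + (B s r)\<^sup>2)) = 3 * (k r * (A s r)\<^sup>2 + k r * (A (s + r) r)\<^sup>2 + k r * (B s r)\<^sup>2)" for r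
      by (simp add: distrib_left mult_ac)
    then show "(\<integral>\<^sup>+r. k r * (3 * ((A s r)\<^sup>2 + (A (s + r) r)\<^sup>2 + (B s r)\<^sup>2)) \<partial>lborel) = 3 * ((\<integral>\<^sup>+r. k r * (A s r)\<^sup>2 \<partial>lborel) + (\<integral>\<^sup>+r. k r * (A (s + r) r)\<^sup>2 \<partial>lborel) + (\<integral>\<^sup>+r. k r * (B s r)\<^sup>2 \<partial>lborel))"
      by (simp add: nn_integral_cmult nn_integral_add)
  qed
  also have "\<dots> = 3 * ((\<integral>\<^sup>+s. \<integral>\<^sup>+r. k r * (A s r)\<^sup>2 \<partial>lborel \<partial>lborel) + (\<integral>\<^sup>+s. \<integral>\<^sup>+r. k r * (A (s + r) r)\<^sup>2 \<partial>lborel \<partial>lborel) + (\<integral>\<^sup>+s. \<integral>\<^sup>+r. k r * (B s r)\<^sup>2 \<partial>lborel \<partial>lborel))"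
    by (simp add: nn_integral_cmult nn_integral_add)
  also have "\<dots> \<le> 3 * (4 * D + 4 * D + D)"
    by (intro mult_left_mono add_mono A_hardy A_hardy_shift B_bound) simp
  also have "\<dots> = 27 * D"
  proof -
    have "4 * D + 4 * D + D = (4 + 4 + 1) * D" by (simp only: distrib_right mult_1)
    then show ?thesis by (simp add: mult.assoc[symmetric])
  qed
  finally show ?thesis .
qed

text \<open>Symmetry in \<open>s\<close> and \<open>t\<close> reduces to the half
  \<open>t > s\<close>; on the diagonal the integrand is 0.\<close>

lemma trace_energy_finite:
  "(\<integral>\<^sup>+s. \<integral>\<^sup>+t. ennreal ((cmod (tr s - tr t))\<^sup>2 / (s - t)\<^sup>2) \<partial>lborel \<partial>lborel) < \<infinity>"
proof -
  let ?G = "\<lambda>s t. ennreal ((cmod (tr s - tr t))\<^sup>2 / (s - t)\<^sup>2)"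
  have sym: "?G s t = ?G t s" for s t by (simp add: norm_minus_commute power2_commute)
  have "(\<integral>\<^sup>+s. \<integral>\<^sup>+t. ?G s t \<partial>lborel \<partial>lborel) = (\<integral>\<^sup>+s. \<integral>\<^sup>+t. indicator {0<..} (t - s) * ?G s t + indicator {0<..} (s - t) * ?G s t \<partial>lborel \<partial>lborel)"
  proof (intro nn_integral_cong)
    fix s t :: real
    consider "s < t" | "t < s" | "s = t" by linarith
    then show "?G s t = indicator {0<..} (t - s) * ?G s t + indicator {0<..} (s - t) * ?G s t" by cases auto
  qed
  also have "\<dots> = (\<integral>\<^sup>+s. \<integral>\<^sup>+t. indicator {0<..} (t - s) * ?G s t \<partial>lborel \<partial>lborel) + (\<integral>\<^sup>+s. \<integral>\<^sup>+t. indicator {0<..} (s - t) * ?G s t \<partial>lborel \<partial>lborel)"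
    by (simp add: nn_integral_add)
  also have "(\<integral>\<^sup>+s. \<integral>\<^sup>+t. indicator {0<..} (s - t) * ?G s t \<partial>lborel \<partial>lborel) = (\<integral>\<^sup>+t. \<integral>\<^sup>+s. indicator {0<..} (s - t) * ?G s t \<partial>lborel \<partial>lborel)"
    by (rule lborel_pair.Fubini') measurable
  also have "\<dots> = (\<integral>\<^sup>+s. \<integral>\<^sup>+t. indicator {0<..} (t - s) * ?G s t \<partial>lborel \<partial>lborel)" by (simp only: sym)
  also have "(\<integral>\<^sup>+s. \<integral>\<^sup>+t. indicator {0<..} (t - s) * ?G s t \<partial>lborel \<partial>lborel) + \<dots> \<le> 27 * D + 27 * D"
    by (intro add_mono trace_half_plane)
  also have "\<dots> < \<infinity>" using D_finite by (simp add: ennreal_mult_less_top)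
  finally show ?thesis .
qed

text \<open>On lines below the axis the fundamental theorem gives increments of \<open>V\<close>.
  The passage to the axis uses dominated convergence for \<open>W\<close> and the vertical limits of
  \<open>V\<close> at the two endpoints.\<close>

lemma trace_integral:
  assumes ab: "a \<le> b"
  shows "set_integrable lborel {a..b} tr" "(LINT x:{a..b}|lborel. tr x) = V (of_real b) - V (of_real a)"
proof -
  define e where "e n = 1 / (real n + 1)" for n
  have e: "e n > 0" "e n \<le> 1" for n by (auto simp: e_def)
  have elim: "e \<longlonglongrightarrow> 0" unfolding e_def using LIMSEQ_inverse_real_of_nat by (simp add: inverse_eq_divide add.commute)
  have Wc: "continuous_on {a..b} (\<lambda>x. W x y)" if "y > 0" for y
  proof -
    have "continuous_on {\<zeta>. Im \<zeta> < 0} V1" by (intro continuous_at_imp_continuous_on ballI DERIV_isCont[OF V1_derivative]) simp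
    then show ?thesis unfolding W_def
    proof (rule continuous_on_compose2)
      show "continuous_on {a..b} (\<lambda>x. Complex x (- y))" unfolding Complex_eq by (intro continuous_intros)
    qed (use that in auto)
  qed
  have ftc: "(\<integral>x. indicator {a..b} x *\<^sub>R W x (e n) \<partial>lborel) = V (Complex b (- e n)) - V (Complex a (- e n))" for n
  proof -
    have "((\<lambda>x. V (Complex x (- e n))) has_vector_derivative W x (e n)) (at x within {a..b})" if "a \<le> x" "x \<le> b" for x
    proof -
      have c: "((\<lambda>x. Complex x (- e n)) has_vector_derivative 1) (at x)"
        unfolding has_vector_derivative_complex_iff by simp
      have "Im (Complex x (- e n)) < 0" using e by simp
      from field_vector_diff_chain_at[OF c V_derivative[OF this]]
      have "((\<lambda>x. V (Complex x (- e n))) has_vector_derivative W x (e n)) (at x)" by (simp only: o_def mult_1 W_def)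
      then show ?thesis by (rule has_vector_derivative_at_within)
    qed
    from integral_FTC_Icc[where F="\<lambda>x. V (Complex x (- e n))" and f="\<lambda>x. W x (e n)", OF ab this Wc[OF e(1)]] show ?thesis .
  qed
  \<comment> \<open>A majorant for all depths at most 1: \<open>W x\<close> differs from its value
    at depth 1 by at most the root of \<open>J x\<close>, and \<open>sqrt j <= 1 + j\<close>.
    Integrability of \<open>J\<close> is finiteness of \<open>D\<close>.\<close>
  define w where "w x = indicator {a..b} x * cmod (W x 1) + (indicator {a..b} x + enn2real (J x))" for x :: real
  have wi: "integrable lborel w"
  proof -
    have 1: "integrable lborel (\<lambda>x. indicator {a..b} x * cmod (W x 1))"
      using borel_integrable_compact[of "{a..b}" "\<lambda>x. cmod (W x 1)"] continuous_on_norm[OF Wc[of 1]] by simp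
    have 2: "integrable lborel (\<lambda>x. indicator {a..b} x :: real)"
      using borel_integrable_compact[of "{a..b}" "\<lambda>_. 1::real"] by simp
    have 3: "integrable lborel (\<lambda>x. enn2real (J x))"
    proof (rule integrableI_nonneg)
      have "(\<integral>\<^sup>+x. ennreal (enn2real (J x)) \<partial>lborel) \<le> (\<integral>\<^sup>+x. J x \<partial>lborel)"
        by (intro nn_integral_mono) (metis ennreal_enn2real_if order_refl top_greatest zero_le ennreal_0)
      also have "\<dots> < \<infinity>" using D_finite by (simp add: D_def J_def)
      finally show "(\<integral>\<^sup>+x. ennreal (enn2real (J x)) \<partial>lborel) < \<infinity>" .
    qed auto
    show ?thesis unfolding w_def by (intro Bochner_Integration.integrable_add 1 2 3)
  qed
  have ae: "AE x in lborel. (\<lambda>n. indicator {a..b} x *\<^sub>R W x (e n)) \<longlonglongrightarrow> indicator {a..b} x *\<^sub>R tr x"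
    using AE_J
  proof eventually_elim
    case (elim x)
    show ?case using trace_limit[OF elim] unfolding e_def by (intro tendsto_scaleR tendsto_const)
  qed
  have bd: "AE x in lborel. norm (indicator {a..b} x *\<^sub>R W x (e n)) \<le> w x" for n
    using AE_J
  proof eventually_elim
    case (elim x)
    obtain j where j: "J x = ennreal j" "j \<ge> 0" using elim by (cases "J x") auto
    have "cmod (W x 1 - W x (e n)) \<le> sqrt (j * 1)" by (rule W_sqrt_bound[OF j e])
    also have "\<dots> \<le> 1 + j"
      using j(2) by (intro real_le_lsqrt) (simp_all add: power2_eq_square algebra_simps)
    finally have "cmod (W x (e n)) \<le> cmod (W x 1) + (1 + j)"
      using norm_triangle_ineq3[of "W x 1" "W x (e n)"] by simp
    then show ?case using j by (simp add: w_def indicator_def)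
  qed
  have m: "(\<lambda>x. indicator {a..b} x *\<^sub>R tr x) \<in> borel_measurable lborel" "\<And>n. (\<lambda>x. indicator {a..b} x *\<^sub>R W x (e n)) \<in> borel_measurable lborel"
    by measurable
  show "set_integrable lborel {a..b} tr"
    unfolding set_integrable_def by (rule integrable_dominated_convergence[OF m wi ae bd])
  have "(\<lambda>n. \<integral>x. indicator {a..b} x *\<^sub>R W x (e n) \<partial>lborel) \<longlonglongrightarrow> (\<integral>x. indicator {a..b} x *\<^sub>R tr x \<partial>lborel)"
    by (rule integral_dominated_convergence[OF m wi ae bd])
  moreover have "(\<lambda>n. \<integral>x. indicator {a..b} x *\<^sub>R W x (e n) \<partial>lborel) \<longlonglongrightarrow> V (of_real b) - V (of_real a)"
    unfolding ftc by (intro tendsto_diff V_vertical_limit elim e)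
  ultimately show "(LINT x:{a..b}|lborel. tr x) = V (of_real b) - V (of_real a)"
    unfolding set_lebesgue_integral_def by (rule LIMSEQ_unique)
qed

end

text \<open>The candidate \<open>g\<close> is the formal derivative of the representation formula.
  It is verified in integrated form, from which almost everywhere differentiability and absolute
  continuity follow; the constant \<open>f 1 - f 0\<close> drops out of the energy.\<close>

lemma (in extension) extension_trace_H_three_half:
  assumes fc: "continuous_on UNIV f"
  shows "H_three_half f"
proof -
  define g where "g x = f 1 - f 0 - 2 / pi * Re (tr x)" for x
  have tri: "set_integrable lborel {a..b} tr" for a b
    using trace_integral(1)[of a b] by (cases "a \<le> b") (simp_all add: set_integrable_def)
  have rei: "set_integrable lborel {a..b} (\<lambda>x. Re (tr x))" for a b
    using integrable_Re[OF tri[of a b, unfolded set_integrable_def]] by (simp add: set_integrable_def)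
  have ci: "set_integrable lborel {a..b} (\<lambda>x. c)" for a b c :: real
    using borel_integrable_compact[of "{a..b}" "\<lambda>_. 1 :: real"] by (simp add: set_integrable_def)
  have gi: "set_integrable lborel {a..b} g" for a b
    unfolding g_def[abs_def] by (intro set_integral_diff ci set_integrable_mult_right rei)
  have ftc: "f b - f a = (LINT x:{a..b}|lborel. g x)" if ab: "a \<le> b" for a b
  proof -
    have "(LINT x:{a..b}|lborel. Re (tr x)) = Re (LINT x:{a..b}|lborel. tr x)"
      using integral_Re[OF tri[of a b, unfolded set_integrable_def]] by (simp add: set_lebesgue_integral_def)
    also have "\<dots> = Re (V (of_real b)) - Re (V (of_real a))" by (simp add: trace_integral(2)[OF ab])
    finally have re: "(LINT x:{a..b}|lborel. Re (tr x)) = Re (V (of_real b)) - Re (V (of_real a))" .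
    have "(LINT x:{a..b}|lborel. g x) = (LINT x:{a..b}|lborel. f 1 - f 0) - (LINT x:{a..b}|lborel. 2 / pi * Re (tr x))"
      unfolding g_def by (intro set_integral_diff ci set_integrable_mult_right rei)
    also have "(LINT x:{a..b}|lborel. f 1 - f 0) = (b - a) * (f 1 - f 0)"
      using ab by (simp add: set_lebesgue_integral_def)
    also have "(LINT x:{a..b}|lborel. 2 / pi * Re (tr x)) = 2 / pi * (Re (V (of_real b)) - Re (V (of_real a)))"
      unfolding set_integral_mult_right re ..
    finally show ?thesis
      using representation[OF fc, of a] representation[OF fc, of b] by (simp add: algebra_simps)
  qed
  have le: "(g s - g t)\<^sup>2 \<le> (cmod (tr s - tr t))\<^sup>2" for s t
  proof (rule power2_le_iff_abs_le[THEN iffD2])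
    have "\<bar>g s - g t\<bar> = 2 / pi * \<bar>Re (tr s - tr t)\<bar>"
    proof -
      have "g s - g t = - (2 / pi * Re (tr s - tr t))" by (simp add: g_def algebra_simps)
      then show ?thesis by (simp only: abs_minus_cancel abs_mult) simp
    qed
    also have "\<dots> \<le> 1 * cmod (tr s - tr t)"
      by (intro mult_mono abs_Re_le_cmod) (use pi_gt3 in simp_all)
    finally show "\<bar>g s - g t\<bar> \<le> cmod (tr s - tr t)" by simp
  qed simp
  have "(\<integral>\<^sup>+s. \<integral>\<^sup>+t. ennreal ((g s - g t)\<^sup>2 / (s - t)\<^sup>2) \<partial>lborel \<partial>lborel)
      \<le> (\<integral>\<^sup>+s. \<integral>\<^sup>+t. ennreal ((cmod (tr s - tr t))\<^sup>2 / (s - t)\<^sup>2) \<partial>lborel \<partial>lborel)"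
    by (intro nn_integral_mono ennreal_leI divide_right_mono le) simp
  then have "H_half g"
    unfolding H_half_iterated locally_integrable_real_def using gi trace_energy_finite by (auto intro: le_less_trans)
  moreover have "AE x in lborel. (f has_real_derivative g x) (at x)"
    by (rule AE_has_derivative_of_integral[OF gi ftc])
  moreover have "locally_abs_continuous f"
    unfolding locally_abs_continuous_def by (intro allI abs_continuous_on_integral[OF gi ftc])
  ultimately show ?thesis unfolding H_three_half_def by blast
qed

theorem theorem8p2:
  fixes f :: "real \<Rightarrow> real"
  assumes "continuous_on UNIV f"
  shows "H_three_half f \<longleftrightarrow>
    (\<exists>F :: complex \<Rightarrow> complex.
       continuous_on closed_upper_half_plane F \<and>
       (\<forall>x. F (of_real x) = of_real (f x)) \<and>
       qc_deformation upper_half_plane F \<and>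
       F \<in> o[inf at_infinity (principal closed_upper_half_plane)](\<lambda>z. z\<^sup>2) \<and>
       (\<exists>h. weak_dbar upper_half_plane F h \<and>
          (\<integral>\<^sup>+ z. ennreal (indicator upper_half_plane z * (cmod (h z))\<^sup>2 / (Im z)\<^sup>2) \<partial>lborel) < \<infinity>))"
proof
  assume "H_three_half f"
  then show "\<exists>F :: complex \<Rightarrow> complex.
       continuous_on closed_upper_half_plane F \<and>
       (\<forall>x. F (of_real x) = of_real (f x)) \<and>
       qc_deformation upper_half_plane F \<and>
       F \<in> o[inf at_infinity (principal closed_upper_half_plane)](\<lambda>z. z\<^sup>2) \<and>
       (\<exists>h. weak_dbar upper_half_plane F h \<and>
          (\<integral>\<^sup>+ z. ennreal (indicator upper_half_plane z * (cmod (h z))\<^sup>2 / (Im z)\<^sup>2) \<partial>lborel) < \<infinity>)"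
    by (rule extension_exists[OF assms])
next
  assume "\<exists>F :: complex \<Rightarrow> complex.
       continuous_on closed_upper_half_plane F \<and>
       (\<forall>x. F (of_real x) = of_real (f x)) \<and>
       qc_deformation upper_half_plane F \<and>
       F \<in> o[inf at_infinity (principal closed_upper_half_plane)](\<lambda>z. z\<^sup>2) \<and>
       (\<exists>h. weak_dbar upper_half_plane F h \<and>
          (\<integral>\<^sup>+ z. ennreal (indicator upper_half_plane z * (cmod (h z))\<^sup>2 / (Im z)\<^sup>2) \<partial>lborel) < \<infinity>)"
  then obtain F h where "extension F h f" unfolding extension_def by blast
  then show "H_three_half f" by (rule extension.extension_trace_H_three_half) (rule assms)
qed

end
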